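(* Let $\chi$ be a primitive Dirichlet character that is non-principal, of conductor $N$, and let $$\xi(s,\chi)=\Big(\frac{\pi}{N}\Big)^{-\frac{s+\kappa}{2}}\Gamma\Big(\frac{s+\kappa}{2}\Big)L(s,\chi),$$ where $\kappa=0$ if $\chi(-1)=1$ and $\kappa=1$ if $\chi(-1)=-1$, and $L(s,\chi)$ is the Dirichlet $L$-function. For real $h$ and $0\le\theta<2\pi$ set $E_{h,\theta}(s,\chi)=e^{i\theta}\xi(s+h,\chi)$ and $$A_{h,\theta}(s,\chi)=\tfrac12\Big(E_{h,\theta}(s,\chi)+\overline{E_{h,\theta}(1-\bar s,\chi)}\Big),\qquad B_{h,\theta}(s,\chi)=-\tfrac1{2i}\Big(E_{h,\theta}(s,\chi)-\overline{E_{h,\theta}(1-\bar s,\chi)}\Big).$$ Let $k\ge1$ be an integer. (1) For every real $h$ with $|h|\ge\tfrac12$ and every $0\le\theta<2\pi$, each of the functions $A_{h,\theta}(s,\chi)$ and $B_{h,\theta}(s,\chi)$ has a limiting distribution, as $T\to\infty$, of its $k$ consecutive normalized zero spacings $(\delta_n,\dots,\delta_{n+k-1})$, and this limiting distribution is the delta (unit point) mass at $(1,1,\dots,1)\in\mathbb R^k$. (2) Assume the Riemann hypothesis for $L(s,\chi)$. Then the same conclusion holds for every real $h$ with $0<|h|<\tfrac12$ and every $0\le\theta<2\pi$: the limiting distribution of $k$ consecutive normalized zero spacings exists for both functions and is the unit point mass at $(1,1,\dots,1)$.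
   Context: The Riemann hypothesis for $L(s,\chi)$ states that all zeros of $L(s,\chi)$ in the strip $0<\Re(s)<1$ lie on $\Re(s)=\tfrac12$. Under the hypotheses of (1) or (2), all zeros of $A_{h,\theta}(s,\chi)$ and $B_{h,\theta}(s,\chi)$ are simple and lie on $\Re(s)=\tfrac12$. For either function write the zeros as $\tfrac12+i\gamma_n$, $n\in\mathbb Z$, with $\gamma_n<\gamma_{n+1}$. The normalized zero spacing is $$\delta_n:=(\gamma_{n+1}-\gamma_n)\,\frac1{2\pi}\log\frac{|\gamma_n|}{2\pi}$$ (defined for $\gamma_n\ne0$). For given $T$, put the uniform probability distribution on the finite family of vectors $(\delta_n,\dots,\delta_{n+k-1})\in\mathbb R^k$ indexed by those $n$ with $|\gamma_n|\le T$ (discarding the finitely many $n$ for which one of the entries is undefined because the corresponding $\gamma$ is $0$). The function has a limiting distribution of $k$ consecutive normalized zero spacings if these probability measures converge weakly, as $T\to\infty$, to a probability measure on $\mathbb R^k$, which is then the limiting distribution. *)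

theory Defs
  imports "HOL-Probability.Probability" "HOL-Complex_Analysis.Complex_Analysis"
begin

definition dirichlet_character :: "nat \<Rightarrow> (int \<Rightarrow> complex) \<Rightarrow> bool" where
  "dirichlet_character N chi \<longleftrightarrow> N > 0 \<and>
     (\<forall>a b. chi (a * b) = chi a * chi b) \<and>
     (\<forall>a. chi (a + int N) = chi a) \<and>
     (\<forall>a. chi a \<noteq> 0 \<longleftrightarrow> coprime a (int N))"

definition non_principal :: "nat \<Rightarrow> (int \<Rightarrow> complex) \<Rightarrow> bool" where
  "non_principal N chi \<longleftrightarrow> (\<exists>a. coprime a (int N) \<and> chi a \<noteq> 1)"

text \<open>A character modulo \<open>N\<close> that is not induced by a character modulo a proper divisor
  of \<open>N\<close>; equivalently, its conductor is \<open>N\<close>.\<close>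

definition primitive_character :: "nat \<Rightarrow> (int \<Rightarrow> complex) \<Rightarrow> bool" where
  "primitive_character N chi \<longleftrightarrow> dirichlet_character N chi \<and>
     (\<forall>d. d dvd N \<longrightarrow> d < N \<longrightarrow>
       \<not> (\<exists>\<psi>. dirichlet_character d \<psi> \<and> (\<forall>a. coprime a (int N) \<longrightarrow> chi a = \<psi> a)))"

text \<open>The entire continuation of the Dirichlet series. It exists for non-principal \<open>chi\<close>
  (for principal \<open>chi\<close> there is a pole at \<open>1\<close> and the value below is unspecified), and it is
  unique by the identity theorem.\<close>

definition dirichlet_L :: "(int \<Rightarrow> complex) \<Rightarrow> complex \<Rightarrow> complex" where
  "dirichlet_L chi = (THE f. f holomorphic_on UNIV \<and>
     (\<forall>s. Re s > 1 \<longrightarrow> (\<lambda>n. chi (int (Suc n)) / of_nat (Suc n) powr s) sums f s))"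

definition riemann_hypothesis_L :: "(int \<Rightarrow> complex) \<Rightarrow> bool" where
  "riemann_hypothesis_L chi \<longleftrightarrow>
     (\<forall>s. 0 < Re s \<longrightarrow> Re s < 1 \<longrightarrow> dirichlet_L chi s = 0 \<longrightarrow> Re s = 1 / 2)"

definition kappa :: "(int \<Rightarrow> complex) \<Rightarrow> nat" where
  "kappa chi = (if chi (-1) = 1 then 0 else 1)"

text \<open>The poles of the Gamma factor are cancelled by the trivial zeros of \<open>L\<close>. Since
  \<open>Gamma\<close> takes the value \<open>0\<close> at its poles, the pointwise product would be wrong there, so the
  removable singularities have to be removed to obtain the entire function \<open>\<xi>\<close>.\<close>

definition xi :: "nat \<Rightarrow> (int \<Rightarrow> complex) \<Rightarrow> complex \<Rightarrow> complex" where
  "xi N chi = remove_sings (\<lambda>s.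
     of_real (pi / real N) powr (- (s + of_nat (kappa chi)) / 2) *
     Gamma ((s + of_nat (kappa chi)) / 2) * dirichlet_L chi s)"

definition E_fun :: "nat \<Rightarrow> (int \<Rightarrow> complex) \<Rightarrow> real \<Rightarrow> real \<Rightarrow> complex \<Rightarrow> complex" where
  "E_fun N chi h \<theta> s = exp (\<i> * of_real \<theta>) * xi N chi (s + of_real h)"

definition A_fun :: "nat \<Rightarrow> (int \<Rightarrow> complex) \<Rightarrow> real \<Rightarrow> real \<Rightarrow> complex \<Rightarrow> complex" where
  "A_fun N chi h \<theta> s = 1 / 2 * (E_fun N chi h \<theta> s + cnj (E_fun N chi h \<theta> (1 - cnj s)))"

definition B_fun :: "nat \<Rightarrow> (int \<Rightarrow> complex) \<Rightarrow> real \<Rightarrow> real \<Rightarrow> complex \<Rightarrow> complex" where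
  "B_fun N chi h \<theta> s =
     - (1 / (2 * \<i>)) * (E_fun N chi h \<theta> s - cnj (E_fun N chi h \<theta> (1 - cnj s)))"

text \<open>All zeros of \<open>F\<close> are simple and lie on the critical line, and \<open>\<gamma>\<close> lists their ordinates
  in increasing order. Such a \<open>\<gamma>\<close> is unique up to a shift of the index, which does not affect
  the notions below.\<close>

definition critical_line_zeros :: "(complex \<Rightarrow> complex) \<Rightarrow> (int \<Rightarrow> real) \<Rightarrow> bool" where
  "critical_line_zeros F \<gamma> \<longleftrightarrow> strict_mono \<gamma> \<and>
     {s. F s = 0} = range (\<lambda>n. Complex (1 / 2) (\<gamma> n)) \<and>
     (\<forall>n. zorder F (Complex (1 / 2) (\<gamma> n)) = 1)"

text \<open>Meaningful only if \<open>\<gamma> n \<noteq> 0\<close>.\<close>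

definition norm_spacing :: "(int \<Rightarrow> real) \<Rightarrow> int \<Rightarrow> real" where
  "norm_spacing \<gamma> n = (\<gamma> (n + 1) - \<gamma> n) * (1 / (2 * pi)) * ln (\<bar>\<gamma> n\<bar> / (2 * pi))"

text \<open>The space \<open>\<real>\<^sup>k\<close> is \<open>real ^ 'k\<close> for a finite linearly ordered index type with
  \<open>k = CARD('k)\<close>; the rank \<open>card {j. j < i}\<close> runs through \<open>0, \<dots>, k - 1\<close> in order, so the
  vector below is \<open>(\<delta>\<^sub>n, \<dots>, \<delta>\<^sub>n\<^sub>+\<^sub>k\<^sub>-\<^sub>1)\<close>.\<close>

definition spacing_vector :: "(int \<Rightarrow> real) \<Rightarrow> int \<Rightarrow> real ^ 'k::{finite, linorder}" where
  "spacing_vector \<gamma> n = (\<chi> i. norm_spacing \<gamma> (n + int (card {j. j < i})))"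

definition spacing_indices :: "nat \<Rightarrow> (int \<Rightarrow> real) \<Rightarrow> real \<Rightarrow> int set" where
  "spacing_indices k \<gamma> T = {n. \<bar>\<gamma> n\<bar> \<le> T \<and> (\<forall>j<k. \<gamma> (n + int j) \<noteq> 0)}"

definition spacing_distribution ::
    "(int \<Rightarrow> real) \<Rightarrow> real \<Rightarrow> (real ^ 'k::{finite, linorder}) measure" where
  "spacing_distribution \<gamma> T =
     distr (uniform_count_measure (spacing_indices CARD('k) \<gamma> T)) borel (spacing_vector \<gamma>)"

definition weakly_converges ::
    "('b \<Rightarrow> 'a::metric_space measure) \<Rightarrow> 'a measure \<Rightarrow> 'b filter \<Rightarrow> bool" where
  "weakly_converges \<mu> M F \<longleftrightarrow>
     (\<forall>f :: 'a \<Rightarrow> real. continuous_on UNIV f \<longrightarrow> bounded (range f) \<longrightarrow>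
        ((\<lambda>t. integral\<^sup>L (\<mu> t) f) \<longlongrightarrow> integral\<^sup>L M f) F)"

definition has_limiting_spacing_distribution ::
    "(complex \<Rightarrow> complex) \<Rightarrow> (real ^ 'k::{finite, linorder}) measure \<Rightarrow> bool" where
  "has_limiting_spacing_distribution F M \<longleftrightarrow>
     prob_space M \<and> sets M = sets borel \<and>
     (\<exists>\<gamma>. critical_line_zeros F \<gamma> \<and> weakly_converges (spacing_distribution \<gamma>) M at_top)"

end

theory Submission
  imports Defs "HOL-Number_Theory.Number_Theory" "HOL-Real_Asymp.Real_Asymp"
begin

text \<open>Up to a unimodular constant, \<open>cnj (E (1 - cnj s))\<close> is \<open>\<xi> (s - h)\<close>, so \<open>A\<close> and \<open>B\<close> are combinations
  \<open>\<alpha> \<xi> (s + h) + \<beta> \<xi> (s - h)\<close> with \<open>\<bar>\<alpha>\<bar> = \<bar>\<beta>\<bar>\<close>. By the functional equation, the zero-free region and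
  Phragmen-Lindeloef, \<open>\<bar>\<xi> (s - h)\<bar> < \<bar>\<xi> (s + h)\<bar>\<close> for \<open>Re s > 1/2\<close>. Hence all zeros lie on the
  critical line, where they are the points at which the phase \<open>P = arg \<xi> (1/2 + h + it)\<close> takes values in a
  translate of \<open>\<pi> \<int>\<close>, and they are simple because \<open>P' > 0\<close> by Hopf's lemma. By Stirling,
  \<open>P' = ln (2 + \<bar>t\<bar>) / 2 + Re (L'/L) + O(1)\<close>, so the spacings concentrate at \<open>1\<close> as soon as the integral of
  \<open>\<bar>Re (L'/L)\<bar>\<close> over \<open>[-T, T]\<close> is \<open>o(T ln T)\<close>. This is clear for \<open>h > 1/2\<close>, and follows from
  Borel-Caratheodory under the Riemann hypothesis. For \<open>h = 1/2\<close> it is shown uniformly on the lines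
  \<open>Re s = 1 + \<eta>\<close>: there \<open>P' > 0\<close> bounds \<open>Re (L'/L)\<close> from below by \<open>- O(ln t)\<close>, mean squares of \<open>L\<close> and \<open>L'\<close> and
  the mean of \<open>ln \<bar>L\<bar>\<close> show that its negative part is small on average, and its weighted mean is bounded.\<close>

section \<open>Dirichlet series\<close>

text \<open>Of the order of T ln T zeros lie up to height T, so an error o(T ln T) in the mean of P'
  spoils only a vanishing share of the spacings. This matters most for |h| = 1/2: there the phase
  lives on the line Re s = 1, where nonvanishing alone gives neither a lower bound for |L| nor a
  pointwise bound for L'/L. Phragmen-Lindeloef requires such a lower bound, so the modulus
  inequality for h = 1/2 is a limit of those for h > 1/2. The integral of |Re (L'/L)| is likewise a
  limit over the lines Re s = 1 + \<eta>, which is why every constant on that way is independent of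
  \<eta>. An absolute value is the number itself plus twice its negative part, so a signed mean and
  the negative part control it. The signed mean is cheap because L'/L is a derivative: with a weight
  vanishing at the ends only integrals of log L remain, and these have integrable singularities near
  the line Re s = 1. The modulus of the root number comes from applying the theta functional
  equation twice. A negative h exchanges the two summands, so only h > 0 is analysed.\<close>

definition dseries :: "(nat \<Rightarrow> complex) \<Rightarrow> complex \<Rightarrow> complex" where
  "dseries a s = (\<Sum>n. a n * of_nat n powr (-s))"

text \<open>The abscissa itself is excluded, so that a little of the exponent can always be given
  away. Here and in \<open>dseries\<close> the term at 0 vanishes, because
  \<open>0 powr x = 0\<close>.\<close>

definition abs_conv_beyond :: "(nat \<Rightarrow> complex) \<Rightarrow> real \<Rightarrow> bool" where
  "abs_conv_beyond a c \<longleftrightarrow> (\<forall>\<sigma>>c. summable (\<lambda>n. norm (a n) * real n powr (-\<sigma>)))"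

lemma norm_of_nat_powr: "norm (of_nat n powr s :: complex) = real n powr Re s"
proof -
  have "norm (complex_of_real (real n) powr s) = real n powr Re s"
    by (subst norm_powr_real_powr) auto
  then show ?thesis by simp
qed

lemma abs_conv_beyondD:
  assumes "abs_conv_beyond a c" "Re s > c"
  shows "summable (\<lambda>n. norm (a n * of_nat n powr (-s)))"
  using assms unfolding abs_conv_beyond_def by (simp add: norm_mult norm_of_nat_powr)

lemma abs_conv_beyond_mono:
  assumes "abs_conv_beyond b c" "\<And>n. norm (a n) \<le> norm (b n)"
  shows "abs_conv_beyond a c"
  unfolding abs_conv_beyond_def
proof (intro allI impI)
  fix \<sigma> assume "\<sigma> > c"
  then have "summable (\<lambda>n. norm (b n) * real n powr (-\<sigma>))"
    using assms(1) unfolding abs_conv_beyond_def by blast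
  then show "summable (\<lambda>n. norm (a n) * real n powr (-\<sigma>))"
    by (rule summable_comparison_test') (use assms(2) in \<open>auto intro!: mult_right_mono\<close>)
qed

text \<open>A logarithm costs an arbitrarily small power of n, and the half-plane is open.\<close>

lemma abs_conv_beyond_ln:
  assumes "abs_conv_beyond a c"
  shows "abs_conv_beyond (\<lambda>n. of_real (ln (real n)) * a n) c"
  unfolding abs_conv_beyond_def
proof (intro allI impI)
  fix \<sigma> :: real assume s: "\<sigma> > c"
  define d where "d = (\<sigma> - c) / 2"
  have d: "d > 0" using s by (simp add: d_def)
  have "summable (\<lambda>n. norm (a n) * real n powr (-(\<sigma> - d)))"
    using assms s unfolding abs_conv_beyond_def by (auto simp: d_def field_simps)
  then have sm: "summable (\<lambda>n. 1 / d * (norm (a n) * real n powr (-(\<sigma> - d))))"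
    by (rule summable_mult)
  show "summable (\<lambda>n. norm (of_real (ln (real n)) * a n) * real n powr (-\<sigma>))"
  proof (rule summable_comparison_test'[OF sm])
    fix n :: nat assume "n \<ge> 0"
    show "norm (norm (of_real (ln (real n)) * a n) * real n powr (-\<sigma>))
            \<le> 1 / d * (norm (a n) * real n powr (-(\<sigma> - d)))"
    proof (cases "n = 0")
      case False
      then have "ln (real n) \<le> real n powr d / d"
        using ln_powr_bound[of "real n" d] d by auto
      moreover have "ln (real n) \<ge> 0" using False by simp
      ultimately have "norm (of_real (ln (real n)) * a n) * real n powr (-\<sigma>)
          \<le> (real n powr d / d * norm (a n)) * real n powr (-\<sigma>)"
        unfolding norm_mult norm_of_real by (intro mult_right_mono) auto
      also have "\<dots> = 1 / d * (norm (a n) * real n powr (d + (-\<sigma>)))"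
        by (subst powr_add) simp
      finally show ?thesis by simp
    qed auto
  qed
qed

lemma abs_conv_beyond_bounded:
  assumes "\<And>n. norm (a n) \<le> C"
  shows "abs_conv_beyond a 1"
  unfolding abs_conv_beyond_def
proof (intro allI impI)
  fix \<sigma> :: real assume "\<sigma> > 1"
  then have "summable (\<lambda>n. C * real n powr (-\<sigma>))"
    by (intro summable_mult) (simp add: summable_real_powr_iff)
  then show "summable (\<lambda>n. norm (a n) * real n powr (-\<sigma>))"
    by (rule summable_comparison_test') (use assms in \<open>auto intro!: mult_right_mono\<close>)
qed

lemma dseries_sums:
  assumes "abs_conv_beyond a c" "Re s > c"
  shows "(\<lambda>n. a n * of_nat n powr (-s)) sums dseries a s"
  unfolding dseries_def using summable_norm_cancel[OF abs_conv_beyondD[OF assms]] by blast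

text \<open>Termwise differentiation: near x the terms are dominated by those at the abscissa Re x -
  d, where d is half the distance of x from the boundary of the half-plane.\<close>

lemma dseries_has_derivative:
  assumes "abs_conv_beyond a c" "Re s > c"
  shows "(dseries a has_field_derivative - dseries (\<lambda>n. of_real (ln (real n)) * a n) s) (at s)"
proof -
  define S where "S = {s. Re s > c}"
  have opS: "open S" unfolding S_def by (rule open_halfspace_Re_gt)
  have "\<exists>g g'. \<forall>x\<in>S. (\<lambda>n. a n * of_nat n powr (-x)) sums g x \<and>
          (\<lambda>n. - (of_real (ln (real n)) * a n * of_nat n powr (-x))) sums g' x \<and>
          (g has_field_derivative g' x) (at x)"
  proof (rule series_and_derivative_comparison_local[OF opS])
    fix n x assume "x \<in> S"
    show "((\<lambda>x. a n * of_nat n powr (-x)) has_field_derivative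
            - (of_real (ln (real n)) * a n * of_nat n powr (-x))) (at x)"
    proof (cases "n = 0")
      case False
      have "Ln (of_nat n) = of_real (ln (real n))"
        using False Ln_of_real[of "real n"] by simp
      then have "((\<lambda>x. of_nat n powr (-x)) has_field_derivative
            (of_real (ln (real n)) * of_nat n powr (-x)) * (-1)) (at x)"
        using False
        by (intro DERIV_chain2[where f = "\<lambda>z. of_nat n powr z" and g = uminus])
           (auto intro!: derivative_eq_intros has_field_derivative_powr_right[THEN DERIV_cong])
      from DERIV_cmult[OF this, of "a n"] show ?thesis by (simp add: mult_ac)
    qed auto
  next
    fix x assume x: "x \<in> S"
    define d where "d = (Re x - c) / 2"
    have d: "d > 0" using x by (auto simp: d_def S_def)
    have sm: "summable (\<lambda>n. norm (a n) * real n powr (-(Re x - d)))"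
      using assms(1) d unfolding abs_conv_beyond_def by (auto simp: d_def field_simps)
    have "norm (a n * of_nat n powr (-y)) \<le> norm (a n) * real n powr (-(Re x - d))"
      if "y \<in> ball x d" for n y
    proof (cases "n = 0")
      case False
      have "\<bar>Re (x - y)\<bar> < d" using that abs_Re_le_cmod[of "x - y"] by (auto simp: dist_norm)
      then have "real n powr (- Re y) \<le> real n powr (-(Re x - d))"
        using False by (intro powr_mono) auto
      then show ?thesis by (auto simp: norm_mult norm_of_nat_powr intro!: mult_left_mono)
    qed auto
    then show "\<exists>d h. 0 < d \<and> summable h \<and> (\<forall>\<^sub>F n in sequentially. \<forall>y\<in>ball x d \<inter> S.
                 cmod (a n * of_nat n powr (-y)) \<le> h n)"
      using d sm by (intro exI[of _ d] exI[of _ "\<lambda>n. norm (a n) * real n powr (-(Re x - d))"]) auto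
  qed
  then obtain g g' where g: "\<And>x. x \<in> S \<Longrightarrow> (\<lambda>n. a n * of_nat n powr (-x)) sums g x"
     "\<And>x. x \<in> S \<Longrightarrow> (\<lambda>n. - (of_real (ln (real n)) * a n * of_nat n powr (-x))) sums g' x"
     "\<And>x. x \<in> S \<Longrightarrow> (g has_field_derivative g' x) (at x)" by blast
  have s: "s \<in> S" using assms by (simp add: S_def)
  have 1: "g x = dseries a x" if "x \<in> S" for x
    using g(1)[OF that] unfolding dseries_def by (simp add: sums_iff)
  have 2: "g' s = - dseries (\<lambda>n. of_real (ln (real n)) * a n) s"
    using sums_minus[OF g(2)[OF s]] unfolding dseries_def by (simp add: sums_iff minus_equation_iff)
  show ?thesis
    using g(3)[OF s] unfolding 2
    by (rule has_field_derivative_transform_within_open[OF _ opS s]) (auto simp: 1)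
qed

lemma dseries_holomorphic:
  assumes "abs_conv_beyond a c" "S \<subseteq> {s. Re s > c}"
  shows "dseries a holomorphic_on S"
proof (rule holomorphic_onI)
  fix x assume "x \<in> S"
  then have "Re x > c" using assms(2) by auto
  from dseries_has_derivative[OF assms(1) this] show "dseries a field_differentiable at x within S"
    using field_differentiable_at_within field_differentiable_def by blast
qed

text \<open>Kept abstract because the logarithm is taken of several series: those of 1, of the
  character, of its twist by n^(-it), and of the conjugate of that twist.\<close>

locale compl_mult =
  fixes f :: "nat \<Rightarrow> complex"
  assumes f_1: "f 1 = 1" and f_mult: "f (m * n) = f m * f n" and f_le: "norm (f n) \<le> 1"
begin

text \<open>The coefficients of the logarithm of the Euler product: f(p)^k / k at a prime power p^k.
  At 0 and 1 the quotient is 0, as \<open>mangoldt\<close> vanishes there.\<close>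

definition logcoeff :: "nat \<Rightarrow> complex" where
  "logcoeff n = f n * of_real (mangoldt n / ln (real n))"

lemma mangoldt_div_ln: "0 \<le> mangoldt n / ln (real n)" "mangoldt n / ln (real n) \<le> (1::real)"
proof -
  have "mangoldt n / ln (real n) \<le> (1::real) \<and> 0 \<le> mangoldt n / ln (real n)"
  proof (cases "n \<le> 1")
    case True then have "n = 0 \<or> n = 1" by auto
    then show ?thesis by auto
  next
    case False then show ?thesis
      using mangoldt_le[of n] mangoldt_nonneg[of n] by (auto simp: field_simps)
  qed
  then show "0 \<le> mangoldt n / ln (real n)" "mangoldt n / ln (real n) \<le> (1::real)" by auto
qed

lemma norm_logcoeff: "norm (logcoeff n) \<le> mangoldt n / ln (real n)"
  unfolding logcoeff_def norm_mult
  using mult_right_mono[OF f_le[of n] mangoldt_div_ln(1)[of n]] mangoldt_div_ln(1)[of n]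
  by (simp only: norm_of_real abs_of_nonneg mult_1_left)

lemma conv_f: "abs_conv_beyond f 1" by (rule abs_conv_beyond_bounded[OF f_le])

lemma conv_logcoeff: "abs_conv_beyond logcoeff 1"
  by (rule abs_conv_beyond_bounded[of _ 1])
     (use norm_logcoeff mangoldt_div_ln(2) order_trans in blast)

lemma ln_logcoeff: "of_real (ln (real n)) * logcoeff n = f n * of_real (mangoldt n)"
proof (cases "n \<le> 1")
  case True then have "n = 0 \<or> n = 1" by auto
  then show ?thesis by (auto simp: logcoeff_def)
next
  case False then show ?thesis by (simp add: logcoeff_def flip: of_real_mult)
qed

text \<open>The divisor sum of the von Mangoldt function is the logarithm. Complete multiplicativity
  lets f pass through this convolution, and absolute convergence allows the double series to be
  regrouped by the product of the indices.\<close>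

lemma dseries_mangoldt_mult:
  assumes s: "Re s > 1"
  shows "dseries (\<lambda>n. f n * of_real (mangoldt n)) s * dseries f s
       = dseries (\<lambda>n. of_real (ln (real n)) * f n) s"
proof -
  let ?A = "\<lambda>n. f n * of_real (mangoldt n) * of_nat n powr (-s)"
  let ?B = "\<lambda>n. f n * of_nat n powr (-s)"
  let ?P = "{0<..} :: nat set"
  have cA: "abs_conv_beyond (\<lambda>n. f n * of_real (mangoldt n)) 1"
    using abs_conv_beyond_ln[OF conv_logcoeff] unfolding ln_logcoeff .
  have hs: "((\<lambda>n. a n * of_nat n powr (-s)) has_sum dseries a s) ?P \<and>
            (\<lambda>n. norm (a n * of_nat n powr (-s))) summable_on ?P"
    if "abs_conv_beyond a 1" for a
  proof -
    have "((\<lambda>n. a n * of_nat n powr (-s)) has_sum dseries a s) UNIV"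
      by (rule norm_summable_imp_has_sum[OF abs_conv_beyondD[OF that s] dseries_sums[OF that s]])
    then have 1: "((\<lambda>n. a n * of_nat n powr (-s)) has_sum dseries a s) ?P"
      by (rule has_sum_cong_neutral[THEN iffD1, rotated -1]) auto
    have "(\<lambda>n. norm (a n * of_nat n powr (-s))) summable_on UNIV"
      using abs_conv_beyondD[OF that s] by (intro norm_summable_imp_summable_on) auto
    then have "(\<lambda>n. norm (a n * of_nat n powr (-s))) summable_on ?P"
      by (rule summable_on_subset_banach) auto
    with 1 show ?thesis by blast
  qed
  note A = hs[OF cA] and B = hs[OF conv_f]
  have smm: "(\<lambda>p. norm ((\<lambda>(x,y). ?A x * ?B y) p)) summable_on (?P \<times> ?P)"
  proof (subst Infinite_Sum.abs_summable_on_Sigma_iff, intro conjI ballI)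
    fix x show "(\<lambda>y. norm (case (x, y) of (x, y) \<Rightarrow> ?A x * ?B y)) summable_on ?P"
      using B by (simp add: norm_mult summable_on_cmult_right mult.assoc)
  next
    have "(\<lambda>x. norm (?A x) * infsum (\<lambda>y. norm (?B y)) ?P) summable_on ?P"
      using A by (intro summable_on_cmult_left) auto
    then show "(\<lambda>x. norm (infsum (\<lambda>y. norm (case (x, y) of (x, y) \<Rightarrow> ?A x * ?B y)) ?P)) summable_on ?P"
      by (simp only: prod.case norm_mult infsum_cmult_right')
         (simp add: norm_mult abs_mult infsum_nonneg)
  qed
  have "((\<lambda>(x,y). ?A x * ?B y) has_sum (dseries (\<lambda>n. f n * of_real (mangoldt n)) s * dseries f s)) (?P \<times> ?P)"
  proof (rule has_sum_SigmaI)
    show "((\<lambda>y. case (x, y) of (x, y) \<Rightarrow> ?A x * ?B y) has_sum (?A x * dseries f s)) ?P" for x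
      using has_sum_cmult_right[of ?B ?P "dseries f s" "?A x"] B by simp
    show "((\<lambda>x. ?A x * dseries f s) has_sum (dseries (\<lambda>n. f n * of_real (mangoldt n)) s * dseries f s)) ?P"
      using A by (intro has_sum_cmult_left) auto
    show "(\<lambda>(x,y). ?A x * ?B y) summable_on (?P \<times> ?P)"
      using smm by (rule Infinite_Sum.abs_summable_summable)
  qed
  also have "?this \<longleftrightarrow> ((\<lambda>(n,d). ?A d * ?B (n div d)) has_sum
      (dseries (\<lambda>n. f n * of_real (mangoldt n)) s * dseries f s)) (Sigma ?P (\<lambda>n. {d. d dvd n}))"
    by (rule has_sum_reindex_bij_witness[where j = "\<lambda>(x,y). (x * y, x)" and i = "\<lambda>(n,d). (d, n div d)"])
       (auto elim!: dvdE)
  finally have "((\<lambda>n. \<Sum>d | d dvd n. ?A d * ?B (n div d)) has_sum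
      (dseries (\<lambda>n. f n * of_real (mangoldt n)) s * dseries f s)) ?P"
    by (rule has_sum_SigmaD) (auto intro!: has_sum_finiteI finite_divisors_nat)
  also have "?this \<longleftrightarrow> ((\<lambda>n. of_real (ln (real n)) * f n * of_nat n powr (-s)) has_sum
      (dseries (\<lambda>n. f n * of_real (mangoldt n)) s * dseries f s)) ?P"
  proof (rule has_sum_cong)
    fix n assume n: "n \<in> ?P"
    have "(\<Sum>d | d dvd n. ?A d * ?B (n div d)) = (\<Sum>d | d dvd n. mangoldt d * (f n * of_nat n powr (-s)))"
    proof (rule sum.cong)
      fix d assume "d \<in> {d. d dvd n}"
      then obtain e where e: "n = d * e" by auto
      with n have de: "d > 0" "e > 0" by auto
      have "of_nat n powr (-s) = (of_nat d powr (-s) * of_nat e powr (-s) :: complex)"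
        using powr_times_real[of "of_nat d" "of_nat e" "-s"] e by simp
      then show "?A d * ?B (n div d) = mangoldt d * (f n * of_nat n powr (-s))"
        using e de by (simp add: f_mult)
    qed auto
    also have "\<dots> = of_real (ln (real n)) * f n * of_nat n powr (-s)"
      using n mangoldt_sum[of n, where ?'a = complex] by (simp flip: sum_distrib_right)
    finally show "(\<Sum>d | d dvd n. ?A d * ?B (n div d)) = of_real (ln (real n)) * f n * of_nat n powr (-s)" .
  qed
  finally show ?thesis
    using hs[OF abs_conv_beyond_ln[OF conv_f]] has_sum_unique by blast
qed

text \<open>For x > 2 the terms beyond n = 1 lose a factor 2^(2 - x) against the series of n^(-2).
  These limits fix the constant of integration in the next theorem.\<close>

lemma dseries_tendsto_1: "((\<lambda>x. dseries f (of_real x)) \<longlongrightarrow> 1) at_top"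
  and logcoeff_tendsto_0: "((\<lambda>x. dseries logcoeff (of_real x)) \<longlongrightarrow> 0) at_top"
proof -
  have main: "((\<lambda>x. dseries a (of_real x)) \<longlongrightarrow> a 1) at_top"
    if a: "abs_conv_beyond a 1" "\<And>n. norm (a n) \<le> 1" for a
  proof -
    define K where "K = (\<Sum>n. real n powr (-2))"
    have s2: "summable (\<lambda>n. real n powr (-2))" by (simp add: summable_real_powr_iff)
    have bd: "norm (dseries a (of_real x) - a 1) \<le> 2 powr (2 - x) * K" if x: "x > 2" for x
    proof -
      have "(\<lambda>n. a n * of_nat n powr (- of_real x)) sums dseries a (of_real x)"
        using x by (intro dseries_sums[OF a(1)]) auto
      moreover have "(\<lambda>n. if n = 1 then a n * of_nat n powr (- of_real x) else 0) sums (a 1 * of_nat 1 powr (- of_real x))"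
        by (rule sums_single)
      ultimately have 1: "(\<lambda>n. a n * of_nat n powr (- of_real x) - (if n = 1 then a n * of_nat n powr (- of_real x) else 0))
           sums (dseries a (of_real x) - a 1)"
        using sums_diff by fastforce
      have sm: "summable (\<lambda>n. 2 powr (2 - x) * real n powr (-2))" by (intro summable_mult s2)
      have "norm (\<Sum>n. a n * of_nat n powr (- of_real x) - (if n = 1 then a n * of_nat n powr (- of_real x) else 0))
            \<le> (\<Sum>n. 2 powr (2 - x) * real n powr (-2))"
      proof (rule norm_suminf_le[OF _ sm])
        fix n
        show "norm (a n * of_nat n powr (- of_real x) - (if n = 1 then a n * of_nat n powr (- of_real x) else 0))
             \<le> 2 powr (2 - x) * real n powr (-2)"
        proof (cases "n \<le> 1")
          case True then have "n = 0 \<or> n = 1" by auto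
          then show ?thesis by auto
        next
          case False
          have "norm (a n) * real n powr (-x) \<le> 1 * real n powr (-x)"
            using a(2) by (intro mult_right_mono) auto
          also have "\<dots> = real n powr (2 - x) * real n powr (-2)" by (simp flip: powr_add)
          also have "\<dots> \<le> 2 powr (2 - x) * real n powr (-2)"
            using False x by (intro mult_right_mono powr_mono2') auto
          finally show ?thesis using False by (simp add: norm_mult norm_of_nat_powr)
        qed
      qed
      then show ?thesis using 1 s2 by (simp add: sums_iff K_def suminf_mult)
    qed
    have "((\<lambda>x::real. 2 powr (2 - x) * K) \<longlongrightarrow> 0) at_top" by real_asymp
    then have "((\<lambda>x. dseries a (of_real x) - a 1) \<longlongrightarrow> 0) at_top"
    proof (rule Lim_null_comparison[rotated])
      show "\<forall>\<^sub>F x in at_top. norm (dseries a (of_real x) - a 1) \<le> 2 powr (2 - x) * K"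
        using eventually_gt_at_top[of "2::real"] by (rule eventually_mono) (rule bd)
    qed
    then show ?thesis using LIM_zero_iff by blast
  qed
  show "((\<lambda>x. dseries f (of_real x)) \<longlongrightarrow> 1) at_top"
    using main[OF conv_f f_le] f_1 by simp
  have "norm (logcoeff n) \<le> 1" for n using norm_logcoeff mangoldt_div_ln(2) order_trans by blast
  from main[OF conv_logcoeff this]
  show "((\<lambda>x. dseries logcoeff (of_real x)) \<longlongrightarrow> 0) at_top"
    by (simp add: logcoeff_def[of "Suc 0"])
qed

text \<open>The quotient of the two sides has derivative 0 by the convolution identity, and it tends
  to 1 along the real axis.\<close>

theorem exp_dseries_logcoeff:
  assumes s: "Re s > 1"
  shows "exp (dseries logcoeff s) = dseries f s"
proof -
  define S where "S = {s. Re s > 1}"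
  define h where "h = (\<lambda>s. dseries f s * exp (- dseries logcoeff s))"
  have "(h has_field_derivative 0) (at z)" if "z \<in> S" for z
  proof -
    have z: "Re z > 1" using that by (simp add: S_def)
    note d1 = dseries_has_derivative[OF conv_f z]
    note d2 = dseries_has_derivative[OF conv_logcoeff z, unfolded ln_logcoeff]
    show ?thesis unfolding h_def
      by (rule derivative_eq_intros d1 d2 refl)+
         (use dseries_mangoldt_mult[OF z] in \<open>simp add: algebra_simps\<close>)
  qed
  then have "h constant_on S"
    by (intro has_field_derivative_0_imp_constant_on)
       (auto simp: S_def open_halfspace_Re_gt convex_connected convex_halfspace_Re_gt)
  then obtain c where c: "\<And>z. z \<in> S \<Longrightarrow> h z = c" by (auto simp: constant_on_def)
  have "((\<lambda>x. h (of_real x)) \<longlongrightarrow> 1 * exp (- 0)) at_top"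
    unfolding h_def by (intro tendsto_intros dseries_tendsto_1 logcoeff_tendsto_0)
  moreover have "\<forall>\<^sub>F x in at_top. h (of_real x) = c"
    using eventually_gt_at_top[of 1] by eventually_elim (auto simp: S_def intro!: c)
  ultimately have "((\<lambda>x::real. c) \<longlongrightarrow> 1) at_top" by (simp add: tendsto_cong)
  then have "c = 1" by (simp add: tendsto_const_iff)
  then have "h s = 1" using c s by (simp add: S_def)
  then show ?thesis by (simp add: h_def exp_minus field_simps)
qed

end

section \<open>Conditional convergence by partial summation\<close>

lemma norm_powr_diff_le:
  assumes s: "Re s > 0" and n: "n > 0"
  shows "norm (of_nat n powr (-s) - of_nat (Suc n) powr (-s) :: complex)
           \<le> norm s / Re s * (real n powr (- Re s) - real (Suc n) powr (- Re s))"
proof -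
  let ?f = "\<lambda>x::real. of_real x powr (-s) :: complex"
  let ?g = "\<lambda>x::real. - (norm s / Re s * x powr (- Re s))"
  have "norm (?f (real (Suc n)) - ?f (real n)) \<le> ?g (real (Suc n)) - ?g (real n)"
  proof (rule differentiable_bound_general)
    show "real n < real (Suc n)" by simp
    show "continuous_on {real n..real (Suc n)} ?f"
      using n by (intro continuous_intros) auto
    show "continuous_on {real n..real (Suc n)} ?g"
      using n by (intro continuous_intros) auto
    fix x assume x: "real n < x" "x < real (Suc n)"
    then have x0: "x > 0" using n by linarith
    have "((\<lambda>z. z powr (-s)) has_field_derivative (-s) * of_real x powr (-s - 1)) (at (of_real x))"
      using x0 by (intro has_field_derivative_powr) auto
    then show "(?f has_vector_derivative (-s) * of_real x powr (-s - 1)) (at x)"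
      by (rule has_vector_derivative_real_field)
    have "((\<lambda>x. x powr (- Re s)) has_real_derivative (- Re s) * x powr (- Re s - 1)) (at x)"
      using x0 by (rule has_real_derivative_powr)
    from DERIV_cmult[OF this, of "- (norm s / Re s)"] s
    show "(?g has_vector_derivative (norm s * x powr (- Re s - 1))) (at x)"
      by (simp add: has_real_derivative_iff_has_vector_derivative field_simps)
    show "norm ((-s) * of_real x powr (-s - 1)) \<le> norm s * x powr (- Re s - 1)"
      using x0 by (simp add: norm_mult norm_powr_real_powr)
  qed
  then show ?thesis by (simp add: norm_minus_commute algebra_simps)
qed

lemma abel_summation:
  fixes a g :: "nat \<Rightarrow> complex"
  defines "A \<equiv> \<lambda>n. \<Sum>k=1..n. a k"
  assumes "Y \<le> M"
  shows "(\<Sum>n=Suc Y..M. a n * g n)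
       = A M * g (Suc M) - A Y * g (Suc Y) + (\<Sum>n=Suc Y..M. A n * (g n - g (Suc n)))"
  using assms(2) by (induction M rule: dec_induct) (auto simp: A_def algebra_simps)

lemma sum_decreasing_powr:
  fixes Y M :: nat
  assumes "Y \<le> M"
  shows "(\<Sum>n=Suc Y..M. real n powr p - real (Suc n) powr p) = real (Suc Y) powr p - real (Suc M) powr p"
  using assms by (induction M rule: dec_induct) auto

text \<open>After Abel summation the differences of n^(-s) are dominated by |s| / Re s times a
  telescoping sum. This linear dependence on |s| is the source of all growth bounds for L in the
  critical strip.\<close>

lemma dseries_partial_diff:
  assumes B: "\<And>M. norm (\<Sum>k=1..M. a k) \<le> B" and s: "Re s > 0" and YM: "Y \<le> M"
  shows "norm (\<Sum>n=Suc Y..M. a n * of_nat n powr (-s))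
           \<le> B * (2 + norm s / Re s) * real (Suc Y) powr (- Re s)"
proof -
  let ?g = "\<lambda>n. of_nat n powr (-s) :: complex"
  let ?A = "\<lambda>n. \<Sum>k=1..n. a k"
  have B0: "B \<ge> 0" using B[of 0] by simp
  have gM: "real (Suc M) powr (- Re s) \<le> real (Suc Y) powr (- Re s)"
    using s YM by (intro powr_mono2') auto
  have "norm (\<Sum>n=Suc Y..M. ?A n * (?g n - ?g (Suc n)))
        \<le> (\<Sum>n=Suc Y..M. B * (norm s / Re s * (real n powr (- Re s) - real (Suc n) powr (- Re s))))"
    by (intro sum_norm_le order_trans[OF norm_mult_ineq] mult_mono B norm_powr_diff_le s B0) auto
  also have "\<dots> = B * (norm s / Re s * (real (Suc Y) powr (- Re s) - real (Suc M) powr (- Re s)))"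
    by (simp only: sum_distrib_left[symmetric] sum_decreasing_powr[OF YM])
  also have "\<dots> \<le> B * (norm s / Re s * real (Suc Y) powr (- Re s))"
    using s B0 by (intro mult_left_mono) auto
  finally have 1: "norm (\<Sum>n=Suc Y..M. ?A n * (?g n - ?g (Suc n))) \<le> B * (norm s / Re s * real (Suc Y) powr (- Re s))" .
  have g: "norm (?g n) = real n powr (- Re s)" for n by (simp add: norm_of_nat_powr)
  have 2: "norm (?A M * ?g (Suc M)) \<le> B * real (Suc Y) powr (- Re s)"
    unfolding norm_mult g using B gM B0 by (intro mult_mono) auto
  have 3: "norm (?A Y * ?g (Suc Y)) \<le> B * real (Suc Y) powr (- Re s)"
    unfolding norm_mult g using B by (intro mult_right_mono) auto
  have "norm (\<Sum>n=Suc Y..M. a n * ?g n)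
     \<le> norm (?A M * ?g (Suc M)) + norm (?A Y * ?g (Suc Y)) + norm (\<Sum>n=Suc Y..M. ?A n * (?g n - ?g (Suc n)))"
    by (subst abel_summation[OF YM],
        rule order_trans[OF norm_triangle_ineq add_right_mono[OF norm_triangle_ineq4]])
  also have "\<dots> \<le> B * real (Suc Y) powr (- Re s) + B * real (Suc Y) powr (- Re s)
                    + B * (norm s / Re s * real (Suc Y) powr (- Re s))"
    by (intro add_mono 1 2 3)
  finally show ?thesis by (simp add: algebra_simps)
qed

lemma nat_powr_neg_tendsto_0:
  fixes p :: real
  assumes "p > 0" shows "(\<lambda>Y. C * real (Suc Y) powr (- p)) \<longlonglongrightarrow> 0"
proof -
  have "(\<lambda>Y. C * real (Suc Y) powr (- p)) \<longlonglongrightarrow> C * 0"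
    using assms by (intro tendsto_mult tendsto_const tendsto_neg_powr filterlim_compose[OF filterlim_real_sequentially] filterlim_Suc) auto
  then show ?thesis by simp
qed

text \<open>The bound for blocks is independent of their upper end M, so it survives M to infinity.
  With Y = 0 it bounds the series itself; with Y about T^2 it approximates the series by a Dirichlet
  polynomial.\<close>

lemma dseries_conditional:
  assumes B: "\<And>M. norm (\<Sum>k=1..M. a k) \<le> B" and s: "Re s > 0"
  shows "(\<lambda>n. a n * of_nat n powr (-s)) sums dseries a s"
    and "norm (dseries a s - (\<Sum>n=1..Y. a n * of_nat n powr (-s)))
            \<le> B * (2 + norm s / Re s) * real (Suc Y) powr (- Re s)"
proof -
  let ?t = "\<lambda>n. a n * of_nat n powr (-s)"
  let ?S = "\<lambda>M. \<Sum>n=1..M. ?t n"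
  let ?C = "B * (2 + norm s / Re s)"
  have diff: "norm (?S M - ?S Y) \<le> ?C * real (Suc Y) powr (- Re s)" if "Y \<le> M" for Y M
  proof -
    have "?S M - ?S Y = (\<Sum>n=Suc Y..M. ?t n)"
      using sum.ub_add_nat[of 1 Y ?t "M - Y"] that by simp
    then show ?thesis using dseries_partial_diff[OF B s that] by simp
  qed
  have "Cauchy ?S"
  proof (rule CauchyI)
    fix e :: real assume e: "e > 0"
    have "\<forall>\<^sub>F Y in sequentially. ?C * real (Suc Y) powr (- Re s) < e"
      using nat_powr_neg_tendsto_0[OF s] e by (rule order_tendstoD)
    then obtain K where K: "\<And>Y. Y \<ge> K \<Longrightarrow> ?C * real (Suc Y) powr (- Re s) < e"
      by (auto simp: eventually_sequentially)
    have "norm (?S m - ?S n) < e" if "m \<ge> K" "n \<ge> K" for m n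
    proof (cases "m \<le> n")
      case True
      have "norm (?S m - ?S n) \<le> ?C * real (Suc m) powr (- Re s)"
        using diff[OF True] by (simp only: norm_minus_commute)
      then show ?thesis using K[OF that(1)] by linarith
    next
      case False
      then show ?thesis using diff[of n m] K[OF that(2)] by linarith
    qed
    then show "\<exists>K. \<forall>m\<ge>K. \<forall>n\<ge>K. norm (?S m - ?S n) < e" by blast
  qed
  then obtain l where l: "?S \<longlonglongrightarrow> l" using Cauchy_convergent convergent_def by blast
  \<comment> \<open>The term at 0 is 0, since \<open>0 powr z = 0\<close>; this reconciles sums
    starting at 1 with those of \<open>sums\<close>.\<close>
  have eq: "?S M = (\<Sum>n<Suc M. ?t n)" for M
  proof -
    have "(\<Sum>n<Suc M. ?t n) = (\<Sum>n=0..M. ?t n)" by (simp only: atLeast0AtMost lessThan_Suc_atMost)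
    also have "\<dots> = ?S M" by (simp add: sum.atLeast_Suc_atMost)
    finally show "?S M = (\<Sum>n<Suc M. ?t n)" by simp
  qed
  have "(\<lambda>M. \<Sum>n<Suc M. ?t n) \<longlonglongrightarrow> l" using l unfolding eq .
  then have tl: "?t sums l" unfolding sums_def by (rule LIMSEQ_imp_Suc)
  then show sm: "?t sums dseries a s" unfolding dseries_def by (simp add: sums_iff)
  with tl have "l = dseries a s" by (rule sums_unique2)
  with l have lim: "(\<lambda>M. norm (?S M - ?S Y)) \<longlonglongrightarrow> norm (dseries a s - ?S Y)"
    by (auto intro!: tendsto_intros)
  show "norm (dseries a s - ?S Y) \<le> ?C * real (Suc Y) powr (- Re s)"
    by (rule tendsto_upperbound[OF lim eventually_sequentiallyI[of Y, OF diff]]) auto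
qed

lemma dseries_conditional_holomorphic:
  assumes B: "\<And>M. norm (\<Sum>k=1..M. a k) \<le> B"
  shows "dseries a holomorphic_on {s. Re s > 0}"
proof (rule holomorphic_uniform_sequence)
  show "open {s. Re s > 0}" by (rule open_halfspace_Re_gt)
  fix n
  have "(\<lambda>s. a k * of_nat k powr (-s)) holomorphic_on {s. Re s > 0}" for k
    by (cases "k = 0") (auto intro!: holomorphic_intros)
  then show "(\<lambda>s. \<Sum>k=1..n. a k * of_nat k powr (-s)) holomorphic_on {s. Re s > 0}"
    by (intro holomorphic_intros)
next
  have B0: "B \<ge> 0" using B[of 0] by simp
  fix z assume z: "z \<in> {s. Re s > 0}"
  define d where "d = Re z / 2"
  have d: "d > 0" using z by (simp add: d_def)
  have cb: "Re s \<ge> d \<and> norm s \<le> norm z + d" if "s \<in> cball z d" for s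
  proof -
    have "norm (z - s) \<le> d" using that by (simp add: dist_norm)
    moreover have "Re (z - s) \<le> norm (z - s)" by (rule complex_Re_le_cmod)
    moreover have "norm s \<le> norm z + norm (z - s)" by (metis norm_minus_commute norm_triangle_sub)
    ultimately show ?thesis by (simp add: d_def)
  qed
  have "uniform_limit (cball z d) (\<lambda>n s. \<Sum>k=1..n. a k * of_nat k powr (-s)) (dseries a) sequentially"
  proof (rule uniform_limitI)
    fix e :: real assume e: "e > 0"
    have "\<forall>\<^sub>F Y in sequentially. B * (2 + (norm z + d) / d) * real (Suc Y) powr (- d) < e"
      using nat_powr_neg_tendsto_0[OF d] e by (rule order_tendstoD)
    then show "\<forall>\<^sub>F n in sequentially. \<forall>s\<in>cball z d.
         dist (\<Sum>k=1..n. a k * of_nat k powr (-s)) (dseries a s) < e"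
    proof eventually_elim
      case (elim Y)
      show ?case
      proof
        fix s assume "s \<in> cball z d"
        note c = cb[OF this]
        then have s: "Re s > 0" using d by linarith
        have "norm s / Re s \<le> (norm z + d) / d" using c d s by (intro frac_le) auto
        moreover have "real (Suc Y) powr (- Re s) \<le> real (Suc Y) powr (- d)"
          using c by (intro powr_mono) auto
        ultimately have "B * (2 + norm s / Re s) * real (Suc Y) powr (- Re s)
            \<le> B * (2 + (norm z + d) / d) * real (Suc Y) powr (- d)"
          using B0 s d by (intro mult_mono) auto
        with dseries_conditional(2)[OF B s, of Y] elim
        show "dist (\<Sum>k=1..Y. a k * of_nat k powr (-s)) (dseries a s) < e"
          by (simp add: dist_norm norm_minus_commute)
      qed
    qed
  qed
  then show "\<exists>d>0. cball z d \<subseteq> {s. Re s > 0} \<and>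
       uniform_limit (cball z d) (\<lambda>n s. \<Sum>k=1..n. a k * of_nat k powr (-s)) (dseries a) sequentially"
    using d cb by (intro exI[of _ d]) force
qed

text \<open>Complete periods cancel, so the length may be reduced below N.\<close>

lemma periodic_partial_sums:
  fixes a :: "nat \<Rightarrow> complex"
  assumes per: "\<And>n. a (n + N) = a n" and z: "(\<Sum>k=1..N. a k) = 0" and le: "\<And>n. norm (a n) \<le> 1"
    and N: "N > 0"
  shows "norm (\<Sum>k=1..M. a k) \<le> real N"
proof (induction M rule: less_induct)
  case (less M)
  show ?case
  proof (cases "M < N")
    case True
    have "norm (\<Sum>k=1..M. a k) \<le> (\<Sum>k=1..M. 1)" by (rule sum_norm_le) (rule le)
    then show ?thesis using True by simp
  next
    case False
    have "(\<Sum>k=1..M. a k) = (\<Sum>k=1..N. a k) + (\<Sum>k=Suc N..M. a k)"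
      using sum.ub_add_nat[of 1 N a "M - N"] False by simp
    also have "(\<Sum>k=Suc N..M. a k) = (\<Sum>k=1..M - N. a (k + N))"
      using sum.shift_bounds_cl_nat_ivl[of a 1 N "M - N"] False by simp
    finally have "(\<Sum>k=1..M. a k) = (\<Sum>k=1..M - N. a k)" using z per by simp
    then show ?thesis using less[of "M - N"] False N by simp
  qed
qed

section \<open>The character as a periodic, completely multiplicative function\<close>

locale prim_char =
  fixes N :: nat and chi :: "int \<Rightarrow> complex"
  assumes prim: "primitive_character N chi" and nonprin: "non_principal N chi"
begin

lemma dchar: "dirichlet_character N chi" using prim by (simp add: primitive_character_def)

lemma N_pos: "N > 0" and chi_mult: "chi (a * b) = chi a * chi b" and chi_add_N: "chi (a + int N) = chi a"
  and chi_eq_0: "chi a = 0 \<longleftrightarrow> \<not> coprime a (int N)"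
  using dchar by (auto simp: dirichlet_character_def)

lemma chi_1: "chi 1 = 1"
  using chi_mult[of 1 1] chi_eq_0[of 1] by auto

lemma chi_power: "chi (a ^ k) = chi a ^ k"
  by (induction k) (auto simp: chi_1 chi_mult)

lemma chi_add_mult: "chi (a + k * int N) = chi a"
proof -
  have *: "chi (a + int k * int N) = chi a" for a and k :: nat
  proof (induction k)
    case (Suc k)
    then show ?case using chi_add_N[of "a + int k * int N"] by (simp add: algebra_simps)
  qed auto
  show ?thesis
  proof (cases "k \<ge> 0")
    case True then show ?thesis using *[of a "nat k"] by simp
  next
    case False then show ?thesis using *[of "a + k * int N" "nat (-k)"] by simp
  qed
qed

lemma chi_cong: "[a = b] (mod int N) \<Longrightarrow> chi a = chi b"
proof -
  assume "[a = b] (mod int N)"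
  then obtain k where "b = a + int N * k" by (auto simp: cong_iff_lin)
  then show ?thesis using chi_add_mult[of a k] by (simp add: mult.commute)
qed

text \<open>By Euler's theorem the value at a unit is a root of unity.\<close>

lemma norm_chi: "coprime a (int N) \<Longrightarrow> norm (chi a) = 1"
proof -
  assume a: "coprime a (int N)"
  define b where "b = nat (a mod int N)"
  have b: "[a = int b] (mod int N)" using N_pos by (simp add: b_def cong_def)
  then have "coprime (int b) (int N)" using a cong_imp_coprime by blast
  then have "coprime b N" by simp
  then have "[b ^ totient N = 1] (mod N)" by (rule euler_theorem)
  then have "[int (b ^ totient N) = int 1] (mod int N)" by (simp only: cong_int_iff)
  then have "chi (int b ^ totient N) = chi 1" using chi_cong by simp
  then have "chi (int b) ^ totient N = 1" by (simp add: chi_power chi_1)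
  then have "norm (chi (int b)) ^ totient N = 1" by (metis norm_one norm_power)
  moreover have "totient N > 0" using N_pos by simp
  ultimately have "norm (chi (int b)) = 1" using power_eq_imp_eq_base[of "norm (chi (int b))" "totient N" 1] by simp
  then show ?thesis using chi_cong[OF b] by simp
qed

lemma norm_chi_le: "norm (chi a) \<le> 1"
  using norm_chi[of a] chi_eq_0[of a] by (cases "coprime a (int N)") auto

lemma N_gt_1: "N > 1"
proof (rule ccontr)
  assume "\<not> N > 1"
  then have [simp]: "N = 1" using N_pos by simp
  have "chi a = 1" for a using chi_cong[of a 1] chi_1 by (auto simp: cong_def)
  then show False using nonprin by (auto simp: non_principal_def)
qed

lemma chi_0: "chi 0 = 0" using N_gt_1 by (simp add: chi_eq_0)

text \<open>Multiplication by a unit permutes the residue classes.\<close>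

lemma sum_mod_mult:
  fixes F :: "int \<Rightarrow> complex"
  assumes b: "coprime b (int N)" and F: "\<And>x y. [x = y] (mod int N) \<Longrightarrow> F x = F y"
  shows "(\<Sum>a=0..<int N. F (a * b)) = (\<Sum>a=0..<int N. F a)"
proof -
  have "bij_betw (\<lambda>a. a * b mod int N) {0..<int N} {0..<int N}"
  proof (rule bij_betwI')
    fix x y assume xy: "x \<in> {0..<int N}" "y \<in> {0..<int N}"
    show "(x * b mod int N = y * b mod int N) = (x = y)"
      using xy b cong_mult_rcancel[of b "int N" x y] by (auto simp: cong_def)
  next
    fix y assume y: "y \<in> {0..<int N}"
    obtain c where c: "[b * c = 1] (mod int N)" using cong_solve_coprime_int[OF b] by blast
    have "[(y * c mod int N) * b = y * (b * c)] (mod int N)"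
      unfolding cong_def mod_mult_left_eq by (simp add: mult_ac)
    also have "[y * (b * c) = y * 1] (mod int N)" by (intro cong_mult cong_refl c)
    finally have "(y * c mod int N) * b mod int N = y" using y by (simp add: cong_def)
    then show "\<exists>x\<in>{0..<int N}. y = x * b mod int N"
      using N_pos by (intro bexI[of _ "y * c mod int N"]) auto
  qed (use N_pos in auto)
  then have "(\<Sum>a=0..<int N. F a) = (\<Sum>a=0..<int N. F (a * b mod int N))"
    by (rule sum.reindex_bij_betw[symmetric])
  also have "\<dots> = (\<Sum>a=0..<int N. F (a * b))" by (intro sum.cong F) (auto simp: cong_def)
  finally show ?thesis by simp
qed

lemma sum_chi: "(\<Sum>a=0..<int N. chi a) = 0"
proof -
  obtain b where b: "coprime b (int N)" "chi b \<noteq> 1" using nonprin by (auto simp: non_principal_def)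
  have "(\<Sum>a=0..<int N. chi a) * chi b = (\<Sum>a=0..<int N. chi a)"
    using sum_mod_mult[OF b(1), of chi] chi_cong by (simp add: chi_mult sum_distrib_right)
  then show ?thesis using b by simp
qed

definition f :: "nat \<Rightarrow> complex" where "f n = chi (int n)"

lemma f_partial: "norm (\<Sum>k=1..M. f k) \<le> real N"
proof (rule periodic_partial_sums)
  show "f (n + N) = f n" for n by (simp add: f_def chi_add_N)
  show "norm (f n) \<le> 1" for n by (simp add: f_def norm_chi_le)
  show "N > 0" by (rule N_pos)
  have "(\<Sum>a=0..<int N. chi a) = (\<Sum>k=0..<N. f k)"
    by (rule sum.reindex_bij_witness[of _ int nat]) (auto simp: f_def)
  also have "\<dots> = (\<Sum>k=1..<N. f k)" using N_pos chi_0
    by (subst sum.atLeast_Suc_lessThan) (auto simp: f_def)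
  also have "\<dots> = (\<Sum>k=1..<N. f k) + f N" using chi_add_N[of 0] chi_0 by (simp add: f_def)
  also have "\<dots> = (\<Sum>k=1..N. f k)" using N_pos
    by (cases N) (auto simp: atLeastLessThanSuc_atLeastAtMost)
  finally show "(\<Sum>k=1..N. f k) = 0" using sum_chi by simp
qed

sublocale cm: compl_mult f
  by unfold_locales (auto simp: f_def chi_1 chi_mult norm_chi_le)

end

section \<open>Nonvanishing on the line of real part one\<close>

lemma dseries_higher_deriv:
  assumes "abs_conv_beyond a c" "Re s > c"
  shows "abs_conv_beyond (\<lambda>n. (- of_real (ln (real n))) ^ k * a n) c \<and>
         (deriv ^^ k) (dseries a) s = dseries (\<lambda>n. (- of_real (ln (real n))) ^ k * a n) s"
  using assms(2)
proof (induction k arbitrary: s)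
  case (Suc k)
  let ?b = "\<lambda>n. (- of_real (ln (real n))) ^ k * a n"
  have c: "abs_conv_beyond ?b c" using Suc by blast
  have "(\<lambda>n. - (of_real (ln (real n)) * ?b n)) = (\<lambda>n. (- of_real (ln (real n))) ^ Suc k * a n)"
    by auto
  then have eq: "- dseries (\<lambda>n. of_real (ln (real n)) * ?b n) s = dseries (\<lambda>n. (- of_real (ln (real n))) ^ Suc k * a n) s"
    using suminf_minus[OF sums_summable[OF dseries_sums[OF abs_conv_beyond_ln[OF c] Suc.prems]]]
    by (simp add: dseries_def mult.assoc)
  have "(deriv ^^ Suc k) (dseries a) s = deriv ((deriv ^^ k) (dseries a)) s" by simp
  also have "\<dots> = deriv (dseries ?b) s"
  proof (rule deriv_cong_ev)
    have "\<forall>\<^sub>F x in nhds s. x \<in> {x. Re x > c}"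
      using Suc.prems by (intro eventually_nhds_in_open open_halfspace_Re_gt) auto
    then show "\<forall>\<^sub>F x in nhds s. (deriv ^^ k) (dseries a) x = dseries ?b x"
      by eventually_elim (use Suc.IH in auto)
  qed simp
  also have "\<dots> = - dseries (\<lambda>n. of_real (ln (real n)) * ?b n) s"
    by (rule DERIV_imp_deriv[OF dseries_has_derivative[OF c Suc.prems]])
  finally show ?case using eq
    abs_conv_beyond_mono[OF abs_conv_beyond_ln[OF c], of "\<lambda>n. (- of_real (ln (real n))) ^ Suc k * a n"]
    by (simp add: norm_mult mult_ac)
qed (use assms in auto)

text \<open>The Taylor coefficients of a Dirichlet series with nonnegative coefficients alternate in sign,
  so that the Taylor series can be rearranged to the left of its centre.\<close>

lemma dseries_nonneg_extend:
  fixes b :: "nat \<Rightarrow> real"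
  assumes b: "\<And>n. b n \<ge> 0" and c: "abs_conv_beyond (\<lambda>n. of_real (b n)) c" and w: "w > c"
    and H: "H holomorphic_on ball (of_real w) R"
    and eq: "\<forall>\<^sub>F s in nhds (of_real w). H s = dseries (\<lambda>n. of_real (b n)) s"
    and r: "0 < r" "r < R"
  shows "summable (\<lambda>n. b n * real n powr (- (w - r)))"
proof -
  let ?a = "\<lambda>n. complex_of_real (b n)"
  have rw: "Re (of_real w) > c" using w by simp
  define S where "S = (\<lambda>k. \<Sum>n. ln (real n) ^ k * b n * real n powr (-w))"
  have sums_S: "(\<lambda>n. ln (real n) ^ k * b n * real n powr (-w)) sums S k" 
    and dS: "(deriv ^^ k) H (of_real w) = (-1) ^ k * of_real (S k)" for k
  proof -
    note hd = dseries_higher_deriv[OF c rw, of k]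
    have "(\<lambda>n. (- of_real (ln (real n))) ^ k * ?a n * of_nat n powr (- of_real w)) sums (deriv ^^ k) (dseries ?a) (of_real w)"
      using dseries_sums[of "\<lambda>n. (- of_real (ln (real n))) ^ k * ?a n", OF _ rw] hd by simp
    moreover have "(- of_real (ln (real n))) ^ k * ?a n * of_nat n powr (- of_real w)
          = (-1) ^ k * of_real (ln (real n) ^ k * b n * real n powr (-w))" for n
    proof -
      have 1: "(- complex_of_real (ln (real n))) ^ k = (-1) ^ k * of_real (ln (real n) ^ k)"
        by (subst power_minus) simp
      have 2: "of_nat n powr (- of_real w) = complex_of_real (real n powr (-w))"
        using powr_of_real[of "real n" "-w"] by simp
      show ?thesis unfolding 1 2 by simp
    qed
    ultimately have 1: "(\<lambda>n. (-1) ^ k * of_real (ln (real n) ^ k * b n * real n powr (-w))) sums (deriv ^^ k) (dseries ?a) (of_real w)"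
      by simp
    have "(\<lambda>n. (-1) ^ k * ((-1) ^ k * complex_of_real (ln (real n) ^ k * b n * real n powr (-w))))
         sums ((-1) ^ k * (deriv ^^ k) (dseries ?a) (of_real w))"
      by (rule sums_mult[OF 1])
    then have 2: "(\<lambda>n. complex_of_real (ln (real n) ^ k * b n * real n powr (-w)))
         sums ((-1) ^ k * (deriv ^^ k) (dseries ?a) (of_real w))"
      by (simp flip: mult.assoc power_mult_distrib)
    from sums_Re[OF 2] show 3: "(\<lambda>n. ln (real n) ^ k * b n * real n powr (-w)) sums S k"
      unfolding S_def by (simp add: sums_iff)
    have "(-1) ^ k * (deriv ^^ k) (dseries ?a) (of_real w) = of_real (S k)"
      using sums_unique2[OF 2 sums_of_real[OF 3]] .
    then have "(-1) ^ k * ((-1) ^ k * (deriv ^^ k) (dseries ?a) (of_real w)) = (-1) ^ k * of_real (S k)" by simp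
    then have "(deriv ^^ k) (dseries ?a) (of_real w) = (-1) ^ k * of_real (S k)"
      by (simp flip: mult.assoc power_mult_distrib)
    then show "(deriv ^^ k) H (of_real w) = (-1) ^ k * of_real (S k)"
      using higher_deriv_cong_ev[OF eq refl, of k] by simp
  qed
  have "(\<lambda>k. (deriv ^^ k) H (of_real w) / fact k * (of_real (w - r) - of_real w) ^ k) sums H (of_real (w - r))"
    by (rule holomorphic_power_series[OF H]) (use r in \<open>auto simp: dist_norm\<close>)
  moreover have "(deriv ^^ k) H (of_real w) / fact k * (of_real (w - r) - of_real w) ^ k
       = of_real (r ^ k / fact k * S k)" for k
    by (cases "even k") (simp_all add: dS)
  ultimately have "(\<lambda>k. complex_of_real (r ^ k / fact k * S k)) sums H (of_real (w - r))" by simp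
  from sums_summable[OF sums_Re[OF this]] have smS: "summable (\<lambda>k. r ^ k / fact k * S k)"
    unfolding Re_complex_of_real .
  define T where "T = (\<Sum>k. r ^ k / fact k * S k)"
  have ln0: "ln (real n) \<ge> 0" for n by (cases "n = 0") auto
  \<comment> \<open>Only finitely many n occur, so their sum may be exchanged with the series over
    k. Expanding exp (r ln n) = n^r then produces the exponent w - r, and the total stays below the
    convergent Taylor series.\<close>
  have part: "(\<Sum>n<M. b n * real n powr (- (w - r))) \<le> T" for M
  proof -
    have "(\<lambda>k. \<Sum>n<M. r ^ k / fact k * (ln (real n) ^ k * b n * real n powr (-w))) sums
          (\<Sum>n<M. exp (r * ln (real n)) * (b n * real n powr (-w)))"
    proof (rule sums_sum)
      fix n
      have "(\<lambda>k. (r * ln (real n)) ^ k /\<^sub>R fact k) sums exp (r * ln (real n))" by (rule exp_converges)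
      from sums_mult2[OF this, of "b n * real n powr (-w)"]
      show "(\<lambda>k. r ^ k / fact k * (ln (real n) ^ k * b n * real n powr (-w))) sums
             (exp (r * ln (real n)) * (b n * real n powr (-w)))"
        by (simp add: power_mult_distrib divide_inverse mult_ac)
    qed
    then have tot: "(\<Sum>n<M. exp (r * ln (real n)) * (b n * real n powr (-w)))
        = (\<Sum>k. \<Sum>n<M. r ^ k / fact k * (ln (real n) ^ k * b n * real n powr (-w)))"
      and sm: "summable (\<lambda>k. \<Sum>n<M. r ^ k / fact k * (ln (real n) ^ k * b n * real n powr (-w)))"
      by (auto simp: sums_iff)
    have le: "(\<Sum>n<M. exp (r * ln (real n)) * (b n * real n powr (-w))) \<le> T" unfolding tot T_def
    proof (rule suminf_le[OF _ sm smS])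
      fix k
      have "(\<Sum>n<M. ln (real n) ^ k * b n * real n powr (-w)) \<le> S k"
        unfolding S_def using sums_summable[OF sums_S[of k]]
        by (intro sum_le_suminf) (auto intro!: mult_nonneg_nonneg b ln0 zero_le_power)
      then show "(\<Sum>n<M. r ^ k / fact k * (ln (real n) ^ k * b n * real n powr (-w))) \<le> r ^ k / fact k * S k"
        using r by (simp only: sum_distrib_left[symmetric]) (intro mult_left_mono, auto)
    qed
    have "(\<Sum>n<M. exp (r * ln (real n)) * (b n * real n powr (-w))) = (\<Sum>n<M. b n * real n powr (- (w - r)))"
    proof (rule sum.cong)
      fix n show "exp (r * ln (real n)) * (b n * real n powr (-w)) = b n * real n powr (- (w - r))"
      proof (cases "n = 0")
        case False
        then have "exp (r * ln (real n)) = real n powr r" by (simp add: powr_def)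
        moreover have "real n powr (- (w - r)) = real n powr r * real n powr (-w)" by (simp flip: powr_add)
        ultimately show ?thesis by simp
      qed auto
    qed auto
    with le show ?thesis by simp
  qed
  show ?thesis
    by (rule summableI_nonneg_bounded[where x = T]) (use b part in auto)
qed

text \<open>A variant of Landau's theorem: the half-plane of convergence extends up to a real singularity
  of the exponential, and the exponential has no zero there because it is at least \<open>1\<close> to the right.\<close>

lemma landau_exp:
  fixes b :: "nat \<Rightarrow> real"
  assumes b: "\<And>n. b n \<ge> 0" and c1: "abs_conv_beyond (\<lambda>n. of_real (b n)) 1"
    and D: "open D" "convex D" "\<And>x. x > 0 \<Longrightarrow> of_real x \<in> D"
    and Z: "Z holomorphic_on D" "\<And>s. s \<in> D \<Longrightarrow> Re s > 1 \<Longrightarrow> exp (dseries (\<lambda>n. of_real (b n)) s) = Z s"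
    and \<sigma>: "\<sigma> > 0"
  shows "summable (\<lambda>n. b n * real n powr (-\<sigma>))"
proof (rule ccontr)
  assume nsum: "\<not> summable (\<lambda>n. b n * real n powr (-\<sigma>))"
  let ?a = "\<lambda>n. complex_of_real (b n)"
  define A where "A = {x. summable (\<lambda>n. b n * real n powr (-x))}"
  have up: "y \<in> A" if "x \<in> A" "x \<le> y" for x y
  proof -
    have "summable (\<lambda>n. b n * real n powr (-x))" using that by (simp add: A_def)
    then have "summable (\<lambda>n. b n * real n powr (-y))"
    proof (rule summable_comparison_test')
      fix n :: nat assume "n \<ge> 0"
      show "norm (b n * real n powr (-y)) \<le> b n * real n powr (-x)"
      proof (cases "n = 0")
        case False
        then have "real n powr (-y) \<le> real n powr (-x)" using that by (intro powr_mono) auto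
        then show ?thesis using b by (auto simp: abs_mult intro!: mult_left_mono)
      qed auto
    qed
    then show ?thesis by (simp add: A_def)
  qed
  have A2: "2 \<in> A" using c1 b unfolding abs_conv_beyond_def A_def by auto
  have lb: "\<sigma> \<le> x" if "x \<in> A" for x using up[OF that, of \<sigma>] nsum by (force simp: A_def)
  define c where "c = Inf A"
  have bdd: "bdd_below A" using lb by (auto simp: bdd_below_def)
  have c\<sigma>: "c \<ge> \<sigma>" unfolding c_def using A2 lb by (intro cInf_greatest) auto
  have cA: "c \<le> x" if "x \<in> A" for x unfolding c_def using that bdd by (rule cInf_lower)
  have Ac: "x \<in> A" if "x > c" for x
    using that A2 bdd up unfolding c_def by (metis cInf_less_iff empty_iff less_imp_le)
  have conv: "abs_conv_beyond ?a c" using Ac b unfolding abs_conv_beyond_def A_def by auto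
  have c0: "c > 0" using c\<sigma> \<sigma> by linarith
  have eqZ: "exp (dseries ?a s) = Z s" if "s \<in> D" "Re s > c" for s
  proof (rule analytic_continuation_open[of "D \<inter> {s. Re s > max c 1}" "D \<inter> {s. Re s > c}" "\<lambda>s. exp (dseries ?a s)" Z])
    show "open (D \<inter> {s. Re s > max c 1})" "open (D \<inter> {s. Re s > c})"
      by (intro open_Int D open_halfspace_Re_gt)+
    show "connected (D \<inter> {s. Re s > c})"
      by (intro convex_connected convex_Int D convex_halfspace_Re_gt)
    have "complex_of_real (max c 1 + 1) \<in> D \<inter> {s. Re s > max c 1}" using D(3)[of "max c 1 + 1"] c0 by (auto simp: max_def)
    then show "D \<inter> {s. Re s > max c 1} \<noteq> {}" by blast
    show "(\<lambda>s. exp (dseries ?a s)) holomorphic_on D \<inter> {s. Re s > c}"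
      by (intro holomorphic_intros dseries_holomorphic[OF conv]) auto
    show "Z holomorphic_on D \<inter> {s. Re s > c}" using Z(1) by (rule holomorphic_on_subset) auto
    show "s \<in> D \<inter> {s. Re s > c}" using that by simp
  qed (use Z(2) in auto)
  have Zge: "Re (Z (of_real x)) \<ge> 1" if "x > c" for x
  proof -
    have "(\<lambda>n. ?a n * of_nat n powr (- of_real x)) sums dseries ?a (of_real x)"
      using that by (intro dseries_sums[OF conv]) auto
    moreover have "?a n * of_nat n powr (- of_real x) = of_real (b n * real n powr (-x))" for n
      using powr_of_real[of "real n" "-x"] by simp
    ultimately have 1: "(\<lambda>n. complex_of_real (b n * real n powr (-x))) sums dseries ?a (of_real x)" by simp
    then have 2: "summable (\<lambda>n. b n * real n powr (-x))" using sums_summable summable_of_real_iff by blast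
    have "dseries ?a (of_real x) = of_real (\<Sum>n. b n * real n powr (-x))"
      using sums_unique2[OF 1 sums_of_real[OF summable_sums[OF 2]]] .
    moreover have "(\<Sum>n. b n * real n powr (-x)) \<ge> 0" using b 2 by (intro suminf_nonneg) auto
    ultimately have "Re (exp (dseries ?a (of_real x))) \<ge> 1" by (simp add: exp_of_real)
    then show ?thesis using eqZ[of "of_real x"] D(3)[of x] that c0 by simp
  qed
  have cD: "of_real c \<in> D" using D(3) c0 by simp
  have contZ: "isCont Z (of_real c)"
    using Z(1) D(1) cD holomorphic_on_imp_continuous_on continuous_on_eq_continuous_at by blast
  have "((\<lambda>x. Re (Z (of_real x))) \<longlongrightarrow> Re (Z (of_real c))) (at_right c)"
    by (intro tendsto_intros isCont_tendsto_compose[OF contZ])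
  then have "Re (Z (of_real c)) \<ge> 1"
    by (rule tendsto_lowerbound) (auto intro!: eventually_at_rightI[of c "c + 1"] Zge)
  then have "Z (of_real c) \<noteq> 0" by auto
  then obtain e where e: "e > 0" "\<And>y. dist (of_real c) y < e \<Longrightarrow> Z y \<noteq> 0"
    using contZ continuous_at_avoid by metis
  obtain e' where e': "e' > 0" "ball (of_real c) e' \<subseteq> D" using D(1) cD openE by blast
  define r where "r = min e e'"
  have r: "r > 0" "ball (of_real c) r \<subseteq> D" "\<And>y. y \<in> ball (of_real c) r \<Longrightarrow> Z y \<noteq> 0"
    using e e' by (auto simp: r_def)
  \<comment> \<open>Since 1/4 + 1/2 < 1, the disc of radius r/2 about w stays inside the one of
    radius r about c, while w - 3r/8 = c - r/8 already lies to the left of the abscissa.\<close>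
  define w where "w = c + r / 4"
  have sub: "ball (of_real w) (r / 2) \<subseteq> ball (complex_of_real c) r"
  proof -
    have "dist (complex_of_real w) (of_real c) = r / 4"
      using r(1) by (simp add: w_def dist_norm flip: of_real_diff)
    then show ?thesis using r(1) by (simp add: ball_subset_ball_iff)
  qed
  have subD: "ball (of_real w) (r / 2) \<subseteq> D" using sub r by blast
  \<comment> \<open>The function continued past c is - Z'/Z rather than a logarithm: it is
    holomorphic wherever Z is holomorphic without zeros, and its coefficients are again
    nonnegative.\<close>
  let ?b = "\<lambda>n. ln (real n) * b n"
  have Zh: "Z holomorphic_on ball (of_real w) (r / 2)" using Z(1) subD holomorphic_on_subset by blast
  have "summable (\<lambda>n. ?b n * real n powr (- (w - 3 * r / 8)))"
  proof (rule dseries_nonneg_extend[where c = c])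
    show "?b n \<ge> 0" for n using b by (cases "n = 0") auto
    show "abs_conv_beyond (\<lambda>n. of_real (?b n)) c" using abs_conv_beyond_ln[OF conv] by simp
    show "w > c" using r by (simp add: w_def)
    show "(\<lambda>s. - (deriv Z s / Z s)) holomorphic_on ball (of_real w) (r / 2)"
      using r sub by (intro holomorphic_intros Zh holomorphic_deriv) auto
    have "\<forall>\<^sub>F s in nhds (of_real w). s \<in> D \<inter> {s. Re s > c}"
      using D r subD by (intro eventually_nhds_in_open open_Int open_halfspace_Re_gt) (auto simp: w_def)
    then show "\<forall>\<^sub>F s in nhds (of_real w). - (deriv Z s / Z s) = dseries (\<lambda>n. of_real (?b n)) s"
    proof eventually_elim
      case (elim s)
      then have s: "s \<in> D" "Re s > c" by auto
      have "((\<lambda>s. exp (dseries ?a s)) has_field_derivative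
              exp (dseries ?a s) * (- dseries (\<lambda>n. of_real (ln (real n)) * ?a n) s)) (at s)"
        by (rule DERIV_chain2[OF DERIV_exp dseries_has_derivative[OF conv s(2)]])
      then have "(Z has_field_derivative
              exp (dseries ?a s) * (- dseries (\<lambda>n. of_real (ln (real n)) * ?a n) s)) (at s)"
        by (rule has_field_derivative_transform_within_open[of _ _ _ "D \<inter> {s. Re s > c}"])
           (use s D eqZ in \<open>auto intro!: open_Int open_halfspace_Re_gt\<close>)
      from DERIV_imp_deriv[OF this]
      have "deriv Z s = Z s * (- dseries (\<lambda>n. of_real (ln (real n)) * ?a n) s)" by (simp only: eqZ[OF s])
      moreover have "Z s \<noteq> 0" unfolding eqZ[OF s, symmetric] by simp
      ultimately show ?case by simp
    qed
  qed (use r in auto)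
  then have sm: "summable (\<lambda>n. 2 * (?b n * real n powr (- (w - 3 * r / 8))))" by (rule summable_mult)
  have "summable (\<lambda>n. b n * real n powr (- (w - 3 * r / 8)))"
  proof (rule summable_comparison_test'[OF sm, of 2])
    fix n :: nat assume n: "n \<ge> 2"
    have "ln 2 \<ge> (1/2 :: real)" using ln2_ge_two_thirds by simp
    also have "ln 2 \<le> ln (real n)" using n by simp
    finally have "1 * (b n * real n powr (- (w - 3 * r / 8))) \<le> (2 * ln (real n)) * (b n * real n powr (- (w - 3 * r / 8)))"
      using b by (intro mult_right_mono) auto
    then show "norm (b n * real n powr (- (w - 3 * r / 8))) \<le> 2 * (?b n * real n powr (- (w - 3 * r / 8)))"
      using b by (simp add: abs_mult mult_ac)
  qed
  then have "w - 3 * r / 8 \<in> A" by (simp add: A_def)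
  from cA[OF this] show False using r by (simp add: w_def)
qed

interpretation one: compl_mult "\<lambda>_. 1"
  by unfold_locales auto

text \<open>The coefficients of log zeta: 1/k at p^k.\<close>

definition lw :: "nat \<Rightarrow> real" where "lw n = mangoldt n / ln (real n)"

definition logzeta :: "real \<Rightarrow> real" where "logzeta x = (\<Sum>n. lw n * real n powr (-x))"

lemma lw_nonneg: "lw n \<ge> 0" and lw_le_1: "lw n \<le> 1"
  using one.mangoldt_div_ln by (auto simp: lw_def)

lemma (in compl_mult) logcoeff_lw: "logcoeff n = f n * of_real (lw n)"
  by (simp add: logcoeff_def lw_def)

lemma of_nat_powr_of_real: "of_nat n powr (- of_real x) = complex_of_real (real n powr (-x))"
  using powr_of_real[of "real n" "-x"] by simp

lemma logzeta_summable: "x > 1 \<Longrightarrow> summable (\<lambda>n. lw n * real n powr (-x))"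
  by (rule summable_comparison_test'[of "\<lambda>n. real n powr (-x)"])
     (auto simp: summable_real_powr_iff abs_mult lw_nonneg lw_le_1 intro!: mult_left_le_one_le)

lemma (in compl_mult) norm_dseries_logcoeff:
  assumes "Re s > 1" shows "norm (dseries logcoeff s) \<le> logzeta (Re s)"
  unfolding dseries_def logzeta_def
proof (rule norm_suminf_le)
  show "norm (logcoeff n * of_nat n powr (-s)) \<le> lw n * real n powr (- Re s)" for n
    using norm_logcoeff[of n] by (auto simp: lw_def[symmetric] norm_mult norm_of_nat_powr intro!: mult_right_mono)
qed (use logzeta_summable assms in auto)

lemma exp_logzeta:
  assumes x: "x > 1" shows "exp (logzeta x) = (\<Sum>n. real n powr (-x))"
proof -
  have s: "summable (\<lambda>n. real n powr (-x))" using x by (simp add: summable_real_powr_iff)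
  have 1: "dseries one.logcoeff (of_real x) = of_real (logzeta x)"
    unfolding dseries_def one.logcoeff_lw of_nat_powr_of_real logzeta_def
    using sums_of_real[OF summable_sums[OF logzeta_summable[OF x]], where ?'a = complex]
    by (simp add: sums_iff)
  have 2: "dseries (\<lambda>_. 1) (of_real x) = of_real (\<Sum>n. real n powr (-x))"
    unfolding dseries_def of_nat_powr_of_real
    using sums_of_real[OF summable_sums[OF s], where ?'a = complex] by (simp add: sums_iff)
  have "exp (complex_of_real (logzeta x)) = of_real (\<Sum>n. real n powr (-x))"
    using one.exp_dseries_logcoeff[of "of_real x"] x unfolding 1 2 by simp
  then show ?thesis by (simp only: exp_of_real of_real_eq_iff)
qed

lemma powr_term_le:
  assumes x: "x > 1" and n: "n \<ge> 1"
  shows "real (Suc n) powr (-x) \<le> (real n powr (1 - x) - real (Suc n) powr (1 - x)) / (x - 1)"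
proof -
  have "\<exists>z. real n < z \<and> z < real (Suc n) \<and> real (Suc n) powr (1 - x) - real n powr (1 - x)
           = (real (Suc n) - real n) * ((1 - x) * z powr (1 - x - 1))"
    using n by (intro MVT2 has_real_derivative_powr) auto
  then obtain z where z: "real n < z" "z < real (Suc n)"
     "real (Suc n) powr (1 - x) - real n powr (1 - x) = (1 - x) * z powr (- x)" by auto
  have "real (Suc n) powr (-x) \<le> z powr (-x)"
    using z n x by (intro powr_mono2') auto
  moreover have "(real n powr (1 - x) - real (Suc n) powr (1 - x)) / (x - 1) = z powr (-x)"
    using z(3) x by (simp add: field_simps)
  ultimately show ?thesis by simp
qed

text \<open>Telescoping \<open>powr_term_le\<close> gives zeta(x) <= 1 + 1/(x - 1). The resulting
  singularity at 1 is only logarithmic, hence integrable, which later keeps integrals of log L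
  across the strip bounded.\<close>

lemma logzeta_le:
  assumes x: "x > 1" shows "logzeta x \<le> ln (1 + 1 / (x - 1))"
proof -
  have s: "summable (\<lambda>n. real n powr (-x))" using x by (simp add: summable_real_powr_iff)
  have p: "(\<Sum>n<Suc (Suc M). real n powr (-x)) \<le> 1 + (1 - real (Suc M) powr (1 - x)) / (x - 1)" for M
  proof (induction M)
    case (Suc M)
    show ?case using Suc powr_term_le[OF x, of "Suc M"] by (simp add: diff_divide_distrib)
  qed simp
  have "(\<Sum>n<M. real n powr (-x)) \<le> 1 + 1 / (x - 1)" for M
  proof -
    have "(\<Sum>n<M. real n powr (-x)) \<le> (\<Sum>n<Suc (Suc M). real n powr (-x))" by simp
    also have "\<dots> \<le> 1 + (1 - real (Suc M) powr (1 - x)) / (x - 1)" by (rule p)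
    also have "\<dots> \<le> 1 + 1 / (x - 1)" using x by (intro add_left_mono divide_right_mono) auto
    finally show ?thesis .
  qed
  then have "exp (logzeta x) \<le> 1 + 1 / (x - 1)" unfolding exp_logzeta[OF x] by (rule suminf_le_const[OF s])
  moreover have "1 + 1 / (x - 1) > 0" using x by (simp add: add_pos_pos)
  ultimately show ?thesis by (simp add: ln_ge_iff)
qed

text \<open>A bound at exponent 1 would bound log zeta(x) for all x > 1, hence every partial sum of
  zeta(x), and as x tends to 1 those of the harmonic series.\<close>

lemma lw_over_n_unbounded: "\<not> (\<forall>M. (\<Sum>n<M. lw n * real n powr (-1)) \<le> K)"
proof
  assume K: "\<forall>M. (\<Sum>n<M. lw n * real n powr (-1)) \<le> K"
  have 1: "(\<Sum>n<M. real n powr (-x)) \<le> exp K" if x: "x > 1" for x M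
  proof -
    have s: "summable (\<lambda>n. real n powr (-x))" using x by (simp add: summable_real_powr_iff)
    have "(\<Sum>n<M. lw n * real n powr (-x)) \<le> K" for M
    proof -
      have "lw n * real n powr (-x) \<le> lw n * real n powr (-1)" for n
      proof (cases "n = 0")
        case False
        then have "real n powr (-x) \<le> real n powr (-1)" using x by (intro powr_mono) auto
        then show ?thesis using lw_nonneg by (rule mult_left_mono)
      qed auto
      then have "(\<Sum>n<M. lw n * real n powr (-x)) \<le> (\<Sum>n<M. lw n * real n powr (-1))"
        by (intro sum_mono)
      also have "\<dots> \<le> K" using K by blast
      finally show ?thesis .
    qed
    then have "logzeta x \<le> K" unfolding logzeta_def by (rule suminf_le_const[OF logzeta_summable[OF x]])
    moreover have "(\<Sum>n<M. real n powr (-x)) \<le> (\<Sum>n. real n powr (-x))" using s by (intro sum_le_suminf) auto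
    ultimately show ?thesis using exp_logzeta[OF x] by (metis exp_le_cancel_iff order_trans)
  qed
  have "(\<Sum>n<M. real n powr (-1)) \<le> exp K" for M
  proof (rule tendsto_upperbound)
    have "((\<lambda>x. real n powr (-x)) \<longlongrightarrow> real n powr (-1)) (at_right 1)" for n
      by (cases "n = 0") (simp, intro tendsto_powr tendsto_const tendsto_minus tendsto_ident_at, simp)
    then show "((\<lambda>x. \<Sum>n<M. real n powr (-x)) \<longlongrightarrow> (\<Sum>n<M. real n powr (-1))) (at_right 1)"
      by (intro tendsto_sum)
    show "\<forall>\<^sub>F x in at_right 1. (\<Sum>n<M. real n powr (-x)) \<le> exp K"
      by (rule eventually_at_rightI[of _ 2]) (auto intro!: 1)
  qed auto
  then have "summable (\<lambda>n. real n powr (-1))" by (intro summableI_nonneg_bounded) auto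
  then show False unfolding summable_real_powr_iff by simp
qed

lemma divide_out_zero:
  assumes F: "F holomorphic_on D" and D: "open D" and a: "F a = 0"
  obtains q where "q holomorphic_on D" "\<And>s. s \<in> D \<Longrightarrow> F s = (s - a) * q s" "q a = deriv F a"
proof
  show "(\<lambda>z. if z = a then deriv F a else F z / (z - a) - F a / (z - a)) holomorphic_on D"
    by (rule pole_theorem_open[OF F D]) auto
qed (use a in auto)

lemma mangoldt_square: "mangoldt (n\<^sup>2) = (mangoldt n :: real)"
proof (cases "n = 0")
  case False
  then have "primepow (n\<^sup>2) \<longleftrightarrow> primepow n" by (simp add: primepow_power_iff_nat)
  then show ?thesis using aprimedivisor_primepow_power[of n 2] by (auto simp: mangoldt_def)
qed auto

lemma lw_square: "lw (n\<^sup>2) = lw n / 2"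
  by (cases "n = 0") (auto simp: lw_def mangoldt_square ln_realpow)

text \<open>The alternating series has bounded partial sums, so it continues to Re s > 0 without a
  pole; this identity lets it stand in for zeta there.\<close>

lemma eta_dseries:
  assumes s: "Re s > 1"
  shows "dseries (\<lambda>n. if even n then -1 else 1) s = (1 - 2 powr (1 - s)) * dseries (\<lambda>_. 1) s"
proof -
  let ?z = "dseries (\<lambda>_. 1) s"
  have z: "(\<lambda>n. 1 * of_nat n powr (-s)) sums ?z" by (rule dseries_sums[OF one.conv_f s])
  have "(\<lambda>n. 2 powr (-s) * of_nat n powr (-s)) sums (2 powr (-s) * ?z)"
    using sums_mult[OF z, of "2 powr (-s)"] by simp
  moreover have "2 powr (-s) * of_nat n powr (-s) = of_nat (2 * n) powr (-s)" for n
    using powr_times_real[of 2 "of_nat n" "-s"] by simp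
  ultimately have "(\<lambda>n. of_nat (2 * n) powr (-s)) sums (2 powr (-s) * ?z)" by simp
  then have "(\<lambda>n. (\<lambda>m. if even m then of_nat m powr (-s) else 0) (2 * n)) sums (2 powr (-s) * ?z)" by simp
  then have "(\<lambda>m. if even m then of_nat m powr (-s) else 0) sums (2 powr (-s) * ?z)"
    by (subst (asm) sums_mono_reindex) (auto simp: strict_mono_def elim!: evenE)
  from sums_diff[OF z sums_mult[OF this, of 2]]
  have "(\<lambda>n. (if even n then -1 else 1) * of_nat n powr (-s)) sums (?z - 2 * (2 powr (-s) * ?z))"
    by (rule sums_cong[THEN iffD1, rotated]) auto
  moreover have "2 powr (1 - s) = 2 * (2 powr (-s) :: complex)"
    using powr_add[of "2::complex" 1 "-s"] by simp
  ultimately show ?thesis by (simp add: dseries_def sums_iff algebra_simps)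
qed

text \<open>The other zeros differ from 1 by multiples of 2 pi i / ln 2, and 2 pi / ln 2 > 9; hence
  the height 8.\<close>

lemma one_minus_two_powr_eq_0:
  assumes "1 - 2 powr (1 - s) = (0::complex)" "\<bar>Im s\<bar> < 8"
  shows "s = 1"
proof -
  have "Ln (2::complex) = of_real (ln 2)" using Ln_of_real[of 2] by simp
  then have "exp ((1 - s) * of_real (ln 2)) = 1"
    using assms by (simp add: powr_def)
  then obtain n :: int where n: "Re ((1 - s) * of_real (ln 2)) = 0" "Im ((1 - s) * of_real (ln 2)) = of_int (2 * n) * pi"
    by (auto simp: exp_eq_1)
  have "- Im s * ln 2 = of_int (2 * n) * pi" using n(2) by simp
  then have "\<bar>of_int (2 * n) * pi\<bar> = \<bar>- Im s * ln 2\<bar>" by simp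
  also have "\<dots> = \<bar>Im s\<bar> * ln 2" by (simp add: abs_mult)
  also have "\<dots> \<le> 8 * (25/36)" using assms(2) ln2_le_25_over_36 by (intro mult_mono) auto
  finally have *: "\<bar>real_of_int n\<bar> * (2 * pi) < 6" by (simp add: abs_mult)
  have "n = 0"
  proof (rule ccontr)
    assume "n \<noteq> 0"
    then have "\<bar>real_of_int n\<bar> \<ge> 1" by simp
    then have "1 * (2 * pi) \<le> \<bar>real_of_int n\<bar> * (2 * pi)" by (intro mult_right_mono) auto
    then show False using * pi_gt3 by linarith
  qed
  then show ?thesis using n by (auto simp: complex_eq_iff)
qed

context prim_char
begin

lemma dseries_f_holomorphic: "dseries f holomorphic_on {s. Re s > 0}"
  by (rule dseries_conditional_holomorphic[OF f_partial])

text \<open>The product \<open>\<zeta>(s)\<^sup>2 L(s + it, \<chi>) L(s - it, \<chi>\<^sup>*)\<close> (with the conjugate character \<open>\<chi>\<^sup>*\<close>) has a logarithm with nonnegative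
  coefficients. A zero of \<open>L\<close> at \<open>1 + it\<close> would cancel the double pole. The continuation of \<open>\<zeta>\<close>
  is expressed through the alternating series, which is why only a strip of height less than
  \<open>2\<pi> / ln 2\<close> is considered.\<close>

lemma dseries_f_nonzero_at_1: "dseries f (1 + \<i> * of_real t) \<noteq> 0"
proof
  assume zero: "dseries f (1 + \<i> * of_real t) = 0"
  define f1 where "f1 n = f n * of_nat n powr (- (\<i> * of_real t))" for n
  interpret f1: compl_mult f1
  proof
    show "f1 1 = 1" using cm.f_1 by (simp add: f1_def)
    show "f1 (m * n) = f1 m * f1 n" for m n
      using powr_times_real[of "of_nat m" "of_nat n" "- (\<i> * of_real t)"] by (simp add: f1_def cm.f_mult)
    show "norm (f1 n) \<le> 1" for n
      using cm.f_le[of n] by (cases "n = 0") (auto simp: f1_def norm_mult norm_of_nat_powr)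
  qed
  interpret f2: compl_mult "\<lambda>n. cnj (f1 n)"
    by unfold_locales (use f1.f_1 f1.f_mult f1.f_le in auto)
  define F1 where "F1 s = dseries f (s + \<i> * of_real t)" for s
  define F2 where "F2 s = cnj (F1 (cnj s))" for s
  have F1: "dseries f1 s = F1 s" for s
  proof -
    have "f1 n * of_nat n powr (-s) = f n * of_nat n powr (- (s + \<i> * of_real t))" for n
      by (simp add: f1_def minus_add_distrib powr_add mult_ac del: minus_add_distrib uminus_add_conv_diff add_uminus_conv_diff)
         (simp add: powr_add[symmetric] algebra_simps)
    then show ?thesis by (simp add: dseries_def F1_def)
  qed
  have F2: "dseries (\<lambda>n. cnj (f1 n)) s = F2 s" if "Re s > 1" for s
  proof -
    have "(\<lambda>n. f1 n * of_nat n powr (- cnj s)) sums dseries f1 (cnj s)"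
      using that by (intro dseries_sums[OF f1.conv_f]) auto
    then have "(\<lambda>n. cnj (f1 n * of_nat n powr (- cnj s))) sums cnj (dseries f1 (cnj s))" by (simp only: sums_cnj)
    moreover have "cnj (of_nat n powr (- cnj s)) = of_nat n powr (-s)" for n
      by (cases "n = 0") (auto simp: cnj_powr)
    ultimately show ?thesis by (simp add: dseries_def F2_def F1[symmetric] sums_iff)
  qed
  define D where "D = {s. Re s > 0} \<inter> {s. \<bar>Im s\<bar> < 8}"
  have Deq: "D = {s. Re s > 0} \<inter> ({s. Im s < 8} \<inter> {s. Im s > -8})" by (auto simp: D_def)
  have D: "open D" "convex D" "\<And>x. x > 0 \<Longrightarrow> of_real x \<in> D" "1 \<in> D"
    unfolding Deq by (auto intro!: open_Int open_halfspace_Re_gt open_halfspace_Im_gt open_halfspace_Im_lt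
       convex_Int convex_halfspace_Re_gt convex_halfspace_Im_gt convex_halfspace_Im_lt)
  have F1h: "F1 holomorphic_on {s. Re s > 0}"
    unfolding F1_def
    by (rule holomorphic_on_compose_gen[unfolded o_def, of "\<lambda>s. s + \<i> * of_real t" _ "dseries f", OF _ dseries_f_holomorphic])
       (auto intro!: holomorphic_intros)
  have cnj_im: "cnj ` {s. Re s > 0} = {s. Re s > 0}"
    by (auto simp: image_iff) (metis complex_cnj_cnj cnj.sel(1))
  have F2h: "F2 holomorphic_on {s. Re s > 0}"
    unfolding F2_def using holomorphic_on_compose_cnj_cnj[of F1 "{s. Re s > 0}"] F1h
    by (simp add: o_def cnj_im open_halfspace_Re_gt)
  have "F1 holomorphic_on D" "F2 holomorphic_on D" using F1h F2h by (auto elim!: holomorphic_on_subset simp: D_def)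
  moreover have F10: "F1 1 = 0" "F2 1 = 0" using zero by (auto simp: F1_def F2_def)
  ultimately obtain q1 q2 where q: "q1 holomorphic_on D" "\<And>s. s \<in> D \<Longrightarrow> F1 s = (s - 1) * q1 s"
     "q2 holomorphic_on D" "\<And>s. s \<in> D \<Longrightarrow> F2 s = (s - 1) * q2 s"
    using divide_out_zero[OF _ D(1)] by metis
  define u where "u s = 1 - 2 powr (1 - s)" for s :: complex
  have u: "u holomorphic_on D" "u 1 = 0" unfolding u_def by (auto intro!: holomorphic_intros)
  have "((\<lambda>w. 2 powr w) has_field_derivative of_real (ln 2)) (at (1 - 1 :: complex))"
    using has_field_derivative_powr_right[of 2 0] by (simp add: Ln_of_real[of 2, simplified])
  moreover have "((\<lambda>z::complex. 1 - z) has_field_derivative (-1)) (at 1)"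
    by (auto intro!: derivative_eq_intros)
  ultimately have "((\<lambda>z. 2 powr (1 - z)) has_field_derivative of_real (ln 2) * (-1)) (at (1::complex))"
    by (rule DERIV_chain2)
  from DERIV_diff[OF DERIV_const this] have "(u has_field_derivative of_real (ln 2)) (at 1)"
    unfolding u_def by simp
  then have du: "deriv u 1 \<noteq> 0" using DERIV_imp_deriv by fastforce
  obtain k where k: "k holomorphic_on D" "\<And>s. s \<in> D \<Longrightarrow> u s = (s - 1) * k s" "k 1 = deriv u 1"
    using divide_out_zero[OF u(1) D(1) u(2)] by blast
  have k0: "k s \<noteq> 0" if "s \<in> D" for s
  proof (cases "s = 1")
    case False
    then have "u s \<noteq> 0" using one_minus_two_powr_eq_0[of s] that by (auto simp: u_def D_def)
    then show ?thesis using k(2)[OF that] by auto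
  qed (use k du in auto)
  define e where "e = (\<lambda>n::nat. if even n then -1 else 1 :: complex)"
  have "norm (\<Sum>j=1..M. e j) \<le> real 2" for M
  proof (rule periodic_partial_sums)
    show "(\<Sum>j=1..2. e j) = 0" by (simp add: e_def numeral_2_eq_2)
  qed (auto simp: e_def)
  then have Eh: "dseries e holomorphic_on {s. Re s > 0}" by (rule dseries_conditional_holomorphic)
  define Z where "Z s = (dseries e s)\<^sup>2 * q1 s * q2 s / (k s)\<^sup>2" for s
  define b where "b n = lw n * (2 + 2 * Re (f1 n))" for n
  have Re_f1: "\<bar>Re (f1 n)\<bar> \<le> 1" for n using f1.f_le abs_Re_le_cmod order_trans by blast
  have b0: "b n \<ge> 0" for n unfolding b_def using Re_f1[of n] lw_nonneg[of n] by (intro mult_nonneg_nonneg) auto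
  have bc: "abs_conv_beyond (\<lambda>n. of_real (b n)) 1"
  proof (rule abs_conv_beyond_bounded)
    fix n
    have "b n \<le> 1 * 4" unfolding b_def using Re_f1[of n] lw_nonneg[of n] lw_le_1[of n] by (intro mult_mono) auto
    then show "norm (complex_of_real (b n)) \<le> 4" using b0[of n] by simp
  qed
  have summable_b: "summable (\<lambda>n. b n * real n powr (-\<sigma>))" if "\<sigma> > 0" for \<sigma>
  proof (rule landau_exp[OF b0 bc D(1-3) _ _ that])
    show "Z holomorphic_on D" unfolding Z_def
      using k0 by (intro holomorphic_intros q k holomorphic_on_subset[OF Eh]) (auto simp: D_def)
    fix s assume s: "s \<in> D" "Re s > 1"
    have sm: "(\<lambda>n. (one.logcoeff n * of_nat n powr (-s) + one.logcoeff n * of_nat n powr (-s))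
          + (f1.logcoeff n * of_nat n powr (-s) + f2.logcoeff n * of_nat n powr (-s))) sums
        ((dseries one.logcoeff s + dseries one.logcoeff s) + (dseries f1.logcoeff s + dseries f2.logcoeff s))"
      using s by (intro sums_add dseries_sums[OF one.conv_logcoeff] dseries_sums[OF f1.conv_logcoeff] dseries_sums[OF f2.conv_logcoeff])
    have cf: "(one.logcoeff n + one.logcoeff n) + (f1.logcoeff n + f2.logcoeff n) = of_real (b n)" for n
      unfolding one.logcoeff_lw f1.logcoeff_lw f2.logcoeff_lw b_def
      by (simp add: complex_eq_iff algebra_simps)
    have "(\<lambda>n. of_real (b n) * of_nat n powr (-s)) sums
        ((dseries one.logcoeff s + dseries one.logcoeff s) + (dseries f1.logcoeff s + dseries f2.logcoeff s))"
      using sm unfolding distrib_right[symmetric] cf .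
    then have "dseries (\<lambda>n. of_real (b n)) s = (dseries one.logcoeff s + dseries one.logcoeff s) + (dseries f1.logcoeff s + dseries f2.logcoeff s)"
      by (simp only: dseries_def sums_iff)
    then have "exp (dseries (\<lambda>n. of_real (b n)) s) = (dseries (\<lambda>_. 1) s)\<^sup>2 * F1 s * F2 s"
      using one.exp_dseries_logcoeff[OF s(2)] f1.exp_dseries_logcoeff[OF s(2)] f2.exp_dseries_logcoeff[OF s(2)]
      by (simp only: exp_add F1 F2[OF s(2)] power2_eq_square mult.assoc)
    also have "\<dots> = Z s"
    proof -
      have E: "dseries e s = (s - 1) * k s * dseries (\<lambda>_. 1) s"
        using eta_dseries[OF s(2)] k(2)[OF s(1)] by (simp add: e_def u_def)
      show ?thesis using k0[OF s(1)]
        unfolding Z_def E q(2)[OF s(1)] q(4)[OF s(1)] by (simp add: field_simps power2_eq_square)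
    qed
    finally show "exp (dseries (\<lambda>n. of_real (b n)) s) = Z s" .
  qed
  define K where "K = (\<Sum>n. b n * real n powr (- (1/2)))"
  have sK: "summable (\<lambda>n. b n * real n powr (- (1/2)))" using summable_b[of "1/2"] by simp
  have part: "(\<Sum>n\<in>A. b n * real n powr (- (1/2))) \<le> K" if "finite A" for A
    unfolding K_def using that b0 by (intro sum_le_suminf sK) auto
  \<comment> \<open>At m with \<open>f1 m = -1\<close> the coefficient \<open>b m\<close> vanishes,
    but then \<open>f1 (m^2) = 1\<close>. So \<open>b m\<close> and \<open>b (m^2)\<close> together
    dominate \<open>lw m\<close>; the inequality behind this is (2x + 1)^2 >= 0. At exponent 1/2 the
    square m^2 has weight 1/m, so summability there contradicts the divergence of
    \<open>lw m / m\<close>.\<close>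
  have "(\<Sum>m<M. lw m * real m powr (-1)) \<le> 2 * K" for M
  proof -
    have "(\<Sum>m<M. lw m * real m powr (-1)) \<le> (\<Sum>m<M. b m * real m powr (- (1/2)) + b (m\<^sup>2) * real (m\<^sup>2) powr (- (1/2)))"
    proof (rule sum_mono)
      fix m
      show "lw m * real m powr (-1) \<le> b m * real m powr (- (1/2)) + b (m\<^sup>2) * real (m\<^sup>2) powr (- (1/2))"
      proof (cases "m = 0")
        case False
        then have m: "real m \<ge> 1" by simp
        define x y where "x = Re (f1 m)" and "y = Im (f1 m)"
        have "x\<^sup>2 + y\<^sup>2 \<le> 1" using f1.f_le[of m] by (simp add: x_def y_def cmod_def)
        moreover have "Re (f1 (m\<^sup>2)) = x\<^sup>2 - y\<^sup>2" by (simp add: power2_eq_square f1.f_mult x_def y_def)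
        moreover have "(2 * x + 1)\<^sup>2 \<ge> 0" by simp
        ultimately have c: "1 \<le> 2 + 2 * x + (1 + Re (f1 (m\<^sup>2)))" by (simp add: power2_eq_square algebra_simps)
        have p: "real (m\<^sup>2) powr (- (1/2)) = real m powr (-1)"
          using False powr_powr[of "real m" 2 "- (1/2)"] by (simp add: powr_realpow)
        have "lw m * real m powr (-1) = 1 * (lw m * real m powr (-1))" by simp
        also have "\<dots> \<le> (2 + 2 * x + (1 + Re (f1 (m\<^sup>2)))) * (lw m * real m powr (-1))"
          using c lw_nonneg by (intro mult_right_mono) auto
        also have "\<dots> = b m * real m powr (-1) + b (m\<^sup>2) * real m powr (-1)"
          unfolding b_def lw_square by (simp add: x_def algebra_simps add_divide_distrib)
        also have "b m * real m powr (-1) \<le> b m * real m powr (- (1/2))"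
          using b0 m by (intro mult_left_mono powr_mono) auto
        finally show ?thesis unfolding p by simp
      qed auto
    qed
    also have "\<dots> = (\<Sum>m\<in>{..<M}. b m * real m powr (- (1/2))) + (\<Sum>n\<in>(\<lambda>m. m\<^sup>2) ` {..<M}. b n * real n powr (- (1/2)))"
      by (subst sum.reindex) (auto simp: sum.distrib inj_on_def)
    also have "\<dots> \<le> K + K" by (intro add_mono part) auto
    finally show ?thesis by simp
  qed
  then show False using lw_over_n_unbounded by blast
qed

lemma dseries_f_nonzero: "Re s \<ge> 1 \<Longrightarrow> dseries f s \<noteq> 0"
proof (cases "Re s = 1")
  case True
  then have "s = 1 + \<i> * of_real (Im s)" by (simp add: complex_eq_iff)
  then show ?thesis using dseries_f_nonzero_at_1 by metis
next
  assume "Re s \<ge> 1" "Re s \<noteq> 1"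
  then have "exp (dseries cm.logcoeff s) = dseries f s" by (intro cm.exp_dseries_logcoeff) auto
  then show ?thesis by (metis exp_not_eq_zero)
qed

end

section \<open>Gauss sums and the theta functional equation\<close>

text \<open>Take for k the product of the primes of m that do not divide a. Then each prime of m
  divides exactly one of a and k * d, hence not their sum.\<close>

lemma coprime_lift:
  fixes a d m :: int
  assumes m: "m > 0" and d: "d dvd m" and a: "coprime a d"
  shows "\<exists>k. coprime (a + k * d) m"
proof -
  define k where "k = (\<Prod>p\<in>{p\<in>prime_factors m. \<not> p dvd a}. p)"
  have fin: "finite {p\<in>prime_factors m. \<not> p dvd a}" by simp
  have "coprime (a + k * d) m"
  proof (rule ccontr)
    assume "\<not> coprime (a + k * d) m"
    then have "\<not> is_unit (gcd (a + k * d) m)" by (simp add: coprime_iff_gcd_eq_1)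
    moreover have "gcd (a + k * d) m \<noteq> 0" using m by simp
    ultimately obtain p where "prime p" "p dvd gcd (a + k * d) m" using prime_divisor_exists by blast
    then have p: "prime p" "p dvd a + k * d" "p dvd m" by auto
    have pm: "p \<in> prime_factors m" using p m by (simp add: prime_factors_dvd)
    show False
    proof (cases "p dvd a")
      case True
      then have "p dvd k * d" using p(2) by (simp add: dvd_add_right_iff)
      then have "p dvd k \<or> p dvd d" using p(1) by (simp add: prime_dvd_mult_iff)
      moreover have "\<not> p dvd d" using True a p(1) coprime_common_divisor not_prime_unit by blast
      ultimately have "p dvd k" by blast
      then obtain q where q: "q \<in> prime_factors m" "\<not> q dvd a" "p dvd q"
        unfolding k_def using prime_dvd_prod_iff[OF fin p(1), of "\<lambda>p. p"] by auto
      then have "p = q" using primes_dvd_imp_eq[OF p(1)] by (auto simp: prime_factors_dvd)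
      then show False using q True by simp
    next
      case False
      then have "p dvd k" unfolding k_def using pm by (intro dvd_prodI[OF fin]) auto
      then have "p dvd a" using p(2) by (simp add: dvd_add_left_iff)
      then show False using False by simp
    qed
  qed
  then show ?thesis ..
qed

context prim_char
begin

text \<open>Otherwise chi would depend on its argument only modulo d. Since units modulo d lift to
  units modulo N, it would then be induced by a character modulo d.\<close>

lemma primitive_witness:
  fixes d :: nat
  assumes d: "d dvd N" "d < N"
  shows "\<exists>b. coprime b (int N) \<and> [b = 1] (mod int d) \<and> chi b \<noteq> 1"
proof (rule ccontr)
  assume "\<not> ?thesis"
  then have triv: "chi b = 1" if "coprime b (int N)" "[b = 1] (mod int d)" for b using that by blast
  have d0: "d > 0" using d N_pos by (auto intro: Nat.gr0I)
  have dN: "int d dvd int N" using d by simp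
  have cop_d: "coprime a (int d)" if "coprime a (int N)" for a
    using that dN coprime_divisors[OF dvd_refl, of "int d" "int N" a] by blast
  have eq: "chi a = chi b" if ab: "coprime a (int N)" "coprime b (int N)" "[a = b] (mod int d)" for a b
  proof -
    obtain c where c: "[b * c = 1] (mod int N)" using cong_solve_coprime_int[OF ab(2)] by blast
    then have cd: "[b * c = 1] (mod int d)" using dN cong_dvd_modulus by blast
    have "[a * c = b * c] (mod int d)" using ab(3) by (intro cong_mult) auto
    then have "[a * c = 1] (mod int d)" using cd cong_trans by blast
    moreover have "coprime c (int N)" using c
      by (metis cong_imp_coprime cong_sym coprime_1_left coprime_mult_left_iff)
    ultimately have "chi (a * c) = 1" using ab(1) by (intro triv) auto
    moreover have "chi (b * c) = 1" using chi_cong[OF c] chi_1 by simp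
    ultimately have "chi a * chi c = chi b * chi c" by (simp add: chi_mult)
    moreover have "chi c \<noteq> 0" using \<open>coprime c (int N)\<close> chi_eq_0 by blast
    ultimately show ?thesis by simp
  qed
  define lift where "lift a = (SOME b. coprime b (int N) \<and> [b = a] (mod int d))" for a
  have lift: "coprime (lift a) (int N) \<and> [lift a = a] (mod int d)" if a: "coprime a (int d)" for a
  proof -
    obtain k where "coprime (a + k * int d) (int N)" using coprime_lift[OF _ dN a] N_pos by auto
    moreover have "[a + k * int d = a] (mod int d)" by (simp add: cong_def)
    ultimately show ?thesis unfolding lift_def
      by (rule someI[of "\<lambda>b. coprime b (int N) \<and> [b = a] (mod int d)", OF conjI])
  qed
  define \<psi> where "\<psi> a = (if coprime a (int d) then chi (lift a) else 0)" for a
  have \<psi>: "\<psi> a = chi b" if "coprime b (int N)" "[b = a] (mod int d)" for a b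
  proof -
    have a: "coprime a (int d)" using cop_d[OF that(1)] that(2) cong_imp_coprime by blast
    note l = lift[OF a]
    have "[lift a = b] (mod int d)" using l that(2) cong_sym cong_trans by blast
    from eq[OF _ that(1) this] l a show ?thesis unfolding \<psi>_def by simp
  qed
  have "dirichlet_character d \<psi>"
    unfolding dirichlet_character_def
  proof (intro conjI allI)
    fix a b
    show "\<psi> (a * b) = \<psi> a * \<psi> b"
    proof (cases "coprime a (int d) \<and> coprime b (int d)")
      case True
      then have "\<psi> (a * b) = chi (lift a * lift b)"
        using lift[of a] lift[of b] by (intro \<psi>) (auto intro: cong_mult)
      then show ?thesis using True by (simp add: \<psi>_def chi_mult)
    qed (auto simp: \<psi>_def)
    show "\<psi> (a + int d) = \<psi> a"
    proof (cases "coprime a (int d)")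
      case True
      then show ?thesis using lift[OF True] \<psi>[of "lift a" "a + int d"] \<psi>[of "lift a" a]
        by (simp add: cong_def)
    next
      case False
      moreover have "coprime (a + int d) (int d) \<longleftrightarrow> coprime a (int d)"
        using gcd_add1[of a "int d"] by (simp add: coprime_iff_gcd_eq_1)
      ultimately show ?thesis by (simp add: \<psi>_def)
    qed
    show "\<psi> a \<noteq> 0 \<longleftrightarrow> coprime a (int d)"
      using lift[of a] chi_eq_0 by (auto simp: \<psi>_def)
  qed (use d0 in auto)
  moreover have "chi a = \<psi> a" if "coprime a (int N)" for a using \<psi>[OF that, of a] by simp
  ultimately show False using prim d unfolding primitive_character_def by blast
qed

definition ee :: "int \<Rightarrow> complex" where "ee a = cis (2 * pi * of_int a / real N)"

lemma ee_cong: "[a = b] (mod int N) \<Longrightarrow> ee a = ee b"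
proof -
  assume "[a = b] (mod int N)"
  then obtain k where k: "b = a + int N * k" by (auto simp: cong_iff_lin)
  have "2 * pi * of_int b / real N = 2 * pi * of_int a / real N + 2 * pi * of_int k"
    using N_pos by (simp add: k field_simps)
  then show ?thesis by (simp add: ee_def flip: cis_mult)
qed

definition gauss :: complex where "gauss = (\<Sum>a=0..<int N. chi a * ee a)"

text \<open>For a unit k substitute a k for a. Otherwise let d = N / gcd(k, N): a unit b = 1 modulo
  d with chi(b) different from 1 fixes every \<open>ee (a * k)\<close> but multiplies the sum by
  chi(b), so the sum is 0. This is where primitivity enters.\<close>

lemma gauss_twist: "(\<Sum>a=0..<int N. chi a * ee (a * k)) = cnj (chi k) * gauss"
proof (cases "coprime k (int N)")
  case True
  have "(\<Sum>a=0..<int N. chi (a * k) * ee (a * k)) = gauss"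
    unfolding gauss_def
    by (rule sum_mod_mult[OF True, of "\<lambda>a. chi a * ee a"]) (use chi_cong ee_cong in metis)
  then have "chi k * (\<Sum>a=0..<int N. chi a * ee (a * k)) = gauss"
    by (simp add: chi_mult sum_distrib_left mult_ac)
  then have "cnj (chi k) * (chi k * (\<Sum>a=0..<int N. chi a * ee (a * k))) = cnj (chi k) * gauss" by simp
  moreover have "cnj (chi k) * chi k = 1" using norm_chi[OF True]
    by (metis complex_norm_square mult.commute of_real_1 power_one)
  ultimately show ?thesis by (simp flip: mult.assoc)
next
  case False
  then have k0: "chi k = 0" using chi_eq_0 by blast
  define g where "g = gcd k (int N)"
  have g: "g > 1" using False N_pos unfolding g_def
    by (metis coprime_iff_gcd_eq_1 gcd_pos_int int_one_le_iff_zero_less less_le of_nat_0_less_iff less_irrefl)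
  define d where "d = nat (int N div g)"
  have gN: "g dvd int N" by (simp add: g_def)
  have dg: "int d * g = int N" using g gN N_pos by (simp add: d_def pos_imp_zdiv_nonneg_iff)
  have "d dvd N" using dg by (metis dvd_triv_left int_dvd_int_iff)
  moreover have "d < N"
  proof -
    have "int d > 0" using dg N_pos g by (metis of_nat_0_less_iff zero_less_mult_pos2 less_trans zero_less_one)
    then have "int d * 1 < int d * g" using g by (intro mult_strict_left_mono)
    then show ?thesis using dg by simp
  qed
  ultimately obtain b where b: "coprime b (int N)" "[b = 1] (mod int d)" "chi b \<noteq> 1"
    using primitive_witness by blast
  have bk: "[k * b = k] (mod int N)"
  proof -
    have "int d dvd b - 1" using b(2) by (simp add: cong_iff_dvd_diff)
    moreover have "g dvd k" by (simp add: g_def)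
    ultimately have "int d * g dvd (b - 1) * k" by (rule mult_dvd_mono)
    then show ?thesis unfolding dg by (simp add: cong_iff_dvd_diff algebra_simps)
  qed
  have eek: "ee ((a * b) * k) = ee (a * k)" for a
  proof (rule ee_cong)
    have "[a * (k * b) = a * k] (mod int N)" using bk by (intro cong_mult) auto
    then show "[(a * b) * k = a * k] (mod int N)" by (simp add: mult_ac)
  qed
  let ?S = "\<Sum>a=0..<int N. chi a * ee (a * k)"
  have "(\<Sum>a=0..<int N. chi (a * b) * ee ((a * b) * k)) = ?S"
  proof (rule sum_mod_mult[OF b(1), of "\<lambda>a. chi a * ee (a * k)"])
    fix x y assume "[x = y] (mod int N)"
    moreover from this have "[x * k = y * k] (mod int N)" by (intro cong_mult) auto
    ultimately show "chi x * ee (x * k) = chi y * ee (y * k)" using chi_cong ee_cong by metis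
  qed
  then have "chi b * ?S = ?S" unfolding eek by (simp add: chi_mult sum_distrib_left mult_ac)
  then show ?thesis using b k0 by simp
qed

end

section \<open>Fourier series and Poisson summation\<close>

lemma antiderivative_exists:
  fixes f :: "real \<Rightarrow> 'a::euclidean_space"
  assumes "continuous_on UNIV f"
  obtains P where "\<And>x. (P has_vector_derivative f x) (at x)"
  using einterval_antiderivative[of "-\<infinity>" "\<infinity>" f] assms
  by (auto simp: continuous_on_eq_continuous_at)

lemma has_vector_derivative_shift:
  assumes "(P has_vector_derivative D) (at (x + h))"
  shows "((\<lambda>x::real. P (x + h)) has_vector_derivative D) (at x within S)"
proof -
  have 1: "((\<lambda>x. x + h) has_derivative (\<lambda>x. x)) (at x within S)" by (auto intro!: derivative_eq_intros)
  from has_derivative_compose[OF 1 assms[unfolded has_vector_derivative_def]]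
  show ?thesis unfolding has_vector_derivative_def .
qed

lemma has_vector_derivative_quotient:
  fixes F :: "real \<Rightarrow> 'a::real_normed_vector"
  assumes "(F has_vector_derivative D) (at 0)"
  shows "((\<lambda>x. (F x - F 0) /\<^sub>R x) \<longlongrightarrow> D) (at 0)"
proof -
  have "(\<lambda>h. norm (F (0 + h) - F 0 - h *\<^sub>R D) / norm h) \<midarrow>0\<rightarrow> 0"
    using assms unfolding has_vector_derivative_def has_derivative_at by blast
  moreover have "\<forall>\<^sub>F h in at 0. norm (F (0 + h) - F 0 - h *\<^sub>R D) / norm h = norm ((F h - F 0) /\<^sub>R h - D)"
  proof (rule eventually_mono)
    show "\<forall>\<^sub>F h::real in at 0. h \<noteq> 0" by (simp add: eventually_at_filter)
    fix h :: real assume h: "h \<noteq> 0"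
    have "(F h - F 0) /\<^sub>R h - D = (F (0 + h) - F 0 - h *\<^sub>R D) /\<^sub>R h"
      using h by (simp add: scaleR_diff_right)
    then show "norm (F (0 + h) - F 0 - h *\<^sub>R D) / norm h = norm ((F h - F 0) /\<^sub>R h - D)"
      by (simp add: divide_inverse mult.commute)
  qed
  ultimately have "((\<lambda>h. norm ((F h - F 0) /\<^sub>R h - D)) \<longlongrightarrow> 0) (at 0)"
    by (rule Lim_transform_eventually)
  then show ?thesis using tendsto_norm_zero_iff LIM_zero_iff by blast
qed

lemma cis_has_vector_derivative:
  "((\<lambda>x. cis (c * x)) has_vector_derivative (\<i> * of_real c * cis (c * x))) (at x within S)"
proof -
  have "((\<lambda>z. exp (\<i> * of_real c * z)) has_field_derivative exp (\<i> * of_real c * of_real x) * (\<i> * of_real c)) (at (of_real x))"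
    by (auto intro!: derivative_eq_intros)
  from has_vector_derivative_real_field[OF this]
  have "((\<lambda>x. exp (\<i> * of_real c * of_real x)) has_vector_derivative exp (\<i> * of_real c * of_real x) * (\<i> * of_real c)) (at x within S)" .
  then show ?thesis by (simp add: cis_conv_exp mult_ac)
qed

text \<open>With a primitive P of G, the derivative of P(1 + h) - P(h) in h is G(1 + h) - G(h) =
  0.\<close>

lemma integral_shift_periodic:
  fixes G :: "real \<Rightarrow> complex"
  assumes c: "continuous_on UNIV G" and p: "\<And>x. G (x + 1) = G x"
  shows "integral {0..1} (\<lambda>x. G (x + h)) = integral {0..1} G"
proof -
  obtain P where P: "\<And>x. (P has_vector_derivative G x) (at x)"
    using antiderivative_exists[OF c] by blast
  have I: "integral {0..1} (\<lambda>x. G (x + h)) = P (1 + h) - P (0 + h)" for h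
  proof (rule integral_unique, rule fundamental_theorem_of_calculus)
    show "((\<lambda>x. P (x + h)) has_vector_derivative G (x + h)) (at x within {0..1})" for x
      by (rule has_vector_derivative_shift[OF P])
  qed simp
  have A: "((\<lambda>h. P (a + h)) has_vector_derivative G (a + h)) (at h within UNIV)" for a h
    using has_vector_derivative_shift[where x = h and h = a and S = UNIV, OF P] by (simp add: add.commute)
  have "((\<lambda>h. P (1 + h) - P (0 + h)) has_vector_derivative (G (1 + h) - G (0 + h))) (at h within UNIV)" for h
    by (rule has_vector_derivative_diff[OF A A])
  moreover have "G (1 + h) - G (0 + h) = 0" for h using p[of h] by (simp add: add.commute)
  ultimately have "((\<lambda>h. P (1 + h) - P (0 + h)) has_vector_derivative 0) (at h within UNIV)" for h by simp
  then have "((\<lambda>h. P (1 + h) - P (0 + h)) has_derivative (\<lambda>_. 0)) (at h within UNIV)" for h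
    unfolding has_vector_derivative_def by simp
  then obtain c where c: "\<And>h. P (1 + h) - P (0 + h) = c"
    using has_derivative_zero_constant[of UNIV "\<lambda>h. P (1 + h) - P (0 + h)"] by auto
  show ?thesis using I[of h] I[of 0] c[of 0] c[of h] by simp
qed

lemma cis_2pi_eq_1: "cis (2 * pi * x) = 1 \<longleftrightarrow> x \<in> \<int>"
proof
  assume "cis (2 * pi * x) = 1"
  then have "cos (2 * pi * x) = 1" by (simp add: complex_eq_iff)
  then obtain n :: int where "2 * pi * x = of_int n * 2 * pi" using cos_one_2pi_int by auto
  then show "x \<in> \<int>" by simp
next
  assume "x \<in> \<int>" then show "cis (2 * pi * x) = 1" by (auto elim!: Ints_cases)
qed

abbreviation fchar :: "int \<Rightarrow> real \<Rightarrow> complex" where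
  "fchar k x \<equiv> cis (- 2 * pi * of_int k * x)"

text \<open>A shift by h = 1/(2k) changes the sign of the exponential. Twice the coefficient is
  therefore an integral of H(x) - H(x + h), which is small by uniform continuity; the interval -1..2
  leaves room for the shift.\<close>

lemma riemann_lebesgue_periodic:
  fixes H :: "real \<Rightarrow> complex"
  assumes c: "continuous_on UNIV H" and p: "\<And>x. H (x + 1) = H x" and e: "e > 0"
  shows "\<exists>K. \<forall>k::int. \<bar>k\<bar> \<ge> K \<longrightarrow> norm (integral {0..1} (\<lambda>x. H x * fchar k x)) \<le> e"
proof -
  have "uniformly_continuous_on {-1..2} H"
    by (rule compact_uniformly_continuous) (use c continuous_on_subset in auto)
  then obtain d where d: "d > 0" "\<And>x y. x \<in> {-1..2} \<Longrightarrow> y \<in> {-1..2} \<Longrightarrow> dist y x < d \<Longrightarrow> dist (H y) (H x) < e"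
    using e unfolding uniformly_continuous_on_def by metis
  define K :: int where "K = \<lceil>1 / d\<rceil> + 1"
  have "norm (integral {0..1} (\<lambda>x. H x * fchar k x)) \<le> e" if k: "\<bar>k\<bar> \<ge> K" for k
  proof -
    have kd: "real_of_int \<bar>k\<bar> > 1 / d" using k unfolding K_def by linarith
    have "1 / d > 0" using d by simp
    then have k0: "k \<noteq> 0" using kd by auto
    define h where "h = 1 / (2 * real_of_int k)"
    have "\<bar>h\<bar> = 1 / (2 * real_of_int \<bar>k\<bar>)" by (simp add: h_def abs_mult)
    moreover have "1 < real_of_int \<bar>k\<bar> * d" using kd d by (simp add: field_simps)
    ultimately have h: "\<bar>h\<bar> < d" using k0 d
      by (simp add: divide_less_eq mult.commute)
    have h1: "\<bar>h\<bar> \<le> 1" using k0 by (simp add: h_def abs_mult field_simps)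
    let ?I = "integral {0..1} (\<lambda>x. H x * fchar k x)"
    have cont: "continuous_on {0..1} (\<lambda>x. H (x + a) * fchar k x)" for a
      by (intro continuous_intros continuous_on_compose2[OF c]) auto
    have "?I = integral {0..1} (\<lambda>x. H (x + h) * fchar k (x + h))"
    proof (rule integral_shift_periodic[symmetric])
      show "continuous_on UNIV (\<lambda>x. H x * fchar k x)" by (intro continuous_intros c)
      have "fchar k (x + 1) = fchar k x" for x
      proof -
        have "- 2 * pi * of_int k * (x + 1) = - 2 * pi * of_int k * x + 2 * pi * of_int (-k)"
          by (simp add: algebra_simps)
        then have "fchar k (x + 1) = fchar k x * cis (2 * pi * of_int (-k))" by (simp only: cis_mult)
        then show ?thesis using cis_2pi_eq_1[of "of_int (-k)"] by (simp del: of_int_minus)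
      qed
      then show "H (x + 1) * fchar k (x + 1) = H x * fchar k x" for x by (simp add: p)
    qed
    also have "\<dots> = integral {0..1} (\<lambda>x. - (H (x + h) * fchar k x))"
    proof (rule integral_cong)
      fix x
      have "- 2 * pi * of_int k * (x + h) = - 2 * pi * of_int k * x + (- pi)"
        using k0 by (simp add: h_def field_simps)
      then have "fchar k (x + h) = fchar k x * cis (- pi)" by (simp add: cis_mult)
      moreover have "cis (- pi) = -1" by (simp add: complex_eq_iff)
      ultimately show "H (x + h) * fchar k (x + h) = - (H (x + h) * fchar k x)" by simp
    qed
    finally have "?I = - integral {0..1} (\<lambda>x. H (x + h) * fchar k x)" by simp
    then have "2 * ?I = ?I - integral {0..1} (\<lambda>x. H (x + h) * fchar k x)" by simp
    also have "\<dots> = integral {0..1} (\<lambda>x. H x * fchar k x - H (x + h) * fchar k x)"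
      using cont[of 0] cont[of h] by (intro integral_diff[symmetric] integrable_continuous_real) auto
    finally have I2: "2 * ?I = integral {0..1} (\<lambda>x. H x * fchar k x - H (x + h) * fchar k x)" .
    have "2 * norm ?I = norm (2 * ?I)" by (simp add: norm_mult)
    also have "\<dots> = norm (integral {0..1} (\<lambda>x. H x * fchar k x - H (x + h) * fchar k x))"
      unfolding I2 ..
    also have "\<dots> \<le> e * (1 - 0)"
    proof (rule integral_bound)
      show "continuous_on {0..1} (\<lambda>x. H x * fchar k x - H (x + h) * fchar k x)"
        using cont[of 0] cont[of h] by (intro continuous_on_diff) auto
      fix x :: real assume x: "x \<in> {0..1}"
      have "dist (H x) (H (x + h)) < e"
        using x h h1 by (intro d(2)) (auto simp: dist_real_def)
      moreover have "norm (H x * fchar k x - H (x + h) * fchar k x) = dist (H x) (H (x + h))"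
        by (simp add: dist_norm norm_mult flip: left_diff_distrib)
      ultimately show "norm (H x * fchar k x - H (x + h) * fchar k x) \<le> e" by simp
    qed auto
    finally show ?thesis using e by simp
  qed
  then show ?thesis by blast
qed

text \<open>Chernoff's argument: the Fourier coefficients of \<open>F - F(0) = (exp(2\<pi>ix) - 1) H\<close> telescope.\<close>

lemma fourier_series_at_0:
  fixes F :: "real \<Rightarrow> complex"
  assumes c: "continuous_on UNIV F" and p: "\<And>x. F (x + 1) = F x"
    and D: "(F has_vector_derivative D) (at 0)"
  shows "(\<lambda>M::nat. \<Sum>k=-int M..int M. integral {0..1} (\<lambda>x. F x * fchar k x)) \<longlonglongrightarrow> F 0"
proof -
  \<comment> \<open>At the integers H takes the limit of the quotient. Its continuity there uses
    nothing but differentiability of F at 0 and periodicity.\<close>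
  define H where "H x = (if x \<in> \<int> then D / (2 * pi * \<i>) else (F x - F 0) / (cis (2 * pi * x) - 1))" for x
  have pc: "cis (2 * pi * (x + 1)) = cis (2 * pi * x)" for x
    by (simp add: distrib_left flip: cis_mult)
  have pH: "H (x + 1) = H x" for x unfolding H_def p pc by simp
  have Fm: "F (of_int m) = F 0" for m
  proof (induction m rule: int_induct[where k = 0])
    case (step1 i) then show ?case using p[of "of_int i"] by simp
  next
    case (step2 i) then show ?case using p[of "of_int i - 1"] by simp
  qed simp
  have pHm: "H (x + of_int m) = H x" for x m
  proof (induction m rule: int_induct[where k = 0])
    case (step1 i) then show ?case using pH[of "x + of_int i"] by (simp add: add.assoc)
  next
    case (step2 i) then show ?case using pH[of "x + of_int i - 1"] by (simp add: algebra_simps)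
  qed simp
  have cH: "continuous_on UNIV H"
  proof (rule continuous_at_imp_continuous_on, rule ballI)
    have "(H \<longlongrightarrow> H 0) (at 0)"
    proof -
      have 1: "((\<lambda>x. (F x - F 0) /\<^sub>R x) \<longlongrightarrow> D) (at 0)"
        using D by (rule has_vector_derivative_quotient)
      have "((\<lambda>x. cis (2 * pi * x)) has_vector_derivative (2 * pi * \<i>)) (at 0)"
        using cis_has_vector_derivative[of "2 * pi" 0 UNIV] by (simp add: mult_ac)
      then have 2: "((\<lambda>x. (cis (2 * pi * x) - cis (2 * pi * 0)) /\<^sub>R x) \<longlongrightarrow> 2 * pi * \<i>) (at 0)"
        by (rule has_vector_derivative_quotient)
      have 3: "((\<lambda>x. ((F x - F 0) /\<^sub>R x) / ((cis (2 * pi * x) - cis (2 * pi * 0)) /\<^sub>R x))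
             \<longlongrightarrow> D / (2 * pi * \<i>)) (at 0)"
        by (intro tendsto_divide 1 2) auto
      have "\<forall>\<^sub>F x::real in at 0. dist x 0 < 1 \<and> x \<noteq> 0"
        by (auto simp: eventually_at intro!: exI[of _ 1])
      then have ev: "\<forall>\<^sub>F x in at 0. ((F x - F 0) /\<^sub>R x) / ((cis (2 * pi * x) - cis (2 * pi * 0)) /\<^sub>R x) = H x"
      proof eventually_elim
        case (elim x)
        then have "x \<notin> \<int>" by (auto elim!: Ints_cases simp: dist_real_def)
        moreover have "(a /\<^sub>R x) / (b /\<^sub>R x) = a / b" for a b :: complex
          using elim by (simp add: scaleR_conv_of_real field_simps)
        ultimately show ?case using elim by (simp add: H_def)
      qed
      show ?thesis using Lim_transform_eventually[OF 3 ev] by (simp add: H_def[of 0])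
    qed
    then have c0: "isCont H 0" by (simp add: isCont_def)
    fix x :: real assume "x \<in> UNIV"
    show "isCont H x"
    proof (cases "x \<in> \<int>")
      case True
      then obtain m where m: "x = of_int m" by (auto elim: Ints_cases)
      have "isCont (\<lambda>y. H (y + of_int (-m))) x"
        by (rule isCont_o2[where g = H and f = "\<lambda>y. y + of_int (-m)"]) (use c0 m in \<open>auto intro!: continuous_intros\<close>)
      then show ?thesis unfolding pHm .
    next
      case False
      have "open (- \<int> :: real set)" using closed_Ints by (simp add: open_Compl)
      then have ev: "\<forall>\<^sub>F y in nhds x. H y = (F y - F 0) / (cis (2 * pi * y) - 1)"
        using False by (auto simp: H_def eventually_nhds)
      have "isCont F x" using c by (simp add: continuous_on_eq_continuous_at)
      then have "isCont (\<lambda>y. (F y - F 0) / (cis (2 * pi * y) - 1)) x"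
        using False cis_2pi_eq_1[of x] has_vector_derivative_continuous[OF cis_has_vector_derivative[of "2 * pi" x UNIV]]
        by (intro continuous_intros) auto
      then show ?thesis using isCont_cong[OF ev] by blast
    qed
  qed
  have FH: "F x - F 0 = H x * (cis (2 * pi * x) - 1)" for x
  proof (cases "x \<in> \<int>")
    case True
    then show ?thesis using cis_2pi_eq_1[of x] Fm by (auto elim!: Ints_cases)
  next
    case False then show ?thesis using cis_2pi_eq_1[of x] by (simp add: H_def)
  qed
  define h where "h k = integral {0..1} (\<lambda>x. H x * fchar k x)" for k
  have ch: "continuous_on {0..1} (\<lambda>x. H x * fchar k x)" for k
    by (intro continuous_intros continuous_on_subset[OF cH]) auto
  have int1: "integral {0..1} (\<lambda>x. fchar k x) = (if k = 0 then 1 else 0)" for k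
  proof (cases "k = 0")
    case False
    have "((\<lambda>x. fchar k x) has_integral (fchar k 1 / (- 2 * pi * k * \<i>) - fchar k 0 / (- 2 * pi * k * \<i>))) {0..1}"
    proof (rule fundamental_theorem_of_calculus)
      fix x :: real
      from has_vector_derivative_divide[OF cis_has_vector_derivative[of "- 2 * pi * of_int k" x "{0..1}"], of "- 2 * pi * k * \<i>"]
      show "((\<lambda>x. fchar k x / (- 2 * pi * k * \<i>)) has_vector_derivative fchar k x) (at x within {0..1})"
        using False by simp
    qed auto
    moreover have "fchar k 1 = 1" using cis_2pi_eq_1[of "of_int (-k)"] by simp
    ultimately show ?thesis using False by (simp add: integral_unique)
  qed simp
  have coeff: "integral {0..1} (\<lambda>x. F x * fchar k x) = (h (k - 1) - h k) + (if k = 0 then F 0 else 0)" for k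
  proof -
    have e: "F x * fchar k x = (H x * fchar (k - 1) x - H x * fchar k x) + F 0 * fchar k x" for x
    proof -
      have "- 2 * pi * of_int (k - 1) * x = 2 * pi * x + (- 2 * pi * of_int k * x)"
        by (simp add: algebra_simps)
      then have e1: "fchar (k - 1) x = cis (2 * pi * x) * fchar k x" by (simp only: cis_mult)
      have e2: "F x = F 0 + H x * (cis (2 * pi * x) - 1)" using FH[of x] by (simp add: algebra_simps)
      have "(a + b * (c - 1)) * d = (b * (c * d) - b * d) + a * d" for a b c d :: complex
        by (simp add: algebra_simps)
      then show ?thesis unfolding e1 by (subst e2)
    qed
    have "((\<lambda>x. (H x * fchar (k - 1) x - H x * fchar k x) + F 0 * fchar k x) has_integral
       (h (k - 1) - h k) + F 0 * integral {0..1} (\<lambda>x. fchar k x)) {0..1}"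
      unfolding h_def
      by (intro has_integral_add has_integral_diff has_integral_mult_right integrable_integral
            integrable_continuous_real ch continuous_intros)
    then have "integral {0..1} (\<lambda>x. F x * fchar k x) = (h (k - 1) - h k) + F 0 * integral {0..1} (\<lambda>x. fchar k x)"
      unfolding e by (rule integral_unique)
    then show ?thesis unfolding int1 by (cases "k = 0") simp_all
  qed
  have sum: "(\<Sum>k=-int M..int M. integral {0..1} (\<lambda>x. F x * fchar k x)) = F 0 + (h (- 1 - int M) - h (int M))" for M
  proof -
    have t: "(\<Sum>k=-int M..int M. h (k - 1) - h k) = h (- 1 - int M) - h (int M)" for M
    proof (induction M)
      case (Suc M)
      have "{- int (Suc M)..int (Suc M)} = insert (- int (Suc M)) (insert (int (Suc M)) {- int M..int M})"
        by auto
      then show ?case using Suc by simp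
    qed simp
    show ?thesis unfolding coeff sum.distrib t by (simp add: sum.delta)
  qed
  have "(\<lambda>M. h (- 1 - int M)) \<longlonglongrightarrow> 0" "(\<lambda>M. h (int M)) \<longlonglongrightarrow> 0"
  proof -
    have lim: "(\<lambda>M. h (u M)) \<longlonglongrightarrow> 0" if u: "\<And>M. \<bar>u M\<bar> \<ge> int M" for u :: "nat \<Rightarrow> int"
    proof (rule LIMSEQ_I)
      fix e :: real assume e: "e > 0"
      then obtain K where K: "\<And>k. \<bar>k\<bar> \<ge> K \<Longrightarrow> norm (h k) \<le> e / 2"
        using riemann_lebesgue_periodic[OF cH pH, of "e/2"] unfolding h_def by auto
      have "norm (h (u M) - 0) < e" if "M \<ge> nat K" for M
      proof -
        have "\<bar>u M\<bar> \<ge> K" using u[of M] that by linarith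
        then show ?thesis using K[of "u M"] e by simp
      qed
      then show "\<exists>no. \<forall>n\<ge>no. norm (h (u n) - 0) < e" by blast
    qed
    show "(\<lambda>M. h (- 1 - int M)) \<longlonglongrightarrow> 0" "(\<lambda>M. h (int M)) \<longlonglongrightarrow> 0" by (rule lim; simp)+
  qed
  then have "(\<lambda>M. F 0 + (h (- 1 - int M) - h (int M))) \<longlonglongrightarrow> F 0 + (0 - 0)" by (intro tendsto_intros)
  then show ?thesis unfolding sum by simp
qed

text \<open>The estimate y^2 <= 2 (y + x)^2 + 2 x^2 behind it is (y + 2x)^2 >= 0.\<close>

lemma inverse_one_plus_square_shift:
  fixes x y R :: real
  assumes "\<bar>x\<bar> \<le> R"
  shows "1 / (1 + (y + x)\<^sup>2) \<le> (2 + 2 * R\<^sup>2) / (1 + y\<^sup>2)"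
proof -
  have "0 \<le> (y + 2 * x)\<^sup>2" by simp
  moreover have "x\<^sup>2 \<le> R\<^sup>2" using assms by (simp add: abs_le_square_iff[symmetric])
  moreover have "R\<^sup>2 * (y + x)\<^sup>2 \<ge> 0" by simp
  ultimately have "1 + y\<^sup>2 \<le> (2 + 2 * R\<^sup>2) * (1 + (y + x)\<^sup>2)"
    by (simp add: power2_eq_square algebra_simps)
  then show ?thesis by (simp add: divide_simps add_pos_nonneg mult.commute split: if_splits)
qed

lemma summable_inverse_one_plus_square: "summable (\<lambda>j. C / (1 + (real j)\<^sup>2))"
proof -
  have "summable (\<lambda>j. inverse (real (Suc j) ^ 2))" using inverse_power_summable[of 2, where ?'a = real]
    by (subst summable_Suc_iff) simp
  then have "summable (\<lambda>j. 2 * \<bar>C\<bar> * inverse (real (Suc j) ^ 2))" by (rule summable_mult)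
  then show ?thesis
  proof (rule summable_comparison_test')
    fix j :: nat assume "j \<ge> 0"
    have "(real j - 1)\<^sup>2 \<ge> 0" by simp
    then have "real (Suc j) ^ 2 \<le> 2 * (1 + (real j)\<^sup>2)" by (simp add: power2_eq_square algebra_simps)
    then have "1 / (1 + (real j)\<^sup>2) \<le> 2 / real (Suc j) ^ 2"
    proof -
      assume *: "real (Suc j) ^ 2 \<le> 2 * (1 + (real j)\<^sup>2)"
      have "1 + (real j)\<^sup>2 > 0" by (simp add: add_pos_nonneg)
      then show ?thesis using * by (subst frac_le_eq) (auto intro!: divide_nonpos_pos mult_pos_pos)
    qed
    then have "\<bar>C\<bar> * (1 / (1 + (real j)\<^sup>2)) \<le> \<bar>C\<bar> * (2 / real (Suc j) ^ 2)" by (rule mult_left_mono) simp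
    then show "norm (C / (1 + (real j)\<^sup>2)) \<le> 2 * \<bar>C\<bar> * inverse (real (Suc j) ^ 2)"
      by (simp add: divide_inverse mult_ac abs_mult)
  qed
qed

text \<open>The Fourier series at 0 of the periodization F of g. The translates by j and -1 - j are
  paired, which turns the sum over the integers into one over the naturals and explains the
  half-open range -M..<M. Quadratic decay of g and g' gives locally uniform convergence of F and of
  its derivative. Both sides are stated as limits of partial sums with one common value, so absolute
  convergence of the transform does not have to be discussed.\<close>

lemma poisson_summation:
  fixes g g' :: "real \<Rightarrow> real" and gh :: "int \<Rightarrow> complex"
  assumes g': "\<And>x. (g has_real_derivative g' x) (at x)"
    and bd: "\<And>x. \<bar>g x\<bar> \<le> C / (1 + x\<^sup>2)" "\<And>x. \<bar>g' x\<bar> \<le> C / (1 + x\<^sup>2)"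
    and gh: "\<And>k. (\<lambda>M::nat. integral {- real M..real M} (\<lambda>x. of_real (g x) * fchar k x)) \<longlonglongrightarrow> gh k"
  shows "\<exists>S::real. (\<lambda>M::nat. \<Sum>n=-int M..<int M. g (of_int n)) \<longlonglongrightarrow> S \<and>
             (\<lambda>M::nat. \<Sum>k=-int M..int M. gh k) \<longlonglongrightarrow> of_real S"
proof -
  have C0: "C \<ge> 0" using bd(1)[of 0] by simp
  define p where "p j x = g (real j + x) + g (- 1 - real j + x)" for j x
  define p' where "p' j x = g' (real j + x) + g' (- 1 - real j + x)" for j x
  define F where "F x = (\<Sum>j. p j x)" for x
  have bdp: "\<bar>u (real j + x) + u (- 1 - real j + x)\<bar> \<le> 2 * C * (2 + 2 * R\<^sup>2) / (1 + (real j)\<^sup>2)"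
    if u: "\<And>x. \<bar>u x\<bar> \<le> C / (1 + x\<^sup>2)" and x: "\<bar>x\<bar> \<le> R" for u x j R
  proof -
    have A: "\<bar>u (y + x)\<bar> \<le> C * ((2 + 2 * R\<^sup>2) / (1 + y\<^sup>2))" for y
      using order_trans[OF u[of "y + x"]] mult_left_mono[OF inverse_one_plus_square_shift[OF x, of y] C0] by simp
    have "1 / (1 + (- 1 - real j)\<^sup>2) \<le> 1 / (1 + (real j)\<^sup>2)"
      by (intro divide_left_mono) (auto simp: power2_eq_square algebra_simps add_pos_nonneg intro!: mult_pos_pos)
    then have "C * (2 + 2 * R\<^sup>2) * (1 / (1 + (- 1 - real j)\<^sup>2)) \<le> C * (2 + 2 * R\<^sup>2) * (1 / (1 + (real j)\<^sup>2))"
      using C0 by (intro mult_left_mono) auto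
    then have "\<bar>u (- 1 - real j + x)\<bar> \<le> C * (2 + 2 * R\<^sup>2) / (1 + (real j)\<^sup>2)"
      using A[of "- 1 - real j"] by simp
    moreover have "\<bar>u (real j + x)\<bar> \<le> C * (2 + 2 * R\<^sup>2) / (1 + (real j)\<^sup>2)"
      using A[of "real j"] by simp
    moreover have "2 * C * (2 + 2 * R\<^sup>2) / (1 + (real j)\<^sup>2)
        = C * (2 + 2 * R\<^sup>2) / (1 + (real j)\<^sup>2) + C * (2 + 2 * R\<^sup>2) / (1 + (real j)\<^sup>2)" by simp
    ultimately show ?thesis by linarith
  qed
  have Fder: "(F has_real_derivative (\<Sum>j. p' j x)) (at x)" and Fsum: "summable (\<lambda>j. p j x)" for x
  proof -
    define R where "R = \<bar>x\<bar> + 1"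
    have uc: "uniformly_convergent_on {-R..R} (\<lambda>n x. \<Sum>i<n. p' i x)"
      by (rule Weierstrass_m_test'[OF _ summable_inverse_one_plus_square[of "2 * C * (2 + 2 * R\<^sup>2)"]])
         (auto simp: p'_def intro!: bdp[OF bd(2)])
    have d: "(p j has_field_derivative p' j x) (at x within {-R..R})" for j x
      unfolding p_def p'_def
      by (intro DERIV_add DERIV_chain2[where f = g and g = "\<lambda>x. _ + x", OF g', THEN DERIV_cong])
         (auto intro!: derivative_eq_intros)
    have "summable (\<lambda>j. p j 0)"
      by (rule summable_comparison_test'[OF summable_inverse_one_plus_square[of "2 * C * (2 + 2 * 0\<^sup>2)"], of 0])
         (use bdp[OF bd(1), of 0 0] in \<open>auto simp: p_def\<close>)
    from has_field_derivative_series'[OF _ d uc _ this, of x]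
    show "summable (\<lambda>j. p j x)" "(F has_real_derivative (\<Sum>j. p' j x)) (at x)"
      using abs_ge_minus_self[of x] abs_ge_self[of x] unfolding F_def R_def by (auto simp: less_le)
  qed
  have psum: "(\<Sum>j<M. p j x) = (\<Sum>n=-int M..<int M. g (of_int n + x))" for M x
  proof (induction M)
    case (Suc M)
    have "{-int (Suc M)..<int (Suc M)} = insert (- int (Suc M)) (insert (int M) {-int M..<int M})" by auto
    then show ?case using Suc by (simp add: p_def)
  qed simp
  have FM: "(\<lambda>M. \<Sum>n=-int M..<int M. g (of_int n + x)) \<longlonglongrightarrow> F x" for x
    using summable_LIMSEQ[OF Fsum[of x]] unfolding psum F_def .
  have g0: "(\<lambda>M. g (real M + x)) \<longlonglongrightarrow> 0" "(\<lambda>M. g (- real M + x)) \<longlonglongrightarrow> 0" for x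
  proof -
    have "(\<lambda>M. C / (1 + (real M + x)\<^sup>2)) \<longlonglongrightarrow> 0" "(\<lambda>M. C / (1 + (- real M + x)\<^sup>2)) \<longlonglongrightarrow> 0" by real_asymp+
    then show "(\<lambda>M. g (real M + x)) \<longlonglongrightarrow> 0" "(\<lambda>M. g (- real M + x)) \<longlonglongrightarrow> 0"
      by (auto intro: Lim_null_comparison[rotated] always_eventually simp: bd)
  qed
  have per: "F (x + 1) = F x" for x
  proof (rule LIMSEQ_unique[OF FM])
    have e: "(\<Sum>n=-int M..<int M. g (of_int n + (x + 1))) = (\<Sum>n=-int M..<int M. g (of_int n + x)) + (g (real M + x) - g (- real M + x))" for M
    proof (induction M)
      case (Suc M)
      have "{-int (Suc M)..<int (Suc M)} = insert (- int (Suc M)) (insert (int M) {-int M..<int M})" by auto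
      then show ?case using Suc by (simp add: algebra_simps)
    qed simp
    have "(\<lambda>M. (\<Sum>n=-int M..<int M. g (of_int n + x)) + (g (real M + x) - g (- real M + x))) \<longlonglongrightarrow> F x + (0 - 0)"
      by (intro tendsto_intros FM g0)
    then show "(\<lambda>M. \<Sum>n=-int M..<int M. g (of_int n + (x + 1))) \<longlonglongrightarrow> F x" unfolding e by simp
  qed
  have cg: "continuous_on A g" for A
    using g' by (meson DERIV_isCont continuous_at_imp_continuous_on)
  have cF: "continuous_on UNIV F"
    using Fder by (meson DERIV_isCont continuous_at_imp_continuous_on)
  have coeff: "integral {0..1} (\<lambda>x. of_real (F x) * fchar k x) = gh k" for k
  proof (rule LIMSEQ_unique[OF _ gh])
    have ul: "uniform_limit {0..1} (\<lambda>M x. \<Sum>j<M. p j x) F sequentially"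
      unfolding F_def
      by (rule Weierstrass_m_test[OF _ summable_inverse_one_plus_square[of "2 * C * (2 + 2 * 1\<^sup>2)"]])
         (unfold p_def, use bdp[OF bd(1), of _ 1] in auto)
    have ul': "uniform_limit {0..1} (\<lambda>M x. of_real (\<Sum>j<M. p j x) * fchar k x) (\<lambda>x. of_real (F x) * fchar k x) sequentially"
    proof (rule uniform_limitI)
      fix e :: real assume "e > 0"
      from uniform_limitD[OF ul this]
      show "\<forall>\<^sub>F M in sequentially. \<forall>x\<in>{0..1}. dist (of_real (\<Sum>j<M. p j x) * fchar k x) (of_real (F x) * fchar k x) < e"
      proof eventually_elim
        case (elim M)
        have "dist (of_real a * fchar k x) (of_real b * fchar k x) = dist a b" for a b x
          by (simp add: dist_norm norm_mult flip: left_diff_distrib of_real_diff)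
        then show ?case using elim by (simp only:)
      qed
    qed
    have cc: "continuous_on A (\<lambda>x. of_real (g x) * fchar k x)" for A
      by (intro continuous_intros cg)
    have I: "integral {0..1} (\<lambda>x. of_real (\<Sum>j<M. p j x) * fchar k x) = integral {- real M..real M} (\<lambda>x. of_real (g x) * fchar k x)" for M
    proof -
      obtain P where P: "\<And>x. (P has_vector_derivative of_real (g x) * fchar k x) (at x)"
        using antiderivative_exists[OF cc] by blast
      have shift: "((\<lambda>x. of_real (g (x + of_int n)) * fchar k x) has_integral P (1 + of_int n) - P (0 + of_int n)) {0..1}" for n
      proof (rule fundamental_theorem_of_calculus)
        fix x :: real
        have "- 2 * pi * of_int k * (x + of_int n) = - 2 * pi * of_int k * x + 2 * pi * of_int (-k * n)"
          by (simp add: algebra_simps)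
        then have "fchar k (x + of_int n) = fchar k x * cis (2 * pi * of_int (-k * n))" by (simp only: cis_mult)
        then have "fchar k (x + of_int n) = fchar k x"
          using cis_2pi_eq_1[of "of_int (-k * n)"] by (simp del: of_int_mult of_int_minus)
        with has_vector_derivative_shift[where h = "of_int n", OF P]
        show "((\<lambda>x. P (x + of_int n)) has_vector_derivative of_real (g (x + of_int n)) * fchar k x) (at x within {0..1})"
          by metis
      qed simp
      have "((\<lambda>x. of_real (\<Sum>j<M. p j x) * fchar k x) has_integral (\<Sum>j<M. (P (1 + of_int (int j)) - P (0 + of_int (int j)))
             + (P (1 + of_int (- 1 - int j)) - P (0 + of_int (- 1 - int j))))) {0..1}"
      proof -
        have eq: "of_real (\<Sum>j<M. p j x) * fchar k x = (\<Sum>j<M. of_real (g (x + of_int (int j))) * fchar k x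
             + of_real (g (x + of_int (- 1 - int j))) * fchar k x)" for x
          unfolding p_def of_real_sum sum_distrib_right of_real_add distrib_right by (simp add: add.commute)
        show ?thesis unfolding eq by (intro has_integral_sum has_integral_add shift) auto
      qed
      moreover have "(\<Sum>j<M. (P (1 + of_int (int j)) - P (0 + of_int (int j)))
             + (P (1 + of_int (- 1 - int j)) - P (0 + of_int (- 1 - int j)))) = P (real M) - P (- real M)"
        by (induction M) (auto simp: algebra_simps)
      ultimately have "integral {0..1} (\<lambda>x. of_real (\<Sum>j<M. p j x) * fchar k x) = P (real M) - P (- real M)"
        by (simp add: integral_unique)
      moreover have "((\<lambda>x. of_real (g x) * fchar k x) has_integral P (real M) - P (- real M)) {- real M..real M}"
        by (rule fundamental_theorem_of_calculus[OF _ has_vector_derivative_at_within[OF P]]) simp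
      ultimately show ?thesis by (simp add: integral_unique)
    qed
    have cp: "continuous_on {0..1} (\<lambda>x. of_real (\<Sum>j<M. p j x) * fchar k x)" for M
      unfolding p_def by (intro continuous_intros continuous_on_compose2[OF cg]) auto
    have "(\<lambda>M. integral {0..1} (\<lambda>x. of_real (\<Sum>j<M. p j x) * fchar k x)) \<longlonglongrightarrow> integral {0..1} (\<lambda>x. of_real (F x) * fchar k x)"
    proof -
      from uniform_limit_integral[OF ul' cp trivial_limit_sequentially] obtain I J where IJ:
        "\<And>n. ((\<lambda>x. of_real (\<Sum>j<n. p j x) * fchar k x) has_integral I n) {0..1}"
        "((\<lambda>x. of_real (F x) * fchar k x) has_integral J) {0..1}" "I \<longlonglongrightarrow> J" by blast
      show ?thesis unfolding integral_unique[OF IJ(1)] integral_unique[OF IJ(2)] by (rule IJ(3))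
    qed
    then show "(\<lambda>M. integral {- real M..real M} (\<lambda>x. of_real (g x) * fchar k x)) \<longlonglongrightarrow> integral {0..1} (\<lambda>x. of_real (F x) * fchar k x)"
      unfolding I .
  qed
  have "(\<lambda>M::nat. \<Sum>k=-int M..int M. integral {0..1} (\<lambda>x. of_real (F x) * fchar k x)) \<longlonglongrightarrow> complex_of_real (F 0)"
  proof (rule fourier_series_at_0)
    show "continuous_on UNIV (\<lambda>x. complex_of_real (F x))" by (intro continuous_intros cF)
    show "((\<lambda>x. complex_of_real (F x)) has_vector_derivative of_real (\<Sum>j. p' j 0)) (at 0)"
      by (rule has_vector_derivative_of_real[OF Fder])
  qed (simp add: per)
  then show ?thesis using FM[of 0] unfolding coeff by auto
qed

lemma has_integral_UNIV_imp_limit: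
  fixes f :: "real \<Rightarrow> complex"
  assumes "(f has_integral v) UNIV"
  shows "(\<lambda>M::nat. integral {- real M..real M} f) \<longlonglongrightarrow> v"
proof (rule LIMSEQ_I)
  fix e :: real assume "e > 0"
  then obtain B where B: "B > 0" "\<And>a b. ball 0 B \<subseteq> cbox a b \<Longrightarrow> norm (integral (cbox a b) f - v) < e"
    using assms[unfolded has_integral_alt'] by auto
  have "norm (integral {- real M..real M} f - v) < e" if "M \<ge> nat \<lceil>B\<rceil>" for M
  proof -
    have "B \<le> real M" using that by linarith
    then have "ball 0 B \<subseteq> cbox (- real M) (real M)" by (auto simp: dist_real_def)
    from B(2)[OF this] show ?thesis by simp
  qed
  then show "\<exists>no. \<forall>n\<ge>no. norm (integral {- real n..real n} f - v) < e" by blast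
qed

text \<open>An affine substitution in the characteristic function of the standard normal
  distribution; c = sqrt (2 pi t) matches c^2 / 2 to the exponent pi t.\<close>

lemma gaussian_fourier_0:
  assumes t: "t > 0"
  shows "(\<lambda>M::nat. integral {- real M..real M} (\<lambda>x. of_real (exp (- pi * t * (x + \<alpha>)\<^sup>2)) * cis (- 2 * pi * \<xi> * x)))
           \<longlonglongrightarrow> of_real (t powr (-1/2) * exp (- pi * \<xi>\<^sup>2 / t)) * cis (2 * pi * \<xi> * \<alpha>)"
proof (rule has_integral_UNIV_imp_limit)
  define c where "c = sqrt (2 * pi * t)"
  have c: "c > 0" "c\<^sup>2 = 2 * pi * t" using t by (auto simp: c_def)
  define u where "u = - 2 * pi * \<xi> / c"
  define d where "d x = std_normal_density x *\<^sub>R iexp (u * x)" for x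
  have id: "integrable lborel d"
  proof (rule Bochner_Integration.integrable_bound)
    show "integrable lborel std_normal_density" by simp
    show "d \<in> borel_measurable lborel" unfolding d_def by measurable
  qed (auto simp: d_def)
  have "integral\<^sup>L lborel d = char std_normal_distribution u"
    unfolding char_def d_def by (subst integral_density) auto
  also have "\<dots> = of_real (exp (- (u^2) / 2))" by (simp add: char_std_normal_distribution)
  finally have "has_bochner_integral lborel d (of_real (exp (- (u^2) / 2)))"
    using id by (simp add: has_bochner_integral_iff)
  then have "has_bochner_integral lborel (\<lambda>x. d (c * \<alpha> + c * x)) (of_real (exp (- (u^2) / 2)) /\<^sub>R \<bar>c\<bar>)"
    using lborel_has_bochner_integral_real_affine_iff[of c d] c by auto
  then have "has_bochner_integral lborel (\<lambda>x. (sqrt (2 * pi) * cis (2 * pi * \<xi> * \<alpha>)) * d (c * \<alpha> + c * x))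
      ((sqrt (2 * pi) * cis (2 * pi * \<xi> * \<alpha>)) * (of_real (exp (- (u^2) / 2)) /\<^sub>R \<bar>c\<bar>))"
    by (intro has_bochner_integral_mult_right) auto
  then have "((\<lambda>x. (sqrt (2 * pi) * cis (2 * pi * \<xi> * \<alpha>)) * d (c * \<alpha> + c * x)) has_integral
      ((sqrt (2 * pi) * cis (2 * pi * \<xi> * \<alpha>)) * (of_real (exp (- (u^2) / 2)) /\<^sub>R \<bar>c\<bar>))) UNIV"
    using has_integral_integral_lborel unfolding has_bochner_integral_iff by metis
  moreover have "(sqrt (2 * pi) * cis (2 * pi * \<xi> * \<alpha>)) * d (c * \<alpha> + c * x)
      = of_real (exp (- pi * t * (x + \<alpha>)\<^sup>2)) * cis (- 2 * pi * \<xi> * x)" for x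
  proof -
    have 1: "- (c * \<alpha> + c * x)\<^sup>2 / 2 = - pi * t * (x + \<alpha>)\<^sup>2"
    proof -
      have "(c * \<alpha> + c * x)\<^sup>2 = c\<^sup>2 * (x + \<alpha>)\<^sup>2" by (simp add: power2_eq_square algebra_simps)
      then show ?thesis unfolding c(2) by simp
    qed
    have e: "u * (c * \<alpha> + c * x) = - 2 * pi * \<xi> * x + - (2 * pi * \<xi> * \<alpha>)"
      using c by (simp add: u_def field_simps)
    have 2: "iexp (u * (c * \<alpha> + c * x)) = cis (- 2 * pi * \<xi> * x) * cis (- (2 * pi * \<xi> * \<alpha>))"
      unfolding e by (simp only: cis_conv_exp[symmetric] cis_mult)
    have 3: "cis (2 * pi * \<xi> * \<alpha>) * cis (- (2 * pi * \<xi> * \<alpha>)) = 1" by (simp add: cis_mult)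
    have "(sqrt (2 * pi) * cis (2 * pi * \<xi> * \<alpha>)) * d (c * \<alpha> + c * x)
        = of_real (sqrt (2 * pi) * (1 / sqrt (2 * pi) * exp (- pi * t * (x + \<alpha>)\<^sup>2))) * cis (- 2 * pi * \<xi> * x)
          * (cis (2 * pi * \<xi> * \<alpha>) * cis (- (2 * pi * \<xi> * \<alpha>)))"
      unfolding d_def std_normal_density_def 1 2 by (simp only: scaleR_conv_of_real of_real_mult mult_ac)
    also have "sqrt (2 * pi) * (1 / sqrt (2 * pi) * exp (- pi * t * (x + \<alpha>)\<^sup>2)) = exp (- pi * t * (x + \<alpha>)\<^sup>2)" by simp
    finally show ?thesis unfolding 3 by simp
  qed
  moreover have "(sqrt (2 * pi) * cis (2 * pi * \<xi> * \<alpha>)) * (of_real (exp (- (u^2) / 2)) /\<^sub>R \<bar>c\<bar>)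
      = of_real (t powr (-1/2) * exp (- pi * \<xi>\<^sup>2 / t)) * cis (2 * pi * \<xi> * \<alpha>)"
  proof -
    have "u\<^sup>2 = 4 * pi\<^sup>2 * \<xi>\<^sup>2 / (2 * pi * t)" unfolding u_def power_divide c(2) by (simp add: power2_eq_square)
    then have 1: "- (u^2) / 2 = - pi * \<xi>\<^sup>2 / t" using t by (simp add: field_simps power2_eq_square)
    have "\<bar>c\<bar> = sqrt (2 * pi) * sqrt t" using c t unfolding c_def by (simp add: real_sqrt_mult)
    then have "sqrt (2 * pi) / \<bar>c\<bar> = inverse (sqrt t)" by (simp add: divide_inverse)
    also have "\<dots> = t powr (-1/2)" using t powr_minus[of t "1/2"] by (simp add: powr_half_sqrt)
    finally have 2: "sqrt (2 * pi) * inverse \<bar>c\<bar> = t powr (-1/2)" by (simp only: divide_inverse)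
    have "(sqrt (2 * pi) * cis (2 * pi * \<xi> * \<alpha>)) * (of_real (exp (- (u^2) / 2)) /\<^sub>R \<bar>c\<bar>)
       = of_real ((sqrt (2 * pi) * inverse \<bar>c\<bar>) * exp (- (u^2) / 2)) * cis (2 * pi * \<xi> * \<alpha>)"
      by (simp only: scaleR_conv_of_real of_real_mult mult_ac)
    then show ?thesis unfolding 1 2 .
  qed
  ultimately show "((\<lambda>x. of_real (exp (- pi * t * (x + \<alpha>)\<^sup>2)) * cis (- 2 * pi * \<xi> * x)) has_integral
      of_real (t powr (-1/2) * exp (- pi * \<xi>\<^sup>2 / t)) * cis (2 * pi * \<xi> * \<alpha>)) UNIV" by simp
qed

text \<open>With half the exponent, c = pi t / 2, and K >= 1, K c >= 1 one has 1 + y^2 <= K exp (c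
  y^2). Squaring uses up the whole Gaussian and leaves a factor 1 + y^2 in the denominator, which is
  then shifted by \<alpha>.\<close>

lemma gaussian_decay:
  assumes t: "t > 0"
  shows "\<exists>C. \<forall>x. (1 + (x + \<alpha>)\<^sup>2) * exp (- pi * t * (x + \<alpha>)\<^sup>2) \<le> C / (1 + x\<^sup>2)"
proof -
  define c where "c = pi * t / 2"
  have c: "c > 0" using t by (simp add: c_def)
  define K where "K = max 1 (1 / c)"
  have K: "K \<ge> 1" "K * c \<ge> 1" using c by (auto simp: K_def max_def field_simps)
  define C where "C = K\<^sup>2 * (2 + 2 * \<alpha>\<^sup>2)"
  have "(1 + y\<^sup>2) * exp (- pi * t * y\<^sup>2) \<le> C / (1 + x\<^sup>2)" if y: "y = x + \<alpha>" for x y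
  proof -
    have "1 + c * y\<^sup>2 \<le> exp (c * y\<^sup>2)" by (rule exp_ge_add_one_self)
    then have "K * (1 + c * y\<^sup>2) \<le> K * exp (c * y\<^sup>2)" using K by (intro mult_left_mono) auto
    moreover have "1 * y\<^sup>2 \<le> (K * c) * y\<^sup>2" using K by (intro mult_right_mono) auto
    ultimately have "1 + y\<^sup>2 \<le> K * exp (c * y\<^sup>2)" using K by (simp add: algebra_simps)
    then have "(1 + y\<^sup>2)\<^sup>2 \<le> (K * exp (c * y\<^sup>2))\<^sup>2" by (intro power_mono) auto
    also have "(K * exp (c * y\<^sup>2))\<^sup>2 = K\<^sup>2 * exp (pi * t * y\<^sup>2)"
      by (simp add: power_mult_distrib c_def flip: exp_double)
    finally have "(1 + y\<^sup>2)\<^sup>2 * exp (- pi * t * y\<^sup>2) \<le> K\<^sup>2 * exp (pi * t * y\<^sup>2) * exp (- pi * t * y\<^sup>2)"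
      by (intro mult_right_mono) auto
    also have "\<dots> = K\<^sup>2" by (simp add: exp_minus)
    finally have A: "(1 + y\<^sup>2) * exp (- pi * t * y\<^sup>2) \<le> K\<^sup>2 * (1 / (1 + y\<^sup>2))"
      by (simp add: field_simps power2_eq_square add_pos_nonneg)
    have "1 / (1 + (x + \<alpha>)\<^sup>2) \<le> (2 + 2 * \<alpha>\<^sup>2) / (1 + x\<^sup>2)" 
      using inverse_one_plus_square_shift[of \<alpha> "\<bar>\<alpha>\<bar>" x] by simp
    then have "K\<^sup>2 * (1 / (1 + y\<^sup>2)) \<le> K\<^sup>2 * ((2 + 2 * \<alpha>\<^sup>2) / (1 + x\<^sup>2))" unfolding y by (intro mult_left_mono) auto
    with A show ?thesis by (simp add: C_def)
  qed
  then show ?thesis by blast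
qed

text \<open>The transform for odd characters: the derivative of the Gaussian is -2 pi t (x +
  \<alpha>) times the Gaussian, so integration by parts reduces it to the even case, with boundary
  terms tending to 0.\<close>

lemma gaussian_fourier_1:
  assumes t: "t > 0"
  shows "(\<lambda>M::nat. integral {- real M..real M} (\<lambda>x. of_real ((x + \<alpha>) * exp (- pi * t * (x + \<alpha>)\<^sup>2)) * cis (- 2 * pi * \<xi> * x)))
           \<longlonglongrightarrow> (- \<i> * \<xi> / t) * (of_real (t powr (-1/2) * exp (- pi * \<xi>\<^sup>2 / t)) * cis (2 * pi * \<xi> * \<alpha>))"
proof -
  let ?G = "\<lambda>x. exp (- pi * t * (x + \<alpha>)\<^sup>2)" and ?c = "\<lambda>x. cis (- 2 * pi * \<xi> * x)"
  let ?I0 = "\<lambda>M::nat. integral {- real M..real M} (\<lambda>x. of_real (?G x) * ?c x)"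
  let ?I1 = "\<lambda>M::nat. integral {- real M..real M} (\<lambda>x. of_real ((x + \<alpha>) * ?G x) * ?c x)"
  have I1: "?I1 M = (of_real (?G (real M)) * ?c (real M) - of_real (?G (- real M)) * ?c (- real M)) / (- 2 * pi * t)
         + (- \<i> * \<xi> / t) * ?I0 M" for M
  proof -
    have "((\<lambda>x. of_real (- 2 * pi * t * ((x + \<alpha>) * ?G x)) * ?c x + (- 2 * pi * \<xi> * \<i>) * (of_real (?G x) * ?c x)) has_integral
        (of_real (?G (real M)) * ?c (real M) - of_real (?G (- real M)) * ?c (- real M))) {- real M..real M}"
    proof (rule fundamental_theorem_of_calculus)
      fix x
      have "(?G has_real_derivative (- 2 * pi * t * ((x + \<alpha>) * ?G x))) (at x within {- real M..real M})"
        by (auto intro!: derivative_eq_intros simp: power2_eq_square)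
      then have 1: "((\<lambda>x. complex_of_real (?G x)) has_vector_derivative of_real (- 2 * pi * t * ((x + \<alpha>) * ?G x))) (at x within {- real M..real M})"
        by (rule has_vector_derivative_of_real)
      from has_vector_derivative_mult[OF 1 cis_has_vector_derivative[of "- 2 * pi * \<xi>"]]
      show "((\<lambda>x. of_real (?G x) * ?c x) has_vector_derivative
         of_real (- 2 * pi * t * ((x + \<alpha>) * ?G x)) * ?c x + (- 2 * pi * \<xi> * \<i>) * (of_real (?G x) * ?c x)) (at x within {- real M..real M})"
        by (simp add: algebra_simps)
    qed auto
    then have "of_real (?G (real M)) * ?c (real M) - of_real (?G (- real M)) * ?c (- real M)
       = integral {- real M..real M} (\<lambda>x. (- 2 * pi * t) * (of_real ((x + \<alpha>) * ?G x) * ?c x) + (- 2 * pi * \<xi> * \<i>) * (of_real (?G x) * ?c x))"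
      by (simp add: integral_unique mult_ac)
    also have "\<dots> = (- 2 * pi * t) * ?I1 M + (- 2 * pi * \<xi> * \<i>) * ?I0 M"
      by (subst integral_add) (auto intro!: integrable_continuous_real continuous_intros simp: mult.assoc)
    finally show ?thesis using t by (simp add: field_simps)
  qed
  have G0: "(\<lambda>M. ?G (real M)) \<longlonglongrightarrow> 0" "(\<lambda>M. ?G (- real M)) \<longlonglongrightarrow> 0" using t by real_asymp+
  have "(\<lambda>M. norm (of_real (?G (real M)) * ?c (real M))) \<longlonglongrightarrow> 0"
       "(\<lambda>M. norm (of_real (?G (- real M)) * ?c (- real M))) \<longlonglongrightarrow> 0"
    using G0 by (simp_all add: norm_mult)
  then have z: "(\<lambda>M. of_real (?G (real M)) * ?c (real M)) \<longlonglongrightarrow> 0" "(\<lambda>M. of_real (?G (- real M)) * ?c (- real M)) \<longlonglongrightarrow> 0"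
    by (simp_all only: tendsto_norm_zero_iff)
  have "- 2 * complex_of_real pi * of_real t \<noteq> 0" using t by simp
  from tendsto_add[OF tendsto_divide[OF tendsto_diff[OF z] tendsto_const this]
         tendsto_mult[OF tendsto_const[of "- \<i> * \<xi> / t"] gaussian_fourier_0[OF t, of \<alpha> \<xi>]]]
  show ?thesis unfolding I1 by simp
qed

section \<open>The theta function of the character\<close>

context prim_char
begin

abbreviation \<kappa> :: nat where "\<kappa> \<equiv> kappa chi"

lemma chi_minus_1: "chi (-1) = (-1) ^ \<kappa>"
proof -
  have "chi (-1) * chi (-1) = 1" using chi_mult[of "-1" "-1"] chi_1 by simp
  then have "chi (-1) = 1 \<or> chi (-1) = -1" by (simp add: square_eq_1_iff)
  then show ?thesis by (auto simp: kappa_def)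
qed

lemma kappa_cases: "\<kappa> = 0 \<or> \<kappa> = 1" by (simp add: kappa_def)

lemma chi_minus: "chi (- a) = (-1) ^ \<kappa> * chi a"
  using chi_mult[of "-1" a] chi_minus_1 by simp

text \<open>The factor with exponent \<kappa> matches the parity of chi and makes the terms even in
  n, so this is half the sum over all integers. The term at 0 vanishes because N > 1 forces chi(0) =
  0.\<close>

definition theta :: "real \<Rightarrow> complex" where
  "theta y = (\<Sum>n. f n * of_real (real n ^ \<kappa> * exp (- pi * (real n)\<^sup>2 * y / real N)))"

lemma theta_term_le: "norm (f n * of_real (real n ^ \<kappa> * x)) \<le> real n * \<bar>x\<bar>"
proof -
  have "norm (f n) * real n ^ \<kappa> \<le> real n"
  proof (cases "n = 0")
    case True then show ?thesis using chi_0 by (simp add: f_def)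
  next
    case False
    have "real n ^ \<kappa> \<le> real n" using False kappa_cases by auto
    then show ?thesis using mult_mono[OF cm.f_le[of n]] by fastforce
  qed
  then have "norm (f n) * real n ^ \<kappa> * \<bar>x\<bar> \<le> real n * \<bar>x\<bar>" by (rule mult_right_mono) simp
  then show ?thesis by (simp add: norm_mult norm_power abs_mult mult.assoc)
qed

lemma summable_n_exp: "c > 0 \<Longrightarrow> summable (\<lambda>n. real n * exp (- c * (real n)\<^sup>2))"
proof -
  assume c: "c > 0"
  have sm: "summable (\<lambda>n. 2 / c\<^sup>2 * inverse (real n ^ 2))"
    by (intro summable_mult inverse_power_summable) simp
  show ?thesis
  proof (rule summable_comparison_test'[OF sm, of 1])
    fix n :: nat assume n: "n \<ge> 1"
    define u where "u = c * (real n)\<^sup>2"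
    have u: "u > 0" using c n by (simp add: u_def)
    have "u\<^sup>2 / 2 \<le> exp u" using exp_lower_Taylor_quadratic[of u] u by simp
    then have "exp (- u) \<le> 2 / u\<^sup>2" using u by (simp add: exp_minus field_simps)
    then have "real n * exp (- u) \<le> real n * (2 / u\<^sup>2)" by (rule mult_left_mono) simp
    also have "\<dots> = 2 / c\<^sup>2 * inverse (real n ^ 3)"
      using n c by (simp add: u_def field_simps power2_eq_square power3_eq_cube)
    also have "\<dots> \<le> 2 / c\<^sup>2 * inverse (real n ^ 2)"
      using n by (intro mult_left_mono le_imp_inverse_le power_increasing) auto
    finally show "norm (real n * exp (- c * (real n)\<^sup>2)) \<le> 2 / c\<^sup>2 * inverse (real n ^ 2)"
      by (simp add: u_def)
  qed
qed

lemma theta_summable: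
  assumes "y > 0"
  shows "summable (\<lambda>n. norm (f n * of_real (real n ^ \<kappa> * exp (- pi * (real n)\<^sup>2 * y / real N))))"
proof (rule summable_comparison_test')
  show "summable (\<lambda>n. real n * exp (- (pi * y / real N) * (real n)\<^sup>2))"
    using assms N_pos by (intro summable_n_exp) auto
  show "norm (norm (f n * of_real (real n ^ \<kappa> * exp (- pi * (real n)\<^sup>2 * y / real N)))) \<le> real n * exp (- (pi * y / real N) * (real n)\<^sup>2)" for n
    using theta_term_le[of n "exp (- pi * (real n)\<^sup>2 * y / real N)"] by (simp add: mult_ac)
qed

lemma sum_residue_classes:
  fixes H :: "int \<Rightarrow> complex"
  shows "(\<Sum>a=0..<int N. \<Sum>n=-int M..<int M. H (n * int N + a)) = (\<Sum>m=-int (M * N)..<int (M * N). H m)"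
proof -
  have "(\<Sum>a=0..<int N. \<Sum>n=-int M..<int M. H (n * int N + a))
      = (\<Sum>(a, n)\<in>{0..<int N} \<times> {-int M..<int M}. H (n * int N + a))"
    by (rule sum.cartesian_product)
  also have "\<dots> = (\<Sum>m=-int (M * N)..<int (M * N). H m)"
  proof (rule sum.reindex_bij_witness[of _ "\<lambda>m. (m mod int N, m div int N)" "\<lambda>(a, n). n * int N + a"])
    fix p assume p: "p \<in> {0..<int N} \<times> {-int M..<int M}"
    obtain a n where [simp]: "p = (a, n)" by force
    have a: "0 \<le> a" "a < int N" and n: "- int M \<le> n" "n + 1 \<le> int M" using p by auto
    have 1: "- int M * int N \<le> n * int N" using n by (intro mult_right_mono) auto
    have 2: "(n + 1) * int N \<le> int M * int N" using n by (intro mult_right_mono) auto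
    show "(case p of (a, n) \<Rightarrow> n * int N + a) \<in> {-int (M * N)..<int (M * N)}"
      using 1 2 a by (auto simp: algebra_simps)
    show "((case p of (a, n) \<Rightarrow> n * int N + a) mod int N, (case p of (a, n) \<Rightarrow> n * int N + a) div int N) = p"
      using a N_pos by simp
  next
    fix m assume m: "m \<in> {-int (M * N)..<int (M * N)}"
    have "m div int N < int M"
    proof (rule ccontr)
      assume "\<not> m div int N < int M"
      then have "int N * int M \<le> int N * (m div int N)" by (intro mult_left_mono) auto
      also have "\<dots> \<le> m" using N_pos mult_div_mod_eq[of "int N" m] pos_mod_sign[of "int N" m] by linarith
      finally show False using m by (simp add: mult.commute)
    qed
    moreover have "- int M \<le> m div int N"
    proof (rule ccontr)
      assume "\<not> - int M \<le> m div int N"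
      then have "int N * (m div int N + 1) \<le> int N * (- int M)" by (intro mult_left_mono) auto
      moreover have "m < int N * (m div int N + 1)"
        using N_pos mult_div_mod_eq[of "int N" m] pos_mod_bound[of "int N" m] unfolding distrib_left by linarith
      ultimately show False using m by (simp add: mult.commute)
    qed
    ultimately show "(m mod int N, m div int N) \<in> {0..<int N} \<times> {-int M..<int M}" using N_pos by simp
  qed auto
  finally show ?thesis .
qed

lemma sum_symmetric_lessThan:
  fixes h :: "int \<Rightarrow> complex"
  assumes "\<And>m. h (- m) = h m" "h 0 = 0"
  shows "(\<Sum>m=-int K..<int K. h m) = 2 * (\<Sum>m<K. h (int m)) + h (int K)"
proof (induction K)
  case (Suc K)
  have "{-int (Suc K)..<int (Suc K)} = insert (- int (Suc K)) (insert (int K) {-int K..<int K})" by auto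
  then show ?case using Suc assms(1)[of "1 + int K"] by (simp add: algebra_simps)
qed (use assms in simp)

lemma sum_symmetric_atMost:
  fixes h :: "int \<Rightarrow> complex"
  assumes "\<And>m. h (- m) = h m" "h 0 = 0"
  shows "(\<Sum>m=-int K..int K. h m) = 2 * (\<Sum>m<Suc K. h (int m))"
proof (induction K)
  case (Suc K)
  have "{-int (Suc K)..int (Suc K)} = insert (- int (Suc K)) (insert (int (Suc K)) {-int K..int K})" by auto
  then show ?case using Suc assms(1)[of "1 + int K"] by (simp add: algebra_simps)
qed (use assms in simp)

text \<open>The root number.\<close>

definition omega :: complex where
  "omega = gauss * (- \<i>) ^ \<kappa> * of_real (real N powr (- 1 / 2))"

text \<open>Poisson summation is applied to each residue class a modulo N and weighted with chi(a).
  On one side the classes reassemble to all integers; on the other \<open>gauss_twist\<close> turns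
  the exponential sums into the conjugate character. Evenness then reduces both sides to sums over
  the naturals.\<close>

lemma theta_functional:
  assumes y: "y > 0"
  shows "theta y = omega * of_real (y powr (- real \<kappa> - 1 / 2)) * cnj (theta (1 / y))"
proof -
  \<comment> \<open>With m = n N + a, the term exp (- pi m^2 y / N) is a Gaussian in n + a/N with
    parameter T.\<close>
  define T where "T = y * real N"
  have T: "T > 0" using y N_pos by (simp add: T_def)
  define g where "g a x = (x + of_int a / real N) ^ \<kappa> * exp (- pi * T * (x + of_int a / real N)\<^sup>2)" for a x
  define gh where "gh a k = (- \<i> * of_int k / T) ^ \<kappa> * (of_real (T powr (-1/2) * exp (- pi * (of_int k)\<^sup>2 / T)) * cis (2 * pi * of_int k * (of_int a / real N)))" for a k :: int
  have P: "\<exists>S::real. (\<lambda>M::nat. \<Sum>n=-int M..<int M. g a (of_int n)) \<longlonglongrightarrow> S \<and>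
             (\<lambda>M::nat. \<Sum>k=-int M..int M. gh a k) \<longlonglongrightarrow> of_real S" for a
  proof -
    define \<alpha> where "\<alpha> = of_int a / real N"
    define g' where "g' x = (if \<kappa> = 0 then - 2 * pi * T * (x + \<alpha>) else 1 - 2 * pi * T * (x + \<alpha>)\<^sup>2) * exp (- pi * T * (x + \<alpha>)\<^sup>2)" for x
    obtain C where C: "\<And>x. (1 + (x + \<alpha>)\<^sup>2) * exp (- pi * T * (x + \<alpha>)\<^sup>2) \<le> C / (1 + x\<^sup>2)"
      using gaussian_decay[OF T, of \<alpha>] by blast
    define B where "B = 1 + 2 * pi * T"
    have B: "B \<ge> 1" "B \<ge> 2 * pi * T" using T by (auto simp: B_def)
    have main: "\<bar>q * exp (- pi * T * (x + \<alpha>)\<^sup>2)\<bar> \<le> B * C / (1 + x\<^sup>2)" if "\<bar>q\<bar> \<le> B * (1 + (x + \<alpha>)\<^sup>2)" for q x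
    proof -
      have "\<bar>q * exp (- pi * T * (x + \<alpha>)\<^sup>2)\<bar> \<le> (B * (1 + (x + \<alpha>)\<^sup>2)) * exp (- pi * T * (x + \<alpha>)\<^sup>2)"
        unfolding abs_mult abs_exp_cancel using that by (intro mult_right_mono) auto
      also have "\<dots> = B * ((1 + (x + \<alpha>)\<^sup>2) * exp (- pi * T * (x + \<alpha>)\<^sup>2))" by simp
      also have "\<dots> \<le> B * (C / (1 + x\<^sup>2))" using B by (intro mult_left_mono C) auto
      finally show ?thesis by simp
    qed
    have ab: "\<bar>u\<bar> \<le> 1 + u\<^sup>2" for u :: real
    proof -
      have "(\<bar>u\<bar> - 1)\<^sup>2 \<ge> 0" by simp
      then have "2 * \<bar>u\<bar> \<le> 1 + u\<^sup>2" by (simp add: power2_eq_square algebra_simps)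
      then show ?thesis by linarith
    qed
    have B1: "z \<le> B * z" if "z \<ge> 0" for z using B that mult_right_mono[of 1 B z] by simp
    have B2: "2 * pi * T * z \<le> B * z" if "z \<ge> 0" for z using B that by (intro mult_right_mono) auto
    show ?thesis
    proof (rule poisson_summation[where C = "B * C" and g' = g'])
      show "(g a has_real_derivative g' x) (at x)" for x
      proof -
        have E: "((\<lambda>x. exp (- pi * T * (x + \<alpha>)\<^sup>2)) has_real_derivative
              (- 2 * pi * T * (x + \<alpha>)) * exp (- pi * T * (x + \<alpha>)\<^sup>2)) (at x)"
          by (auto intro!: derivative_eq_intros simp: power2_eq_square)
        have "((\<lambda>x. x + \<alpha>) has_real_derivative 1) (at x)" by (auto intro!: derivative_eq_intros)
        from DERIV_mult[OF this E]
        have E1: "((\<lambda>x. (x + \<alpha>) * exp (- pi * T * (x + \<alpha>)\<^sup>2)) has_real_derivative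
              1 * exp (- pi * T * (x + \<alpha>)\<^sup>2) + (- 2 * pi * T * (x + \<alpha>)) * exp (- pi * T * (x + \<alpha>)\<^sup>2) * (x + \<alpha>)) (at x)" .
        have "1 * u + (- 2 * pi * T * z) * u * z = (1 - 2 * pi * T * z\<^sup>2) * u" for u z :: real
          by (simp add: algebra_simps power2_eq_square)
        then show ?thesis using kappa_cases E E1 unfolding g_def g'_def \<alpha>_def[symmetric] by auto
      qed
      show "\<bar>g a x\<bar> \<le> B * C / (1 + x\<^sup>2)" for x
        unfolding g_def \<alpha>_def[symmetric]
      proof (rule main)
        have "\<bar>(x + \<alpha>) ^ \<kappa>\<bar> \<le> 1 + (x + \<alpha>)\<^sup>2" using kappa_cases ab by auto
        then show "\<bar>(x + \<alpha>) ^ \<kappa>\<bar> \<le> B * (1 + (x + \<alpha>)\<^sup>2)" using B1[of "1 + (x + \<alpha>)\<^sup>2"] by simp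
      qed
      show "\<bar>g' x\<bar> \<le> B * C / (1 + x\<^sup>2)" for x
        unfolding g'_def
      proof (rule main)
        have "2 * pi * T * \<bar>x + \<alpha>\<bar> \<le> 2 * pi * T * (1 + (x + \<alpha>)\<^sup>2)" using T by (intro mult_left_mono ab) auto
        also have "\<dots> \<le> B * (1 + (x + \<alpha>)\<^sup>2)" by (rule B2) simp
        finally have 0: "\<bar>- 2 * pi * T * (x + \<alpha>)\<bar> \<le> B * (1 + (x + \<alpha>)\<^sup>2)"
          using T by (simp add: abs_mult)
        have "\<bar>1 - 2 * pi * T * (x + \<alpha>)\<^sup>2\<bar> \<le> 1 + 2 * pi * T * (x + \<alpha>)\<^sup>2"
          using T by (intro abs_leI) (auto intro: add_nonneg_nonneg)
        also have "\<dots> \<le> B * 1 + B * (x + \<alpha>)\<^sup>2" using B1[of 1] B2[of "(x + \<alpha>)\<^sup>2"] by simp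
        finally have "\<bar>1 - 2 * pi * T * (x + \<alpha>)\<^sup>2\<bar> \<le> B * (1 + (x + \<alpha>)\<^sup>2)" by (simp add: algebra_simps)
        with 0 show "\<bar>if \<kappa> = 0 then - 2 * pi * T * (x + \<alpha>) else 1 - 2 * pi * T * (x + \<alpha>)\<^sup>2\<bar> \<le> B * (1 + (x + \<alpha>)\<^sup>2)"
          by (simp only: split: if_split) simp
      qed
      show "(\<lambda>M::nat. integral {- real M..real M} (\<lambda>x. of_real (g a x) * fchar k x)) \<longlonglongrightarrow> gh a k" for k
      proof (cases "\<kappa> = 0")
        case True
        then show ?thesis using gaussian_fourier_0[OF T, of \<alpha> "of_int k"] unfolding g_def gh_def \<alpha>_def by simp
      next
        case False
        then have [simp]: "\<kappa> = 1" using kappa_cases by simp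
        show ?thesis using gaussian_fourier_1[OF T, of \<alpha> "of_int k"] unfolding g_def gh_def \<alpha>_def by simp
      qed
    qed
  qed
  then obtain S :: "int \<Rightarrow> real" where S: "\<And>a. (\<lambda>M::nat. \<Sum>n=-int M..<int M. g a (of_int n)) \<longlonglongrightarrow> S a"
      "\<And>a. (\<lambda>M::nat. \<Sum>k=-int M..int M. gh a k) \<longlonglongrightarrow> of_real (S a)" by metis
  define S0 where "S0 = (\<Sum>a=0..<int N. chi a * of_real (S a))"
  define h where "h m = chi m * of_real (of_int m ^ \<kappa> * exp (- pi * (of_int m)\<^sup>2 * y / real N))" for m :: int
  define h2 where "h2 k = cnj (chi k) * of_real (of_int k ^ \<kappa> * exp (- pi * (of_int k)\<^sup>2 * (1 / y) / real N))" for k :: int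
  have sq: "((-1) ^ \<kappa> * (-1) ^ \<kappa> :: complex) = 1" by (simp flip: power_mult_distrib)
  have h: "h (- m) = h m" "h 0 = 0" for m
    using sq by (auto simp: h_def chi_minus chi_0 power_minus[of "of_int m :: real"] power_minus[of "of_int m :: complex"])
  have h2: "h2 (- m) = h2 m" "h2 0 = 0" for m
    using sq by (auto simp: h2_def chi_minus chi_0 power_minus[of "of_int m :: real"] power_minus[of "of_int m :: complex"])
  have L1: "(\<lambda>M. \<Sum>a=0..<int N. chi a * of_real (\<Sum>n=-int M..<int M. g a (of_int n))) \<longlonglongrightarrow> S0"
    unfolding S0_def by (intro tendsto_intros S)
  have L2: "(\<Sum>a=0..<int N. chi a * of_real (\<Sum>n=-int M..<int M. g a (of_int n)))
      = of_real (real N powr (- real \<kappa>)) * (2 * (\<Sum>m<M * N. h (int m)))" for M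
  proof -
    have "chi a * of_real (g a (of_int n)) = of_real (real N powr (- real \<kappa>)) * h (n * int N + a)" for a n
    proof -
      have 1: "chi (n * int N + a) = chi a" using chi_add_mult[of a n] by (simp add: add.commute)
      have 2: "of_int n + of_int a / real N = of_int (n * int N + a) / real N" using N_pos by (simp add: field_simps)
      have 3: "- pi * T * (of_int (n * int N + a) / real N)\<^sup>2 = - pi * (of_int (n * int N + a))\<^sup>2 * y / real N"
        using N_pos by (simp add: T_def power_divide power2_eq_square)
      have 4: "(of_int (n * int N + a) / real N) ^ \<kappa> = real N powr (- real \<kappa>) * of_int (n * int N + a) ^ \<kappa>"
        using N_pos kappa_cases by (auto simp: powr_minus divide_inverse)
      show ?thesis unfolding g_def 2 3 4 h_def 1 by simp
    qed
    then have "(\<Sum>a=0..<int N. chi a * of_real (\<Sum>n=-int M..<int M. g a (of_int n)))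
       = of_real (real N powr (- real \<kappa>)) * (\<Sum>a=0..<int N. \<Sum>n=-int M..<int M. h (n * int N + a))"
      unfolding of_real_sum sum_distrib_left by simp
    also have "\<dots> = of_real (real N powr (- real \<kappa>)) * (2 * (\<Sum>m<M * N. h (int m)) + h (int (M * N)))"
      unfolding sum_residue_classes sum_symmetric_lessThan[of h, OF h] ..
    also have "h (int (M * N)) = 0" using chi_add_mult[of 0 "int M"] chi_0 by (simp add: h_def)
    finally show ?thesis by simp
  qed
  have L3: "(\<lambda>M. \<Sum>m<M * N. h (int m)) \<longlonglongrightarrow> theta y"
  proof -
    have "(\<lambda>n. h (int n)) sums theta y"
      using summable_norm_cancel[OF theta_summable[OF y]] unfolding theta_def h_def f_def by (simp add: summable_sums)
    then have "(\<lambda>M. \<Sum>m<M. h (int m)) \<longlonglongrightarrow> theta y" by (simp add: sums_def)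
    moreover have "filterlim (\<lambda>M. M * N) sequentially sequentially"
      using N_pos by (intro filterlim_subseq) (auto simp: strict_mono_def)
    ultimately show ?thesis by (rule filterlim_compose)
  qed
  have A: "S0 = of_real (real N powr (- real \<kappa>)) * (2 * theta y)"
    by (rule LIMSEQ_unique[OF L1[unfolded L2]]) (intro tendsto_mult tendsto_const L3)
  have R1: "(\<lambda>M. \<Sum>a=0..<int N. chi a * (\<Sum>k=-int M..int M. gh a k)) \<longlonglongrightarrow> S0"
    unfolding S0_def by (intro tendsto_intros S)
  have R2: "(\<Sum>a=0..<int N. chi a * (\<Sum>k=-int M..int M. gh a k))
      = gauss * (- \<i>) ^ \<kappa> * of_real (T powr (- real \<kappa> - 1 / 2)) * (2 * (\<Sum>m<Suc M. h2 (int m)))" for M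
  proof -
    have "(\<Sum>a=0..<int N. chi a * gh a k) = gauss * (- \<i>) ^ \<kappa> * of_real (T powr (- real \<kappa> - 1 / 2)) * h2 k" for k
    proof -
      define c where "c = (- \<i> * of_int k / T) ^ \<kappa> * of_real (T powr (-1/2) * exp (- pi * (of_int k)\<^sup>2 / T))"
      have "cis (2 * pi * of_int k * (of_int a / real N)) = ee (a * k)" for a by (simp add: ee_def mult_ac)
      then have "(\<Sum>a=0..<int N. chi a * gh a k) = c * (\<Sum>a=0..<int N. chi a * ee (a * k))"
        by (simp add: gh_def c_def sum_distrib_left mult_ac)
      also have "\<dots> = c * (cnj (chi k) * gauss)" by (simp only: gauss_twist)
      also have "c = (- \<i>) ^ \<kappa> * of_real (T powr (- real \<kappa> - 1 / 2)) * of_real (of_int k ^ \<kappa> * exp (- pi * (of_int k)\<^sup>2 * (1 / y) / real N))"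
      proof -
        have 1: "- pi * (of_int k)\<^sup>2 / T = - pi * (of_int k)\<^sup>2 * (1 / y) / real N" by (simp add: T_def)
        have 2: "T powr (- real \<kappa> - 1 / 2) = T powr (-1/2) / T ^ \<kappa>"
        proof -
          have "T powr (- real \<kappa> - 1 / 2) = T powr (- real \<kappa>) * T powr (-1/2)" by (simp flip: powr_add)
          moreover have "T powr (- real \<kappa>) = 1 / T ^ \<kappa>" using T by (simp add: powr_minus powr_realpow divide_inverse)
          ultimately show ?thesis by simp
        qed
        show ?thesis unfolding c_def 1 2 using T kappa_cases by (auto simp: field_simps)
      qed
      finally show ?thesis by (simp add: h2_def mult_ac)
    qed
    then have "(\<Sum>k=-int M..int M. \<Sum>a=0..<int N. chi a * gh a k)
        = gauss * (- \<i>) ^ \<kappa> * of_real (T powr (- real \<kappa> - 1 / 2)) * (\<Sum>k=-int M..int M. h2 k)"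
      by (simp only: sum_distrib_left)
    then show ?thesis unfolding sum_symmetric_atMost[of h2, OF h2] sum_distrib_left[of "chi _"] by (subst sum.swap) simp
  qed
  have R3: "(\<lambda>M. \<Sum>m<Suc M. h2 (int m)) \<longlonglongrightarrow> cnj (theta (1 / y))"
  proof -
    have "(\<lambda>n. f n * of_real (real n ^ \<kappa> * exp (- pi * (real n)\<^sup>2 * (1 / y) / real N))) sums theta (1 / y)"
      using summable_norm_cancel[OF theta_summable[of "1 / y"]] y unfolding theta_def by (simp add: summable_sums)
    then have "(\<lambda>n. cnj (f n * of_real (real n ^ \<kappa> * exp (- pi * (real n)\<^sup>2 * (1 / y) / real N)))) sums cnj (theta (1 / y))"
      by (simp only: sums_cnj)
    then have "(\<lambda>n. h2 (int n)) sums cnj (theta (1 / y))" by (simp add: h2_def f_def)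
    then show ?thesis unfolding sums_def by (rule LIMSEQ_Suc)
  qed
  have B: "S0 = gauss * (- \<i>) ^ \<kappa> * of_real (T powr (- real \<kappa> - 1 / 2)) * (2 * cnj (theta (1 / y)))"
    by (rule LIMSEQ_unique[OF R1[unfolded R2]]) (intro tendsto_mult tendsto_const R3)
  have TT: "T powr (- real \<kappa> - 1 / 2) = y powr (- real \<kappa> - 1 / 2) * (real N powr (- real \<kappa>) * real N powr (- 1 / 2))"
    using y N_pos by (simp add: T_def powr_mult powr_add[symmetric])
  have "of_real (real N powr (- real \<kappa>)) * (2 * theta y)
     = gauss * (- \<i>) ^ \<kappa> * of_real (T powr (- real \<kappa> - 1 / 2)) * (2 * cnj (theta (1 / y)))"
    using A B by (rule trans[OF sym])
  also have "\<dots> = of_real (real N powr (- real \<kappa>)) * (2 * (omega * of_real (y powr (- real \<kappa> - 1 / 2)) * cnj (theta (1 / y))))"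
    unfolding TT omega_def of_real_mult by (simp only: mult_ac)
  finally have "of_real (real N powr (- real \<kappa>)) * (2 * theta y)
     = of_real (real N powr (- real \<kappa>)) * (2 * (omega * of_real (y powr (- real \<kappa> - 1 / 2)) * cnj (theta (1 / y))))" .
  moreover have "of_real (real N powr (- real \<kappa>)) * 2 \<noteq> (0::complex)" using N_pos by simp
  ultimately show ?thesis by (simp add: mult.assoc[symmetric])
qed

end

section \<open>The entire completion\<close>

text \<open>Euler's integral, rescaled by c. The Bochner form over the whole line suits the exchange
  of sum and integral in \<open>mellin\<close>.\<close>

lemma gamma_bochner:
  assumes c: "c > 0" and z: "Re z > 0"
  shows "has_bochner_integral lborel
           (\<lambda>y. indicator {0<..} y *\<^sub>R (exp ((z - 1) * of_real (ln y)) * of_real (exp (- c * y))))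
           (Gamma z / of_real c powr z)"
proof -
  let ?f = "\<lambda>y::real. indicator {0<..} y *\<^sub>R (exp ((z - 1) * of_real (ln y)) * of_real (exp (- y)))"
  have m: "?f \<in> borel_measurable borel"
    by (intro borel_measurable_continuous_on_indicator continuous_intros) auto
  have eq: "indicator {0<..} t *\<^sub>R (complex_of_real t powr (z - 1) / of_real (exp t)) = ?f t" for t :: real
    by (auto simp: indicator_def powr_def Ln_of_real exp_minus divide_inverse)
  have si: "set_integrable lebesgue {0<..} (\<lambda>t. complex_of_real t powr (z - 1) / of_real (exp t))"
    using absolutely_integrable_Gamma_integral'[OF z] .
  then have 1: "integrable lborel ?f"
    unfolding set_integrable_def eq using m by (subst (asm) integrable_completion) auto
  have "integral\<^sup>L lborel ?f = integral\<^sup>L lebesgue ?f" using m by (subst integral_completion) auto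
  also have "\<dots> = integral {0<..} (\<lambda>t. complex_of_real t powr (z - 1) / of_real (exp t))"
    using set_lebesgue_integral_eq_integral(2)[OF si] unfolding set_lebesgue_integral_def eq .
  also have "\<dots> = Gamma z" using Gamma_integral_complex'[OF z] by (rule integral_unique)
  finally have "has_bochner_integral lborel ?f (Gamma z)" using 1 by (simp add: has_bochner_integral_iff)
  then have "has_bochner_integral lborel (\<lambda>x. ?f (0 + c * x)) (Gamma z /\<^sub>R \<bar>c\<bar>)"
    using lborel_has_bochner_integral_real_affine_iff[of c ?f "Gamma z" 0] c by blast
  from has_bochner_integral_mult_right[OF this, of "exp (- (z - 1) * of_real (ln c))"]
  have "has_bochner_integral lborel (\<lambda>x. exp (- (z - 1) * of_real (ln c)) * ?f (0 + c * x)) (exp (- (z - 1) * of_real (ln c)) * (Gamma z /\<^sub>R \<bar>c\<bar>))" by simp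
  moreover have "exp (- (z - 1) * of_real (ln c)) * ?f (0 + c * x)
      = indicator {0<..} x *\<^sub>R (exp ((z - 1) * of_real (ln x)) * of_real (exp (- c * x)))" for x
  proof (cases "x > 0")
    case True
    then have "ln (c * x) = ln c + ln x" using c by (simp add: ln_mult)
    then have "exp (- (z - 1) * of_real (ln c)) * exp ((z - 1) * of_real (ln (c * x))) = exp ((z - 1) * of_real (ln x))"
      by (simp add: algebra_simps flip: exp_add)
    then show ?thesis using True c by (simp add: mult.assoc[symmetric])
  next
    case False
    then have "\<not> 0 < c * x" using c by (simp add: zero_less_mult_iff)
    then show ?thesis using False by simp
  qed
  moreover have "exp (- (z - 1) * of_real (ln c)) * (Gamma z /\<^sub>R \<bar>c\<bar>) = Gamma z / of_real c powr z"
  proof -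
    have "of_real c powr z = exp ((z - 1) * of_real (ln c)) * exp (of_real (ln c))"
      using c by (simp add: powr_def Ln_of_real algebra_simps flip: exp_add)
    also have "exp (of_real (ln c)) = complex_of_real c" using c by (simp add: exp_of_real)
    finally have 1: "of_real c powr z = exp ((z - 1) * of_real (ln c)) * of_real c" .
    have 2: "exp (- (z - 1) * of_real (ln c)) = inverse (exp ((z - 1) * of_real (ln c)))"
      by (simp only: mult_minus_left exp_minus)
    show ?thesis unfolding 1 2 using c by (simp add: scaleR_conv_of_real divide_inverse)
  qed
  ultimately show ?thesis by (simp only:)
qed

lemma gamma_bochner_real:
  fixes c x :: real
  assumes c: "c > 0" and x: "x > 0"
  shows "has_bochner_integral lborel
           (\<lambda>y. indicator {0<..} y * (exp ((x - 1) * ln y) * exp (- c * y))) (Gamma x / c powr x)"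
proof -
  have "has_bochner_integral lborel
     (\<lambda>y. Re (indicator {0<..} y *\<^sub>R (exp ((of_real x - 1) * of_real (ln y)) * of_real (exp (- c * y)))))
           (Re (Gamma (of_real x) / of_real c powr of_real x))"
    by (rule has_bochner_integral_bounded_linear[OF bounded_linear_Re gamma_bochner]) (use assms in auto)
  moreover have "Gamma (of_real x) / of_real c powr of_real x = complex_of_real (Gamma x / c powr x)"
    using c by (simp add: Gamma_complex_of_real powr_of_real)
  moreover have "exp ((of_real x - 1) * of_real (ln y)) * of_real (exp (- c * y)) = complex_of_real (exp ((x - 1) * ln y) * exp (- c * y))" for y
  proof -
    have e: "(of_real x - 1) * of_real (ln y) = complex_of_real ((x - 1) * ln y)" by simp
    show ?thesis unfolding of_real_mult[of "exp ((x - 1) * ln y)"] e exp_of_real ..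
  qed
  ultimately show ?thesis by (simp only: Re_complex_of_real scaleR_complex.sel real_scaleR_def)
qed

lemma powr_le_exp_linear:
  fixes R c :: real
  assumes "c > 0" "R > 0"
  shows "\<exists>K>0. \<forall>y>0. exp (R * ln y) \<le> K * exp (c * y)"
proof -
  define a where "a = c / R"
  have a: "a > 0" using assms by (simp add: a_def)
  have "exp (R * ln y) \<le> exp (- R * ln a) * exp (c * y)" if "y > 0" for y
  proof -
    have "ln (a * y) \<le> a * y" using ln_le_minus_one[of "a * y"] a that by simp
    then have "ln y \<le> a * y - ln a" using a that by (simp add: ln_mult)
    then have "R * ln y \<le> R * (a * y - ln a)" using assms by (intro mult_left_mono) auto
    also have "\<dots> = - R * ln a + c * y" using assms by (simp add: a_def algebra_simps)
    finally show ?thesis by (simp flip: exp_add)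
  qed
  then show ?thesis by (intro exI[of _ "exp (- R * ln a)"]) auto
qed

context prim_char
begin

lemma theta_continuous: "continuous_on {0<..} theta"
proof -
  have *: "continuous_on {d<..} theta" if d: "d > 0" for d
  proof (rule uniform_limit_theorem)
    show "uniform_limit {d<..} (\<lambda>M y. \<Sum>n<M. f n * of_real (real n ^ \<kappa> * exp (- pi * (real n)\<^sup>2 * y / real N))) theta sequentially"
      unfolding theta_def
    proof (rule Weierstrass_m_test)
      show "summable (\<lambda>n. real n * exp (- (pi * d / real N) * (real n)\<^sup>2))"
        using d N_pos by (intro summable_n_exp) auto
      fix n y assume "y \<in> {d<..}"
      then have "- pi * (real n)\<^sup>2 * y / real N \<le> - (pi * d / real N) * (real n)\<^sup>2"
        using N_pos by (simp add: field_simps mult_right_mono)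
      then have "real n * \<bar>exp (- pi * (real n)\<^sup>2 * y / real N)\<bar> \<le> real n * exp (- (pi * d / real N) * (real n)\<^sup>2)"
        by (intro mult_left_mono) auto
      with theta_term_le[of n "exp (- pi * (real n)\<^sup>2 * y / real N)"]
      show "norm (f n * of_real (real n ^ \<kappa> * exp (- pi * (real n)\<^sup>2 * y / real N))) \<le> real n * exp (- (pi * d / real N) * (real n)\<^sup>2)"
        by linarith
    qed
  qed (use N_pos in \<open>auto intro!: always_eventually continuous_intros\<close>)
  have "isCont theta y" if "y > 0" for y
    using *[of "y / 2"] that by (auto simp: continuous_on_eq_continuous_at)
  then show ?thesis by (auto intro!: continuous_at_imp_continuous_on)
qed

text \<open>From (n^2 - 1)(y - 1) >= 0 follows n^2 y >= n^2 + y - 1, so the decay in y separates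
  from a convergent series in n.\<close>

lemma theta_bound: "\<exists>C>0. \<forall>y\<ge>1. norm (theta y) \<le> C * exp (- (pi / real N) * y)"
proof -
  define c where "c = pi / real N"
  have c: "c > 0" using N_pos by (simp add: c_def)
  define S where "S = (\<Sum>n. exp c * (real n * exp (- c * (real n)\<^sup>2)))"
  have sm: "summable (\<lambda>n. exp c * (real n * exp (- c * (real n)\<^sup>2)))"
    by (intro summable_mult summable_n_exp c)
  have S0: "S \<ge> 0" unfolding S_def by (intro suminf_nonneg sm) auto
  have "norm (theta y) \<le> (S + 1) * exp (- c * y)" if y: "y \<ge> 1" for y
  proof -
    have "norm (theta y) \<le> (\<Sum>n. exp c * (real n * exp (- c * (real n)\<^sup>2)) * exp (- c * y))"
      unfolding theta_def
    proof (rule norm_suminf_le[OF _ summable_mult2[OF sm]])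
      fix n
      have "real n * exp (- pi * (real n)\<^sup>2 * y / real N) \<le> exp c * (real n * exp (- c * (real n)\<^sup>2)) * exp (- c * y)"
      proof (cases "n = 0")
        case False
        then have "(real n)\<^sup>2 \<ge> 1" by simp
        then have "((real n)\<^sup>2 - 1) * (y - 1) \<ge> 0" using y by (intro mult_nonneg_nonneg) auto
        then have "(real n)\<^sup>2 * y \<ge> (real n)\<^sup>2 + y - 1" by (simp add: algebra_simps)
        then have "- c * ((real n)\<^sup>2 * y) \<le> - c * ((real n)\<^sup>2 + y - 1)" using c by simp
        then have "exp (- pi * (real n)\<^sup>2 * y / real N) \<le> exp (c + (- c * (real n)\<^sup>2) + (- c * y))"
          by (simp add: c_def algebra_simps diff_divide_distrib add_divide_distrib)
        also have "\<dots> = exp c * exp (- c * (real n)\<^sup>2) * exp (- c * y)" by (simp only: exp_add)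
        finally have "real n * exp (- pi * (real n)\<^sup>2 * y / real N) \<le> real n * (exp c * exp (- c * (real n)\<^sup>2) * exp (- c * y))"
          by (rule mult_left_mono) simp
        then show ?thesis by (simp only: mult_ac)
      qed auto
      with theta_term_le[of n "exp (- pi * (real n)\<^sup>2 * y / real N)"]
      show "norm (f n * of_real (real n ^ \<kappa> * exp (- pi * (real n)\<^sup>2 * y / real N)))
          \<le> exp c * (real n * exp (- c * (real n)\<^sup>2)) * exp (- c * y)" by simp
    qed
    also have "\<dots> = S * exp (- c * y)" unfolding S_def by (rule suminf_mult2[symmetric, OF sm])
    also have "\<dots> \<le> (S + 1) * exp (- c * y)" by (intro mult_right_mono) auto
    finally show ?thesis .
  qed
  then show ?thesis using S0 unfolding c_def by (intro exI[of _ "S + 1"]) auto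
qed

definition mel :: "complex \<Rightarrow> real \<Rightarrow> complex" where
  "mel s y = exp (((s + of_nat \<kappa>) / 2 - 1) * of_real (ln y)) * theta y"

lemma mel_continuous: "S \<subseteq> {0<..} \<Longrightarrow> continuous_on S (mel s)"
  unfolding mel_def by (intro continuous_intros continuous_on_subset[OF theta_continuous]) auto

text \<open>Truncation makes \<open>J\<close> a locally uniform limit of integrals over compact
  intervals, which are entire by differentiation under the integral.\<close>

definition Jn :: "nat \<Rightarrow> complex \<Rightarrow> complex" where
  "Jn n s = integral {1..real n + 1} (mel s)"

definition J :: "complex \<Rightarrow> complex" where "J s = lim (\<lambda>n. Jn n s)"

lemma Jn_holomorphic: "Jn n holomorphic_on UNIV"
proof -
  have "(\<lambda>s. integral (cbox 1 (real n + 1)) (mel s)) holomorphic_on UNIV"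
  proof (rule leibniz_rule_holomorphic)
    show "((\<lambda>s. mel s t) has_field_derivative (of_real (ln t) / 2 * mel s t)) (at s within UNIV)" for s t
      unfolding mel_def by (auto intro!: derivative_eq_intros)
    show "mel s integrable_on cbox 1 (real n + 1)" for s
      unfolding cbox_interval by (intro integrable_continuous_real mel_continuous) auto
    show "continuous_on (UNIV \<times> cbox 1 (real n + 1)) (\<lambda>(s, t). of_real (ln t) / 2 * mel s t)"
      unfolding mel_def case_prod_unfold
      by (intro continuous_intros continuous_on_compose2[OF theta_continuous]) auto
  qed auto
  then show ?thesis unfolding Jn_def[abs_def] cbox_interval .
qed

lemma Jn_limit: "(\<lambda>n. Jn n s) \<longlonglongrightarrow> J s"
  and J_tail: "\<exists>C c. c > 0 \<and> (\<forall>s n. norm s \<le> R \<longrightarrow> norm (J s - Jn n s) \<le> C * exp (- c * real n))"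
proof -
  have main: "\<exists>C c. c > 0 \<and> C \<ge> 0 \<and> (\<forall>s n m. norm s \<le> R \<longrightarrow> n \<le> m \<longrightarrow> norm (Jn m s - Jn n s) \<le> C * exp (- c * real n))" for R
  proof -
    obtain C where C: "C > 0" "\<And>y. y \<ge> 1 \<Longrightarrow> norm (theta y) \<le> C * exp (- (pi / real N) * y)"
      using theta_bound by blast
    define c where "c = pi / real N / 2"
    have c: "c > 0" using N_pos by (simp add: c_def)
    define r where "r = \<bar>R\<bar> + 1"
    have r: "r > 0" by (simp add: r_def)
    obtain K where K: "K > 0" "\<And>y. y > 0 \<Longrightarrow> exp (r * ln y) \<le> K * exp (c * y)"
      using powr_le_exp_linear[OF c r] by blast
    have bd: "norm (mel s y) \<le> C * K * exp (- c * y)" if s: "norm s \<le> R" and y: "y \<ge> 1" for s y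
    proof -
      have "Re ((s + of_nat \<kappa>) / 2 - 1) \<le> r"
        using complex_Re_le_cmod[of s] s kappa_cases by (auto simp: r_def)
      then have "Re ((s + of_nat \<kappa>) / 2 - 1) * ln y \<le> r * ln y" using y by (intro mult_right_mono) auto
      then have "norm (exp (((s + of_nat \<kappa>) / 2 - 1) * of_real (ln y))) \<le> exp (r * ln y)"
        by simp
      also have "\<dots> \<le> K * exp (c * y)" using y by (intro K) auto
      finally have "norm (mel s y) \<le> K * exp (c * y) * (C * exp (- (pi / real N) * y))"
        unfolding mel_def norm_mult using C(2)[OF y] K by (intro mult_mono) auto
      also have "\<dots> = C * K * exp (c * y + - (pi / real N) * y)" by (simp only: exp_add mult_ac)
      also have "c * y + - (pi / real N) * y = - c * y" by (simp add: c_def field_simps)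
      finally show ?thesis .
    qed
    have "norm (Jn m s - Jn n s) \<le> C * K / c * exp (- c * real n)" if s: "norm s \<le> R" and nm: "n \<le> m" for s n m
    proof -
      have "Jn m s = Jn n s + integral {real n + 1..real m + 1} (mel s)"
        unfolding Jn_def using nm
        by (intro Henstock_Kurzweil_Integration.integral_combine[symmetric] integrable_continuous_real mel_continuous) auto
      then have "norm (Jn m s - Jn n s) = norm (integral {real n + 1..real m + 1} (mel s))" by simp
      also have "\<dots> \<le> integral {real n + 1..real m + 1} (\<lambda>y. C * K * exp (- c * y))"
      proof (rule integral_norm_bound_integral)
        show "mel s integrable_on {real n + 1..real m + 1}" by (intro integrable_continuous_real mel_continuous) auto
        show "(\<lambda>y. C * K * exp (- c * y)) integrable_on {real n + 1..real m + 1}"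
          by (intro integrable_continuous_real continuous_intros)
        show "norm (mel s y) \<le> C * K * exp (- c * y)" if "y \<in> {real n + 1..real m + 1}" for y
          using that by (intro bd s) auto
      qed
      also have "\<dots> = - (C * K / c) * exp (- c * (real m + 1)) - - (C * K / c) * exp (- c * (real n + 1))"
      proof (rule integral_unique, rule fundamental_theorem_of_calculus)
        show "((\<lambda>y. - (C * K / c) * exp (- c * y)) has_vector_derivative C * K * exp (- c * y)) (at y within {real n + 1..real m + 1})" for y
          using c by (auto intro!: derivative_eq_intros simp: has_real_derivative_iff_has_vector_derivative[symmetric])
      qed (use nm in auto)
      also have "\<dots> \<le> C * K / c * exp (- c * (real n + 1))" using C(1) K(1) c by simp
      also have "\<dots> \<le> C * K / c * exp (- c * real n)" using C(1) K(1) c by (intro mult_left_mono) auto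
      finally show ?thesis .
    qed
    then show ?thesis using c C(1) K(1) by (intro exI[of _ "C * K / c"] exI[of _ c]) auto
  qed
  have e0: "(\<lambda>n. C * exp (- c * real n)) \<longlonglongrightarrow> 0" if "c > 0" for C c :: real using that by real_asymp
  have conv: "(\<lambda>n. Jn n s) \<longlonglongrightarrow> J s" for s
  proof -
    obtain C c where Cc: "c > 0" "C \<ge> 0" "\<And>n m. n \<le> m \<Longrightarrow> norm (Jn m s - Jn n s) \<le> C * exp (- c * real n)"
      using main[of "norm s"] by blast
    have "Cauchy (\<lambda>n. Jn n s)"
    proof (rule CauchyI)
      fix e :: real assume "e > 0"
      then obtain K where K: "\<And>n. n \<ge> K \<Longrightarrow> C * exp (- c * real n) < e"
        using order_tendstoD(2)[OF e0[OF Cc(1), of C]] by (auto simp: eventually_sequentially)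
      have "norm (Jn m s - Jn n s) < e" if "m \<ge> K" "n \<ge> K" for m n
      proof (cases "n \<le> m")
        case True then show ?thesis using Cc(3)[OF True] K[OF that(2)] by linarith
      next
        case False
        then show ?thesis using Cc(3)[of m n] K[OF that(1)] norm_minus_commute[of "Jn m s" "Jn n s"] by simp
      qed
      then show "\<exists>M. \<forall>m\<ge>M. \<forall>n\<ge>M. norm (Jn m s - Jn n s) < e" by blast
    qed
    then show ?thesis unfolding J_def using Cauchy_convergent convergent_LIMSEQ_iff by blast
  qed
  then show "(\<lambda>n. Jn n s) \<longlonglongrightarrow> J s" .
  obtain C c where Cc: "c > 0" "\<And>s n m. norm s \<le> R \<Longrightarrow> n \<le> m \<Longrightarrow> norm (Jn m s - Jn n s) \<le> C * exp (- c * real n)"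
    using main[of R] by blast
  have "norm (J s - Jn n s) \<le> C * exp (- c * real n)" if "norm s \<le> R" for s n
  proof (rule tendsto_upperbound)
    show "(\<lambda>m. norm (Jn m s - Jn n s)) \<longlonglongrightarrow> norm (J s - Jn n s)" by (intro tendsto_intros conv)
    show "\<forall>\<^sub>F m in sequentially. norm (Jn m s - Jn n s) \<le> C * exp (- c * real n)"
      using eventually_ge_at_top[of n] by eventually_elim (use Cc that in auto)
  qed auto
  then show "\<exists>C c. c > 0 \<and> (\<forall>s n. norm s \<le> R \<longrightarrow> norm (J s - Jn n s) \<le> C * exp (- c * real n))" using Cc(1) by blast
qed

lemma J_holomorphic: "J holomorphic_on UNIV"
proof (rule holomorphic_uniform_sequence[OF open_UNIV Jn_holomorphic])
  fix z :: complex
  obtain C c where Cc: "c > 0" "\<And>s n. norm s \<le> norm z + 1 \<Longrightarrow> norm (J s - Jn n s) \<le> C * exp (- c * real n)"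
    using J_tail[of "norm z + 1"] by blast
  have e0: "(\<lambda>n. C * exp (- c * real n)) \<longlonglongrightarrow> 0" using Cc(1) by real_asymp
  have "uniform_limit (cball z 1) Jn J sequentially"
  proof (rule uniform_limitI)
    fix e :: real assume "e > 0"
    from order_tendstoD(2)[OF e0 this] show "\<forall>\<^sub>F n in sequentially. \<forall>s\<in>cball z 1. dist (Jn n s) (J s) < e"
    proof eventually_elim
      case (elim n)
      show ?case
      proof
        fix s assume "s \<in> cball z 1"
        then have "norm (s - z) \<le> 1" by (simp add: dist_norm norm_minus_commute)
        then have "norm s \<le> norm z + 1" using norm_triangle_sub[of s z] by linarith
        from Cc(2)[OF this, of n] elim show "dist (Jn n s) (J s) < e" by (simp add: dist_norm norm_minus_commute)
      qed
    qed
  qed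
  then show "\<exists>d>0. cball z d \<subseteq> UNIV \<and> uniform_limit (cball z d) Jn J sequentially"
    by (intro exI[of _ 1]) auto
qed

text \<open>Termwise integration of theta. It is justified by the absolute integrals
  \<open>u n\<close>, which are Gamma integrals at Re w and sum to a multiple of the absolutely
  convergent Dirichlet series.\<close>

lemma mellin:
  assumes s: "Re s > 1"
  defines "w \<equiv> (s + of_nat \<kappa>) / 2"
  shows "has_bochner_integral lborel (\<lambda>y. indicator {0<..} y *\<^sub>R mel s y)
           (of_real (pi / real N) powr (- w) * Gamma w * dseries f s)"
proof -
  have w: "Re w > 1 / 2" using s kappa_cases by (auto simp: w_def)
  define c where "c n = pi / real N * (real n)\<^sup>2" for n
  define t where "t n y = (f n * of_real (real n ^ \<kappa>)) * (indicator {0<..} y *\<^sub>R (exp ((w - 1) * of_real (ln y)) * of_real (exp (- c n * y))))" for n y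
  define v where "v n = (f n * of_real (real n ^ \<kappa>)) * (Gamma w / of_real (c n) powr w)" for n
  define u where "u n = norm (f n * of_real (real n ^ \<kappa>)) * (Gamma (Re w) / c n powr Re w)" for n
  have c: "c n > 0" if "n > 0" for n using that N_pos by (simp add: c_def)
  have f0: "f 0 = 0" using chi_0 by (simp add: f_def)
  have t: "has_bochner_integral lborel (t n) (v n)" for n
  proof (cases "n = 0")
    case True
    then show ?thesis by (simp add: t_def[abs_def] v_def f0 has_bochner_integral_zero)
  next
    case False
    then show ?thesis unfolding t_def[abs_def] v_def using c w
      by (intro has_bochner_integral_mult_right gamma_bochner) auto
  qed
  have nt: "norm (t n y) = norm (f n * of_real (real n ^ \<kappa>)) * (indicator {0<..} y * (exp ((Re w - 1) * ln y) * exp (- c n * y)))" for n y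
    unfolding t_def by (simp add: norm_mult indicator_def)
  have tn: "has_bochner_integral lborel (\<lambda>y. norm (t n y)) (u n)" for n
  proof (cases "n = 0")
    case True
    then show ?thesis by (simp add: nt u_def f0 has_bochner_integral_zero)
  next
    case False
    then show ?thesis unfolding nt u_def using c w
      by (intro has_bochner_integral_mult_right gamma_bochner_real) auto
  qed
  have cp: "of_real (c n) powr w = of_real (pi / real N) powr w * of_nat n powr (2 * w)" if "n > 0" for n
  proof -
    have "Ln (of_real (c n)) = complex_of_real (ln (pi / real N) + 2 * ln (real n))"
      using c[OF that] that N_pos unfolding c_def by (subst Ln_of_real) (auto simp: ln_mult ln_div ln_realpow)
    then show ?thesis using c[OF that] that N_pos Ln_of_real[of "real n"] Ln_of_real[of "pi / real N"]
      by (auto simp: powr_def exp_add[symmetric] algebra_simps)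
  qed
  have pw: "of_real (real n ^ \<kappa>) / of_nat n powr (2 * w) = of_nat n powr (-s)" if "n > 0" for n
  proof -
    have "2 * w = s + of_nat \<kappa>" by (simp add: w_def)
    then have "of_nat n powr (2 * w) = of_nat n powr s * of_nat n ^ \<kappa>" using that by (simp add: powr_add powr_nat')
    then show ?thesis using that by (simp add: powr_minus field_simps)
  qed
  have v: "v n = of_real (pi / real N) powr (- w) * Gamma w * (f n * of_nat n powr (-s))" for n
  proof (cases "n = 0")
    case False
    then have "v n = f n * (of_real (real n ^ \<kappa>) / of_nat n powr (2 * w)) * Gamma w / of_real (pi / real N) powr w"
      unfolding v_def by (subst cp) auto
    also have "\<dots> = of_real (pi / real N) powr (- w) * Gamma w * (f n * of_nat n powr (-s))"
      using False by (subst pw) (auto simp: powr_minus divide_inverse)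
    finally show ?thesis .
  qed (simp add: v_def f0)
  have u: "u n = norm (of_real (pi / real N) powr (- w)) * Gamma (Re w) * norm (f n * of_nat n powr (-s))" for n
  proof (cases "n = 0")
    case False
    then have cn: "c n > 0" by (rule c[OF neq0_conv[THEN iffD1]])
    have "c n powr Re w = norm (of_real (c n) powr w)" using cn by (subst norm_powr_real_powr) auto
    also have "\<dots> = norm (of_real (pi / real N) powr w) * norm (of_nat n powr (2 * w) :: complex)"
      using False by (subst cp) (auto simp: norm_mult)
    finally have 1: "c n powr Re w = norm (of_real (pi / real N) powr w) * norm (of_nat n powr (2 * w) :: complex)" .
    have "norm (f n * of_real (real n ^ \<kappa>)) / norm (of_nat n powr (2 * w) :: complex) = norm (f n * (of_real (real n ^ \<kappa>) / of_nat n powr (2 * w)))"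
      by (simp add: norm_mult norm_divide)
    also have "\<dots> = norm (f n * of_nat n powr (-s))" using False by (subst pw) auto
    finally have 2: "norm (f n * of_real (real n ^ \<kappa>)) / norm (of_nat n powr (2 * w) :: complex) = norm (f n * of_nat n powr (-s))" .
    have "u n = (norm (f n * of_real (real n ^ \<kappa>)) / norm (of_nat n powr (2 * w) :: complex)) * Gamma (Re w) / norm (of_real (pi / real N) powr w)"
      unfolding u_def 1 by simp
    then show ?thesis unfolding 2 by (simp add: powr_minus norm_inverse divide_inverse)
  qed (simp add: u_def f0)
  have su: "summable u" unfolding u by (intro summable_mult abs_conv_beyondD[OF cm.conv_f s])
  have sv: "v sums (of_real (pi / real N) powr (- w) * Gamma w * dseries f s)"
    unfolding v by (intro sums_mult dseries_sums[OF cm.conv_f s])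
  have it: "integrable lborel (t n)" for n using t[of n] by (simp add: has_bochner_integral_iff)
  have sn: "summable (\<lambda>n. norm (t n y))" for y
  proof (cases "y > 0")
    case True
    have eq: "norm (t n y) = norm (exp ((w - 1) * of_real (ln y))) * norm (f n * of_real (real n ^ \<kappa> * exp (- pi * (real n)\<^sup>2 * y / real N)))" for n
      using True by (simp add: t_def norm_mult c_def)
    show ?thesis unfolding eq by (intro summable_mult theta_summable True)
  qed (simp add: t_def)
  have ts: "(\<Sum>n. t n y) = indicator {0<..} y *\<^sub>R mel s y" for y
  proof (cases "y > 0")
    case True
    have "t n y = exp ((w - 1) * of_real (ln y)) * (f n * of_real (real n ^ \<kappa> * exp (- pi * (real n)\<^sup>2 * y / real N)))" for n
      using True by (simp add: t_def c_def)
    then show ?thesis using True suminf_mult[OF summable_norm_cancel[OF theta_summable[OF True]]]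
      by (simp add: mel_def theta_def w_def)
  qed (simp add: t_def)
  have su': "summable (\<lambda>n. integral\<^sup>L lborel (\<lambda>y. norm (t n y)))"
    using su tn by (simp add: has_bochner_integral_iff)
  have 1: "integrable lborel (\<lambda>y. \<Sum>n. t n y)"
    by (rule integrable_suminf[OF it _ su']) (use sn in auto)
  have 2: "(\<lambda>n. integral\<^sup>L lborel (t n)) sums (integral\<^sup>L lborel (\<lambda>y. \<Sum>n. t n y))"
    by (rule sums_integral[OF it _ su']) (use sn in auto)
  have "(\<lambda>n. integral\<^sup>L lborel (t n)) = v" using t by (auto simp: has_bochner_integral_iff)
  with 2 sv have "integral\<^sup>L lborel (\<lambda>y. \<Sum>n. t n y) = of_real (pi / real N) powr (- w) * Gamma w * dseries f s"
    using sums_unique2 by simp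
  with 1 show ?thesis unfolding ts by (simp add: has_bochner_integral_iff)
qed

text \<open>The half-line is exhausted by intervals invariant under y -> 1/y, so that their part
  below 1 is the mirror image of the part above 1.\<close>

lemma mellin_limit:
  assumes s: "Re s > 1"
  shows "(\<lambda>n. integral {1 / (real n + 1)..real n + 1} (mel s)) \<longlonglongrightarrow>
     of_real (pi / real N) powr (- ((s + of_nat \<kappa>) / 2)) * Gamma ((s + of_nat \<kappa>) / 2) * dseries f s"
proof -
  define A where "A n = {1 / (real n + 1)..real n + 1}" for n
  have UA: "(\<Union>n. A n) = {0<..}"
  proof (intro equalityI subsetI)
    fix y :: real assume y: "y \<in> {0<..}"
    obtain n where n: "real n \<ge> max y (1 / y)" using real_arch_simple by blast
    have "1 / y \<le> real n" using n by simp
    then have "1 / (real n + 1) \<le> y" using y by (simp add: field_simps)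
    then show "y \<in> (\<Union>n. A n)" using n by (auto simp: A_def intro!: exI[of _ n])
  next
    fix y assume "y \<in> (\<Union>n. A n)"
    then obtain n where n: "1 / (real n + 1) \<le> y" by (auto simp: A_def)
    have "0 < 1 / (real n + 1)" by simp
    also note n
    finally show "y \<in> {0<..}" by simp
  qed
  note M = mellin[OF s]
  have si: "set_integrable lborel (\<Union>n. A n) (mel s)"
    using M unfolding UA set_integrable_def by (simp add: has_bochner_integral_iff)
  have "(\<lambda>n. LINT y:A n|lborel. mel s y) \<longlonglongrightarrow> (LINT y:(\<Union>n. A n)|lborel. mel s y)"
    by (rule set_integral_cont_up[OF _ _ si]) (auto simp: A_def incseq_def intro!: divide_left_mono)
  moreover have "(LINT y:A n|lborel. mel s y) = integral (A n) (mel s)" for n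
    by (rule set_borel_integral_eq_integral(2)[OF set_integrable_subset[OF si]]) (auto simp: A_def)
  moreover have "(LINT y:(\<Union>n. A n)|lborel. mel s y) = of_real (pi / real N) powr (- ((s + of_nat \<kappa>) / 2)) * Gamma ((s + of_nat \<kappa>) / 2) * dseries f s"
    using M unfolding UA set_lebesgue_integral_def by (simp add: has_bochner_integral_iff)
  ultimately show ?thesis by (simp add: A_def)
qed

text \<open>Substitute 1/x and insert the functional equation of theta; the powers of x then combine
  to the conjugate of the integrand at 1 - cnj s.\<close>

lemma mel_reflect:
  assumes M: "M \<ge> 1"
  shows "integral {1 / M..1} (mel s) = omega * cnj (integral {1..M} (mel (1 - cnj s)))"
proof -
  have "((\<lambda>x. (- (1 / x\<^sup>2)) *\<^sub>R mel s (1 / x)) has_integral (integral {1 / 1..1 / M} (mel s) - integral {1 / M..1 / 1} (mel s))) {1..M}"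
  proof (rule has_integral_substitution_general[where s = "{}" and c = "1 / M" and d = 1])
    show "(\<lambda>x. 1 / x) ` {1..M} \<subseteq> {1 / M..1}" using M by (auto simp: field_simps)
    show "continuous_on {1 / M..1} (mel s)"
    proof (rule mel_continuous)
      have "0 < 1 / M" using M by simp
      then show "{1 / M..1} \<subseteq> {0<..}" by (auto simp del: divide_pos_pos zero_less_divide_1_iff intro: less_le_trans)
    qed
    show "continuous_on {1..M} (\<lambda>x::real. 1 / x)" by (intro continuous_intros) auto
    show "((\<lambda>x. 1 / x) has_real_derivative - (1 / x\<^sup>2)) (at x within {1..M})" if "x \<in> {1..M} - {}" for x
      using that by (auto intro!: derivative_eq_intros simp: power2_eq_square)
  qed (use M in auto)
  moreover have "integral {1 / 1..1 / M} (mel s) = 0"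
    using M by (cases "M = 1") (auto simp: field_simps)
  ultimately have "((\<lambda>x. (- (1 / x\<^sup>2)) *\<^sub>R mel s (1 / x)) has_integral (- integral {1 / M..1} (mel s))) {1..M}" by simp
  from has_integral_neg[OF this]
  have "((\<lambda>x. (1 / x\<^sup>2) *\<^sub>R mel s (1 / x)) has_integral (integral {1 / M..1} (mel s))) {1..M}" by simp
  moreover have "((\<lambda>x. (1 / x\<^sup>2) *\<^sub>R mel s (1 / x)) has_integral (omega * cnj (integral {1..M} (mel (1 - cnj s))))) {1..M}"
  proof -
    have "((mel (1 - cnj s)) has_integral (integral {1..M} (mel (1 - cnj s)))) {1..M}"
      by (intro integrable_integral integrable_continuous_real mel_continuous) auto
    then have "((\<lambda>x. cnj (mel (1 - cnj s) x)) has_integral cnj (integral {1..M} (mel (1 - cnj s)))) {1..M}"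
      by (simp add: has_integral_cnj[unfolded o_def])
    from has_integral_mult_right[OF this, of omega]
    show ?thesis
    proof (rule has_integral_eq[rotated])
      fix x assume "x \<in> {1..M}"
      then have x: "x > 0" by simp
      have th: "theta (1 / x) = omega * of_real ((1 / x) powr (- real \<kappa> - 1 / 2)) * cnj (theta x)"
        using theta_functional[of "1 / x"] x by simp
      have p1: "(1 / x) powr (- real \<kappa> - 1 / 2) = exp ((real \<kappa> + 1 / 2) * ln x)"
        using x by (simp add: powr_def ln_div algebra_simps)
      have "exp (2 * ln x) = x\<^sup>2" using x by (simp add: exp_double)
      then have p2: "1 / x\<^sup>2 = exp (- 2 * ln x)" by (simp add: exp_minus divide_inverse)
      have "(1 / x\<^sup>2) *\<^sub>R mel s (1 / x) =
         omega * (of_real (exp (- 2 * ln x)) * exp (((s + of_nat \<kappa>) / 2 - 1) * of_real (ln (1 / x))) * of_real (exp ((real \<kappa> + 1 / 2) * ln x))) * cnj (theta x)"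
        unfolding mel_def th p1 p2 scaleR_conv_of_real by (simp only: mult_ac)
      also have "of_real (exp (- 2 * ln x)) * exp (((s + of_nat \<kappa>) / 2 - 1) * of_real (ln (1 / x))) * of_real (exp ((real \<kappa> + 1 / 2) * ln x))
          = exp (cnj ((((1 - cnj s) + of_nat \<kappa>) / 2 - 1) * of_real (ln x)))"
        unfolding exp_of_real[symmetric] exp_add[symmetric] using x
        by (intro arg_cong[where f = exp]) (simp add: ln_div field_simps)
      finally show "omega * cnj (mel (1 - cnj s) x) = (1 / x\<^sup>2) *\<^sub>R mel s (1 / x)"
        by (simp add: mel_def exp_cnj mult_ac)
    qed
  qed
  ultimately show ?thesis by (rule has_integral_unique)
qed

text \<open>Riemann's Mellin transform of the theta function, split at \<open>1\<close>. It is entire by construction, whereas the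
  product with the Gamma factor has removable singularities.\<close>

definition Xi :: "complex \<Rightarrow> complex" where
  "Xi s = J s + omega * cnj (J (1 - cnj s))"

lemma cnj_cnj_holomorphic:
  assumes "g holomorphic_on UNIV" shows "(\<lambda>s. cnj (g (1 - cnj s))) holomorphic_on UNIV"
proof -
  have "(\<lambda>s. cnj (g (cnj s))) holomorphic_on UNIV"
    using holomorphic_on_compose_cnj_cnj[of g UNIV] assms by (simp add: o_def surj_def) (metis complex_cnj_cnj surj_def)
  from holomorphic_on_compose_gen[OF _ this, of "\<lambda>s. 1 - s" UNIV]
  show ?thesis by (simp add: o_def holomorphic_intros)
qed

lemma Xi_holomorphic: "Xi holomorphic_on S"
proof -
  have "Xi holomorphic_on UNIV"
    unfolding Xi_def[abs_def] by (intro holomorphic_intros J_holomorphic cnj_cnj_holomorphic)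
  then show ?thesis using holomorphic_on_subset by blast
qed

lemma Xi_eq_dseries:
  assumes s: "Re s > 1"
  shows "Xi s = of_real (pi / real N) powr (- ((s + of_nat \<kappa>) / 2)) * Gamma ((s + of_nat \<kappa>) / 2) * dseries f s"
proof (rule LIMSEQ_unique[OF _ mellin_limit[OF s]])
  have "integral {1 / (real n + 1)..real n + 1} (mel s) = Jn n s + omega * cnj (Jn n (1 - cnj s))" for n
  proof -
    have p: "0 < 1 / (real n + 1)" "1 / (real n + 1) \<le> 1" by auto
    have "{1 / (real n + 1)..real n + 1} \<subseteq> {0<..}" using p(1) by (meson atLeastAtMost_iff greaterThan_iff less_le_trans subsetI)
    then have "integral {1 / (real n + 1)..1} (mel s) + integral {1..real n + 1} (mel s) = integral {1 / (real n + 1)..real n + 1} (mel s)"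
      using p(2) by (intro Henstock_Kurzweil_Integration.integral_combine integrable_continuous_real mel_continuous) auto
    then have "integral {1 / (real n + 1)..real n + 1} (mel s) = integral {1 / (real n + 1)..1} (mel s) + Jn n s"
      by (simp only: Jn_def)
    also have "integral {1 / (real n + 1)..1} (mel s) = omega * cnj (Jn n (1 - cnj s))"
      unfolding Jn_def by (rule mel_reflect) simp
    finally show ?thesis by (simp only: add.commute)
  qed
  then show "(\<lambda>n. integral {1 / (real n + 1)..real n + 1} (mel s)) \<longlonglongrightarrow> Xi s"
    unfolding Xi_def by (auto intro!: tendsto_intros Jn_limit)
qed

lemma Xi_nonzero_right: "Re s > 1 \<Longrightarrow> Xi s \<noteq> 0"
proof -
  assume s: "Re s > 1"
  have "(s + of_nat \<kappa>) / 2 \<notin> \<int>\<^sub>\<le>\<^sub>0"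
  proof
    assume "(s + of_nat \<kappa>) / 2 \<in> \<int>\<^sub>\<le>\<^sub>0"
    then obtain n where n: "(s + of_nat \<kappa>) / 2 = - of_nat n" by (auto elim!: nonpos_Ints_cases')
    then have "Re ((s + of_nat \<kappa>) / 2) = - real n" by simp
    then show False using s by simp
  qed
  then show ?thesis using s dseries_f_nonzero[of s] N_pos by (simp add: Xi_eq_dseries Gamma_eq_zero_iff)
qed

text \<open>Two applications of the functional equation give (|omega|^2 - 1) theta = 0. If theta
  vanished identically, its Mellin transform would give Xi(2) = 0, contradicting the Euler
  product.\<close>

lemma norm_omega: "norm omega = 1"
proof (rule ccontr)
  assume no: "norm omega \<noteq> 1"
  have "theta y = 0" if y: "y > 0" for y
  proof -
    have "theta y = omega * of_real (y powr (- real \<kappa> - 1 / 2)) * cnj (omega * of_real ((1 / y) powr (- real \<kappa> - 1 / 2)) * cnj (theta y))"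
      using theta_functional[OF y] theta_functional[of "1 / y"] y by simp
    also have "\<dots> = (omega * cnj omega) * of_real (y powr (- real \<kappa> - 1 / 2) * (1 / y) powr (- real \<kappa> - 1 / 2)) * theta y" by simp
    also have "y powr (- real \<kappa> - 1 / 2) * (1 / y) powr (- real \<kappa> - 1 / 2) = 1"
      using y by (simp flip: powr_mult)
    finally have "(omega * cnj omega - 1) * theta y = 0" by (simp add: algebra_simps)
    moreover have "omega * cnj omega \<noteq> 1"
    proof
      assume "omega * cnj omega = 1"
      then have "complex_of_real ((norm omega)\<^sup>2) = of_real 1" by (simp only: complex_norm_square of_real_1)
      then have "(norm omega)\<^sup>2 = 1" unfolding of_real_eq_iff .
      then show False using no power2_eq_1_iff[of "norm omega"] norm_ge_zero[of omega] by auto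
    qed
    ultimately show ?thesis by simp
  qed
  then have "mel 2 y = 0" if "y > 0" for y using that by (simp add: mel_def)
  then have "(\<lambda>y. indicator {0<..} y *\<^sub>R mel 2 y) = (\<lambda>y. 0)" by (auto simp: indicator_def fun_eq_iff)
  then have "Xi 2 = 0"
    using mellin[of 2] unfolding Xi_eq_dseries[of 2, simplified] by (simp add: has_bochner_integral_iff)
  then show False using Xi_nonzero_right[of 2] by simp
qed

lemma Xi_functional: "cnj (Xi (1 - cnj s)) = cnj omega * Xi s"
proof -
  have "cnj omega * omega = 1" using norm_omega complex_norm_square[of omega] by (simp add: mult.commute)
  then have "cnj omega * (omega * z) = z" for z by (simp flip: mult.assoc)
  then show ?thesis by (simp add: Xi_def algebra_simps)
qed

end

section \<open>Identification with the L-function and the completion of the statement\<close>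

context prim_char
begin

text \<open>The continuation of L, read off from the completion. As \<open>rGamma\<close> is entire,
  the division by the Gamma factor is a product and the trivial zeros appear by themselves.\<close>

definition Lf :: "complex \<Rightarrow> complex" where
  "Lf s = Xi s * of_real (pi / real N) powr ((s + of_nat \<kappa>) / 2) * rGamma ((s + of_nat \<kappa>) / 2)"

lemma pi_N: "complex_of_real (pi / real N) \<noteq> 0" using N_pos by simp

lemma Lf_holomorphic: "Lf holomorphic_on S"
  unfolding Lf_def[abs_def] using pi_N by (intro holomorphic_intros Xi_holomorphic) auto

lemma not_nonpos_Int: "Re z > 0 \<Longrightarrow> z \<notin> \<int>\<^sub>\<le>\<^sub>0"
  by (auto elim!: nonpos_Ints_cases')

lemma Lf_eq_dseries_right:
  assumes "Re s > 1" shows "Lf s = dseries f s"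
proof -
  have "(s + of_nat \<kappa>) / 2 \<notin> \<int>\<^sub>\<le>\<^sub>0" using assms by (intro not_nonpos_Int) auto
  then have "Gamma ((s + of_nat \<kappa>) / 2) * rGamma ((s + of_nat \<kappa>) / 2) = 1"
    by (simp add: rGamma_inverse_Gamma Gamma_eq_zero_iff)
  moreover have "of_real (pi / real N) powr (- ((s + of_nat \<kappa>) / 2)) * of_real (pi / real N) powr ((s + of_nat \<kappa>) / 2) = (1::complex)"
    using pi_N by (simp flip: powr_add)
  moreover have "Lf s = (of_real (pi / real N) powr (- ((s + of_nat \<kappa>) / 2)) * of_real (pi / real N) powr ((s + of_nat \<kappa>) / 2))
       * (Gamma ((s + of_nat \<kappa>) / 2) * rGamma ((s + of_nat \<kappa>) / 2)) * dseries f s"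
    unfolding Lf_def Xi_eq_dseries[OF assms] by (simp only: mult_ac)
  ultimately show ?thesis by simp
qed

lemma Lf_eq_dseries: "Re s > 0 \<Longrightarrow> Lf s = dseries f s"
  by (rule analytic_continuation_open[of "{s. Re s > 1}" "{s. Re s > 0}" Lf "dseries f"])
     (auto simp: open_halfspace_Re_gt convex_connected convex_halfspace_Re_gt Lf_eq_dseries_right
           intro!: Lf_holomorphic dseries_f_holomorphic exI[of _ "2::complex"])

lemma dirichlet_L_eq: "dirichlet_L chi = Lf"
  unfolding dirichlet_L_def
proof (rule the_equality)
  have sums: "(\<lambda>n. chi (int (Suc n)) / of_nat (Suc n) powr s) sums dseries f s" if "Re s > 1" for s
  proof -
    have "(\<lambda>n. f n * of_nat n powr (-s)) sums (dseries f s + f 0 * of_nat 0 powr (-s))"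
      using dseries_sums[OF cm.conv_f that] by simp
    then have "(\<lambda>n. f (Suc n) * of_nat (Suc n) powr (-s)) sums dseries f s"
      by (subst sums_Suc_iff) simp
    then show ?thesis by (simp add: f_def powr_minus divide_inverse)
  qed
  then show "Lf holomorphic_on UNIV \<and> (\<forall>s. 1 < Re s \<longrightarrow> (\<lambda>n. chi (int (Suc n)) / of_nat (Suc n) powr s) sums Lf s)"
    using Lf_holomorphic Lf_eq_dseries_right by auto
  fix g assume g: "g holomorphic_on UNIV \<and> (\<forall>s. 1 < Re s \<longrightarrow> (\<lambda>n. chi (int (Suc n)) / of_nat (Suc n) powr s) sums g s)"
  show "g = Lf"
  proof
    fix s
    show "g s = Lf s"
    proof (rule analytic_continuation_open[of "{s. Re s > 1}" UNIV g Lf])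
      fix z assume "z \<in> {s. Re s > 1}"
      then have z: "Re z > 1" by simp
      then show "g z = Lf z" using g sums[OF z] sums_unique2 Lf_eq_dseries_right[OF z] by metis
    qed (use g in \<open>auto intro!: Lf_holomorphic open_halfspace_Re_gt exI[of _ "2::complex"]\<close>)
  qed
qed

text \<open>The nonpositive integers are discrete, so some punctured neighbourhood of z contains no
  pole of the Gamma factor. There the product equals \<open>Xi\<close>, and
  \<open>remove_sings\<close> returns the limit at z.\<close>

lemma xi_eq: "xi N chi = Xi"
proof
  fix z
  let ?w = "\<lambda>s. (s + of_nat \<kappa>) / 2 :: complex"
  let ?F = "\<lambda>s. of_real (pi / real N) powr (- (s + of_nat (kappa chi)) / 2) * Gamma ((s + of_nat (kappa chi)) / 2) * dirichlet_L chi s"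
  have eq: "?F s = Xi s" if "?w s \<notin> \<int>\<^sub>\<le>\<^sub>0" for s
  proof -
    have 1: "Gamma (?w s) * rGamma (?w s) = 1"
      using that by (simp add: rGamma_inverse_Gamma Gamma_eq_zero_iff)
    have 2: "of_real (pi / real N) powr (- (s + of_nat \<kappa>) / 2) * of_real (pi / real N) powr (?w s) = (1::complex)"
      unfolding minus_divide_left[symmetric] powr_minus using pi_N by (intro left_inverse) simp
    have "?F s = Xi s * (of_real (pi / real N) powr (- (s + of_nat \<kappa>) / 2) * of_real (pi / real N) powr (?w s)) * (Gamma (?w s) * rGamma (?w s))"
      unfolding dirichlet_L_eq Lf_def by (simp only: mult_ac)
    then show ?thesis unfolding 1 2 by simp
  qed
  have "closed (\<int>\<^sub>\<le>\<^sub>0 - {?w z})"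
    by (rule closed_subset_Ints) (auto simp: nonpos_Ints_subset_Ints[THEN subsetD])
  then have "open (- (\<int>\<^sub>\<le>\<^sub>0 - {?w z}))" by (rule open_Compl)
  then have "open (?w -` (- (\<int>\<^sub>\<le>\<^sub>0 - {?w z})))"
    by (rule open_vimage) (intro continuous_intros, simp)
  then have "\<forall>\<^sub>F s in nhds z. s \<in> ?w -` (- (\<int>\<^sub>\<le>\<^sub>0 - {?w z}))"
    by (rule eventually_nhds_in_open) auto
  then have ev: "\<forall>\<^sub>F s in at z. Xi s = ?F s"
    unfolding eventually_at_filter
  proof eventually_elim
    case (elim s)
    show ?case
    proof (intro impI)
      assume "s \<noteq> z"
      then have "?w s \<notin> \<int>\<^sub>\<le>\<^sub>0" using elim by auto
      from eq[OF this] show "Xi s = ?F s" by (rule sym)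
    qed
  qed
  have "Xi \<midarrow>z\<rightarrow> Xi z"
    using Xi_holomorphic[of UNIV] holomorphic_on_imp_continuous_on continuous_on_eq_continuous_at[OF open_UNIV]
    by (auto simp: isCont_def)
  from Lim_transform_eventually[OF this ev] show "xi N chi z = Xi z" unfolding xi_def by (rule remove_sings_eqI)
qed

end

section \<open>Digamma and quotients of Gamma values\<close>

lemma Ln_step_bound:
  assumes u: "Re u > 0"
  shows "norm (Ln (u + 1) - Ln u - inverse u) \<le> 1 / (norm u)\<^sup>2"
proof -
  let ?S = "closed_segment u (u + 1)"
  have S: "Re v > 0 \<and> norm u \<le> norm v \<and> norm (v - u) \<le> 1" if "v \<in> ?S" for v
  proof -
    obtain t where t: "0 \<le> t" "t \<le> 1" "v = (1 - t) *\<^sub>R u + t *\<^sub>R (u + 1)" using \<open>v \<in> ?S\<close> by (auto simp: closed_segment_def)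
    then have v: "v = u + of_real t" by (simp add: scaleR_conv_of_real algebra_simps)
    have "(Re u)\<^sup>2 \<le> (Re u + t)\<^sup>2" using u t by (intro power_mono) auto
    then show ?thesis using u t(1,2) by (auto simp: v cmod_def)
  qed
  have u0: "u \<noteq> 0" using u by auto
  have "norm ((Ln (u + 1) - (u + 1) / u) - (Ln u - u / u)) \<le> 1 / (norm u)\<^sup>2 * norm (u + 1 - u)"
  proof (rule field_differentiable_bound[of ?S "\<lambda>v. Ln v - v / u" "\<lambda>v. inverse v - 1 / u"])
    fix v assume v: "v \<in> ?S"
    then have "Re v > 0" using S by blast
    then have "v \<notin> \<real>\<^sub>\<le>\<^sub>0" and v0: "v \<noteq> 0" by (auto simp: complex_nonpos_Reals_iff)
    then show "((\<lambda>v. Ln v - v / u) has_field_derivative inverse v - 1 / u) (at v within ?S)"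
      using u0 by (auto intro!: derivative_eq_intros simp: divide_inverse)
    have "norm (inverse v - 1 / u) = norm (v - u) / (norm u * norm v)"
      using u0 v0 by (simp add: field_simps norm_mult norm_divide norm_inverse norm_minus_commute flip: norm_mult)
    also have "\<dots> \<le> 1 / (norm u * norm u)"
      using S[OF v] u0 by (intro frac_le mult_left_mono) auto
    finally show "norm (inverse v - 1 / u) \<le> 1 / (norm u)\<^sup>2" by (simp add: power2_eq_square)
  qed auto
  moreover have "(Ln (u + 1) - (u + 1) / u) - (Ln u - u / u) = Ln (u + 1) - Ln u - inverse u"
    using u0 by (simp add: add_divide_distrib inverse_eq_divide)
  ultimately show ?thesis by (simp only:) simp
qed

text \<open>Digamma z is the limit of ln m minus the sum of 1/(z + n), and Ln (z + m) - Ln z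
  telescopes over the same range with errors at most 1/|z + n|^2. The bound 1/4 is the least real
  part of (s + \<kappa>)/2 for Re s >= 1/2; it gives |z + n| >= (n + 1)/4, hence the factor
  16.\<close>

lemma Digamma_minus_Ln_bounded:
  "\<exists>C. \<forall>z. Re z \<ge> 1 / 4 \<longrightarrow> norm (Digamma z - Ln z) \<le> C"
proof -
  define C where "C = (\<Sum>n. 16 * inverse (real (Suc n) ^ 2))"
  have "summable (\<lambda>n. inverse (real (Suc n) ^ 2))" using inverse_power_summable[of 2, where ?'a = real]
    by (subst summable_Suc_iff) simp
  then have sC: "summable (\<lambda>n. 16 * inverse (real (Suc n) ^ 2))" by (rule summable_mult)
  have "norm (Digamma z - Ln z) \<le> C" if z: "Re z \<ge> 1 / 4" for z
  proof -
    have z0: "z \<noteq> 0" using z by auto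
    have b: "norm (Ln (z + of_nat m) - Ln z - (\<Sum>n<m. inverse (z + of_nat n))) \<le> (\<Sum>n<m. 16 * inverse (real (Suc n) ^ 2))" for m
    proof (induction m)
      case (Suc m)
      have "norm (Ln (z + of_nat m + 1) - Ln (z + of_nat m) - inverse (z + of_nat m)) \<le> 1 / (norm (z + of_nat m))\<^sup>2"
        using z by (intro Ln_step_bound) auto
      also have "\<dots> \<le> 16 * inverse (real (Suc m) ^ 2)"
      proof -
        have "real (Suc m) / 4 \<le> Re (z + of_nat m)" using z by simp
        also have "\<dots> \<le> norm (z + of_nat m)" by (rule complex_Re_le_cmod)
        finally have "(real (Suc m) / 4)\<^sup>2 \<le> (norm (z + of_nat m))\<^sup>2" by (intro power_mono) auto
        then have "1 / (norm (z + of_nat m))\<^sup>2 \<le> 1 / (real (Suc m) / 4)\<^sup>2"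
          by (intro frac_le) auto
        moreover have "1 / (x / 4)\<^sup>2 = 16 / x\<^sup>2" for x :: real by (simp add: power_divide)
        ultimately show ?thesis unfolding divide_inverse[of 16, symmetric] by (simp only:)
      qed
      finally have 1: "norm (Ln (z + of_nat m + 1) - Ln (z + of_nat m) - inverse (z + of_nat m)) \<le> 16 * inverse (real (Suc m) ^ 2)" .
      have "Ln (z + of_nat (Suc m)) - Ln z - (\<Sum>n<Suc m. inverse (z + of_nat n))
         = (Ln (z + of_nat m) - Ln z - (\<Sum>n<m. inverse (z + of_nat n))) + (Ln (z + of_nat m + 1) - Ln (z + of_nat m) - inverse (z + of_nat m))"
        by (simp add: algebra_simps)
      then have "norm (Ln (z + of_nat (Suc m)) - Ln z - (\<Sum>n<Suc m. inverse (z + of_nat n)))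
         \<le> norm (Ln (z + of_nat m) - Ln z - (\<Sum>n<m. inverse (z + of_nat n))) + norm (Ln (z + of_nat m + 1) - Ln (z + of_nat m) - inverse (z + of_nat m))"
        by (metis norm_triangle_ineq)
      then show ?case using Suc 1 by simp
    qed simp
    have b': "norm (Ln (z + of_nat m) - Ln z - (\<Sum>n<m. inverse (z + of_nat n))) \<le> C" for m
      using b[of m] sum_le_suminf[OF sC, of "{..<m}"] unfolding C_def by force
    have "(\<lambda>m. Ln (1 + z / of_nat m)) \<longlonglongrightarrow> Ln (1 + 0)"
      by (intro tendsto_intros lim_const_over_n) auto
    then have l1: "(\<lambda>m. Ln (1 + z / of_nat m)) \<longlonglongrightarrow> 0" by simp
    have l2: "(\<lambda>m. of_real (ln (real m)) - (\<Sum>n<m. inverse (z + of_nat n))) \<longlonglongrightarrow> Digamma z"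
      using Digamma_LIMSEQ[OF z0] by simp
    have "(\<lambda>m. norm (Ln (1 + z / of_nat m) + (of_real (ln (real m)) - (\<Sum>n<m. inverse (z + of_nat n))) - Ln z)) \<longlonglongrightarrow> norm (0 + Digamma z - Ln z)"
      by (intro tendsto_intros l1 l2)
    moreover have "\<forall>\<^sub>F m in sequentially. norm (Ln (1 + z / of_nat m) + (of_real (ln (real m)) - (\<Sum>n<m. inverse (z + of_nat n))) - Ln z) \<le> C"
      using eventually_gt_at_top[of 0]
    proof eventually_elim
      case (elim m)
      have "Re (1 + z / of_nat m) > 0" using elim z by (simp add: Re_divide_of_nat add_pos_nonneg)
      then have nz: "1 + z / of_nat m \<noteq> 0" by (metis less_irrefl zero_complex.sel(1))
      have "z + of_nat m = of_nat m * (1 + z / of_nat m)" using elim by (simp add: field_simps)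
      also have "Ln \<dots> = Ln (of_nat m) + Ln (1 + z / of_nat m)" by (rule Ln_times_of_nat[OF elim nz])
      also have "Ln (of_nat m) = of_real (ln (real m))" using elim Ln_of_real[of "real m"] by simp
      finally have "Ln (z + of_nat m) = of_real (ln (real m)) + Ln (1 + z / of_nat m)" .
      then show ?case using b'[of m] by (simp add: algebra_simps)
    qed
    ultimately have "norm (0 + Digamma z - Ln z) \<le> C" by (rule tendsto_upperbound) auto
    then show ?thesis by simp
  qed
  then show ?thesis by blast
qed

lemma Re_Digamma_bound:
  "\<exists>C\<ge>0. \<forall>z. Re z \<ge> 1 / 4 \<longrightarrow> \<bar>Re (Digamma z) - ln (norm z)\<bar> \<le> C"
proof -
  obtain C where C: "\<And>z. Re z \<ge> 1 / 4 \<Longrightarrow> norm (Digamma z - Ln z) \<le> C"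
    using Digamma_minus_Ln_bounded by blast
  have "\<bar>Re (Digamma z) - ln (norm z)\<bar> \<le> C" if "Re z \<ge> 1 / 4" for z
  proof -
    have "z \<noteq> 0" using that by auto
    then have "Re (Digamma z - Ln z) = Re (Digamma z) - ln (norm z)" by simp
    then show ?thesis using C[OF that] abs_Re_le_cmod[of "Digamma z - Ln z"] by simp
  qed
  moreover have "C \<ge> 0" using order_trans[OF norm_ge_zero C[of 1]] by simp
  ultimately show ?thesis by blast
qed

text \<open>The derivative of ln |Gamma| in the real part is Re Digamma, which is at least ln |z| -
  C, and |z| grows to the right; so the mean value theorem applies with |z| taken at the left
  end.\<close>

lemma Gamma_ratio_bound:
  "\<exists>C\<ge>0. \<forall>x1 x2 y. 1 / 4 \<le> x1 \<longrightarrow> x1 \<le> x2 \<longrightarrow>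
     norm (Gamma (Complex x1 y)) \<le> norm (Gamma (Complex x2 y)) * exp ((x2 - x1) * (C - ln (norm (Complex x1 y))))"
proof -
  obtain C where C: "C \<ge> 0" "\<And>z. Re z \<ge> 1 / 4 \<Longrightarrow> \<bar>Re (Digamma z) - ln (norm z)\<bar> \<le> C"
    using Re_Digamma_bound by blast
  have "norm (Gamma (Complex x1 y)) \<le> norm (Gamma (Complex x2 y)) * exp ((x2 - x1) * (C - ln (norm (Complex x1 y))))"
    if x: "1 / 4 \<le> x1" "x1 \<le> x2" for x1 x2 y
  proof (cases "x1 = x2")
    case False
    then have lt: "x1 < x2" using x by simp
    define q where "q x = Re (ln_Gamma (of_real x + \<i> * of_real y))" for x
    have Cx: "Complex x y = of_real x + \<i> * of_real y" for x by (simp add: complex_eq_iff)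
    have gq: "norm (Gamma (Complex x y)) = exp (q x)" if "x \<ge> 1/4" for x
    proof -
      have "Complex x y \<notin> \<int>\<^sub>\<le>\<^sub>0" using that by (auto elim!: nonpos_Ints_cases' simp: complex_eq_iff)
      then have "Gamma (Complex x y) = exp (ln_Gamma (Complex x y))" by (simp add: Gamma_complex_altdef)
      then show ?thesis by (simp add: q_def Cx)
    qed
    have "\<exists>z. x1 < z \<and> z < x2 \<and> q x2 - q x1 = (x2 - x1) * Re (Digamma (of_real z + \<i> * of_real y))"
    proof (rule MVT2[OF lt])
      fix x assume xx: "x1 \<le> x" "x \<le> x2"
      have "of_real x + \<i> * of_real y \<notin> \<real>\<^sub>\<le>\<^sub>0" using xx x by (auto simp: complex_nonpos_Reals_iff)
      then have 1: "(ln_Gamma has_field_derivative Digamma (of_real x + \<i> * of_real y)) (at (of_real x + \<i> * of_real y))"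
        by (rule has_field_derivative_ln_Gamma_complex)
      have "((\<lambda>w. w + \<i> * of_real y) has_field_derivative 1) (at (of_real x))" by (auto intro!: derivative_eq_intros)
      from DERIV_chain2[OF 1 this]
      have "((\<lambda>w. ln_Gamma (w + \<i> * of_real y)) has_field_derivative Digamma (of_real x + \<i> * of_real y)) (at (of_real x))" by simp
      from has_vector_derivative_real_field[OF this]
      have "((\<lambda>x. ln_Gamma (of_real x + \<i> * of_real y)) has_vector_derivative Digamma (of_real x + \<i> * of_real y)) (at x)" .
      from bounded_linear.has_vector_derivative[OF bounded_linear_Re this]
      show "(q has_real_derivative Re (Digamma (of_real x + \<i> * of_real y))) (at x)"
        unfolding q_def has_real_derivative_iff_has_vector_derivative .
    qed
    then obtain z where z: "x1 < z" "z < x2" "q x2 - q x1 = (x2 - x1) * Re (Digamma (Complex z y))" by (auto simp: Cx)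
    have "x1\<^sup>2 \<le> z\<^sup>2" using z x by (intro power_mono) auto
    then have "norm (Complex x1 y) \<le> norm (Complex z y)" by (simp add: cmod_def)
    moreover have "norm (Complex x1 y) > 0" using x by (simp add: complex_eq_iff)
    ultimately have "ln (norm (Complex x1 y)) \<le> ln (norm (Complex z y))" by (intro ln_mono)
    moreover have "ln (norm (Complex z y)) - C \<le> Re (Digamma (Complex z y))" using C(2)[of "Complex z y"] z x by simp
    ultimately have "(x2 - x1) * (ln (norm (Complex x1 y)) - C) \<le> q x2 - q x1"
      unfolding z(3) using lt by (intro mult_left_mono) auto
    then have "q x1 \<le> q x2 + (x2 - x1) * (C - ln (norm (Complex x1 y)))" by (simp add: algebra_simps)
    then have "exp (q x1) \<le> exp (q x2 + (x2 - x1) * (C - ln (norm (Complex x1 y))))" by simp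
    then show ?thesis using gq x by (simp add: exp_add)
  qed simp
  then show ?thesis using C(1) by blast
qed

section \<open>Comparison of the completion across the critical line\<close>

text \<open>Divide by (1 + e s)^(m + 1): in the half-plane its modulus is at least 1 and at least
  that of (e s)^(m + 1), so it beats the growth on large half-discs. The maximum principle gives the
  bound with this factor, and e tends to 0.\<close>

lemma phragmen_lindelof_halfplane:
  assumes cont: "continuous_on {s. Re s \<ge> 0} Q" and hol: "Q holomorphic_on {s. Re s > 0}"
    and line: "\<And>s. Re s = 0 \<Longrightarrow> norm (Q s) \<le> 1"
    and growth: "\<And>s. Re s \<ge> 0 \<Longrightarrow> norm (Q s) \<le> A * (1 + norm s) ^ m"
    and s: "Re s \<ge> 0"
  shows "norm (Q s) \<le> 1"
proof -
  have A0: "A \<ge> 0" using growth[of 0] by (simp add: order_trans[OF norm_ge_zero])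
  have main: "norm (Q s) \<le> norm (1 + of_real e * s) ^ Suc m" if e: "e > 0" and s0: "Re s > 0" for e :: real
  proof -
    define g where "g w = Q w / (1 + of_real e * w) ^ Suc m" for w
    have n1: "norm (1 + of_real e * w) \<ge> 1" if "Re w \<ge> 0" for w
    proof -
      have "1 \<le> Re (1 + of_real e * w)" using e that by simp
      also have "\<dots> \<le> norm (1 + of_real e * w)" by (rule complex_Re_le_cmod)
      finally show ?thesis .
    qed
    have nz: "1 + of_real e * w \<noteq> 0" if "Re w \<ge> 0" for w using n1[OF that] by auto
    have n2: "norm (1 + of_real e * w) \<ge> e * norm w" if "Re w \<ge> 0" for w
    proof -
      have "(e * norm w)\<^sup>2 = (e * Re w)\<^sup>2 + (e * Im w)\<^sup>2" by (simp add: cmod_def power_mult_distrib algebra_simps)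
      also have "\<dots> \<le> (1 + e * Re w)\<^sup>2 + (e * Im w)\<^sup>2"
        using e that by (intro add_right_mono power_mono) auto
      also have "\<dots> = (norm (1 + of_real e * w))\<^sup>2" by (simp add: cmod_def)
      finally show ?thesis by (rule power2_le_imp_le) simp
    qed
    have "((\<lambda>R. A * (1 + R) ^ m / (e * R) ^ Suc m) \<longlongrightarrow> 0) at_top"
    proof (rule Lim_null_comparison)
      show "\<forall>\<^sub>F R in at_top. norm (A * (1 + R) ^ m / (e * R) ^ Suc m) \<le> A * 2 ^ m / e ^ Suc m * (1 / R)"
        using eventually_ge_at_top[of 1]
      proof eventually_elim
        case (elim R)
        have "A * (1 + R) ^ m \<le> A * (2 * R) ^ m" using elim A0 by (intro mult_left_mono power_mono) auto
        then have "A * (1 + R) ^ m / (e * R) ^ Suc m \<le> A * (2 * R) ^ m / (e * R) ^ Suc m"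
          using e elim by (intro divide_right_mono) auto
        also have "\<dots> = A * 2 ^ m / e ^ Suc m * (1 / R)" using e elim by (simp add: power_mult_distrib field_simps)
        finally show ?case using A0 e elim by simp
      qed
      show "((\<lambda>R. A * 2 ^ m / e ^ Suc m * (1 / R)) \<longlongrightarrow> 0) at_top" by real_asymp
    qed
    then have "\<forall>\<^sub>F R in at_top. A * (1 + R) ^ m / (e * R) ^ Suc m < 1" by (rule order_tendstoD) simp
    then have "\<forall>\<^sub>F R in at_top. A * (1 + R) ^ m / (e * R) ^ Suc m < 1 \<and> R > norm s \<and> R > 0"
      using eventually_gt_at_top[of "norm s"] eventually_gt_at_top[of 0] by eventually_elim auto
    then obtain R where R: "A * (1 + R) ^ m / (e * R) ^ Suc m < 1" "R > norm s" "R > 0"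
      using eventually_happens'[OF trivial_limit_at_top_linorder, of "\<lambda>R. A * (1 + R) ^ m / (e * R) ^ Suc m < 1 \<and> R > norm s \<and> R > 0"] by blast
    define S where "S = {s. Re s > 0} \<inter> ball 0 R"
    have opS: "open S" unfolding S_def by (intro open_Int open_halfspace_Re_gt open_ball)
    have "closed ({s. Re s \<ge> 0} \<inter> cball 0 R)" by (intro closed_Int closed_halfspace_Re_ge closed_cball)
    then have clS: "closure S \<subseteq> {s. Re s \<ge> 0} \<inter> cball 0 R"
      by (intro closure_minimal) (auto simp: S_def)
    have "norm (g s) \<le> 1"
    proof (rule maximum_modulus_frontier[of g S])
      have "g holomorphic_on S" unfolding g_def
        by (intro holomorphic_intros holomorphic_on_subset[OF hol]) (use nz in \<open>auto simp: S_def\<close>)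
      then show "g holomorphic_on interior S" using interior_open[OF opS] by simp
      show "continuous_on (closure S) g" unfolding g_def
        by (intro continuous_intros continuous_on_subset[OF cont]) (use nz clS in auto)
      show "bounded S" unfolding S_def by (rule bounded_subset[OF bounded_ball]) auto
      show "s \<in> S" using s0 R by (simp add: S_def)
      fix w assume "w \<in> frontier S"
      then have w: "w \<in> closure S" "w \<notin> S" using opS by (auto simp: frontier_def interior_open)
      then have w1: "Re w \<ge> 0" "norm w \<le> R" using clS by auto
      show "norm (g w) \<le> 1"
      proof (cases "Re w = 0")
        case True
        have "norm (Q w) \<le> 1" by (rule line[OF True])
        also have "1 \<le> norm (1 + of_real e * w) ^ Suc m" by (intro one_le_power n1 w1)
        finally show ?thesis using nz[OF w1(1)] by (simp add: g_def norm_divide norm_power norm_mult)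
      next
        case False
        then have nw: "norm w = R" using w w1 by (auto simp: S_def)
        have "(e * R) ^ Suc m \<le> norm (1 + of_real e * w) ^ Suc m"
          using n2[OF w1(1)] nw e R by (intro power_mono) auto
        then have "norm (g w) \<le> A * (1 + R) ^ m / (e * R) ^ Suc m"
          unfolding g_def norm_divide norm_power using growth[OF w1(1)] nw e R A0
          by (intro frac_le) auto
        then show ?thesis using R by simp
      qed
    qed
    then show ?thesis using nz[of s] s0 by (simp add: g_def norm_divide norm_power norm_mult divide_le_eq split: if_splits)
  qed
  show ?thesis
  proof (cases "Re s = 0")
    case False
    have "((\<lambda>e. norm (1 + of_real e * s) ^ Suc m) \<longlongrightarrow> norm (1 + of_real 0 * s) ^ Suc m) (at_right 0)"
      by (intro tendsto_intros)
    moreover have "\<forall>\<^sub>F e in at_right 0. norm (Q s) \<le> norm (1 + of_real e * s) ^ Suc m"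
      using main False s by (intro eventually_at_rightI[of 0 1]) auto
    ultimately have "norm (Q s) \<le> norm (1 + of_real 0 * s) ^ Suc m" by (rule tendsto_lowerbound) auto
    then show ?thesis by simp
  qed (rule line)
qed

text \<open>A local form of Hopf's lemma: a boundary zero of \<open>Q - Q(s0)\<close> of order at least two, or a derivative in any
  other direction, would make \<open>Q\<close> leave the unit disc inside the half-plane.\<close>

lemma boundary_derivative:
  assumes hol: "Q holomorphic_on ball s0 r" and r: "r > 0"
    and le: "\<And>s. s \<in> ball s0 r \<Longrightarrow> Re s \<ge> Re s0 \<Longrightarrow> norm (Q s) \<le> 1"
    and one: "norm (Q s0) = 1" and nc: "s1 \<in> ball s0 r" "norm (Q s1) < 1"
  shows "\<exists>c<0. deriv Q s0 = of_real c * Q s0"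
proof -
  have Q0: "Q s0 \<noteq> 0" using one by auto
  define g where "g s = Q s / Q s0 - 1" for s
  have gh: "g holomorphic_on ball s0 r" unfolding g_def by (intro holomorphic_intros hol Q0)
  have g0: "g s0 = 0" using Q0 by (simp add: g_def)
  have "\<not> g constant_on ball s0 r"
  proof
    assume "g constant_on ball s0 r"
    then have "g s1 = g s0" using nc(1) r by (auto simp: constant_on_def)
    then have "Q s1 = Q s0" using Q0 by (simp add: g_def)
    then show False using nc one by simp
  qed
  then obtain k e n where k: "0 < n" "0 < e" "ball s0 e \<subseteq> ball s0 r" "k holomorphic_on ball s0 e"
     "\<And>w. w \<in> ball s0 e \<Longrightarrow> g w = (w - s0) ^ n * k w" "\<And>w. w \<in> ball s0 e \<Longrightarrow> k w \<noteq> 0"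
    using holomorphic_factor_zero_nonconstant[OF gh open_ball connected_ball _ g0] r by (metis centre_in_ball)
  define c where "c = k s0"
  have c0: "c \<noteq> 0" using k(2,6) by (simp add: c_def)
  have contk: "isCont k s0"
    using k(2,4) holomorphic_on_imp_continuous_on continuous_on_eq_continuous_at[OF open_ball] centre_in_ball by blast
  \<comment> \<open>Along the ray of angle \<alpha> into the half-plane, the leading term of Q/Q(s0)
    - 1 is c x^n cis (n \<alpha>), and |Q| <= 1 makes its real part nonpositive.\<close>
  have dir: "Re (cis (real n * \<alpha>) * c) \<le> 0" if a: "\<bar>\<alpha>\<bar> < pi / 2" for \<alpha>
  proof -
    define u where "u x = s0 + of_real x * cis \<alpha>" for x :: real
    have "((\<lambda>x. Re (cis (real n * \<alpha>) * k (u x))) \<longlongrightarrow> Re (cis (real n * \<alpha>) * k s0)) (at_right 0)"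
    proof (intro tendsto_intros isCont_tendsto_compose[OF contk])
      have "(u \<longlongrightarrow> s0 + of_real 0 * cis \<alpha>) (at_right 0)" unfolding u_def by (intro tendsto_intros)
      then show "(u \<longlongrightarrow> s0) (at_right 0)" by simp
    qed
    moreover have "\<forall>\<^sub>F x in at_right 0. Re (cis (real n * \<alpha>) * k (u x)) \<le> 0"
    proof (rule eventually_at_rightI[of 0 e])
      fix x assume x: "x \<in> {0<..<e}"
      have ub: "u x \<in> ball s0 e" using x by (simp add: u_def dist_norm norm_mult)
      have "cos \<alpha> > 0" using a by (intro cos_gt_zero_pi) auto
      then have "Re (u x) \<ge> Re s0" using x by (simp add: u_def)
      then have "norm (Q (u x)) \<le> 1" using le ub k(3) by blast
      then have "norm (Q (u x) / Q s0) \<le> 1" using one by (simp add: norm_divide)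
      then have "Re (Q (u x) / Q s0) \<le> 1" using complex_Re_le_cmod order_trans by blast
      then have "Re (g (u x)) \<le> 0" by (simp add: g_def)
      also have "g (u x) = of_real (x ^ n) * (cis (real n * \<alpha>) * k (u x))"
      proof -
        have "u x - s0 = of_real x * cis \<alpha>" by (simp add: u_def)
        moreover have "cis \<alpha> ^ n = cis (real n * \<alpha>)" by (rule Complex.DeMoivre)
        ultimately show ?thesis unfolding k(5)[OF ub] by (simp add: power_mult_distrib)
      qed
      also have "Re (of_real (x ^ n) * (cis (real n * \<alpha>) * k (u x))) = x ^ n * Re (cis (real n * \<alpha>) * k (u x))"
        by (simp only: Re_complex_of_real Im_complex_of_real times_complex.sel mult_zero_left diff_zero)
      finally have "x ^ n * Re (cis (real n * \<alpha>) * k (u x)) \<le> 0" .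
      moreover have "x ^ n > 0" using x by simp
      ultimately show "Re (cis (real n * \<alpha>) * k (u x)) \<le> 0" by (metis mult_pos_pos not_le)
    qed (use k in auto)
    ultimately show ?thesis unfolding c_def by (rule tendsto_upperbound) auto
  qed
  define \<phi> where "\<phi> = Arg c"
  have \<phi>: "- pi < \<phi>" "\<phi> \<le> pi" unfolding \<phi>_def using mpi_less_Arg Arg_le_pi by auto
  have cc: "c = of_real (norm c) * cis \<phi>" using c0 rcis_cmod_Arg[of c] by (simp add: \<phi>_def rcis_def)
  have dir': "cos (real n * \<alpha> + \<phi>) \<le> 0" if a: "\<bar>\<alpha>\<bar> < pi / 2" for \<alpha>
  proof -
    have "Re (cis (real n * \<alpha>) * c) = norm c * cos (real n * \<alpha> + \<phi>)"
      by (subst cc) (simp add: cos_add algebra_simps)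
    then show ?thesis using dir[OF a] c0 by (simp add: mult_le_0_iff)
  qed
  \<comment> \<open>For any other argument some admissible ray gives a positive cosine: \<alpha> = -
    \<phi>/2 if n = 1, and \<alpha> = - \<phi>/n if n >= 2, where |\<phi>| < pi keeps it inside the
    half-plane.\<close>
  have phi: "\<phi> = pi"
  proof (rule ccontr)
    assume "\<phi> \<noteq> pi"
    then have lt: "\<bar>\<phi>\<bar> < pi" using \<phi> by auto
    show False
    proof (cases "n = 1")
      case True
      have "cos (\<phi> / 2) > 0" using lt by (intro cos_gt_zero_pi) auto
      then show False using dir'[of "- \<phi> / 2"] lt True by simp
    next
      case False
      then have n2: "real n \<ge> 2" using k(1) by linarith
      have "pi * 2 \<le> pi * real n" using n2 by (intro mult_left_mono) auto
      then have "\<bar>\<phi>\<bar> * 2 < pi * real n" using lt by linarith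
      then have "\<bar>- \<phi> / real n\<bar> < pi / 2" using k(1) by (simp add: field_simps abs_mult)
      from dir'[OF this] show False using k(1) by simp
    qed
  qed
  \<comment> \<open>For n >= 2 the ray with n \<alpha> = 3 pi / 4 is admissible, and the cosine of 3
    pi / 4 + pi is positive.\<close>
  have n1: "n = 1"
  proof (rule ccontr)
    assume "n \<noteq> 1"
    then have n2: "real n \<ge> 2" using k(1) by linarith
    have "3 * pi / 4 * 2 < pi * real n" using n2 mult_left_mono[of 2 "real n" pi] pi_gt_zero by (simp add: mult.commute)
    then have "\<bar>3 * pi / (4 * real n)\<bar> < pi / 2" using k(1) by (simp add: field_simps)
    from dir'[OF this] have "cos (3 * pi / 4 + pi) \<le> 0" using k(1) phi by simp
    then have "- cos (3 * pi / 4) \<le> 0" unfolding cos_periodic_pi .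
    moreover have "cos (3 * pi / 4) = - cos (pi / 4)"
    proof -
      have "3 * pi / 4 = pi - pi / 4" by simp
      then show ?thesis by (simp only: cos_pi_minus)
    qed
    moreover have "cos (pi / 4) > 0" by (simp add: cos_45)
    ultimately show False by linarith
  qed
  have "deriv Q s0 = c * Q s0"
  proof (rule DERIV_imp_deriv)
    have kd: "(k has_field_derivative deriv k s0) (at s0)"
      using k(2,4) by (intro holomorphic_derivI[OF _ open_ball]) auto
    have "((\<lambda>w. Q s0 * (1 + (w - s0) * k w)) has_field_derivative c * Q s0) (at s0)"
      by (auto intro!: derivative_eq_intros kd simp: c_def)
    then show "(Q has_field_derivative c * Q s0) (at s0)"
    proof (rule has_field_derivative_transform_within_open[OF _ open_ball[of s0 e]])
      fix w assume "w \<in> ball s0 e"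
      from k(5)[OF this] show "Q s0 * (1 + (w - s0) * k w) = Q w" using Q0 n1 by (simp add: g_def field_simps)
    qed (use k in auto)
  qed
  moreover have "c = of_real (- norm c)" using cc phi by (metis cis_pi mult_minus1_right of_real_minus)
  ultimately show ?thesis using c0 by (intro exI[of _ "- norm c"]) auto
qed

context prim_char
begin

lemma norm_Xi_reflect: "norm (Xi (1 - cnj s)) = norm (Xi s)"
proof -
  have "norm (cnj (Xi (1 - cnj s))) = norm (cnj omega * Xi s)" by (simp only: Xi_functional)
  then show ?thesis by (simp add: norm_mult norm_omega)
qed

lemma Xi_eq:
  assumes "Re s > 0"
  shows "Xi s = of_real (pi / real N) powr (- ((s + of_nat \<kappa>) / 2)) * Gamma ((s + of_nat \<kappa>) / 2) * dseries f s"
proof -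
  have "(s + of_nat \<kappa>) / 2 \<notin> \<int>\<^sub>\<le>\<^sub>0" using assms by (intro not_nonpos_Int) auto
  then have 1: "Gamma ((s + of_nat \<kappa>) / 2) * rGamma ((s + of_nat \<kappa>) / 2) = 1"
    by (simp add: rGamma_inverse_Gamma Gamma_eq_zero_iff)
  have 2: "of_real (pi / real N) powr (- ((s + of_nat \<kappa>) / 2)) * of_real (pi / real N) powr ((s + of_nat \<kappa>) / 2) = (1::complex)"
    unfolding powr_minus using pi_N by (intro left_inverse) simp
  have "of_real (pi / real N) powr (- ((s + of_nat \<kappa>) / 2)) * Gamma ((s + of_nat \<kappa>) / 2) * dseries f s
     = Xi s * (of_real (pi / real N) powr (- ((s + of_nat \<kappa>) / 2)) * of_real (pi / real N) powr ((s + of_nat \<kappa>) / 2))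
       * (Gamma ((s + of_nat \<kappa>) / 2) * rGamma ((s + of_nat \<kappa>) / 2))"
    unfolding Lf_eq_dseries[OF assms, symmetric] Lf_def by (simp only: mult_ac)
  then show ?thesis unfolding 1 2 by simp
qed

lemma norm_Xi:
  assumes "Re s > 0"
  shows "norm (Xi s) = (pi / real N) powr (- ((Re s + real \<kappa>) / 2)) * norm (Gamma ((s + of_nat \<kappa>) / 2)) * norm (dseries f s)"
proof -
  have "norm (complex_of_real (pi / real N) powr (- ((s + of_nat \<kappa>) / 2))) = (pi / real N) powr (- ((Re s + real \<kappa>) / 2))"
    using N_pos by (subst norm_powr_real_powr) auto
  then show ?thesis unfolding Xi_eq[OF assms] norm_mult by simp
qed

lemma Xi_eq_0_iff: "Re s > 0 \<Longrightarrow> Xi s = 0 \<longleftrightarrow> dseries f s = 0"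
  using not_nonpos_Int[of "(s + of_nat \<kappa>) / 2"] N_pos by (simp add: Xi_eq Gamma_eq_zero_iff)

text \<open>At equal heights only the Gamma factors differ substantially, and the larger real part
  wins once |z| is large. The values of L are cross-multiplied, so that zeros do no harm.\<close>

lemma Xi_compare:
  "\<exists>C\<ge>0. \<forall>z s. 1 / 2 \<le> Re z \<longrightarrow> Re z \<le> Re s \<longrightarrow> Im z = Im s \<longrightarrow>
     norm (Xi z) * norm (dseries f s) \<le>
       norm (Xi s) * norm (dseries f z) * exp ((Re s - Re z) / 2 * (C - ln (norm ((z + of_nat \<kappa>) / 2))))"
proof -
  obtain C where C: "C \<ge> 0" "\<And>x1 x2 y. 1 / 4 \<le> x1 \<Longrightarrow> x1 \<le> x2 \<Longrightarrow>
     norm (Gamma (Complex x1 y)) \<le> norm (Gamma (Complex x2 y)) * exp ((x2 - x1) * (C - ln (norm (Complex x1 y))))"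
    using Gamma_ratio_bound by blast
  define l where "l = ln (pi / real N)"
  have "norm (Xi z) * norm (dseries f s) \<le>
       norm (Xi s) * norm (dseries f z) * exp ((Re s - Re z) / 2 * (C + \<bar>l\<bar> - ln (norm ((z + of_nat \<kappa>) / 2))))"
    if z: "1 / 2 \<le> Re z" "Re z \<le> Re s" "Im z = Im s" for z s
  proof -
    define x1 where "x1 = (Re z + real \<kappa>) / 2"
    define x2 where "x2 = (Re s + real \<kappa>) / 2"
    have x: "1 / 4 \<le> x1" "x1 \<le> x2" using z by (auto simp: x1_def x2_def)
    have w1: "(z + of_nat \<kappa>) / 2 = Complex x1 (Im s / 2)" using z by (simp add: complex_eq_iff x1_def)
    have w2: "(s + of_nat \<kappa>) / 2 = Complex x2 (Im s / 2)" by (simp add: complex_eq_iff x2_def)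
    have d: "x2 - x1 = (Re s - Re z) / 2" by (simp add: x1_def x2_def field_simps)
    have p: "(pi / real N) powr (- x1) \<le> (pi / real N) powr (- x2) * exp ((x2 - x1) * \<bar>l\<bar>)"
    proof -
      have "- x1 * l \<le> - x2 * l + (x2 - x1) * \<bar>l\<bar>"
        using mult_left_mono[of l "\<bar>l\<bar>" "x2 - x1"] x by (simp add: algebra_simps)
      then have "exp (- x1 * l) \<le> exp (- x2 * l) * exp ((x2 - x1) * \<bar>l\<bar>)" by (simp flip: exp_add)
      then show ?thesis using N_pos by (simp add: powr_def l_def)
    qed
    have "norm (Xi z) * norm (dseries f s) = ((pi / real N) powr (- x1) * norm (Gamma (Complex x1 (Im s / 2)))) * (norm (dseries f z) * norm (dseries f s))"
      using z by (subst norm_Xi) (auto simp: w1 x1_def mult_ac)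
    also have "\<dots> \<le> ((pi / real N) powr (- x2) * exp ((x2 - x1) * \<bar>l\<bar>) *
          (norm (Gamma (Complex x2 (Im s / 2))) * exp ((x2 - x1) * (C - ln (norm (Complex x1 (Im s / 2))))))) * (norm (dseries f z) * norm (dseries f s))"
      by (intro mult_right_mono mult_mono p C(2) x) auto
    also have "\<dots> = ((pi / real N) powr (- x2) * norm (Gamma (Complex x2 (Im s / 2))) * norm (dseries f s)) * norm (dseries f z) *
          (exp ((x2 - x1) * \<bar>l\<bar>) * exp ((x2 - x1) * (C - ln (norm (Complex x1 (Im s / 2))))))" by (simp only: mult_ac)
    also have "exp ((x2 - x1) * \<bar>l\<bar>) * exp ((x2 - x1) * (C - ln (norm (Complex x1 (Im s / 2)))))
          = exp ((x2 - x1) * (C + \<bar>l\<bar> - ln (norm (Complex x1 (Im s / 2)))))" by (simp add: algebra_simps flip: exp_add)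
    also have "(pi / real N) powr (- x2) * norm (Gamma (Complex x2 (Im s / 2))) * norm (dseries f s) = norm (Xi s)"
      using z by (subst norm_Xi) (auto simp: w2 x2_def)
    finally show ?thesis unfolding w1[symmetric] d .
  qed
  then show ?thesis using C(1) by (intro exI[of _ "C + \<bar>l\<bar>"]) auto
qed

text \<open>If s - h falls to the left of the critical line, it is replaced by its mirror image,
  which has the same height and the same |Xi|; then \<open>Xi_compare\<close> applies over a
  distance of at most 2h. The linear factor is the growth of L, and ln 4 comes from |(z +
  \<kappa>)/2| >= 1/4.\<close>

lemma Xi_growth:
  assumes h: "h > 0"
  shows "\<exists>A\<ge>0. \<forall>s. Re s \<ge> 1 / 2 \<longrightarrow>
     norm (Xi (s - of_real h)) * norm (dseries f (s + of_real h)) \<le> A * (1 + norm s) * norm (Xi (s + of_real h))"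
proof -
  obtain C where C: "C \<ge> 0" "\<And>z s. 1 / 2 \<le> Re z \<Longrightarrow> Re z \<le> Re s \<Longrightarrow> Im z = Im s \<Longrightarrow>
     norm (Xi z) * norm (dseries f s) \<le>
       norm (Xi s) * norm (dseries f z) * exp ((Re s - Re z) / 2 * (C - ln (norm ((z + of_nat \<kappa>) / 2))))"
    using Xi_compare by blast
  define A where "A = real N * (4 + 2 * h) * exp (h * (C + ln 4))"
  have "norm (Xi (s - of_real h)) * norm (dseries f (s + of_real h)) \<le> A * (1 + norm s) * norm (Xi (s + of_real h))"
    if s: "Re s \<ge> 1 / 2" for s
  proof -
    define z where "z = (if Re s - h \<ge> 1 / 2 then s - of_real h else 1 - cnj s + of_real h)"
    have e: "1 - cnj (s - of_real h) = 1 - cnj s + of_real h" by simp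
    have Xz: "norm (Xi z) = norm (Xi (s - of_real h))"
      using norm_Xi_reflect[of "s - of_real h"] unfolding e by (simp add: z_def)
    have z: "1 / 2 \<le> Re z" "Re z \<le> Re (s + of_real h)" "Im z = Im (s + of_real h)" "Re (s + of_real h) - Re z \<le> 2 * h"
      using s h by (auto simp: z_def)
    have nz: "norm z \<le> norm s + 1 + h"
    proof (cases "Re s - h \<ge> 1 / 2")
      case True
      then show ?thesis using norm_triangle_ineq4[of s "of_real h"] h by (simp add: z_def)
    next
      case False
      have "norm (1 - cnj s + of_real h) \<le> norm (1 - cnj s) + norm (of_real h :: complex)" by (rule norm_triangle_ineq)
      also have "norm (1 - cnj s) \<le> 1 + norm s" using norm_triangle_ineq4[of 1 "cnj s"] by simp
      finally show ?thesis using False h by (simp add: z_def)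
    qed
    have Lz: "norm (dseries f z) \<le> real N * (4 + 2 * h) * (1 + norm s)"
    proof -
      have "norm (dseries f z) \<le> real N * (2 + norm z / Re z)"
        using dseries_conditional(2)[OF f_partial, of z 0] z by simp
      also have "\<dots> \<le> real N * ((4 + 2 * h) * (1 + norm s))"
      proof (rule mult_left_mono)
        have "norm z / Re z \<le> norm z / (1 / 2)" using z by (intro divide_left_mono) auto
        also have "\<dots> \<le> 2 * (norm s + 1 + h)" using nz by simp
        finally show "2 + norm z / Re z \<le> (4 + 2 * h) * (1 + norm s)" using h
          by (simp add: algebra_simps) (smt (verit) mult_nonneg_nonneg norm_ge_zero)
      qed simp
      finally show ?thesis by (simp add: mult.assoc)
    qed
    have ex: "exp ((Re (s + of_real h) - Re z) / 2 * (C - ln (norm ((z + of_nat \<kappa>) / 2)))) \<le> exp (h * (C + ln 4))"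
    proof -
      have "1 / 4 \<le> Re ((z + of_nat \<kappa>) / 2)" using z by simp
      also have "\<dots> \<le> norm ((z + of_nat \<kappa>) / 2)" by (rule complex_Re_le_cmod)
      finally have "ln (1 / 4) \<le> ln (norm ((z + of_nat \<kappa>) / 2))" by (intro ln_mono) auto
      then have 1: "C - ln (norm ((z + of_nat \<kappa>) / 2)) \<le> C + ln 4" by (simp add: ln_div)
      have "(Re (s + of_real h) - Re z) / 2 * (C - ln (norm ((z + of_nat \<kappa>) / 2))) \<le> (Re (s + of_real h) - Re z) / 2 * (C + ln 4)"
        using z 1 by (intro mult_left_mono) auto
      also have "\<dots> \<le> h * (C + ln 4)" using z C(1) by (intro mult_right_mono) auto
      finally show ?thesis by simp
    qed
    have "norm (Xi (s - of_real h)) * norm (dseries f (s + of_real h)) \<le>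
        norm (Xi (s + of_real h)) * norm (dseries f z) * exp ((Re (s + of_real h) - Re z) / 2 * (C - ln (norm ((z + of_nat \<kappa>) / 2))))"
      unfolding Xz[symmetric] by (rule C(2)[OF z(1-3)])
    also have "\<dots> \<le> norm (Xi (s + of_real h)) * (real N * (4 + 2 * h) * (1 + norm s)) * exp (h * (C + ln 4))"
      using h by (intro mult_mono Lz ex) auto
    finally show ?thesis by (simp add: A_def mult_ac)
  qed
  moreover have "A \<ge> 0" using h by (simp add: A_def)
  ultimately show ?thesis by blast
qed

text \<open>The modulus of log L is at most log zeta at the same real part, which bounds |L| from
  above and from below alike.\<close>

lemma norm_dseries_bounds:
  assumes "Re s \<ge> x" "x > 1"
  shows "norm (dseries f s) \<le> 1 + 1 / (x - 1)" "1 \<le> (1 + 1 / (x - 1)) * norm (dseries f s)"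
proof -
  have s: "Re s > 1" using assms by simp
  have "\<bar>Re (dseries cm.logcoeff s)\<bar> \<le> logzeta (Re s)"
    using cm.norm_dseries_logcoeff[OF s] abs_Re_le_cmod order_trans by blast
  also have "\<dots> \<le> ln (1 + 1 / (Re s - 1))" by (rule logzeta_le[OF s])
  also have "\<dots> \<le> ln (1 + 1 / (x - 1))" using assms by (intro ln_mono add_left_mono divide_left_mono) (auto intro: add_pos_pos)
  finally have l: "\<bar>Re (dseries cm.logcoeff s)\<bar> \<le> ln (1 + 1 / (x - 1))" .
  have p: "1 + 1 / (x - 1) > 0" using assms by (simp add: add_pos_pos)
  have n: "norm (dseries f s) = exp (Re (dseries cm.logcoeff s))"
    unfolding cm.exp_dseries_logcoeff[OF s, symmetric] by simp
  have "exp (Re (dseries cm.logcoeff s)) \<le> exp (ln (1 + 1 / (x - 1)))" using l by simp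
  then show "norm (dseries f s) \<le> 1 + 1 / (x - 1)" unfolding n using p by simp
  have "exp (- ln (1 + 1 / (x - 1))) \<le> exp (Re (dseries cm.logcoeff s))" using l by simp
  then have "inverse (1 + 1 / (x - 1)) \<le> norm (dseries f s)" unfolding n exp_minus using p by simp
  then show "1 \<le> (1 + 1 / (x - 1)) * norm (dseries f s)" using p by (simp add: inverse_eq_divide pos_divide_le_eq mult.commute)
qed

text \<open>One point of strict inequality is what rules out a constant quotient in the maximum
  principle. Far to the right the Gamma factors decide.\<close>

lemma Xi_lt_far:
  assumes h: "h > 0"
  shows "\<exists>x>1 / 2. norm (Xi (of_real x - of_real h)) < norm (Xi (of_real x + of_real h))"
proof -
  obtain C where C: "C \<ge> 0" "\<And>z s. 1 / 2 \<le> Re z \<Longrightarrow> Re z \<le> Re s \<Longrightarrow> Im z = Im s \<Longrightarrow>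
     norm (Xi z) * norm (dseries f s) \<le>
       norm (Xi s) * norm (dseries f z) * exp ((Re s - Re z) / 2 * (C - ln (norm ((z + of_nat \<kappa>) / 2))))"
    using Xi_compare by blast
  \<comment> \<open>This makes the exponential factor at most 1/5. The bounds for |L| and 1/|L| to
    the right of 2 lose a factor 2 each, and 4/5 < 1.\<close>
  define y where "y = max 2 (2 * exp (C + ln 5 / h))"
  define x where "x = y + h"
  have y: "y \<ge> 2" "y / 2 \<ge> exp (C + ln 5 / h)" by (auto simp: y_def)
  have n: "norm ((of_real y + of_nat \<kappa>) / 2 :: complex) \<ge> y / 2"
  proof -
    have "y / 2 \<le> Re ((of_real y + of_nat \<kappa>) / 2 :: complex)" by simp
    also have "\<dots> \<le> norm ((of_real y + of_nat \<kappa>) / 2 :: complex)" by (rule complex_Re_le_cmod)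
    finally show ?thesis .
  qed
  have "C + ln 5 / h = ln (exp (C + ln 5 / h))" by simp
  also have "\<dots> \<le> ln (norm ((of_real y + of_nat \<kappa>) / 2 :: complex))" using y(2) n by (intro ln_mono) (auto intro: order_trans)
  finally have "h * (C - ln (norm ((of_real y + of_nat \<kappa>) / 2 :: complex))) \<le> h * (- (ln 5 / h))" using h by (intro mult_left_mono) auto
  then have "h * (C - ln (norm ((of_real y + of_nat \<kappa>) / 2 :: complex))) \<le> - ln 5" using h by simp
  then have "exp (h * (C - ln (norm ((of_real y + of_nat \<kappa>) / 2 :: complex)))) \<le> exp (- ln 5)" by simp
  then have ex: "exp (h * (C - ln (norm ((of_real y + of_nat \<kappa>) / 2 :: complex)))) \<le> 1 / 5" by (simp add: exp_minus)
  define s where "s = (of_real x + of_real h :: complex)"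
  have xh: "of_real x - of_real h = (of_real y :: complex)" by (simp add: x_def)
  have b1: "norm (dseries f (of_real y)) \<le> 2" using norm_dseries_bounds(1)[of 2 "of_real y"] y by simp
  have b2: "1 \<le> 2 * norm (dseries f s)" using norm_dseries_bounds(2)[of 2 s] y h by (simp add: s_def x_def)
  have Xs: "norm (Xi s) > 0" using Xi_nonzero_right[of s] y h by (simp add: s_def x_def)
  have "norm (Xi (of_real y)) * norm (dseries f s) \<le> norm (Xi s) * norm (dseries f (of_real y)) * exp ((Re s - y) / 2 * (C - ln (norm ((of_real y + of_nat \<kappa>) / 2 :: complex))))"
    using C(2)[of "of_real y" s] y h by (simp add: s_def x_def)
  also have "(Re s - y) / 2 = h" by (simp add: s_def x_def)
  also have "norm (Xi s) * norm (dseries f (of_real y)) * exp (h * (C - ln (norm ((of_real y + of_nat \<kappa>) / 2 :: complex)))) \<le> norm (Xi s) * 2 * (1 / 5)"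
    by (intro mult_mono b1 ex) auto
  finally have "norm (Xi (of_real y)) * norm (dseries f s) \<le> norm (Xi s) * 2 * (1 / 5)" .
  moreover have "norm (Xi (of_real y)) \<le> 2 * (norm (Xi (of_real y)) * norm (dseries f s))"
    using mult_left_mono[OF b2, of "norm (Xi (of_real y))"] by simp
  ultimately have "norm (Xi (of_real y)) < norm (Xi s)" using Xs by linarith
  moreover have "x > 1 / 2" using y h by (simp add: x_def)
  ultimately show ?thesis unfolding s_def xh[symmetric] by blast
qed

lemma Xi_shift_holomorphic: "(\<lambda>s. Xi (s + a)) holomorphic_on S"
  using holomorphic_on_compose_gen[OF _ Xi_holomorphic[of UNIV], of "\<lambda>s. s + a" S]
  by (simp add: o_def holomorphic_intros)

text \<open>A polynomial lower bound for L turns \<open>Xi_growth\<close> into polynomial growth of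
  the quotient. On the critical line the quotient has modulus 1 by the functional equation, so
  Phragmen-Lindeloef gives modulus at most 1 to the right of it.\<close>

lemma Xi_le_of_growth:
  assumes h: "h > 0" and nz: "\<And>s. Re s \<ge> 1 / 2 + h \<Longrightarrow> Xi s \<noteq> 0"
    and lower: "\<And>s. Re s \<ge> 1 / 2 + h \<Longrightarrow> 1 \<le> B * (1 + norm s) ^ m * norm (dseries f s)"
    and s: "Re s \<ge> 1 / 2"
  shows "norm (Xi (s - of_real h)) \<le> norm (Xi (s + of_real h))"
proof -
  obtain A where A: "A \<ge> 0" "\<And>s. Re s \<ge> 1 / 2 \<Longrightarrow>
     norm (Xi (s - of_real h)) * norm (dseries f (s + of_real h)) \<le> A * (1 + norm s) * norm (Xi (s + of_real h))"
    using Xi_growth[OF h] by blast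
  define Q where "Q s = Xi (s + (1 / 2 - of_real h)) / Xi (s + (1 / 2 + of_real h))" for s
  have nzQ: "Xi (s + (1 / 2 + of_real h)) \<noteq> 0" if "Re s \<ge> 0" for s using that by (intro nz) auto
  have Qh: "Q holomorphic_on {s. Re s \<ge> 0}"
    unfolding Q_def using nzQ by (intro holomorphic_intros Xi_shift_holomorphic) auto
  have "norm (Q (s - 1 / 2)) \<le> 1"
  proof (rule phragmen_lindelof_halfplane[of Q])
    show "continuous_on {s. Re s \<ge> 0} Q" by (rule holomorphic_on_imp_continuous_on[OF Qh])
    show "Q holomorphic_on {s. Re s > 0}" by (rule holomorphic_on_subset[OF Qh]) auto
    show "Re (s - 1 / 2) \<ge> 0" using s by simp
    fix w :: complex
    {
      assume w: "Re w = 0"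
      have "1 - cnj (w + (1 / 2 - of_real h)) = w + (1 / 2 + of_real h)" using w by (simp add: complex_eq_iff)
      then have "norm (Xi (w + (1 / 2 + of_real h))) = norm (Xi (w + (1 / 2 - of_real h)))" by (metis norm_Xi_reflect)
      then show "norm (Q w) \<le> 1" using nzQ[of w] w by (simp add: Q_def norm_divide)
    }
    {
      assume w: "Re w \<ge> 0"
      define v where "v = w + 1 / 2"
      have v: "Re v \<ge> 1 / 2" using w by (simp add: v_def)
      have nv: "norm v \<le> norm w + 1 / 2" unfolding v_def by (rule order_trans[OF norm_triangle_ineq]) simp
      have nvh: "norm (v + of_real h) \<le> norm w + 1 / 2 + h"
        using norm_triangle_ineq[of v "of_real h"] nv h by simp
      have B0: "B \<ge> 0"
      proof -
        have "1 \<le> B * ((1 + norm (v + of_real h)) ^ m * norm (dseries f (v + of_real h)))"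
          using lower[of "v + of_real h"] v by (simp add: mult.assoc)
        then show ?thesis by (smt (verit) mult_nonneg_nonneg mult_neg_pos norm_ge_zero zero_le_power mult_nonpos_nonneg)
      qed
      define X where "X = norm (Xi (v - of_real h))"
      have "X * 1 \<le> X * (B * (1 + norm (v + of_real h)) ^ m * norm (dseries f (v + of_real h)))"
        using lower[of "v + of_real h"] v by (intro mult_left_mono) (auto simp: X_def)
      also have "\<dots> = B * (1 + norm (v + of_real h)) ^ m * (X * norm (dseries f (v + of_real h)))" by simp
      also have "\<dots> \<le> B * (1 + norm (v + of_real h)) ^ m * (A * (1 + norm v) * norm (Xi (v + of_real h)))"
        unfolding X_def using A(2)[OF v] B0 by (intro mult_left_mono) auto
      also have "\<dots> \<le> B * ((2 + h) * (1 + norm w)) ^ m * (A * ((2 + h) * (1 + norm w)) * norm (Xi (v + of_real h)))"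
      proof -
        have hw: "h * norm w \<ge> 0" using h by simp
        have 1: "1 + norm (v + of_real h) \<le> (2 + h) * (1 + norm w)"
          using nvh h hw norm_ge_zero[of w] unfolding distrib_left distrib_right by linarith
        have 2: "1 + norm v \<le> (2 + h) * (1 + norm w)"
          using nv h hw norm_ge_zero[of w] unfolding distrib_left distrib_right by linarith
        show ?thesis using 1 2 A(1) B0 h by (intro mult_mono power_mono mult_left_mono) auto
      qed
      also have "\<dots> = (B * A * (2 + h) ^ Suc m * (1 + norm w) ^ Suc m) * norm (Xi (v + of_real h))"
        by (simp add: power_mult_distrib mult_ac)
      finally have "X \<le> (B * A * (2 + h) ^ Suc m * (1 + norm w) ^ Suc m) * norm (Xi (v + of_real h))" by simp
      moreover have "norm (Xi (v + of_real h)) > 0" using nz[of "v + of_real h"] v by simp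
      ultimately have "X / norm (Xi (v + of_real h)) \<le> B * A * (2 + h) ^ Suc m * (1 + norm w) ^ Suc m"
        by (simp add: pos_divide_le_eq)
      moreover have e: "w + (1 / 2 - of_real h) = v - of_real h" "w + (1 / 2 + of_real h) = v + of_real h"
        by (auto simp: v_def)
      ultimately show "norm (Q w) \<le> (B * A * (2 + h) ^ Suc m) * (1 + norm w) ^ Suc m"
        unfolding Q_def norm_divide X_def e by (simp only:)
    }
  qed
  moreover have "s - 1 / 2 + (1 / 2 - of_real h) = s - of_real h" "s - 1 / 2 + (1 / 2 + of_real h) = s + of_real h" by auto
  moreover have "Xi (s + of_real h) \<noteq> 0" using nz[of "s + of_real h"] s by simp
  ultimately show ?thesis by (simp add: Q_def norm_divide divide_le_eq split: if_splits)
qed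

text \<open>For h > 1/2 the shifted line lies in the region of absolute convergence, where |L| is
  bounded below. The weak inequality passes to h = 1/2 by continuity from the right.\<close>

lemma Xi_le_unconditional:
  assumes h: "h \<ge> 1 / 2" and s: "Re s \<ge> 1 / 2"
  shows "norm (Xi (s - of_real h)) \<le> norm (Xi (s + of_real h))"
proof -
  have gt: "norm (Xi (s - of_real h)) \<le> norm (Xi (s + of_real h))" if h: "h > 1 / 2" for h
  proof (rule Xi_le_of_growth[where B = "1 + 1 / (h - 1 / 2)" and m = 0])
    show "Xi s \<noteq> 0" if "Re s \<ge> 1 / 2 + h" for s using that h by (intro Xi_nonzero_right) simp
    show "1 \<le> (1 + 1 / (h - 1 / 2)) * (1 + norm s) ^ 0 * norm (dseries f s)" if "Re s \<ge> 1 / 2 + h" for s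
      using norm_dseries_bounds(2)[OF that] h by (simp add: algebra_simps)
  qed (use h s in auto)
  have cont: "isCont Xi z" for z
    using Xi_holomorphic[of UNIV] holomorphic_on_imp_continuous_on continuous_on_eq_continuous_at[OF open_UNIV] by blast
  have l1: "((\<lambda>x. norm (Xi (s - of_real x))) \<longlongrightarrow> norm (Xi (s - of_real h))) (at_right h)"
    by (intro tendsto_intros isCont_tendsto_compose[OF cont])
  have l2: "((\<lambda>x. norm (Xi (s + of_real x))) \<longlongrightarrow> norm (Xi (s + of_real h))) (at_right h)"
    by (intro tendsto_intros isCont_tendsto_compose[OF cont])
  show ?thesis
    by (rule tendsto_le[OF _ l2 l1]) (use h in \<open>auto intro!: eventually_at_rightI[of h "h + 1"] gt\<close>)
qed

end

section \<open>Zeros of the linear combinations\<close>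

context prim_char
begin

text \<open>The Hermite-Biehler condition for \<open>\<xi> (s + h)\<close> with respect to the critical line.\<close>

definition good :: "real \<Rightarrow> bool" where
  "good h \<longleftrightarrow> h > 0 \<and> (\<forall>s. Re s \<ge> 1 / 2 + h \<longrightarrow> Xi s \<noteq> 0) \<and>
     (\<forall>s. Re s \<ge> 1 / 2 \<longrightarrow> norm (Xi (s - of_real h)) \<le> norm (Xi (s + of_real h)))"

definition Q :: "real \<Rightarrow> complex \<Rightarrow> complex" where
  "Q h s = Xi (s - of_real h) / Xi (s + of_real h)"

lemma Q_holomorphic:
  assumes "\<And>s. s \<in> S \<Longrightarrow> Xi (s + of_real h) \<noteq> 0"
  shows "Q h holomorphic_on S"
  unfolding Q_def using assms Xi_shift_holomorphic[of "- of_real h" S]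
  by (intro holomorphic_intros Xi_shift_holomorphic) auto

text \<open>Equality at an interior point would make \<open>Q h\<close> constant of modulus 1,
  contradicting \<open>Xi_lt_far\<close>.\<close>

lemma Xi_lt:
  assumes g: "good h" and s: "Re s > 1 / 2"
  shows "norm (Xi (s - of_real h)) < norm (Xi (s + of_real h))"
proof (rule ccontr)
  assume n: "\<not> ?thesis"
  let ?S = "{s. Re s > 1 / 2}"
  have nz: "Xi (s + of_real h) \<noteq> 0" if "s \<in> ?S" for s using g that by (auto simp: good_def)
  have le: "norm (Q h w) \<le> 1" if "w \<in> ?S" for w
    using g nz[OF that] that by (auto simp: good_def Q_def norm_divide divide_le_eq)
  have "norm (Q h s) \<ge> 1" using n nz s by (simp add: Q_def norm_divide le_divide_eq)
  have "Q h constant_on ?S"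
  proof (rule maximum_modulus_principle[where U = ?S and \<xi> = s])
    show "Q h holomorphic_on ?S" by (intro Q_holomorphic nz)
    show "open ?S" "open ?S" by (rule open_halfspace_Re_gt)+
    show "connected ?S" by (rule convex_connected[OF convex_halfspace_Re_gt])
    show "s \<in> ?S" using s by simp
    show "norm (Q h z) \<le> norm (Q h s)" if "z \<in> ?S" for z
      using le[OF that] \<open>norm (Q h s) \<ge> 1\<close> by linarith
  qed auto
  then obtain c where c: "\<And>w. w \<in> ?S \<Longrightarrow> Q h w = c" by (auto simp: constant_on_def)
  obtain x where x: "x > 1 / 2" "norm (Xi (of_real x - of_real h)) < norm (Xi (of_real x + of_real h))"
    using Xi_lt_far[of h] g unfolding good_def by blast
  have "norm (Q h (of_real x)) < 1"
    using x nz[of "of_real x"] by (simp add: Q_def norm_divide divide_less_eq)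
  then show False using c[of "of_real x"] c[of s] s x \<open>norm (Q h s) \<ge> 1\<close> by simp
qed

abbreviation ln_pt :: "real \<Rightarrow> real \<Rightarrow> complex" where "ln_pt h t \<equiv> Complex (1 / 2 + h) t"

text \<open>The derivative of the argument of \<open>Xi\<close> along the vertical line.\<close>

definition dphase :: "real \<Rightarrow> real \<Rightarrow> real" where
  "dphase h t = Re (deriv Xi (ln_pt h t) / Xi (ln_pt h t))"

lemma Xi_deriv: "(Xi has_field_derivative deriv Xi s) (at s)"
  by (rule holomorphic_derivI[OF Xi_holomorphic[of UNIV] open_UNIV]) simp

lemma ln_pt_vd: "((\<lambda>t. Xi (ln_pt h t)) has_vector_derivative \<i> * deriv Xi (ln_pt h t)) (at t within S)"
proof -
  have e: "ln_pt h t = of_real (1 / 2 + h) + \<i> * of_real t" for t by (simp add: complex_eq_iff)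
  have "((\<lambda>z. Xi (of_real (1 / 2 + h) + \<i> * z)) has_field_derivative deriv Xi (of_real (1 / 2 + h) + \<i> * of_real t) * \<i>) (at (of_real t))"
    by (rule DERIV_chain2[OF Xi_deriv]) (auto intro!: derivative_eq_intros)
  from has_vector_derivative_real_field[OF this] show ?thesis unfolding e by (simp add: mult.commute)
qed

lemma Xi_continuous: "continuous_on S Xi" "continuous_on S (deriv Xi)"
  using Xi_holomorphic holomorphic_on_imp_continuous_on holomorphic_deriv[OF Xi_holomorphic open_UNIV]
    continuous_on_subset by blast+

lemma continuous_ln_pt: "continuous_on S (ln_pt h)"
proof -
  have e: "ln_pt h t = of_real (1 / 2 + h) + \<i> * of_real t" for t by (simp add: complex_eq_iff)
  show ?thesis unfolding e by (intro continuous_intros)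
qed

lemma good_nz: "good h \<Longrightarrow> Xi (ln_pt h t) \<noteq> 0" by (auto simp: good_def)

lemma dphase_continuous: "good h \<Longrightarrow> continuous_on S (dphase h)"
  unfolding dphase_def
  by (intro continuous_intros continuous_on_compose2[OF Xi_continuous(1)[of UNIV] continuous_ln_pt]
      continuous_on_compose2[OF Xi_continuous(2)[of UNIV] continuous_ln_pt]) (auto simp: good_nz)

text \<open>A primitive of i Xi'/Xi along the line is a continuous logarithm up to a constant; P is
  its imaginary part, shifted by the argument of that constant.\<close>

lemma phase_exists:
  assumes g: "good h"
  obtains P where "\<And>t. (P has_real_derivative dphase h t) (at t)"
    "\<And>t. Xi (ln_pt h t) = of_real (norm (Xi (ln_pt h t))) * cis (P t)"
proof -
  define \<psi> where "\<psi> t = deriv Xi (ln_pt h t) / Xi (ln_pt h t)" for t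
  have c\<psi>: "continuous_on UNIV \<psi>" unfolding \<psi>_def
    by (intro continuous_intros continuous_on_compose2[OF Xi_continuous(1)[of UNIV] continuous_ln_pt]
      continuous_on_compose2[OF Xi_continuous(2)[of UNIV] continuous_ln_pt]) (auto simp: good_nz g)
  obtain L where L: "\<And>t. (L has_vector_derivative \<i> * \<psi> t) (at t)"
    using antiderivative_exists[OF continuous_on_mult_left[OF c\<psi>]] by blast
  have "((\<lambda>t. Xi (ln_pt h t) * exp (- L t)) has_vector_derivative 0) (at t within UNIV)" for t
  proof -
    have "((\<lambda>t. exp (- L t)) has_vector_derivative (- (\<i> * \<psi> t)) * exp (- L t)) (at t)"
      using field_vector_diff_chain_at[OF has_vector_derivative_minus[OF L[of t]] DERIV_exp[of "- L t"]]
      by (simp add: o_def)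
    from has_vector_derivative_mult[OF ln_pt_vd[of h t UNIV] this]
    show ?thesis using good_nz[OF g, of t] by (simp add: \<psi>_def field_simps)
  qed
  then have "((\<lambda>t. Xi (ln_pt h t) * exp (- L t)) has_derivative (\<lambda>_. 0)) (at t within UNIV)" for t
    unfolding has_vector_derivative_def by simp
  then obtain c where c: "\<And>t. Xi (ln_pt h t) * exp (- L t) = c"
    using has_derivative_zero_constant[of UNIV "\<lambda>t. Xi (ln_pt h t) * exp (- L t)"] by auto
  have X: "Xi (ln_pt h t) = c * exp (L t)" for t
    using c[of t] by (simp add: exp_minus field_simps)
  have c0: "c \<noteq> 0" using X[of 0] good_nz[OF g, of 0] by auto
  define P where "P t = Arg c + Im (L t)" for t
  have "(P has_real_derivative dphase h t) (at t)" for t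
  proof -
    have "((\<lambda>t. Im (L t)) has_vector_derivative Im (\<i> * \<psi> t)) (at t)"
      by (rule bounded_linear.has_vector_derivative[OF bounded_linear_Im L])
    then have "((\<lambda>t. Im (L t)) has_real_derivative Re (\<psi> t)) (at t)"
      by (simp add: has_real_derivative_iff_has_vector_derivative)
    from DERIV_add[OF DERIV_const[of "Arg c"] this] show ?thesis
      unfolding P_def dphase_def \<psi>_def by simp
  qed
  moreover have "Xi (ln_pt h t) = of_real (norm (Xi (ln_pt h t))) * cis (P t)" for t
  proof -
    have 1: "c = of_real (norm c) * cis (Arg c)" using rcis_cmod_Arg[of c] by (simp add: rcis_def)
    have 2: "exp (L t) = of_real (exp (Re (L t))) * cis (Im (L t))" by (simp add: exp_eq_polar)
    have "c * exp (L t) = of_real (norm c * exp (Re (L t))) * cis (P t)"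
      unfolding 2 P_def cis_mult[symmetric] by (subst 1) simp
    then show ?thesis unfolding X by (simp add: norm_mult)
  qed
  ultimately show ?thesis using that by blast
qed

lemma Xi_left_line: "Xi (Complex (1 / 2 - h) t) = omega * cnj (Xi (ln_pt h t))"
proof -
  have "1 - cnj (Complex (1 / 2 - h) t) = ln_pt h t" by (simp add: complex_eq_iff)
  then have "cnj (Xi (ln_pt h t)) = cnj omega * Xi (Complex (1 / 2 - h) t)"
    using Xi_functional[of "Complex (1 / 2 - h) t"] by simp
  moreover have "omega * cnj omega = 1" using norm_omega complex_norm_square[of omega] by simp
  ultimately show ?thesis by (simp flip: mult.assoc)
qed

text \<open>On the critical line \<open>Q h\<close> equals omega times cis (-2 P), so its derivative
  there is -2 P' times its value. Since |Q| <= 1 to the right and < 1 somewhere,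
  \<open>boundary_derivative\<close> makes this factor negative. Comparing the two gives P' >
  0.\<close>

lemma Q_deriv:
  assumes g: "good h"
  shows "(Q h has_field_derivative of_real (-2 * dphase h t) * Q h (Complex (1 / 2) t)) (at (Complex (1 / 2) t))"
    "dphase h t > 0" "Q h (Complex (1 / 2) t) \<noteq> 0"
proof -
  define s0 where "s0 = Complex (1 / 2) t"
  have e: "Complex (1 / 2) t + of_real h = ln_pt h t" "Complex (1 / 2) t - of_real h = Complex (1 / 2 - h) t" for t
    by (auto simp: complex_eq_iff)
  have cX: "isCont (\<lambda>s. Xi (s + of_real h)) s0"
    using holomorphic_on_imp_continuous_on[OF Xi_shift_holomorphic[of "of_real h" UNIV]]
    by (simp add: continuous_on_eq_continuous_at)
  have X0: "Xi (s0 + of_real h) \<noteq> 0" unfolding s0_def e using good_nz[OF g] .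
  obtain r where r: "r > 0" "\<And>y. dist s0 y < r \<Longrightarrow> Xi (y + of_real h) \<noteq> 0"
    using continuous_at_avoid[OF cX X0] by blast
  have Qh: "Q h holomorphic_on ball s0 r" using r by (intro Q_holomorphic) auto
  obtain P where P: "\<And>t. (P has_real_derivative dphase h t) (at t)"
    "\<And>t. Xi (ln_pt h t) = of_real (norm (Xi (ln_pt h t))) * cis (P t)"
    using phase_exists[OF g] by blast
  have Ql: "Q h (Complex (1 / 2) t) = omega * cis (-2 * P t)" for t
  proof -
    define \<rho> where "\<rho> = norm (Xi (ln_pt h t))"
    have \<rho>: "\<rho> \<noteq> 0" using good_nz[OF g] by (simp add: \<rho>_def)
    have X: "Xi (ln_pt h t) = of_real \<rho> * cis (P t)" unfolding \<rho>_def by (rule P(2))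
    have "cis (- P t) / cis (P t) = cis (-2 * P t)" by (simp add: cis_divide)
    then show ?thesis unfolding Q_def e Xi_left_line X using \<rho> by (simp add: cis_cnj) (simp flip: times_divide_eq_right)
  qed
  have one: "norm (Q h s0) = 1" unfolding s0_def Ql by (simp add: norm_mult norm_omega)
  then show q0: "Q h (Complex (1 / 2) t) \<noteq> 0" by (auto simp: s0_def)
  have "\<exists>c<0. deriv (Q h) s0 = of_real c * Q h s0"
  proof (rule boundary_derivative[OF Qh r(1) _ one])
    fix s assume s: "s \<in> ball s0 r" "Re s0 \<le> Re s"
    then have "Xi (s + of_real h) \<noteq> 0" using r(2) by simp
    then show "norm (Q h s) \<le> 1" using g s by (auto simp: good_def Q_def norm_divide divide_le_eq s0_def)
  next
    show "s0 + of_real (r / 2) \<in> ball s0 r" using r(1) by (simp add: dist_norm)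
    then have "Xi (s0 + of_real (r / 2) + of_real h) \<noteq> 0" using r(2) by simp
    moreover have "Re (s0 + of_real (r / 2)) > 1 / 2" using r(1) by (simp add: s0_def)
    ultimately show "norm (Q h (s0 + of_real (r / 2))) < 1"
      using Xi_lt[OF g, of "s0 + of_real (r / 2)"] by (simp add: Q_def norm_divide divide_less_eq)
  qed
  then obtain c where c: "c < 0" "deriv (Q h) s0 = of_real c * Q h s0" by blast
  have Qd: "(Q h has_field_derivative of_real c * Q h s0) (at s0)"
    using holomorphic_derivI[OF Qh open_ball, of s0 UNIV] r(1) c by simp
  have "((\<lambda>t. Q h (Complex (1 / 2) t)) has_vector_derivative of_real c * Q h s0 * \<i>) (at t)"
  proof -
    have e2: "Complex (1 / 2) t = of_real (1 / 2) + \<i> * of_real t" for t by (simp add: complex_eq_iff)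
    have "((\<lambda>z. Q h (of_real (1 / 2) + \<i> * z)) has_field_derivative of_real c * Q h s0 * \<i>) (at (of_real t))"
      by (rule DERIV_chain2[where f = "Q h"]) (use Qd in \<open>auto simp: s0_def e2 intro!: derivative_eq_intros\<close>)
    from has_vector_derivative_real_field[OF this] show ?thesis unfolding e2 .
  qed
  moreover have "((\<lambda>t. Q h (Complex (1 / 2) t)) has_vector_derivative of_real (-2 * dphase h t) * Q h s0 * \<i>) (at t)"
  proof -
    have "((\<lambda>t. -2 * P t) has_real_derivative -2 * dphase h t) (at t)" by (intro DERIV_cmult P)
    then have "((\<lambda>t. cis (-2 * P t)) has_vector_derivative (-2 * dphase h t) *\<^sub>R (\<i> * cis (-2 * P t))) (at t)"
      using vector_diff_chain_at[of "\<lambda>t. -2 * P t" "-2 * dphase h t" t cis "\<i> * cis (-2 * P t)"]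
        cis_has_vector_derivative[of 1 "-2 * P t" UNIV]
      by (simp add: o_def has_real_derivative_iff_has_vector_derivative)
    from has_vector_derivative_mult_right[OF this, of omega]
    show ?thesis unfolding Ql s0_def by (simp add: scaleR_conv_of_real mult_ac)
  qed
  ultimately have "of_real c * Q h s0 * \<i> = of_real (-2 * dphase h t) * Q h s0 * \<i>"
    by (rule vector_derivative_unique_at)
  then have c2: "c = -2 * dphase h t" using q0 unfolding s0_def[symmetric]
    by (simp only: mult_cancel_right complex_i_not_zero of_real_eq_iff) simp
  then show "dphase h t > 0" using c(1) by simp
  show "(Q h has_field_derivative of_real (-2 * dphase h t) * Q h (Complex (1 / 2) t)) (at (Complex (1 / 2) t))"
    using Qd unfolding c2 s0_def .
qed

definition FF :: "complex \<Rightarrow> complex \<Rightarrow> real \<Rightarrow> complex \<Rightarrow> complex" where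
  "FF \<alpha> \<beta> h s = \<alpha> * Xi (s + of_real h) + \<beta> * Xi (s - of_real h)"

text \<open>Off the line the two summands have different moduli, by \<open>Xi_lt\<close> on the
  right and its reflection on the left. On the line, dividing by the modulus leaves the equation cis
  (2 P) = - \<beta> omega / \<alpha> with a unimodular right side; \<open>c0\<close> is half of its
  argument.\<close>

lemma FF_zeros:
  assumes g: "good h" and ab: "norm \<alpha> = norm \<beta>" "\<beta> \<noteq> 0"
    and P: "\<And>t. (P has_real_derivative dphase h t) (at t)"
    "\<And>t. Xi (ln_pt h t) = of_real (norm (Xi (ln_pt h t))) * cis (P t)"
  shows "\<exists>c0. \<forall>s. FF \<alpha> \<beta> h s = 0 \<longleftrightarrow> Re s = 1 / 2 \<and> (P (Im s) - c0) / pi \<in> \<int>"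
proof -
  have \<alpha>: "\<alpha> \<noteq> 0" using ab by auto
  define c0 where "c0 = Arg (- \<beta> * omega / \<alpha>) / 2"
  have "norm (- \<beta> * omega / \<alpha>) = 1" using ab by (simp add: norm_divide norm_mult norm_omega)
  then have c0: "cis (2 * c0) = - \<beta> * omega / \<alpha>" using rcis_cmod_Arg[of "- \<beta> * omega / \<alpha>"] by (simp add: c0_def rcis_def)
  have line: "FF \<alpha> \<beta> h (Complex (1 / 2) t) = 0 \<longleftrightarrow> (P t - c0) / pi \<in> \<int>" for t
  proof -
    have e: "Complex (1 / 2) t + of_real h = ln_pt h t" "Complex (1 / 2) t - of_real h = Complex (1 / 2 - h) t"
      by (auto simp: complex_eq_iff)
    define \<rho> where "\<rho> = norm (Xi (ln_pt h t))"
    have \<rho>: "\<rho> \<noteq> 0" using good_nz[OF g] by (simp add: \<rho>_def)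
    have X: "Xi (ln_pt h t) = of_real \<rho> * cis (P t)" unfolding \<rho>_def by (rule P(2))
    have c2: "of_real \<rho> * cis (P t) = of_real \<rho> * (cis (- P t) * cis (2 * P t))" by (simp add: cis_mult)
    have c3: "cnj (of_real \<rho> * cis (P t)) = of_real \<rho> * cis (- P t)" by (simp add: cis_cnj)
    have "FF \<alpha> \<beta> h (Complex (1 / 2) t) = of_real \<rho> * cis (- P t) * (\<alpha> * cis (2 * P t) + \<beta> * omega)"
      unfolding FF_def e Xi_left_line X c3 unfolding c2 by (simp only: ring_distribs mult_ac)
    then have "FF \<alpha> \<beta> h (Complex (1 / 2) t) = 0 \<longleftrightarrow> \<alpha> * cis (2 * P t) + \<beta> * omega = 0" using \<rho> by simp
    also have "\<dots> \<longleftrightarrow> cis (2 * P t) = cis (2 * c0)" unfolding c0 using \<alpha>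
      by (simp add: field_simps eq_neg_iff_add_eq_0)
    also have "\<dots> \<longleftrightarrow> cis (2 * P t) / cis (2 * c0) = 1" by simp
    also have "cis (2 * P t) / cis (2 * c0) = cis (2 * pi * ((P t - c0) / pi))"
      by (simp add: cis_divide)
    also have "\<dots> = 1 \<longleftrightarrow> (P t - c0) / pi \<in> \<int>" by (rule cis_2pi_eq_1)
    finally show ?thesis .
  qed
  have off: "FF \<alpha> \<beta> h s \<noteq> 0" if "Re s \<noteq> 1 / 2" for s
  proof
    assume "FF \<alpha> \<beta> h s = 0"
    then have "\<alpha> * Xi (s + of_real h) = - (\<beta> * Xi (s - of_real h))" by (simp add: FF_def eq_neg_iff_add_eq_0)
    then have "norm (\<alpha> * Xi (s + of_real h)) = norm (\<beta> * Xi (s - of_real h))" by simp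
    then have eq: "norm (Xi (s + of_real h)) = norm (Xi (s - of_real h))" using ab \<alpha> by (simp add: norm_mult)
    show False
    proof (cases "Re s > 1 / 2")
      case True then show False using Xi_lt[OF g True] eq by simp
    next
      case False
      then have r: "Re (1 - cnj s) > 1 / 2" using that by simp
      have e1: "1 - cnj (s + of_real h) = (1 - cnj s) - of_real h" and e2: "1 - cnj (s - of_real h) = (1 - cnj s) + of_real h" by auto
      show False using Xi_lt[OF g r] eq norm_Xi_reflect[of "s + of_real h", unfolded e1] norm_Xi_reflect[of "s - of_real h", unfolded e2] by linarith
    qed
  qed
  show ?thesis
  proof (intro exI[of _ c0] allI)
    fix s
    show "FF \<alpha> \<beta> h s = 0 \<longleftrightarrow> Re s = 1 / 2 \<and> (P (Im s) - c0) / pi \<in> \<int>"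
    proof (cases "Re s = 1 / 2")
      case True
      then have e: "Complex (1 / 2) (Im s) = s" by (simp add: complex_eq_iff)
      show ?thesis using line[of "Im s", unfolded e] True by simp
    qed (use off in simp)
  qed
qed

text \<open>Near the zero FF is Xi(s + h) (\<alpha> + \<beta> Q), where Xi(s + h) is nonzero and Q'
  does not vanish on the critical line.\<close>

lemma FF_simple:
  assumes g: "good h" and b: "\<beta> \<noteq> 0" and z: "FF \<alpha> \<beta> h (Complex (1 / 2) t) = 0"
  shows "zorder (FF \<alpha> \<beta> h) (Complex (1 / 2) t) = 1"
proof -
  define s0 where "s0 = Complex (1 / 2) t"
  have e: "s0 + of_real h = ln_pt h t" by (simp add: s0_def complex_eq_iff)
  have Fh: "FF \<alpha> \<beta> h holomorphic_on UNIV"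
    unfolding FF_def using Xi_shift_holomorphic[of "- of_real h"] by (intro holomorphic_intros Xi_shift_holomorphic) auto
  have X0: "Xi (s0 + of_real h) \<noteq> 0" unfolding e by (rule good_nz[OF g])
  have cX: "isCont (\<lambda>s. Xi (s + of_real h)) s0"
    using holomorphic_on_imp_continuous_on[OF Xi_shift_holomorphic[of "of_real h" UNIV]]
    by (simp add: continuous_on_eq_continuous_at)
  obtain r where r: "r > 0" "\<And>y. dist s0 y < r \<Longrightarrow> Xi (y + of_real h) \<noteq> 0"
    using continuous_at_avoid[OF cX X0] by blast
  note Qd = Q_deriv[OF g, of t, folded s0_def]
  have FQ: "FF \<alpha> \<beta> h s = Xi (s + of_real h) * (\<alpha> + \<beta> * Q h s)" if "s \<in> ball s0 r" for s
    using r(2)[of s] that by (simp add: FF_def Q_def field_simps)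
  have z0: "\<alpha> + \<beta> * Q h s0 = 0" using FQ[of s0] r(1) X0 z by (simp add: s0_def)
  have "((\<lambda>s. Xi (s + of_real h)) has_field_derivative deriv Xi (s0 + of_real h)) (at s0)"
    using DERIV_chain2[OF Xi_deriv DERIV_add[OF DERIV_ident DERIV_const]] by simp
  moreover have "((\<lambda>s. \<alpha> + \<beta> * Q h s) has_field_derivative \<beta> * (of_real (-2 * dphase h t) * Q h s0)) (at s0)"
    using DERIV_add[OF DERIV_const DERIV_cmult[OF Qd(1), of \<beta>]] by simp
  ultimately have "((\<lambda>s. Xi (s + of_real h) * (\<alpha> + \<beta> * Q h s)) has_field_derivative
      deriv Xi (s0 + of_real h) * (\<alpha> + \<beta> * Q h s0) + \<beta> * (of_real (-2 * dphase h t) * Q h s0) * Xi (s0 + of_real h)) (at s0)"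
    by (rule DERIV_mult)
  then have "(FF \<alpha> \<beta> h has_field_derivative \<beta> * (of_real (-2 * dphase h t) * Q h s0) * Xi (s0 + of_real h)) (at s0)"
    unfolding z0 mult_zero_right add_0
    by (rule has_field_derivative_transform_within_open[OF _ open_ball[of s0 r]]) (use r(1) in simp, rule FQ[symmetric])
  then have dF: "deriv (FF \<alpha> \<beta> h) s0 \<noteq> 0" using DERIV_imp_deriv Qd(2,3) b X0 by fastforce
  obtain q where q: "q holomorphic_on UNIV" "\<And>s. FF \<alpha> \<beta> h s = (s - s0) * q s" "q s0 = deriv (FF \<alpha> \<beta> h) s0"
    using divide_out_zero[OF Fh open_UNIV, of s0] z by (auto simp: s0_def)
  have "zorder (FF \<alpha> \<beta> h) s0 = 1"
    by (rule zorder_eqI[OF open_UNIV _ q(1)]) (use q dF in auto)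
  then show ?thesis by (simp add: s0_def)
qed

end

section \<open>Spacings from the growth of a phase\<close>

text \<open>Only the mean deviation of \<open>p\<close> from \<open>ln (2 + \<bar>t\<bar>) / 2\<close> is controlled: individual spacings may be far from \<open>1\<close>,
  but only for a vanishing proportion of the indices.\<close>

locale phase_asymp =
  fixes P p :: "real \<Rightarrow> real"
  assumes P_deriv: "\<And>t. (P has_real_derivative p t) (at t)"
    and p_cont: "continuous_on UNIV p"
    and p_pos: "\<And>t. p t > 0"
    and star: "\<And>e. e > 0 \<Longrightarrow> \<forall>\<^sub>F T in at_top. integral {-T..T} (\<lambda>t. \<bar>p t - ln (2 + \<bar>t\<bar>) / 2\<bar>) \<le> e * T * ln T"
begin

definition r :: "real \<Rightarrow> real" where "r t = p t - ln (2 + \<bar>t\<bar>) / 2"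

lemma r_cont: "continuous_on S r"
  unfolding r_def by (intro continuous_intros continuous_on_subset[OF p_cont]) auto

lemma ln2_cont: "continuous_on S (\<lambda>t::real. ln (2 + \<bar>t\<bar>))"
  by (intro continuous_intros) auto

lemma P_strict_mono: "strict_mono P"
  unfolding strict_mono_def using DERIV_pos_imp_increasing P_deriv p_pos by blast

lemma P_diff: "x \<le> y \<Longrightarrow> P y - P x = integral {x..y} (\<lambda>t. ln (2 + \<bar>t\<bar>)) / 2 + integral {x..y} r"
proof -
  assume xy: "x \<le> y"
  have "(p has_integral P y - P x) {x..y}"
    by (rule fundamental_theorem_of_calculus[OF xy])
       (rule has_real_derivative_iff_has_vector_derivative[THEN iffD1, OF has_field_derivative_at_within[OF P_deriv]])
  moreover have "((\<lambda>t. ln (2 + \<bar>t\<bar>) / 2 + r t) has_integral (integral {x..y} (\<lambda>t. ln (2 + \<bar>t\<bar>)) / 2 + integral {x..y} r)) {x..y}"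
    by (intro has_integral_add has_integral_divide integrable_integral integrable_continuous_real r_cont ln2_cont)
  moreover have "(\<lambda>t. ln (2 + \<bar>t\<bar>) / 2 + r t) = p" by (simp add: r_def fun_eq_iff)
  ultimately show ?thesis using has_integral_unique[of p] by simp
qed

definition V :: "real \<Rightarrow> real \<Rightarrow> real" where "V x y = integral {x..y} (\<lambda>t. \<bar>r t\<bar>)"

lemma absr_int: "(\<lambda>t. \<bar>r t\<bar>) integrable_on {x..y}"
  by (intro integrable_continuous_real continuous_on_rabs r_cont)

lemma V_add: "x \<le> y \<Longrightarrow> y \<le> z \<Longrightarrow> V x y + V y z = V x z"
  unfolding V_def by (intro Henstock_Kurzweil_Integration.integral_combine absr_int)

lemma V_nonneg: "V x y \<ge> 0" unfolding V_def by (intro integral_nonneg absr_int) auto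

lemma V_mono: "a \<le> x \<Longrightarrow> y \<le> b \<Longrightarrow> V x y \<le> V a b"
  unfolding V_def by (intro integral_subset_le absr_int) auto

lemma r_le_V: "\<bar>integral {x..y} r\<bar> \<le> V x y"
  unfolding V_def
  by (intro integral_norm_bound_integral[where f = r, simplified] absr_int integrable_continuous_real r_cont) auto

lemma V_small: "e > 0 \<Longrightarrow> \<forall>\<^sub>F T in at_top. V (-T) T \<le> e * T * ln T"
  using star[of e] unfolding V_def r_def .

lemma ln_integral_lower:
  fixes T :: real
  assumes "T \<ge> 0"
  shows "integral {0..T} (\<lambda>t. ln (2 + \<bar>t\<bar>)) \<ge> T / 2 * ln (2 + T / 2)"
    "integral {-T..0} (\<lambda>t. ln (2 + \<bar>t\<bar>)) \<ge> T / 2 * ln (2 + T / 2)"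
proof -
  have gen: "integral {a..b} (\<lambda>t. ln (2 + \<bar>t\<bar>)) \<ge> T / 2 * ln (2 + T / 2)"
    if sub: "{c..c + T / 2} \<subseteq> {a..b}" and big: "\<And>t. t \<in> {c..c + T / 2} \<Longrightarrow> \<bar>t\<bar> \<ge> T / 2" for a b c :: real
  proof -
    have "T / 2 * ln (2 + T / 2) = integral {c..c + T / 2} (\<lambda>t. ln (2 + T / 2))" using assms by simp
    also have "\<dots> \<le> integral {c..c + T / 2} (\<lambda>t. ln (2 + \<bar>t\<bar>))"
      using big assms by (intro integral_le integrable_continuous_real ln2_cont continuous_intros) (auto intro!: ln_mono)
    also have "\<dots> \<le> integral {a..b} (\<lambda>t. ln (2 + \<bar>t\<bar>))"
      using sub by (intro integral_subset_le integrable_continuous_real ln2_cont) auto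
    finally show ?thesis .
  qed
  show "integral {0..T} (\<lambda>t. ln (2 + \<bar>t\<bar>)) \<ge> T / 2 * ln (2 + T / 2)"
    using assms by (intro gen[of "T / 2"]) auto
  show "integral {-T..0} (\<lambda>t. ln (2 + \<bar>t\<bar>)) \<ge> T / 2 * ln (2 + T / 2)"
    using assms by (intro gen[of "-T"]) auto
qed

text \<open>On either side of 0 the main term is at least about T ln T / 4, of which the deviation
  takes at most T ln T / 16. Only the order T ln T matters later.\<close>

lemma P_growth: "\<forall>\<^sub>F T in at_top. P T - P 0 \<ge> T * ln T / 8 \<and> P 0 - P (-T) \<ge> T * ln T / 8"
proof -
  have "\<forall>\<^sub>F T::real in at_top. T / 4 * ln (2 + T / 2) - T * ln T / 16 \<ge> T * ln T / 8" by real_asymp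
  moreover have "\<forall>\<^sub>F T in at_top. V (-T) T \<le> 1 / 16 * T * ln T" by (rule V_small) simp
  ultimately show ?thesis using eventually_ge_at_top[of 0]
  proof eventually_elim
    case (elim T)
    have "V 0 T \<le> V (-T) T" "V (-T) 0 \<le> V (-T) T" using elim by (auto intro!: V_mono)
    then have "V 0 T \<le> T * ln T / 16" "V (-T) 0 \<le> T * ln T / 16" using elim by auto
    then show ?case
      using elim P_diff[of 0 T] P_diff[of "-T" 0] r_le_V[of 0 T] r_le_V[of "-T" 0] ln_integral_lower[of T]
      by (auto simp: abs_le_iff)
  qed
qed

lemma P_surj: "\<exists>t. P t = y"
proof -
  have "filterlim (\<lambda>T::real. T * ln T / 8) at_top at_top" by real_asymp
  then have "\<forall>\<^sub>F T in at_top. T * ln T / 8 \<ge> \<bar>y - P 0\<bar>" by (simp add: filterlim_at_top)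
  then have "\<forall>\<^sub>F T in at_top. P (-T) \<le> y \<and> y \<le> P T \<and> T \<ge> 0"
    using P_growth eventually_ge_at_top[of 0] by eventually_elim (intro conjI; linarith)
  then obtain T where T: "P (-T) \<le> y" "y \<le> P T" "T \<ge> 0"
    using eventually_happens'[OF trivial_limit_at_top_linorder, of "\<lambda>T. P (-T) \<le> y \<and> y \<le> P T \<and> T \<ge> 0"] by blast
  have "continuous_on {-T..T} P"
    using P_deriv DERIV_isCont by (intro continuous_at_imp_continuous_on) blast
  then show ?thesis using IVT'[of P "-T" y T] T by auto
qed

definition \<gamma> :: "real \<Rightarrow> int \<Rightarrow> real" where "\<gamma> c n = (THE t. P t = c + pi * of_int n)"

lemma P_gamma: "P (\<gamma> c n) = c + pi * of_int n"
proof -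
  obtain t where t: "P t = c + pi * of_int n" using P_surj by blast
  then have "\<gamma> c n = t" unfolding \<gamma>_def
    using strict_mono_eq[OF P_strict_mono] by (intro the_equality) (auto simp flip: t)
  then show ?thesis using t by simp
qed

lemma gamma_less: "\<gamma> c m < \<gamma> c n \<longleftrightarrow> m < n"
proof -
  have "\<gamma> c m < \<gamma> c n \<longleftrightarrow> P (\<gamma> c m) < P (\<gamma> c n)" using strict_mono_less[OF P_strict_mono] by simp
  then show ?thesis by (simp add: P_gamma)
qed

lemma gamma_strict_mono: "strict_mono (\<gamma> c)" by (simp add: strict_mono_def gamma_less)

lemma gamma_range: "(P t - c) / pi \<in> \<int> \<longleftrightarrow> t \<in> range (\<gamma> c)"
proof
  assume "(P t - c) / pi \<in> \<int>"
  then obtain n where "(P t - c) / pi = of_int n" by (auto elim: Ints_cases)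
  then have "P t = P (\<gamma> c n)" by (simp add: P_gamma field_simps)
  then have "t = \<gamma> c n" using strict_mono_eq[OF P_strict_mono] by blast
  then show "t \<in> range (\<gamma> c)" by blast
qed (auto simp: P_gamma)

definition I :: "real \<Rightarrow> real \<Rightarrow> int set" where "I c T = {n. \<bar>\<gamma> c n\<bar> \<le> T}"

lemma I_eq: "I c T = {\<lceil>(P (-T) - c) / pi\<rceil>..\<lfloor>(P T - c) / pi\<rfloor>}"
proof -
  have "n \<in> I c T \<longleftrightarrow> P (-T) \<le> c + pi * of_int n \<and> c + pi * of_int n \<le> P T" for n
  proof -
    have "n \<in> I c T \<longleftrightarrow> -T \<le> \<gamma> c n \<and> \<gamma> c n \<le> T" by (auto simp: I_def)
    also have "\<dots> \<longleftrightarrow> P (-T) \<le> P (\<gamma> c n) \<and> P (\<gamma> c n) \<le> P T"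
      using strict_mono_less_eq[OF P_strict_mono] by simp
    finally show ?thesis by (simp add: P_gamma)
  qed
  moreover have "\<lceil>(P (-T) - c) / pi\<rceil> \<le> n \<longleftrightarrow> P (-T) \<le> c + pi * of_int n" for n
    by (simp add: ceiling_le_iff pos_divide_le_eq algebra_simps)
  moreover have "n \<le> \<lfloor>(P T - c) / pi\<rfloor> \<longleftrightarrow> c + pi * of_int n \<le> P T" for n
    by (simp add: le_floor_iff pos_le_divide_eq algebra_simps)
  ultimately show ?thesis by (simp add: set_eq_iff)
qed

lemma I_finite: "finite (I c T)" unfolding I_eq by simp

lemma I_card: "\<forall>\<^sub>F T in at_top. real (card (I c T)) \<ge> T * ln T / 16"
proof -
  \<comment> \<open>P grows by at least T ln T / 4 over the interval and each zero accounts for pi.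
    As pi < 4, lowering the constant to 1/16 absorbs the rounding at both ends.\<close>
  have "1 / (4 * pi) - 1 / 16 > (0::real)" using pi_less_4 by (simp add: field_simps)
  then have "filterlim (\<lambda>T::real. (1 / (4 * pi) - 1 / 16) * (T * ln T)) at_top at_top"
    by (intro filterlim_tendsto_pos_mult_at_top[OF tendsto_const]) (simp, real_asymp)
  then have "\<forall>\<^sub>F T::real in at_top. 1 \<le> (1 / (4 * pi) - 1 / 16) * (T * ln T)" unfolding filterlim_at_top by blast
  then have "\<forall>\<^sub>F T::real in at_top. T * ln T / (4 * pi) - 1 \<ge> T * ln T / 16"
    by eventually_elim (simp add: algebra_simps)
  then show ?thesis using P_growth
  proof eventually_elim
    case (elim T)
    have "P T - P (-T) \<ge> T * ln T / 4" using elim by linarith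
    then have "(P T - P (-T)) / pi \<ge> T * ln T / 4 / pi" by (intro divide_right_mono) auto
    then have "(P T - c) / pi - (P (-T) - c) / pi - 1 \<ge> T * ln T / 16" 
    proof -
      have "(P T - c) / pi - (P (-T) - c) / pi = (P T - P (-T)) / pi" "T * ln T / 4 / pi = T * ln T / (4 * pi)"
        by (simp_all add: diff_divide_distrib)
      then show ?thesis using elim \<open>(P T - P (-T)) / pi \<ge> T * ln T / 4 / pi\<close> by linarith
    qed
    moreover have "real (card (I c T)) \<ge> of_int (\<lfloor>(P T - c) / pi\<rfloor> - \<lceil>(P (-T) - c) / pi\<rceil> + 1)"
      unfolding I_eq by simp
    ultimately show ?case by linarith
  qed
qed

definition dR :: "real \<Rightarrow> int \<Rightarrow> real" where "dR c n = integral {\<gamma> c n..\<gamma> c (n + 1)} r"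

lemma sum_dR: "m \<le> n \<Longrightarrow> (\<Sum>k\<in>{m..<n}. \<bar>dR c k\<bar>) \<le> V (\<gamma> c m) (\<gamma> c n)"
proof (induction n rule: int_ge_induct)
  case base then show ?case by (simp add: V_nonneg)
next
  case (step n)
  have "{m..<n + 1} = insert n {m..<n}" using step by auto
  then have "(\<Sum>k\<in>{m..<n + 1}. \<bar>dR c k\<bar>) = \<bar>dR c n\<bar> + (\<Sum>k\<in>{m..<n}. \<bar>dR c k\<bar>)" by simp
  also have "\<dots> \<le> V (\<gamma> c n) (\<gamma> c (n + 1)) + V (\<gamma> c m) (\<gamma> c n)"
    using step.IH r_le_V unfolding dR_def by (intro add_mono) auto
  also have "\<dots> = V (\<gamma> c m) (\<gamma> c (n + 1))"
    using V_add[of "\<gamma> c m" "\<gamma> c n" "\<gamma> c (n + 1)"] gamma_less[of c] step.hyps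
    by (simp add: not_less[symmetric] del: not_less)
  finally show ?case .
qed

text \<open>Markov's inequality. The largest index is counted apart, because its gap may reach
  beyond T; this is the summand e.\<close>

lemma card_dR:
  assumes e: "e > 0" and T: "T \<ge> 0"
  shows "e * real (card {n \<in> I c T. \<bar>dR c n\<bar> \<ge> e}) \<le> V (-T) T + e"
proof -
  define a b where "a = \<lceil>(P (-T) - c) / pi\<rceil>" and "b = \<lfloor>(P T - c) / pi\<rfloor>"
  have I: "I c T = {a..b}" unfolding I_eq a_def b_def ..
  show ?thesis
  proof (cases "a \<le> b")
    case False
    then show ?thesis using e V_nonneg[of "-T" T] by (simp add: I)
  next
    case True
    let ?B = "{n \<in> {a..<b}. \<bar>dR c n\<bar> \<ge> e}"
    have fB: "finite ?B" by (rule finite_subset[of _ "{a..<b}"]) auto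
    have "{n \<in> I c T. \<bar>dR c n\<bar> \<ge> e} \<subseteq> insert b ?B" unfolding I by auto
    then have "card {n \<in> I c T. \<bar>dR c n\<bar> \<ge> e} \<le> card (insert b ?B)" using fB by (intro card_mono finite.insertI)
    also have "\<dots> \<le> Suc (card ?B)" by (simp only: card_insert_if[OF fB]) auto
    finally have 1: "real (card {n \<in> I c T. \<bar>dR c n\<bar> \<ge> e}) \<le> 1 + real (card ?B)" by linarith
    have "e * real (card ?B) = (\<Sum>n\<in>?B. e)" by simp
    also have "\<dots> \<le> (\<Sum>n\<in>?B. \<bar>dR c n\<bar>)" by (intro sum_mono) auto
    also have "\<dots> \<le> (\<Sum>n\<in>{a..<b}. \<bar>dR c n\<bar>)" by (intro sum_mono2) auto
    also have "\<dots> \<le> V (\<gamma> c a) (\<gamma> c b)" by (rule sum_dR[OF True])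
    also have "\<dots> \<le> V (-T) T"
    proof (rule V_mono)
      have "a \<in> I c T" "b \<in> I c T" using True by (auto simp: I)
      then show "-T \<le> \<gamma> c a" "\<gamma> c b \<le> T" by (auto simp: I_def)
    qed
    finally have "e * real (card ?B) \<le> V (-T) T" .
    moreover have "e * real (card {n \<in> I c T. \<bar>dR c n\<bar> \<ge> e}) \<le> e * (1 + real (card ?B))"
      using 1 e by (intro mult_left_mono) auto
    ultimately show ?thesis by (simp add: algebra_simps)
  qed
qed

text \<open>P gains exactly pi over a gap. If the deviation contributes less than e, the logarithm
  has integral close to 2 pi there. The crude bound ln (2 + |t|) >= 1/2 first limits the gap to 20;
  at large height the logarithm is then nearly constant on it.\<close>

lemma spacing_close:
  assumes \<eta>: "\<eta> > 0"
  shows "\<exists>M e. e > 0 \<and> M \<ge> 0 \<and> (\<forall>n. \<bar>\<gamma> c n\<bar> \<ge> M \<longrightarrow> \<bar>dR c n\<bar> < e \<longrightarrow> \<bar>norm_spacing (\<gamma> c) n - 1\<bar> \<le> \<eta>)"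
proof -
  \<comment> \<open>So that (1 + \<epsilon>)^2 <= 1 + 3 \<epsilon> <= 1 + \<eta>.\<close>
  define \<epsilon> where "\<epsilon> = min \<eta> 1 / 3"
  have \<epsilon>: "\<epsilon> > 0" "\<epsilon> \<le> 1 / 3" "3 * \<epsilon> \<le> \<eta>" using \<eta> by (auto simp: \<epsilon>_def)
  define e where "e = min 1 (pi * \<epsilon>)"
  have e: "e > 0" "e \<le> 1" "e \<le> pi * \<epsilon>" using \<epsilon> by (auto simp: e_def)
  \<comment> \<open>On a gap of length at most 20 the quantity 2 + |t| lies between x - 18 and x +
    22, where x is the modulus of the ordinate at its left end.\<close>
  have "((\<lambda>x::real. ln (x / (2 * pi)) / ln (x - 18)) \<longlongrightarrow> 1) at_top" by real_asymp
  then have 1: "\<forall>\<^sub>F x::real in at_top. ln (x / (2 * pi)) / ln (x - 18) < 1 + \<epsilon>" using \<epsilon> by (intro order_tendstoD) auto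
  have "((\<lambda>x::real. ln (x / (2 * pi)) / ln (x + 22)) \<longlongrightarrow> 1) at_top" by real_asymp
  then have 2: "\<forall>\<^sub>F x::real in at_top. ln (x / (2 * pi)) / ln (x + 22) > 1 - \<epsilon>" using \<epsilon> by (intro order_tendstoD) auto
  have "\<forall>\<^sub>F x::real in at_top. ln (x / (2 * pi)) / ln (x - 18) < 1 + \<epsilon> \<and> ln (x / (2 * pi)) / ln (x + 22) > 1 - \<epsilon> \<and> x \<ge> 30"
    using 1 2 eventually_ge_at_top[of 30] by eventually_elim auto
  then obtain M0 where M0: "\<And>x. x \<ge> M0 \<Longrightarrow> ln (x / (2 * pi)) / ln (x - 18) < 1 + \<epsilon> \<and> ln (x / (2 * pi)) / ln (x + 22) > 1 - \<epsilon> \<and> x \<ge> 30"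
    by (auto simp: eventually_at_top_linorder)
  have "\<bar>norm_spacing (\<gamma> c) n - 1\<bar> \<le> \<eta>" if n: "\<bar>\<gamma> c n\<bar> \<ge> max M0 0" "\<bar>dR c n\<bar> < e" for n
  proof -
    define x y where "x = \<gamma> c n" and "y = \<gamma> c (n + 1)"
    define X where "X = \<bar>x\<bar>"
    have xy: "x < y" unfolding x_def y_def gamma_less by simp
    define g where "g = y - x"
    have g: "g > 0" using xy by (simp add: g_def)
    have X: "ln (X / (2 * pi)) / ln (X - 18) < 1 + \<epsilon>" "ln (X / (2 * pi)) / ln (X + 22) > 1 - \<epsilon>" "X \<ge> 30"
      using M0[of X] n by (auto simp: X_def x_def)
    let ?J = "integral {x..y} (\<lambda>t. ln (2 + \<bar>t\<bar>))"
    have "P y - P x = pi" unfolding x_def y_def P_gamma by (simp add: algebra_simps)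
    then have J: "?J / 2 + dR c n = pi" using P_diff[of x y] xy unfolding dR_def x_def y_def by simp
    have lower: "g * m \<le> ?J" if "\<And>t. t \<in> {x..y} \<Longrightarrow> m \<le> ln (2 + \<bar>t\<bar>)" for m
    proof -
      have "g * m = integral {x..y} (\<lambda>t. m)" using xy by (simp add: g_def)
      also have "\<dots> \<le> ?J" by (intro integral_le integrable_continuous_real ln2_cont continuous_intros that)
      finally show ?thesis .
    qed
    have upper: "?J \<le> g * m" if "\<And>t. t \<in> {x..y} \<Longrightarrow> ln (2 + \<bar>t\<bar>) \<le> m" for m
    proof -
      have "?J \<le> integral {x..y} (\<lambda>t. m)" by (intro integral_le integrable_continuous_real ln2_cont continuous_intros that)
      also have "\<dots> = g * m" using xy by (simp add: g_def)
      finally show ?thesis .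
    qed
    have "g * (1 / 2) \<le> ?J"
    proof (rule lower)
      fix t :: real
      have "(1::real) / 2 \<le> ln 2" using ln2_ge_two_thirds by simp
      also have "\<dots> \<le> ln (2 + \<bar>t\<bar>)" by (intro ln_mono) auto
      finally show "1 / 2 \<le> ln (2 + \<bar>t\<bar>)" .
    qed
    then have g20: "g \<le> 20" using J n e pi_less_4 by (auto simp: abs_less_iff)
    have lo: "g * ln (X - 18) \<le> ?J"
      by (rule lower, rule ln_mono) (use g20 X in \<open>auto simp: X_def g_def\<close>)
    have hi: "?J \<le> g * ln (X + 22)"
      by (rule upper, rule ln_mono) (use g20 X in \<open>auto simp: X_def g_def\<close>)
    define L where "L = ln (X / (2 * pi))"
    have L0: "L > 0" using X pi_less_4 by (simp add: L_def field_simps)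
    have lo0: "ln (X - 18) > 0" and hi0: "ln (X + 22) > 0" using X by auto
    have ns: "norm_spacing (\<gamma> c) n = g * L / (2 * pi)"
      by (simp add: norm_spacing_def g_def L_def X_def x_def y_def)
    have J1: "?J \<le> 2 * pi * (1 + \<epsilon>)" "?J \<ge> 2 * pi * (1 - \<epsilon>)"
      using J n(2) e(3) by (auto simp: algebra_simps abs_less_iff)
    have "L \<le> (1 + \<epsilon>) * ln (X - 18)" using X(1) lo0 by (simp add: L_def divide_less_eq)
    then have "g * L \<le> g * ((1 + \<epsilon>) * ln (X - 18))" using g by (intro mult_left_mono) auto
    also have "\<dots> = (1 + \<epsilon>) * (g * ln (X - 18))" by simp
    also have "\<dots> \<le> (1 + \<epsilon>) * (2 * pi * (1 + \<epsilon>))" using lo J1 \<epsilon> by (intro mult_left_mono) auto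
    finally have "g * L / (2 * pi) \<le> (1 + \<epsilon>) * (1 + \<epsilon>)" by (simp add: divide_le_eq mult_ac)
    also have "\<dots> \<le> 1 + 3 * \<epsilon>" using \<epsilon> mult_left_mono[of \<epsilon> 1 \<epsilon>] by (simp add: algebra_simps)
    finally have U: "g * L / (2 * pi) \<le> 1 + \<eta>" using \<epsilon> by linarith
    have "(1 - \<epsilon>) * ln (X + 22) \<le> L" using X(2) hi0 by (simp add: L_def less_divide_eq)
    then have "g * ((1 - \<epsilon>) * ln (X + 22)) \<le> g * L" using g by (intro mult_left_mono) auto
    moreover have "(1 - \<epsilon>) * (2 * pi * (1 - \<epsilon>)) \<le> (1 - \<epsilon>) * (g * ln (X + 22))" using hi J1 \<epsilon> by (intro mult_left_mono) auto
    ultimately have "(1 - \<epsilon>) * (2 * pi * (1 - \<epsilon>)) \<le> g * L" by (simp add: mult_ac)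
    then have "(1 - \<epsilon>) * (1 - \<epsilon>) \<le> g * L / (2 * pi)" by (simp add: le_divide_eq mult_ac)
    moreover have "1 - 2 * \<epsilon> \<le> (1 - \<epsilon>) * (1 - \<epsilon>)" using \<epsilon> by (simp add: algebra_simps)
    ultimately have "1 - \<eta> \<le> g * L / (2 * pi)" using \<epsilon> by linarith
    with U show ?thesis unfolding ns by (simp add: abs_le_iff)
  qed
  then show ?thesis using e(1) by (intro exI[of _ "max M0 0"] exI[of _ e]) auto
qed

text \<open>A bad index either belongs to a fixed bounded range of ordinates or has a large
  deviation \<open>dR\<close>; the latter are counted by \<open>card_dR\<close>.\<close>

lemma bad_small:
  assumes \<eta>: "\<eta> > 0" and d: "d > 0"
  shows "\<forall>\<^sub>F T in at_top. real (card {n \<in> I c T. \<bar>norm_spacing (\<gamma> c) n - 1\<bar> > \<eta>}) \<le> d * (T * ln T)"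
proof -
  obtain M e where Me: "e > 0" "M \<ge> 0" "\<And>n. \<bar>\<gamma> c n\<bar> \<ge> M \<Longrightarrow> \<bar>dR c n\<bar> < e \<Longrightarrow> \<bar>norm_spacing (\<gamma> c) n - 1\<bar> \<le> \<eta>"
    using spacing_close[OF \<eta>] by blast
  have "filterlim (\<lambda>T::real. d / 2 * (T * ln T)) at_top at_top" using d by real_asymp
  then have "\<forall>\<^sub>F T in at_top. real (card (I c M)) + 1 \<le> d / 2 * (T * ln T)" unfolding filterlim_at_top by blast
  moreover have "\<forall>\<^sub>F T in at_top. V (-T) T \<le> (e * d / 2) * T * ln T" using Me(1) d by (intro V_small) auto
  ultimately show ?thesis using eventually_ge_at_top[of 0]
  proof eventually_elim
    case (elim T)
    have "{n \<in> I c T. \<bar>norm_spacing (\<gamma> c) n - 1\<bar> > \<eta>} \<subseteq> I c M \<union> {n \<in> I c T. \<bar>dR c n\<bar> \<ge> e}"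
    proof
      fix n assume n: "n \<in> {n \<in> I c T. \<bar>norm_spacing (\<gamma> c) n - 1\<bar> > \<eta>}"
      show "n \<in> I c M \<union> {n \<in> I c T. \<bar>dR c n\<bar> \<ge> e}"
        using n Me(3)[of n] by (cases "\<bar>\<gamma> c n\<bar> \<le> M"; cases "\<bar>dR c n\<bar> < e") (auto simp: I_def not_less)
    qed
    then have "card {n \<in> I c T. \<bar>norm_spacing (\<gamma> c) n - 1\<bar> > \<eta>} \<le> card (I c M \<union> {n \<in> I c T. \<bar>dR c n\<bar> \<ge> e})"
      by (intro card_mono) (auto simp: I_finite)
    also have "\<dots> \<le> card (I c M) + card {n \<in> I c T. \<bar>dR c n\<bar> \<ge> e}" by (rule card_Un_le)
    finally have 1: "real (card {n \<in> I c T. \<bar>norm_spacing (\<gamma> c) n - 1\<bar> > \<eta>}) \<le> real (card (I c M)) + real (card {n \<in> I c T. \<bar>dR c n\<bar> \<ge> e})"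
      by linarith
    have "e * real (card {n \<in> I c T. \<bar>dR c n\<bar> \<ge> e}) \<le> V (-T) T + e" using elim Me by (intro card_dR) auto
    also have "\<dots> \<le> e * (d / 2 * (T * ln T) + 1)" using elim by (simp add: algebra_simps)
    finally have "real (card {n \<in> I c T. \<bar>dR c n\<bar> \<ge> e}) \<le> d / 2 * (T * ln T) + 1" using Me(1) by simp
    then show ?case using 1 elim by (simp add: algebra_simps)
  qed
qed

text \<open>A bounded continuous f is averaged over the windows. Nearly all windows have every entry
  close to 1, where f is close to its value at the point mass; the others are too few to
  matter.\<close>

theorem spacing_limit:
  "weakly_converges (spacing_distribution (\<gamma> c)) (return borel (\<chi> i. 1) :: (real ^ 'k::{finite, linorder}) measure) at_top"
  unfolding weakly_converges_def
proof (intro allI impI)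
  fix f :: "real ^ 'k::{finite, linorder} \<Rightarrow> real"
  assume cf: "continuous_on UNIV f" and bf: "bounded (range f)"
  let ?k = "CARD('k)"
  let ?one = "(\<chi> i. 1) :: real ^ 'k::{finite, linorder}"
  obtain B where B: "B > 0" "\<And>v. \<bar>f v\<bar> \<le> B" using bf by (auto simp: bounded_pos)
  have fm: "f \<in> borel_measurable borel" using cf by (rule borel_measurable_continuous_onI)
  have lim: "integral\<^sup>L (return borel ?one) f = f ?one" using fm by (simp add: integral_return)
  show "((\<lambda>T. integral\<^sup>L (spacing_distribution (\<gamma> c) T) f) \<longlongrightarrow> integral\<^sup>L (return borel ?one) f) at_top"
    unfolding lim
  proof (rule tendstoI)
    fix e :: real assume e: "e > 0"
    have "isCont f ?one" using cf by (simp add: continuous_on_eq_continuous_at)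
    then obtain d where d: "d > 0" "\<And>v. dist v ?one < d \<Longrightarrow> dist (f v) (f ?one) < e / 2"
      using e unfolding continuous_at_eps_delta by (metis half_gt_zero)
    define \<eta> where "\<eta> = d / (2 * real ?k)"
    have \<eta>: "\<eta> > 0" using d by (simp add: \<eta>_def)
    have close: "\<bar>f v - f ?one\<bar> < e / 2" if v: "\<And>i. \<bar>v $ i - 1\<bar> \<le> \<eta>" for v :: "real ^ 'k::{finite, linorder}"
    proof -
      have "norm (v - ?one) \<le> (\<Sum>i\<in>UNIV. \<bar>(v - ?one) $ i\<bar>)" by (rule norm_le_l1_cart)
      also have "\<dots> \<le> (\<Sum>i\<in>(UNIV :: 'k set). \<eta>)" using v by (intro sum_mono) simp
      also have "\<dots> = d / 2" by (simp add: \<eta>_def)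
      also have "\<dots> < d" using d by simp
      finally show ?thesis using d(2)[of v] by (simp add: dist_norm)
    qed
    \<comment> \<open>The exceptional windows number at most 2 k \<delta> W = e W / (256 B), with k
      entries per vector and W = T ln T. As W <= 32 card S, they change the mean by at most 2 B e /
      (8 B) = e/4, which together with e/2 stays below e.\<close>
    define \<delta> where "\<delta> = e / (512 * B * real ?k)"
    have \<delta>: "\<delta> > 0" using e B by (simp add: \<delta>_def)
    have "\<forall>\<^sub>F T::real in at_top. real ?k \<le> T * ln T / 32" by real_asymp
    moreover have "\<forall>\<^sub>F T::real in at_top. real ?k \<le> \<delta> * (T * ln T) \<and> T * ln T > 0" 
    proof (rule eventually_conj)
      show "\<forall>\<^sub>F T::real in at_top. real ?k \<le> \<delta> * (T * ln T)" using \<delta> by real_asymp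
      show "\<forall>\<^sub>F T::real in at_top. T * ln T > 0" by real_asymp
    qed
    ultimately show "\<forall>\<^sub>F T in at_top. dist (integral\<^sup>L (spacing_distribution (\<gamma> c) T) f) (f ?one) < e"
      using bad_small[OF \<eta> \<delta>, of c] I_card[of c]
    proof eventually_elim
      case (elim T)
      define W where "W = T * ln T"
      define S where "S = spacing_indices ?k (\<gamma> c) T"
      define bad where "bad = {n \<in> I c T. \<bar>norm_spacing (\<gamma> c) n - 1\<bar> > \<eta>}"
      have SI: "S \<subseteq> I c T" by (auto simp: S_def spacing_indices_def I_def)
      have Sfin: "finite S" using SI I_finite finite_subset by blast
      \<comment> \<open>A window is discarded only if one of its k entries is the index of the zero
        of ordinate 0. That index is unique, so at most k windows are lost.\<close>
      have "I c T - S \<subseteq> (\<lambda>j. (THE m. \<gamma> c m = 0) - int j) ` {..<?k}"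
      proof
        fix n assume "n \<in> I c T - S"
        then obtain j where j: "j < ?k" "\<gamma> c (n + int j) = 0" by (auto simp: S_def spacing_indices_def I_def)
        have "(THE m. \<gamma> c m = 0) = n + int j"
          using j strict_mono_eq[OF gamma_strict_mono[of c]] by (intro the_equality) (auto simp flip: j(2))
        then have "n = (THE m. \<gamma> c m = 0) - int j" by simp
        then show "n \<in> (\<lambda>j. (THE m. \<gamma> c m = 0) - int j) ` {..<?k}" using j by blast
      qed
      then have "card (I c T - S) \<le> card ((\<lambda>j. (THE m. \<gamma> c m = 0) - int j) ` {..<?k})" by (intro card_mono) auto
      also have "\<dots> \<le> ?k" using card_image_le[of "{..<?k}"] by fastforce
      finally have "card (I c T) \<le> card S + ?k" using card_Diff_subset[OF Sfin SI] by simp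
      then have Sc: "real (card S) \<ge> W / 32" using elim by (simp add: W_def)
      have W0: "W > 0" using elim by (simp add: W_def)
      have Spos: "real (card S) > 0" using Sc W0 by linarith
      define VB where "VB = {n \<in> S. \<exists>i::'k. \<bar>spacing_vector (\<gamma> c) n $ i - 1\<bar> > \<eta>}"
      define b where "b = \<lfloor>(P T - c) / pi\<rfloor>"
      \<comment> \<open>A far vector has an entry which is a bad index up to T, shifted by some j <
        k, or an entry beyond T. The second can happen only for the last k indices.\<close>
      have "VB \<subseteq> (\<Union>j\<in>{..<?k}. (\<lambda>m. m - int j) ` bad) \<union> {b - int ?k<..b}"
      proof
        fix n assume n: "n \<in> VB"
        then obtain i :: 'k where i: "\<bar>spacing_vector (\<gamma> c) n $ i - 1\<bar> > \<eta>" by (auto simp: VB_def)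
        define j where "j = card {j. j < i}"
        have jk: "j < ?k" unfolding j_def by (intro psubset_card_mono) auto
        have dj: "\<bar>norm_spacing (\<gamma> c) (n + int j) - 1\<bar> > \<eta>" using i by (simp add: spacing_vector_def j_def)
        have nI: "n \<in> I c T" using n SI by (auto simp: VB_def)
        show "n \<in> (\<Union>j\<in>{..<?k}. (\<lambda>m. m - int j) ` bad) \<union> {b - int ?k<..b}"
        proof (cases "n + int j \<in> I c T")
          case True
          then have "n + int j \<in> bad" using dj by (simp add: bad_def)
          then have "n \<in> (\<lambda>m. m - int j) ` bad" by (intro image_eqI[of _ _ "n + int j"]) auto
          then show ?thesis using jk by blast
        next
          case False
          then show ?thesis using nI jk unfolding I_eq b_def[symmetric] by auto
        qed
      qed
      moreover have badfin: "finite bad" by (simp add: bad_def I_finite)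
      ultimately have "card VB \<le> card ((\<Union>j\<in>{..<?k}. (\<lambda>m. m - int j) ` bad) \<union> {b - int ?k<..b})"
        by (intro card_mono) auto
      also have "\<dots> \<le> card (\<Union>j\<in>{..<?k}. (\<lambda>m. m - int j) ` bad) + card {b - int ?k<..b}" by (rule card_Un_le)
      also have "card (\<Union>j\<in>{..<?k}. (\<lambda>m. m - int j) ` bad) \<le> (\<Sum>j<?k. card ((\<lambda>m. m - int j) ` bad))"
        by (rule card_UN_le) simp
      also have "\<dots> \<le> (\<Sum>j<?k. card bad)" by (intro sum_mono card_image_le badfin)
      finally have "card VB \<le> ?k * card bad + ?k" by simp
      then have "real (card VB) \<le> real ?k * real (card bad) + real ?k"
        by (metis of_nat_add of_nat_le_iff of_nat_mult)
      also have "\<dots> \<le> real ?k * (\<delta> * W) + real ?k * (\<delta> * W)"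
      proof (intro add_mono mult_left_mono)
        show "real (card bad) \<le> \<delta> * W" using elim by (simp add: bad_def W_def)
        have "real ?k \<le> \<delta> * W" using elim by (simp add: W_def)
        also have "\<delta> * W \<le> real ?k * (\<delta> * W)" using \<delta> W0 by simp
        finally show "real ?k \<le> real ?k * (\<delta> * W)" .
      qed auto
      also have "\<dots> = e * W / (256 * B)" by (simp add: \<delta>_def field_simps)
      finally have VBc: "real (card VB) \<le> e * W / (256 * B)" .
      have m: "spacing_vector (\<gamma> c) \<in> measurable (uniform_count_measure S) (borel :: (real ^ 'k::{finite, linorder}) measure)"
        by (auto simp: uniform_count_measure_def measurable_def space_point_measure sets_point_measure)
      have "integral\<^sup>L (spacing_distribution (\<gamma> c) T) f = (\<Sum>n\<in>S. f (spacing_vector (\<gamma> c) n)) / real (card S)"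
        unfolding spacing_distribution_def S_def[symmetric] integral_distr[OF m fm]
        by (rule integral_uniform_count_measure[OF Sfin])
      also have "\<dots> - f ?one = (\<Sum>n\<in>S. f (spacing_vector (\<gamma> c) n) - f ?one) / real (card S)"
        using Spos by (simp add: sum_subtractf field_simps)
      finally have "\<bar>integral\<^sup>L (spacing_distribution (\<gamma> c) T) f - f ?one\<bar> = \<bar>\<Sum>n\<in>S. f (spacing_vector (\<gamma> c) n) - f ?one\<bar> / real (card S)"
        by (simp add: abs_divide)
      also have "\<dots> \<le> (\<Sum>n\<in>S. \<bar>f (spacing_vector (\<gamma> c) n) - f ?one\<bar>) / real (card S)"
        by (intro divide_right_mono sum_abs) simp
      finally have F1: "\<bar>integral\<^sup>L (spacing_distribution (\<gamma> c) T) f - f ?one\<bar> \<le> (\<Sum>n\<in>S. \<bar>f (spacing_vector (\<gamma> c) n) - f ?one\<bar>) / real (card S)" .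
      have "(\<Sum>n\<in>S. \<bar>f (spacing_vector (\<gamma> c) n) - f ?one\<bar>) \<le> (\<Sum>n\<in>S. e / 2 + (if n \<in> VB then 2 * B else 0))"
      proof (rule sum_mono)
        fix n assume n: "n \<in> S"
        show "\<bar>f (spacing_vector (\<gamma> c) n) - f ?one\<bar> \<le> e / 2 + (if n \<in> VB then 2 * B else 0)"
        proof (cases "n \<in> VB")
          case True
          have "\<bar>f (spacing_vector (\<gamma> c) n) - f ?one\<bar> \<le> \<bar>f (spacing_vector (\<gamma> c) n)\<bar> + \<bar>f ?one\<bar>" by (rule abs_triangle_ineq4)
          also have "\<dots> \<le> B + B" by (intro add_mono B)
          finally show ?thesis using True e by simp
        next
          case False
          then have "\<bar>spacing_vector (\<gamma> c) n $ i - 1\<bar> \<le> \<eta>" for i :: 'k using n by (auto simp: VB_def not_less)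
          from close[OF this] show ?thesis using False by simp
        qed
      qed
      also have "\<dots> = real (card S) * (e / 2) + 2 * B * real (card VB)"
      proof -
        have "S \<inter> VB = VB" by (auto simp: VB_def)
        then show ?thesis using Sfin by (simp add: sum.distrib sum.If_cases)
      qed
      finally have F2: "(\<Sum>n\<in>S. \<bar>f (spacing_vector (\<gamma> c) n) - f ?one\<bar>) / real (card S) \<le> (real (card S) * (e / 2) + 2 * B * real (card VB)) / real (card S)"
        by (intro divide_right_mono) auto
      have "(real (card S) * (e / 2) + 2 * B * real (card VB)) / real (card S) < e"
      proof -
        have "2 * B * real (card VB) \<le> 2 * B * (e * W / (256 * B))" using VBc B by (intro mult_left_mono) auto
        also have "\<dots> = e * (W / 32) / 4" using B by (simp add: field_simps)
        also have "\<dots> \<le> e * real (card S) / 4" using Sc e by (intro divide_right_mono mult_left_mono) auto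
        finally have "real (card S) * (e / 2) + 2 * B * real (card VB) \<le> (3 / 4 * e) * real (card S)" by simp
        also have "\<dots> < e * real (card S)" using Spos e by (intro mult_strict_right_mono) auto
        finally show ?thesis using Spos by (simp add: divide_less_eq)
      qed
      with F1 F2 show ?case by (simp add: dist_real_def)
    qed
  qed
qed

end

section \<open>The logarithmic derivative\<close>

text \<open>After subtracting the value at the centre the real part stays below M = A + B + 1. The
  map F / (2 M - F) sends that half-plane into the unit disc and fixes 0, so Schwarz's lemma applies
  after rescaling the disc.\<close>

lemma borel_caratheodory:
  assumes hol: "f holomorphic_on ball s0 R" and R: "0 \<le> r" "r < R" and A: "A \<ge> 0"
    and Re: "\<And>z. z \<in> ball s0 R \<Longrightarrow> Re (f z) \<le> A" and B: "norm (f s0) \<le> B"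
    and z: "norm (z - s0) \<le> r"
  shows "norm (f z) \<le> B + 2 * (A + B + 1) * (r / (R - r))"
proof -
  define M where "M = A + B + 1"
  have B0: "B \<ge> 0" using B norm_ge_zero order_trans by blast
  have M: "M > 0" using A B0 by (simp add: M_def)
  define F where "F w = f (s0 + of_real R * w) - f s0" for w
  have inb: "s0 + of_real R * w \<in> ball s0 R" if "norm w < 1" for w
    using that R by (simp add: dist_norm norm_mult)
  have Fh: "F holomorphic_on ball 0 1"
  proof -
    have "f \<circ> (\<lambda>w. s0 + of_real R * w) holomorphic_on ball 0 1"
      by (rule holomorphic_on_compose_gen[OF _ hol]) (auto intro!: holomorphic_intros inb simp: dist_norm)
    then show ?thesis unfolding F_def o_def by (intro holomorphic_intros)
  qed
  have ReF: "Re (F w) < M" if "norm w < 1" for w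
    using Re[OF inb[OF that]] abs_Re_le_cmod[of "f s0"] B by (simp add: F_def M_def)
  have nz: "2 * of_real M - F w \<noteq> 0" if "norm w < 1" for w
    using ReF[OF that] M by (auto simp: complex_eq_iff)
  have lt: "norm (F w) < norm (2 * of_real M - F w)" if "norm w < 1" for w
  proof -
    have "(norm (2 * of_real M - F w))\<^sup>2 - (norm (F w))\<^sup>2 = 4 * M * (M - Re (F w))"
    proof -
      have "(norm (2 * of_real M - F w))\<^sup>2 = (2 * M - Re (F w))\<^sup>2 + (Im (F w))\<^sup>2" by (simp add: cmod_power2)
      moreover have "(norm (F w))\<^sup>2 = (Re (F w))\<^sup>2 + (Im (F w))\<^sup>2" by (rule cmod_power2)
      ultimately show ?thesis by (simp add: power2_eq_square algebra_simps)
    qed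
    also have "\<dots> > 0" using M ReF[OF that] by simp
    finally show ?thesis using power2_less_imp_less[of "norm (F w)" "norm (2 * of_real M - F w)"] by simp
  qed
  define w where "w = (z - s0) / of_real R"
  have w: "norm w \<le> r / R" using z R by (simp add: w_def norm_divide divide_right_mono)
  have w1: "norm w < 1"
  proof -
    have "r / R < 1" using R by simp
    with w show ?thesis by linarith
  qed
  have "norm (F w / (2 * of_real M - F w)) \<le> norm w"
    using w1 nz lt
    by (intro Schwarz_Lemma(1)[of "\<lambda>w. F w / (2 * of_real M - F w)"] holomorphic_intros Fh)
       (auto simp: F_def norm_divide divide_less_eq)
  then have "norm (F w) \<le> norm w * norm (2 * of_real M - F w)"
    using nz[OF w1] by (simp add: norm_divide divide_le_eq)
  also have "\<dots> \<le> r / R * (2 * M + norm (F w))"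
  proof (rule mult_mono[OF w])
    show "norm (2 * of_real M - F w) \<le> 2 * M + norm (F w)"
      using norm_triangle_ineq4[of "2 * of_real M" "F w"] M by (simp add: norm_mult)
  qed (use R in auto)
  finally have "norm (F w) * (R - r) \<le> 2 * M * r" using R by (simp add: field_simps)
  then have "norm (F w) \<le> 2 * M * (r / (R - r))" using R by (simp add: field_simps)
  moreover have "f z = f s0 + F w" using R by (simp add: F_def w_def)
  ultimately show ?thesis using norm_triangle_ineq[of "f s0" "F w"] B unfolding M_def by simp
qed

text \<open>Compare the Taylor coefficients at the centre with both bounds: the first terms are controlled
  by the bound on the small disc, the tail by the bound on the large one.\<close>

lemma two_discs_bound:
  assumes r: "0 \<le> r" "r < R" and \<rho>: "0 < \<rho>" "\<rho> \<le> R" and e: "e > 0" and K: "K \<ge> 0"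
  shows "\<exists>C\<ge>0. \<forall>F s0 z M. F holomorphic_on ball s0 R \<longrightarrow> continuous_on (cball s0 R) F \<longrightarrow>
     (\<forall>s\<in>cball s0 \<rho>. norm (F s) \<le> K) \<longrightarrow> (\<forall>s\<in>cball s0 R. norm (F s) \<le> M) \<longrightarrow> norm (z - s0) \<le> r \<longrightarrow>
     norm (F z) \<le> C + e * M"
proof -
  define q where "q = r / R"
  have q: "0 \<le> q" "q < 1" using r by (auto simp: q_def)
  have "(\<lambda>n. q ^ n / (1 - q)) \<longlonglongrightarrow> 0 / (1 - q)" using q by (intro tendsto_intros LIMSEQ_power_zero) auto
  then have "\<forall>\<^sub>F n in sequentially. q ^ n / (1 - q) < e" using e by (intro order_tendstoD(2)) auto
  then obtain n0 where n0: "q ^ n0 / (1 - q) < e" by (auto simp: eventually_sequentially)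
  define C where "C = (\<Sum>n<n0. K / \<rho> ^ n * r ^ n)"
  have "C \<ge> 0" unfolding C_def using K \<rho> r by (intro sum_nonneg) auto
  moreover have "norm (F z) \<le> C + e * M"
    if F: "F holomorphic_on ball s0 R" "continuous_on (cball s0 R) F" "\<forall>s\<in>cball s0 \<rho>. norm (F s) \<le> K"
      "\<forall>s\<in>cball s0 R. norm (F s) \<le> M" "norm (z - s0) \<le> r" for F s0 z M
  proof -
    have M0: "M \<ge> 0" using F(4)[rule_format, of s0] r norm_ge_zero order_trans[of 0 "norm (F s0)" M] by simp
    define a where "a n = (deriv ^^ n) F s0 / fact n" for n
    have "z \<in> ball s0 R" using F(5) r by (simp add: dist_norm norm_minus_commute)
    from holomorphic_power_series[OF F(1) this]
    have sums: "(\<lambda>n. a n * (z - s0) ^ n) sums F z" by (simp add: a_def)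
    have a1: "norm (a n) \<le> K / \<rho> ^ n" for n
    proof -
      have "norm ((deriv ^^ n) F s0) \<le> fact n * K / \<rho> ^ n"
      proof (rule Cauchy_inequality[OF _ _ \<rho>(1)])
        show "F holomorphic_on ball s0 \<rho>" by (rule holomorphic_on_subset[OF F(1)]) (use \<rho> in auto)
        show "continuous_on (cball s0 \<rho>) F" by (rule continuous_on_subset[OF F(2)]) (use \<rho> in auto)
      qed (use F(3) in \<open>auto simp: dist_norm\<close>)
      then show ?thesis by (simp add: a_def norm_divide field_simps)
    qed
    have a2: "norm (a n) \<le> M / R ^ n" for n
    proof -
      have "norm ((deriv ^^ n) F s0) \<le> fact n * M / R ^ n"
        by (rule Cauchy_inequality[OF F(1,2)]) (use F(4) r in \<open>auto simp: dist_norm\<close>)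
      then show ?thesis by (simp add: a_def norm_divide field_simps)
    qed
    have t: "norm (a n * (z - s0) ^ n) \<le> norm (a n) * r ^ n" for n
      unfolding norm_mult norm_power using F(5) by (intro mult_left_mono power_mono) auto
    have sm: "summable (\<lambda>n. a n * (z - s0) ^ n)" using sums by (rule sums_summable)
    have "F z = (\<Sum>n. a (n + n0) * (z - s0) ^ (n + n0)) + (\<Sum>n<n0. a n * (z - s0) ^ n)"
      using suminf_split_initial_segment[OF sm, of n0] sums by (simp add: sums_iff)
    moreover have "norm (\<Sum>n<n0. a n * (z - s0) ^ n) \<le> C"
      unfolding C_def
    proof (rule order_trans[OF norm_sum], rule sum_mono)
      fix n
      show "norm (a n * (z - s0) ^ n) \<le> K / \<rho> ^ n * r ^ n"
        using t[of n] mult_right_mono[OF a1[of n], of "r ^ n"] r by simp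
    qed
    moreover have "norm (\<Sum>n. a (n + n0) * (z - s0) ^ (n + n0)) \<le> (\<Sum>n. M * q ^ n0 * q ^ n)"
    proof (rule norm_suminf_le)
      fix n
      have "norm (a (n + n0) * (z - s0) ^ (n + n0)) \<le> M / R ^ (n + n0) * r ^ (n + n0)"
        using t[of "n + n0"] mult_right_mono[OF a2[of "n + n0"], of "r ^ (n + n0)"] r by simp
      also have "\<dots> = M * q ^ n0 * q ^ n" by (simp add: q_def power_divide power_add mult_ac)
      finally show "norm (a (n + n0) * (z - s0) ^ (n + n0)) \<le> M * q ^ n0 * q ^ n" .
    qed (use q in \<open>auto intro!: summable_mult summable_geometric\<close>)
    moreover have "(\<Sum>n. M * q ^ n0 * q ^ n) = M * (q ^ n0 / (1 - q))"
      using q by (subst suminf_mult) (auto intro!: summable_geometric simp: suminf_geometric)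
    moreover have "M * (q ^ n0 / (1 - q)) \<le> M * e" using n0 M0 by (intro mult_left_mono) auto
    ultimately show ?thesis
      using norm_triangle_ineq[of "\<Sum>n. a (n + n0) * (z - s0) ^ (n + n0)" "\<Sum>n<n0. a n * (z - s0) ^ n"]
      by (simp add: mult.commute)
  qed
  ultimately show ?thesis by blast
qed

context prim_char
begin

definition LD :: "complex \<Rightarrow> complex" where "LD s = deriv (dseries f) s / dseries f s"

lemma dseries_f_deriv: "Re s > 0 \<Longrightarrow> (dseries f has_field_derivative deriv (dseries f) s) (at s)"
  by (rule holomorphic_derivI[OF dseries_f_holomorphic open_halfspace_Re_gt]) simp

lemma dseries_f_continuous: "S \<subseteq> {s. Re s > 0} \<Longrightarrow> continuous_on S (dseries f)"
  "S \<subseteq> {s. Re s > 0} \<Longrightarrow> continuous_on S (deriv (dseries f))"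
  using holomorphic_on_imp_continuous_on[OF dseries_f_holomorphic]
    holomorphic_on_imp_continuous_on[OF holomorphic_deriv[OF dseries_f_holomorphic open_halfspace_Re_gt]]
    continuous_on_subset by blast+

lemma LD_right:
  assumes "Re s > 1"
  shows "LD s = - dseries (\<lambda>n. of_real (ln (real n)) * cm.logcoeff n) s"
    "(dseries cm.logcoeff has_field_derivative LD s) (at s)"
proof -
  define G' where "G' = - dseries (\<lambda>n. of_real (ln (real n)) * cm.logcoeff n) s"
  have G: "(dseries cm.logcoeff has_field_derivative G') (at s)"
    unfolding G'_def by (rule dseries_has_derivative[OF cm.conv_logcoeff assms])
  have "((\<lambda>s. exp (dseries cm.logcoeff s)) has_field_derivative exp (dseries cm.logcoeff s) * G') (at s)"
    by (rule DERIV_chain2[OF DERIV_exp G])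
  then have "(dseries f has_field_derivative exp (dseries cm.logcoeff s) * G') (at s)"
    by (rule has_field_derivative_transform_within_open[OF _ open_halfspace_Re_gt[of 1]])
       (use assms cm.exp_dseries_logcoeff in auto)
  then have "deriv (dseries f) s = dseries f s * G'"
    using cm.exp_dseries_logcoeff[OF assms] by (simp add: DERIV_imp_deriv)
  then have "LD s = G'" using dseries_f_nonzero[of s] assms by (simp add: LD_def)
  then show "LD s = - dseries (\<lambda>n. of_real (ln (real n)) * cm.logcoeff n) s"
    "(dseries cm.logcoeff has_field_derivative LD s) (at s)" using G by (auto simp: G'_def)
qed

lemma LD_bounded:
  assumes x: "x > 1"
  shows "\<exists>K\<ge>0. \<forall>s. Re s \<ge> x \<longrightarrow> norm (LD s) \<le> K"
proof -
  let ?b = "\<lambda>n. of_real (ln (real n)) * cm.logcoeff n"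
  have sm: "summable (\<lambda>n. norm (?b n) * real n powr (-x))"
    using abs_conv_beyond_ln[OF cm.conv_logcoeff] x unfolding abs_conv_beyond_def by blast
  have "norm (LD s) \<le> (\<Sum>n. norm (?b n) * real n powr (-x))" if "Re s \<ge> x" for s
  proof -
    have s: "Re s > 1" using that x by simp
    have "norm (LD s) = norm (\<Sum>n. ?b n * of_nat n powr (-s))" unfolding LD_right(1)[OF s] by (simp add: dseries_def)
    also have "\<dots> \<le> (\<Sum>n. norm (?b n) * real n powr (-x))"
    proof (rule norm_suminf_le[OF _ sm])
      fix n
      have "real n powr (- Re s) \<le> real n powr (-x)"
        using that by (cases "n = 0") (auto intro!: powr_mono)
      then show "norm (?b n * of_nat n powr (-s)) \<le> norm (?b n) * real n powr (-x)"
        unfolding norm_mult[of "?b n"] by (intro mult_left_mono) (simp_all add: norm_of_nat_powr)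
    qed
    finally show ?thesis .
  qed
  moreover have "(\<Sum>n. norm (?b n) * real n powr (-x)) \<ge> 0" by (rule suminf_nonneg[OF sm]) simp
  ultimately show ?thesis by blast
qed

lemma Xi_logderiv:
  assumes s: "Re s > 0" and nz: "dseries f s \<noteq> 0"
  shows "deriv Xi s / Xi s = - of_real (ln (pi / real N)) / 2 + Digamma ((s + of_nat \<kappa>) / 2) / 2 + LD s"
proof -
  define c where "c = complex_of_real (pi / real N)"
  define w where "w s = (s + of_nat \<kappa>) / (2 :: complex)" for s
  have c0: "c \<noteq> 0" unfolding c_def by (rule pi_N)
  have Lnc: "Ln c = of_real (ln (pi / real N))" unfolding c_def using N_pos by (intro Ln_of_real) simp
  have wn: "w s \<notin> \<int>\<^sub>\<le>\<^sub>0" using s by (intro not_nonpos_Int) (simp add: w_def)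
  have dw: "(w has_field_derivative 1 / 2) (at s)" unfolding w_def by (auto intro!: derivative_eq_intros)
  have D1: "((\<lambda>s. c powr (- (w s))) has_field_derivative Ln c * c powr (- (w s)) * (- (1 / 2))) (at s)"
    by (rule DERIV_chain2[OF _ DERIV_minus[OF dw]]) (rule has_field_derivative_powr_right[OF c0])
  have D2: "((\<lambda>s. Gamma (w s)) has_field_derivative Gamma (w s) * Digamma (w s) * (1 / 2)) (at s)"
    by (rule DERIV_chain2[OF _ dw]) (rule has_field_derivative_Gamma[OF wn])
  have "(Xi has_field_derivative (Ln c * c powr (- (w s)) * (- (1 / 2)) * Gamma (w s) +
      Gamma (w s) * Digamma (w s) * (1 / 2) * c powr (- (w s))) * dseries f s +
      deriv (dseries f) s * (c powr (- (w s)) * Gamma (w s))) (at s)"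
    by (rule has_field_derivative_transform_within_open[OF DERIV_mult[OF DERIV_mult[OF D1 D2] dseries_f_deriv[OF s]]
          open_halfspace_Re_gt[of 0]]) (use s Xi_eq in \<open>auto simp: c_def w_def\<close>)
  then have "deriv Xi s = (Ln c * c powr (- (w s)) * (- (1 / 2)) * Gamma (w s) +
      Gamma (w s) * Digamma (w s) * (1 / 2) * c powr (- (w s))) * dseries f s +
      deriv (dseries f) s * (c powr (- (w s)) * Gamma (w s))" by (rule DERIV_imp_deriv)
  moreover have "Xi s = c powr (- (w s)) * Gamma (w s) * dseries f s" using Xi_eq[OF s] by (simp add: c_def w_def)
  moreover have "c powr (- (w s)) \<noteq> 0" "Gamma (w s) \<noteq> 0" using c0 wn by (auto simp: Gamma_eq_zero_iff)
  ultimately show ?thesis unfolding LD_def Lnc[symmetric] w_def[symmetric] using nz by (simp add: field_simps)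
qed

text \<open>By the Digamma estimate the only growing contribution of the Gamma factor is half the
  logarithm of the height; 16 and 3 + |H| compare |z| with 2 + |t|. The constant is uniform in h <=
  H, as the approach to h = 1/2 demands.\<close>

lemma dphase_bound:
  "\<exists>C\<ge>0. \<forall>h t. 0 < h \<longrightarrow> h \<le> H \<longrightarrow> dseries f (ln_pt h t) \<noteq> 0 \<longrightarrow>
     \<bar>dphase h t - ln (2 + \<bar>t\<bar>) / 2 - Re (LD (ln_pt h t))\<bar> \<le> C"
proof -
  obtain C0 where C0: "C0 \<ge> 0" "\<And>z. Re z \<ge> 1 / 4 \<Longrightarrow> \<bar>Re (Digamma z) - ln (norm z)\<bar> \<le> C0"
    using Re_Digamma_bound by blast
  define C where "C = \<bar>ln (pi / real N)\<bar> + C0 + ln 16 + ln (3 + \<bar>H\<bar>)"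
  have "C \<ge> 0" using C0 by (simp add: C_def)
  moreover have "\<bar>dphase h t - ln (2 + \<bar>t\<bar>) / 2 - Re (LD (ln_pt h t))\<bar> \<le> C"
    if h: "0 < h" "h \<le> H" "dseries f (ln_pt h t) \<noteq> 0" for h t
  proof -
    define z where "z = (ln_pt h t + of_nat \<kappa>) / 2"
    have k: "real \<kappa> \<le> 1" by (simp add: kappa_def)
    have Rez: "Re z = (1 / 2 + h + real \<kappa>) / 2" and Imz: "Im z = t / 2" by (auto simp: z_def)
    have z1: "Re z \<ge> 1 / 4" using h Rez by simp
    have nz1: "norm z \<ge> 1 / 4" using abs_Re_le_cmod[of z] z1 by linarith
    have "norm z \<ge> \<bar>t\<bar> / 2" using abs_Im_le_cmod[of z] Imz by simp
    then have "2 + \<bar>t\<bar> \<le> 16 * norm z" using nz1 by linarith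
    then have "ln (2 + \<bar>t\<bar>) \<le> ln (16 * norm z)" using nz1 by (intro ln_mono) auto
    then have l1: "ln (2 + \<bar>t\<bar>) \<le> ln 16 + ln (norm z)" using nz1 by (subst (asm) ln_mult_pos) auto
    have "norm z \<le> \<bar>Re z\<bar> + \<bar>Im z\<bar>" by (rule cmod_le)
    also have "\<dots> \<le> (3 + \<bar>H\<bar>) + \<bar>t\<bar>" using h k Rez Imz by auto
    also have "\<dots> \<le> (3 + \<bar>H\<bar>) * (2 + \<bar>t\<bar>)" by (simp add: algebra_simps)
    finally have "ln (norm z) \<le> ln ((3 + \<bar>H\<bar>) * (2 + \<bar>t\<bar>))" using nz1 by (intro ln_mono) auto
    also have "\<dots> = ln (3 + \<bar>H\<bar>) + ln (2 + \<bar>t\<bar>)" by (intro ln_mult_pos) auto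
    finally have l2: "ln (norm z) \<le> ln (3 + \<bar>H\<bar>) + ln (2 + \<bar>t\<bar>)" .
    have l0: "ln 16 \<ge> (0::real)" "ln (3 + \<bar>H\<bar>) \<ge> 0" by auto
    have "dphase h t = - ln (pi / real N) / 2 + Re (Digamma z) / 2 + Re (LD (ln_pt h t))"
      unfolding dphase_def z_def using Xi_logderiv[OF _ h(3)] h(1) by simp
    then show ?thesis using C0(2)[OF z1] l0 l1 l2 C0(1) unfolding C_def by linarith
  qed
  ultimately show ?thesis by blast
qed

lemma good_dseries: "good h \<Longrightarrow> dseries f (ln_pt h t) \<noteq> 0"
  using good_nz[of h t] Xi_eq_0_iff[of "ln_pt h t"] by (auto simp: good_def)

lemma LD_continuous:
  assumes "h > - 1 / 2" "\<And>t. t \<in> S \<Longrightarrow> dseries f (ln_pt h t) \<noteq> 0"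
  shows "continuous_on S (\<lambda>t. LD (ln_pt h t))"
  unfolding LD_def
  by (intro continuous_on_divide continuous_on_compose2[OF dseries_f_continuous(1) continuous_ln_pt, of "{s. Re s > 0}"]
      continuous_on_compose2[OF dseries_f_continuous(2) continuous_ln_pt, of "{s. Re s > 0}"]) (use assms in auto)

text \<open>The bounded difference between the two integrands contributes O(T), which is absorbed by
  e T ln T.\<close>

lemma star_from_LD:
  assumes g: "good h" and e: "e > 0"
    and LD: "\<And>e. e > 0 \<Longrightarrow> \<forall>\<^sub>F T in at_top. integral {-T..T} (\<lambda>t. \<bar>Re (LD (ln_pt h t))\<bar>) \<le> e * T * ln T"
  shows "\<forall>\<^sub>F T in at_top. integral {-T..T} (\<lambda>t. \<bar>dphase h t - ln (2 + \<bar>t\<bar>) / 2\<bar>) \<le> e * T * ln T"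
proof -
  obtain C where C: "C \<ge> 0" "\<And>t. \<bar>dphase h t - ln (2 + \<bar>t\<bar>) / 2 - Re (LD (ln_pt h t))\<bar> \<le> C"
    using dphase_bound[of h] g good_dseries[OF g] unfolding good_def by blast
  have "filterlim (\<lambda>T::real. e * ln T) at_top at_top" using e by real_asymp
  then have "\<forall>\<^sub>F T::real in at_top. 4 * C \<le> e * ln T" unfolding filterlim_at_top by blast
  moreover have "\<forall>\<^sub>F T in at_top. integral {-T..T} (\<lambda>t. \<bar>Re (LD (ln_pt h t))\<bar>) \<le> e / 2 * T * ln T"
    using e by (intro LD) simp
  ultimately show ?thesis using eventually_ge_at_top[of 0]
  proof eventually_elim
    case (elim T)
    have c: "continuous_on {-T..T} (\<lambda>t. \<bar>Re (LD (ln_pt h t))\<bar>)"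
      using g good_dseries[OF g] by (intro continuous_intros LD_continuous) (auto simp: good_def)
    have "integral {-T..T} (\<lambda>t. \<bar>dphase h t - ln (2 + \<bar>t\<bar>) / 2\<bar>) \<le> integral {-T..T} (\<lambda>t. \<bar>Re (LD (ln_pt h t))\<bar> + C)"
    proof (rule integral_le)
      show "(\<lambda>t. \<bar>dphase h t - ln (2 + \<bar>t\<bar>) / 2\<bar>) integrable_on {-T..T}"
        using g by (intro integrable_continuous_real continuous_intros dphase_continuous) auto
      show "(\<lambda>t. \<bar>Re (LD (ln_pt h t))\<bar> + C) integrable_on {-T..T}"
        by (intro integrable_continuous_real continuous_on_add c continuous_on_const)
      show "\<bar>dphase h t - ln (2 + \<bar>t\<bar>) / 2\<bar> \<le> \<bar>Re (LD (ln_pt h t))\<bar> + C" for t using C(2)[of t] by linarith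
    qed
    also have "\<dots> = integral {-T..T} (\<lambda>t. \<bar>Re (LD (ln_pt h t))\<bar>) + 2 * T * C"
      using elim by (subst Henstock_Kurzweil_Integration.integral_add) (auto intro!: integrable_continuous_real c)
    also have "\<dots> \<le> e / 2 * T * ln T + T * (e * ln T / 2)"
      using elim mult_left_mono[of "2 * C" "e * ln T / 2" T] by (simp add: mult_ac)
    finally show ?case by (simp add: mult_ac)
  qed
qed

end

section \<open>The case under the Riemann hypothesis\<close>

lemma holomorphic_on_derivI:
  assumes "\<And>z. z \<in> S \<Longrightarrow> (g has_field_derivative g' z) (at z)"
  shows "g holomorphic_on S"
proof (rule holomorphic_onI)
  fix z assume "z \<in> S"
  from has_field_derivative_at_within[OF assms[OF this]] show "g field_differentiable at z within S"
    unfolding field_differentiable_def by (rule exI)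
qed

context prim_char
begin

lemma star_of_small_LD:
  assumes g: "good h"
    and small: "\<And>e. e > 0 \<Longrightarrow> \<exists>T0. \<forall>t. \<bar>t\<bar> \<ge> T0 \<longrightarrow> \<bar>Re (LD (ln_pt h t))\<bar> \<le> e * ln \<bar>t\<bar>"
    and e: "e > 0"
  shows "\<forall>\<^sub>F T in at_top. integral {-T..T} (\<lambda>t. \<bar>dphase h t - ln (2 + \<bar>t\<bar>) / 2\<bar>) \<le> e * T * ln T"
proof (rule star_from_LD[OF g e])
  fix e :: real assume e: "e > 0"
  obtain T0 where T0: "\<And>t. \<bar>t\<bar> \<ge> T0 \<Longrightarrow> \<bar>Re (LD (ln_pt h t))\<bar> \<le> e / 4 * ln \<bar>t\<bar>"
    using small[of "e / 4"] e by auto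
  have c: "continuous_on S (\<lambda>t. Re (LD (ln_pt h t)))" for S
    using g good_dseries[OF g] by (intro continuous_intros LD_continuous) (auto simp: good_def)
  define T1 where "T1 = max T0 1"
  have "compact ((\<lambda>t. Re (LD (ln_pt h t))) ` {-T1..T1})" by (intro compact_continuous_image c) simp
  from compact_imp_bounded[OF this] obtain B where B: "B > 0" "\<And>t. t \<in> {-T1..T1} \<Longrightarrow> \<bar>Re (LD (ln_pt h t))\<bar> \<le> B"
    by (auto simp: bounded_pos)
  have "filterlim (\<lambda>T::real. e / 4 * ln T) at_top at_top" using e by real_asymp
  then have "\<forall>\<^sub>F T::real in at_top. B \<le> e / 4 * ln T" unfolding filterlim_at_top by blast
  then show "\<forall>\<^sub>F T in at_top. integral {-T..T} (\<lambda>t. \<bar>Re (LD (ln_pt h t))\<bar>) \<le> e * T * ln T"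
    using eventually_ge_at_top[of 1]
  proof eventually_elim
    case (elim T)
    have le: "\<bar>Re (LD (ln_pt h t))\<bar> \<le> B + e / 4 * ln T" if t: "t \<in> {-T..T}" for t
    proof (cases "\<bar>t\<bar> \<le> T1")
      case True
      have "0 \<le> e / 4 * ln T" using e elim by simp
      with B(2)[of t] True show ?thesis by (simp add: abs_le_iff)
    next
      case False
      then have "ln \<bar>t\<bar> \<le> ln T" using t by (intro ln_mono) (auto simp: T1_def)
      then have "e / 4 * ln \<bar>t\<bar> \<le> e / 4 * ln T" using e by (intro mult_left_mono) auto
      moreover have "\<bar>Re (LD (ln_pt h t))\<bar> \<le> e / 4 * ln \<bar>t\<bar>" using False by (intro T0) (simp add: T1_def)
      ultimately show ?thesis using B(1) by linarith
    qed
    have "integral {-T..T} (\<lambda>t. \<bar>Re (LD (ln_pt h t))\<bar>) \<le> integral {-T..T} (\<lambda>t. B + e / 4 * ln T)"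
      by (intro integral_le integrable_continuous_real continuous_on_rabs c continuous_on_const le)
    also have "\<dots> = 2 * T * (B + e / 4 * ln T)" using elim by simp
    also have "\<dots> \<le> 2 * T * (e / 4 * ln T + e / 4 * ln T)" using elim by (intro mult_left_mono) auto
    finally show ?case by (simp add: mult_ac)
  qed
qed

text \<open>Here the line lies inside the region of absolute convergence, so L has no zeros there
  and L'/L is bounded.\<close>

lemma star_gt_half:
  assumes h: "h > 1 / 2" and e: "e > 0"
  shows "good h"
    "\<forall>\<^sub>F T in at_top. integral {-T..T} (\<lambda>t. \<bar>dphase h t - ln (2 + \<bar>t\<bar>) / 2\<bar>) \<le> e * T * ln T"
proof -
  have nz: "Xi s \<noteq> 0" if "Re s \<ge> 1 / 2 + h" for s
    using Xi_nonzero_right[of s] that h by simp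
  show g: "good h" unfolding good_def using h nz Xi_le_unconditional[of h] by auto
  obtain K where K: "K \<ge> 0" "\<And>s. Re s \<ge> 1 / 2 + h \<Longrightarrow> norm (LD s) \<le> K"
    using LD_bounded[of "1 / 2 + h"] h by auto
  show "\<forall>\<^sub>F T in at_top. integral {-T..T} (\<lambda>t. \<bar>dphase h t - ln (2 + \<bar>t\<bar>) / 2\<bar>) \<le> e * T * ln T"
  proof (rule star_of_small_LD[OF g _ e])
    fix e :: real assume e: "e > 0"
    have "\<bar>Re (LD (ln_pt h t))\<bar> \<le> e * ln \<bar>t\<bar>" if "\<bar>t\<bar> \<ge> exp (K / e)" for t
    proof -
      have "K / e \<le> ln \<bar>t\<bar>" using that ln_mono[of "exp (K / e)" "\<bar>t\<bar>"] by simp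
      then have "K \<le> e * ln \<bar>t\<bar>" using e by (simp add: divide_le_eq mult.commute)
      then show ?thesis using K(2)[of "ln_pt h t"] abs_Re_le_cmod[of "LD (ln_pt h t)"] by simp
    qed
    then show "\<exists>T0. \<forall>t. \<bar>t\<bar> \<ge> T0 \<longrightarrow> \<bar>Re (LD (ln_pt h t))\<bar> \<le> e * ln \<bar>t\<bar>" by blast
  qed
qed

lemma dseries_f_upper:
  assumes "Re s \<ge> 1 / 2" shows "norm (dseries f s) \<le> 2 * real N * (1 + norm s)"
proof -
  have "norm (dseries f s - (\<Sum>n=1..0. f n * of_nat n powr (-s))) \<le> real N * (2 + norm s / Re s) * real (Suc 0) powr (- Re s)"
    by (rule dseries_conditional(2)[OF f_partial]) (use assms in simp)
  then have "norm (dseries f s) \<le> real N * (2 + norm s / Re s)" by simp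
  also have "\<dots> \<le> real N * (2 + norm s / (1 / 2))" using assms by (intro mult_left_mono add_left_mono divide_left_mono) auto
  finally show ?thesis by (simp add: algebra_simps)
qed

context
  assumes RH: "riemann_hypothesis_L chi"
begin

lemma RH_nonzero:
  assumes "Re s > 1 / 2" shows "dseries f s \<noteq> 0"
proof (cases "Re s \<ge> 1")
  case False
  show ?thesis
  proof
    assume "dseries f s = 0"
    then have "dirichlet_L chi s = 0" using Lf_eq_dseries[of s] assms by (simp add: dirichlet_L_eq)
    then have "Re s = 1 / 2" using RH assms False unfolding riemann_hypothesis_L_def by simp
    then show False using assms by simp
  qed
qed (use dseries_f_nonzero in simp)

text \<open>The half-plane Re s > 1/2 is convex and free of zeros of L, so L'/L has a primitive.
  Normalising it at 2 makes it agree with the series logarithm.\<close>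

lemma RH_log:
  obtains g where "\<And>s. Re s > 1 / 2 \<Longrightarrow> (g has_field_derivative LD s) (at s)"
    "\<And>s. Re s > 1 / 2 \<Longrightarrow> norm (dseries f s) = exp (Re (g s))"
    "\<And>s. Re s > 1 \<Longrightarrow> g s = dseries cm.logcoeff s"
proof -
  define D where "D = {s::complex. Re s > 1 / 2}"
  have D: "open D" "convex D" unfolding D_def by (rule open_halfspace_Re_gt convex_halfspace_Re_gt)+
  have Dsub: "D \<subseteq> {s. Re s > 0}" by (auto simp: D_def)
  have hol: "dseries f holomorphic_on D" by (rule holomorphic_on_subset[OF dseries_f_holomorphic Dsub])
  have LDh: "LD holomorphic_on D"
    unfolding LD_def[abs_def] by (intro holomorphic_intros hol holomorphic_deriv D) (auto simp: D_def RH_nonzero)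
  have cD: "continuous_on D LD" by (rule holomorphic_on_imp_continuous_on[OF LDh])
  have fD: "LD field_differentiable at x" if "x \<in> interior D - {}" for x
    using that LDh D(1) holomorphic_on_imp_differentiable_at by (auto simp: interior_open)
  obtain g0 where g0: "\<And>s. s \<in> D \<Longrightarrow> (g0 has_field_derivative LD s) (at s within D)"
    by (rule holomorphic_convex_primitive[OF D(2) finite.emptyI cD fD]) (assumption, rule that, blast)
  define g where "g s = g0 s + (dseries cm.logcoeff 2 - g0 2)" for s
  have gd: "(g has_field_derivative LD s) (at s)" if "s \<in> D" for s
  proof -
    have "((\<lambda>s. g0 s + (dseries cm.logcoeff 2 - g0 2)) has_field_derivative LD s + 0) (at s within D)"
      by (rule DERIV_add[OF g0[OF that] DERIV_const])
    moreover have "g = (\<lambda>s. g0 s + (dseries cm.logcoeff 2 - g0 2))" by (simp add: g_def fun_eq_iff)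
    ultimately show ?thesis using at_within_open[OF that D(1)] by simp
  qed
  have 2: "g 2 = dseries cm.logcoeff 2" by (simp add: g_def)
  have gG: "g s = dseries cm.logcoeff s" if s: "Re s > 1" for s
  proof -
    have "\<exists>c. \<forall>s\<in>{s. Re s > 1}. g s - dseries cm.logcoeff s = c"
    proof (rule has_field_derivative_zero_constant[OF convex_halfspace_Re_gt])
      fix x :: complex assume x: "x \<in> {s. Re s > 1}"
      then have "((\<lambda>s. g s - dseries cm.logcoeff s) has_field_derivative LD x - LD x) (at x)"
        by (intro DERIV_diff gd LD_right) (auto simp: D_def)
      then show "((\<lambda>s. g s - dseries cm.logcoeff s) has_field_derivative 0) (at x within {s. Re s > 1})"
        by (simp add: has_field_derivative_at_within)
    qed
    then obtain c where c: "\<And>s. Re s > 1 \<Longrightarrow> g s - dseries cm.logcoeff s = c" by auto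
    show ?thesis using c[of 2] c[OF s] 2 by simp
  qed
  have gL: "norm (dseries f s) = exp (Re (g s))" if s: "s \<in> D" for s
  proof -
    have "\<exists>c. \<forall>s\<in>D. dseries f s * exp (- g s) = c"
    proof (rule has_field_derivative_zero_constant[OF D(2)])
      fix x :: complex assume x: "x \<in> D"
      have e: "((\<lambda>s. exp (- g s)) has_field_derivative exp (- g x) * (- LD x)) (at x)"
        by (rule DERIV_chain2[OF DERIV_exp DERIV_minus[OF gd[OF x]]])
      have "((\<lambda>s. dseries f s * exp (- g s)) has_field_derivative
          deriv (dseries f) x * exp (- g x) + exp (- g x) * (- LD x) * dseries f x) (at x)"
        by (rule DERIV_mult[OF dseries_f_deriv e]) (use x Dsub in auto)
      moreover have "LD x * dseries f x = deriv (dseries f) x" using x RH_nonzero[of x] by (simp add: LD_def D_def)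
      ultimately show "((\<lambda>s. dseries f s * exp (- g s)) has_field_derivative 0) (at x within D)"
        by (simp add: has_field_derivative_at_within mult.assoc)
    qed
    then obtain c where c: "\<And>s. s \<in> D \<Longrightarrow> dseries f s * exp (- g s) = c" by auto
    have "c = 1" using c[of 2] cm.exp_dseries_logcoeff[of 2] 2 dseries_f_nonzero[of 2] by (simp add: D_def exp_minus)
    then have "dseries f s = exp (g s)" using c[OF s] by (simp add: exp_minus field_simps)
    then show ?thesis by simp
  qed
  show ?thesis by (rule that[of g]) (use gd gL gG in \<open>auto simp: D_def\<close>)
qed

text \<open>The argument of the logarithm bounds |L| on the disc of radius 3/2 about 2 + it, by
  \<open>dseries_f_upper\<close>.\<close>

definition \<Lambda> :: "real \<Rightarrow> real" where "\<Lambda> t = ln (6 * real N * (2 + \<bar>t\<bar>))"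

lemma Lambda_ge_1: "\<Lambda> t \<ge> 1"
proof -
  have "exp 1 \<le> (6 * 1 * (2 + \<bar>t\<bar>) :: real)" using exp_le by simp
  also have "\<dots> \<le> 6 * real N * (2 + \<bar>t\<bar>)" using N_pos by (intro mult_right_mono mult_left_mono) auto
  finally show ?thesis unfolding \<Lambda>_def using ln_mono[of "exp 1" "6 * real N * (2 + \<bar>t\<bar>)"] by simp
qed

text \<open>Borel-Caratheodory on the disc of radius 3/2 about 2 + it, which touches the critical
  line. There Re log L = ln |L| is at most \<open>\<Lambda> t\<close>. Staying h/4 away from the
  boundary costs at most 6/h, and 2 * 3 * 6 = 36.\<close>

lemma RH_log_bound:
  assumes gd: "\<And>s. Re s > 1 / 2 \<Longrightarrow> (g has_field_derivative LD s) (at s)"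
    and gL: "\<And>s. Re s > 1 / 2 \<Longrightarrow> norm (dseries f s) = exp (Re (g s))"
    and gG: "\<And>s. Re s > 1 \<Longrightarrow> g s = dseries cm.logcoeff s"
    and h: "0 < h" "h < 1 / 2" and s: "norm (s - Complex 2 t) \<le> 3 / 2 - h / 4"
  shows "norm (g s) \<le> (1 + 36 / h) * \<Lambda> t"
proof -
  have sub: "Re z > 1 / 2" if "z \<in> ball (Complex 2 t) (3 / 2)" for z
    using that abs_Re_le_cmod[of "z - Complex 2 t"] by (simp add: dist_norm norm_minus_commute)
  have "norm (g s) \<le> 1 + 2 * (\<Lambda> t + 1 + 1) * ((3 / 2 - h / 4) / (3 / 2 - (3 / 2 - h / 4)))"
  proof (rule borel_caratheodory[OF _ _ _ _ _ _ s])
    show "g holomorphic_on ball (Complex 2 t) (3 / 2)"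
      by (rule holomorphic_on_derivI) (use gd sub in blast)
    show "Re (g z) \<le> \<Lambda> t" if z: "z \<in> ball (Complex 2 t) (3 / 2)" for z
    proof -
      have "norm z \<le> norm (z - Complex 2 t) + norm (Complex 2 t)" using norm_triangle_ineq[of "z - Complex 2 t" "Complex 2 t"] by simp
      moreover have "norm (Complex 2 t) \<le> 2 + \<bar>t\<bar>" using cmod_le[of "Complex 2 t"] by simp
      ultimately have "1 + norm z \<le> 3 * (2 + \<bar>t\<bar>)" using z by (simp add: dist_norm norm_minus_commute)
      then have "2 * real N * (1 + norm z) \<le> 2 * real N * (3 * (2 + \<bar>t\<bar>))" by (intro mult_left_mono) auto
      then have "norm (dseries f z) \<le> 6 * real N * (2 + \<bar>t\<bar>)"
        using dseries_f_upper[of z] sub[OF z] by (simp add: algebra_simps)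
      then have "exp (Re (g z)) \<le> 6 * real N * (2 + \<bar>t\<bar>)" using gL[OF sub[OF z]] by simp
      then show ?thesis unfolding \<Lambda>_def using ln_mono[of "exp (Re (g z))"] by simp
    qed
    have "norm (g (Complex 2 t)) \<le> logzeta 2" using gG[of "Complex 2 t"] cm.norm_dseries_logcoeff[of "Complex 2 t"] by simp
    also have "\<dots> \<le> ln (1 + 1 / (2 - 1))" by (rule logzeta_le) simp
    also have "\<dots> \<le> 1" using ln2_le_25_over_36 by simp
    finally show "norm (g (Complex 2 t)) \<le> 1" .
  qed (use h Lambda_ge_1[of t] in auto)
  also have "\<dots> \<le> \<Lambda> t + 2 * (3 * \<Lambda> t) * (6 / h)"
  proof (intro add_mono mult_mono)
    show "(3 / 2 - h / 4) / (3 / 2 - (3 / 2 - h / 4)) \<le> 6 / h" using h by (simp add: field_simps)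
  qed (use h Lambda_ge_1[of t] in auto)
  finally show ?thesis by (simp add: algebra_simps)
qed

text \<open>The bound for |log L| exponentiates to 1/|L| <= exp (m \<open>\<Lambda>\<close>), a
  polynomial of degree m in the height; the degree depends on h only. To the right of 2 the Euler
  product bounds 1/|L|.\<close>

lemma RH_good:
  assumes h: "0 < h" "h < 1 / 2"
  shows "good h"
proof -
  obtain g where g: "\<And>s. Re s > 1 / 2 \<Longrightarrow> (g has_field_derivative LD s) (at s)"
    "\<And>s. Re s > 1 / 2 \<Longrightarrow> norm (dseries f s) = exp (Re (g s))"
    "\<And>s. Re s > 1 \<Longrightarrow> g s = dseries cm.logcoeff s" using RH_log by blast
  define m where "m = nat \<lceil>1 + 36 / h\<rceil>"
  have m: "1 + 36 / h \<le> real m" by (simp add: m_def real_nat_ceiling_ge)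
  define B where "B = 2 * (12 * real N) ^ m"
  have N1: "real N \<ge> 1" using N_pos by simp
  have B2: "B \<ge> 2" unfolding B_def using one_le_power[of "12 * real N" m] N1 by simp
  have lower: "1 \<le> B * (1 + norm s) ^ m * norm (dseries f s)" if s: "Re s \<ge> 1 / 2 + h" for s
  proof (cases "Re s \<ge> 2")
    case True
    have "2 * 1 \<le> B * (1 + norm s) ^ m" using B2 by (intro mult_mono one_le_power) auto
    then have "2 * norm (dseries f s) \<le> B * (1 + norm s) ^ m * norm (dseries f s)" by (intro mult_right_mono) auto
    with norm_dseries_bounds(2)[OF True] show ?thesis by simp
  next
    case False
    define t where "t = Im s"
    have "s - Complex 2 t = of_real (Re s - 2)" by (simp add: complex_eq_iff t_def)
    then have "norm (s - Complex 2 t) = \<bar>Re s - 2\<bar>" by (simp only: norm_of_real)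
    also have "\<dots> \<le> 3 / 2 - h / 4" using False s h by simp
    finally have "norm (g s) \<le> (1 + 36 / h) * \<Lambda> t" by (intro RH_log_bound g h)
    also have "\<dots> \<le> real m * \<Lambda> t" using m Lambda_ge_1[of t] by (intro mult_right_mono) auto
    finally have "- Re (g s) \<le> real m * \<Lambda> t" using abs_Re_le_cmod[of "g s"] by linarith
    then have "exp (- Re (g s)) \<le> exp (\<Lambda> t) ^ m" by (simp flip: exp_of_nat_mult)
    also have "exp (\<Lambda> t) = 6 * real N * (2 + \<bar>t\<bar>)" using N_pos by (simp add: \<Lambda>_def)
    also have "\<dots> ^ m \<le> (12 * real N * (1 + norm s)) ^ m"
    proof (rule power_mono)
      have "2 + \<bar>t\<bar> \<le> 2 * (1 + norm s)" using abs_Im_le_cmod[of s] by (simp add: t_def)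
      then have "6 * real N * (2 + \<bar>t\<bar>) \<le> 6 * real N * (2 * (1 + norm s))" by (intro mult_left_mono) auto
      then show "6 * real N * (2 + \<bar>t\<bar>) \<le> 12 * real N * (1 + norm s)" by (simp add: algebra_simps)
    qed simp
    also have "\<dots> \<le> B * (1 + norm s) ^ m" unfolding B_def power_mult_distrib by simp
    finally have "exp (- Re (g s)) \<le> B * (1 + norm s) ^ m" .
    then have "exp (- Re (g s)) * norm (dseries f s) \<le> B * (1 + norm s) ^ m * norm (dseries f s)" by (intro mult_right_mono) auto
    then show ?thesis using g(2)[of s] s h by (simp flip: exp_add)
  qed
  have nz: "Xi s \<noteq> 0" if "Re s \<ge> 1 / 2 + h" for s
    using RH_nonzero[of s] Xi_eq_0_iff[of s] that h by simp
  show ?thesis unfolding good_def using h nz Xi_le_of_growth[OF h(1) nz lower] by blast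
qed

text \<open>Cauchy's inequality alone gives L'/L = O(ln t), which is not small enough. Interpolating
  with the region Re s >= 3/2, where L'/L is bounded, makes the coefficient of ln t arbitrarily
  small.\<close>

lemma RH_star:
  assumes h: "0 < h" "h < 1 / 2" and e: "e > 0"
  shows "\<forall>\<^sub>F T in at_top. integral {-T..T} (\<lambda>t. \<bar>dphase h t - ln (2 + \<bar>t\<bar>) / 2\<bar>) \<le> e * T * ln T"
proof (rule star_of_small_LD[OF RH_good[OF h] _ e])
  fix e :: real assume e: "e > 0"
  obtain g where g: "\<And>s. Re s > 1 / 2 \<Longrightarrow> (g has_field_derivative LD s) (at s)"
    "\<And>s. Re s > 1 / 2 \<Longrightarrow> norm (dseries f s) = exp (Re (g s))"
    "\<And>s. Re s > 1 \<Longrightarrow> g s = dseries cm.logcoeff s" using RH_log by blast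
  define K where "K = (1 + 36 / h) / (h / 4)"
  have K: "K > 0" using h by (simp add: K_def add_pos_pos)
  obtain K1 where K1: "K1 \<ge> 0" "\<And>s. Re s \<ge> 3 / 2 \<Longrightarrow> norm (LD s) \<le> K1" using LD_bounded[of "3 / 2"] by auto
  \<comment> \<open>All discs have centre 2 + it: the point on the line of the phase is at distance
    3/2 - h, and L'/L is bounded by K \<open>\<Lambda>\<close> up to 3/2 - h/2. The latter follows
    from Cauchy's inequality with radius h/4 and the bound for log L up to 3/2 - h/4. On the disc of
    radius 1/2 the bound is \<open>K1\<close>.\<close>
  have "\<exists>C\<ge>0. \<forall>F s0 z M. F holomorphic_on ball s0 (3 / 2 - h / 2) \<longrightarrow> continuous_on (cball s0 (3 / 2 - h / 2)) F \<longrightarrow>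
     (\<forall>s\<in>cball s0 (1 / 2). norm (F s) \<le> K1) \<longrightarrow> (\<forall>s\<in>cball s0 (3 / 2 - h / 2). norm (F s) \<le> M) \<longrightarrow> norm (z - s0) \<le> 3 / 2 - h \<longrightarrow>
     norm (F z) \<le> C + e / 2 / K * M"
    by (rule two_discs_bound) (use h e K K1(1) in auto)
  then obtain C where C: "\<forall>F s0 z M. F holomorphic_on ball s0 (3 / 2 - h / 2) \<longrightarrow> continuous_on (cball s0 (3 / 2 - h / 2)) F \<longrightarrow>
     (\<forall>s\<in>cball s0 (1 / 2). norm (F s) \<le> K1) \<longrightarrow> (\<forall>s\<in>cball s0 (3 / 2 - h / 2). norm (F s) \<le> M) \<longrightarrow> norm (z - s0) \<le> 3 / 2 - h \<longrightarrow>
     norm (F z) \<le> C + e / 2 / K * M" by (elim exE conjE)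
  have C': "norm (F z) \<le> C + e / 2 / K * M"
    if "F holomorphic_on ball s0 (3 / 2 - h / 2)" "continuous_on (cball s0 (3 / 2 - h / 2)) F"
      "\<forall>s\<in>cball s0 (1 / 2). norm (F s) \<le> K1" "\<forall>s\<in>cball s0 (3 / 2 - h / 2). norm (F s) \<le> M" "norm (z - s0) \<le> 3 / 2 - h"
    for F s0 z M using C that by blast
  define D where "D = {s::complex. Re s > 1 / 2}"
  have D: "open D" unfolding D_def by (rule open_halfspace_Re_gt)
  have gh: "g holomorphic_on D"
    by (rule holomorphic_on_derivI) (use g(1) in \<open>simp add: D_def\<close>)
  have LDg: "LD s = deriv g s" if "s \<in> D" for s using DERIV_imp_deriv[OF g(1)] that by (simp add: D_def)
  have LDh: "LD holomorphic_on D" by (rule holomorphic_transform[OF holomorphic_deriv[OF gh D]]) (simp add: LDg)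
  have bd: "norm (LD (ln_pt h t)) \<le> C + e / 2 * \<Lambda> t" for t
  proof -
    have Dsub: "cball (Complex 2 t) r \<subseteq> D" if "r < 3 / 2" for r
    proof
      fix z assume "z \<in> cball (Complex 2 t) r"
      then show "z \<in> D" using that abs_Re_le_cmod[of "z - Complex 2 t"] by (simp add: D_def dist_norm norm_minus_commute)
    qed
    have "norm (LD (ln_pt h t)) \<le> C + e / 2 / K * (K * \<Lambda> t)"
    proof (rule C'[of LD "Complex 2 t"])
      show "LD holomorphic_on ball (Complex 2 t) (3 / 2 - h / 2)"
        by (rule holomorphic_on_subset[OF LDh order_trans[OF ball_subset_cball Dsub]]) (use h in simp)
      show "continuous_on (cball (Complex 2 t) (3 / 2 - h / 2)) LD"
        by (rule continuous_on_subset[OF holomorphic_on_imp_continuous_on[OF LDh] Dsub]) (use h in simp)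
      show "\<forall>s\<in>cball (Complex 2 t) (1 / 2). norm (LD s) \<le> K1"
      proof
        fix s assume "s \<in> cball (Complex 2 t) (1 / 2)"
        then show "norm (LD s) \<le> K1" using abs_Re_le_cmod[of "s - Complex 2 t"]
          by (intro K1) (simp add: dist_norm norm_minus_commute)
      qed
      show "\<forall>s\<in>cball (Complex 2 t) (3 / 2 - h / 2). norm (LD s) \<le> K * \<Lambda> t"
      proof
        fix s assume s: "s \<in> cball (Complex 2 t) (3 / 2 - h / 2)"
        have sub: "cball s (h / 4) \<subseteq> cball (Complex 2 t) (3 / 2 - h / 4)"
          using s h by (intro cball_subset_cball_iff[THEN iffD2]) (auto simp: dist_commute)
        then have sD: "cball s (h / 4) \<subseteq> D" using Dsub[of "3 / 2 - h / 4"] h by auto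
        have "norm ((deriv ^^ 1) g s) \<le> fact 1 * ((1 + 36 / h) * \<Lambda> t) / (h / 4) ^ 1"
        proof (rule Cauchy_inequality)
          show "g holomorphic_on ball s (h / 4)" by (rule holomorphic_on_subset[OF gh order_trans[OF ball_subset_cball sD]])
          show "continuous_on (cball s (h / 4)) g"
            by (rule continuous_on_subset[OF holomorphic_on_imp_continuous_on[OF gh] sD])
          fix x assume "norm (s - x) = h / 4"
          then have "x \<in> cball (Complex 2 t) (3 / 2 - h / 4)" using sub by (auto simp: dist_norm)
          then show "norm (g x) \<le> (1 + 36 / h) * \<Lambda> t"
            by (intro RH_log_bound g h) (simp_all add: dist_norm norm_minus_commute)
        qed (use h in simp)
        moreover have "s \<in> D" using sD h by auto
        ultimately show "norm (LD s) \<le> K * \<Lambda> t" using LDg[of s] h by (simp add: K_def field_simps)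
      qed
      have "ln_pt h t - Complex 2 t = of_real (h - 3 / 2)" by (simp add: complex_eq_iff)
      then have "norm (ln_pt h t - Complex 2 t) = \<bar>h - 3 / 2\<bar>" by (simp only: norm_of_real)
      then show "norm (ln_pt h t - Complex 2 t) \<le> 3 / 2 - h" using h by simp
    qed
    then show ?thesis using K by simp
  qed
  define X where "X = 2 / e * (C + e / 2 * ln (12 * real N))"
  have "\<bar>Re (LD (ln_pt h t))\<bar> \<le> e * ln \<bar>t\<bar>" if t: "\<bar>t\<bar> \<ge> max 2 (exp X)" for t
  proof -
    have "X \<le> ln \<bar>t\<bar>" using t ln_mono[of "exp X" "\<bar>t\<bar>"] by simp
    then have 1: "C + e / 2 * ln (12 * real N) \<le> e / 2 * ln \<bar>t\<bar>" using e by (simp add: X_def field_simps)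
    have "6 * real N * (2 + \<bar>t\<bar>) \<le> 6 * real N * (2 * \<bar>t\<bar>)" using t by (intro mult_left_mono) auto
    then have "\<Lambda> t \<le> ln (12 * real N * \<bar>t\<bar>)" unfolding \<Lambda>_def using N_pos by (intro ln_mono) auto
    also have "\<dots> = ln (12 * real N) + ln \<bar>t\<bar>" using N_pos t by (intro ln_mult_pos) auto
    finally have "e / 2 * \<Lambda> t \<le> e / 2 * (ln (12 * real N) + ln \<bar>t\<bar>)" using e by (intro mult_left_mono) auto
    then have "C + e / 2 * \<Lambda> t \<le> e * ln \<bar>t\<bar>" using 1 by (simp add: algebra_simps)
    then show ?thesis using bd[of t] abs_Re_le_cmod[of "LD (ln_pt h t)"] by linarith
  qed
  then show "\<exists>T0. \<forall>t. \<bar>t\<bar> \<ge> T0 \<longrightarrow> \<bar>Re (LD (ln_pt h t))\<bar> \<le> e * ln \<bar>t\<bar>" by blast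
qed

end

end

section \<open>The case of shift one half\<close>

lemma sum_inverse_le_ln:
  assumes "Y \<ge> 1" shows "(\<Sum>k=1..Y. 1 / real k) \<le> 1 + ln (real Y)"
  using assms
proof (induction Y rule: dec_induct)
  case (step n)
  have "ln (real n / real (Suc n)) \<le> real n / real (Suc n) - 1"
    using step by (intro ln_le_minus_one) auto
  also have "\<dots> = - (1 / real (Suc n))" by (simp add: field_simps)
  also have "ln (real n / real (Suc n)) = ln (real n) - ln (real (Suc n))" using step by (intro ln_divide_pos) auto
  finally have "1 / real (Suc n) \<le> ln (real (Suc n)) - ln (real n)" by linarith
  then show ?case using step by simp
qed simp

lemma integral_cis_bound:
  assumes c: "c \<noteq> 0"
  shows "((\<lambda>t. cis (c * t)) has_integral integral {a..b} (\<lambda>t. cis (c * t))) {a..b}"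
    "norm (integral {a..b} (\<lambda>t. cis (c * t))) \<le> 2 / \<bar>c\<bar>"
proof -
  show "((\<lambda>t. cis (c * t)) has_integral integral {a..b} (\<lambda>t. cis (c * t))) {a..b}"
    by (intro integrable_integral integrable_continuous_real continuous_intros)
  show "norm (integral {a..b} (\<lambda>t. cis (c * t))) \<le> 2 / \<bar>c\<bar>"
  proof (cases "a \<le> b")
    case True
    have "((\<lambda>t. cis (c * t)) has_integral (cis (c * b) / (\<i> * of_real c) - cis (c * a) / (\<i> * of_real c))) {a..b}"
    proof (rule fundamental_theorem_of_calculus[OF True])
      fix t
      from has_vector_derivative_divide[OF cis_has_vector_derivative[of c t "{a..b}"], of "\<i> * of_real c"] c
      show "((\<lambda>t. cis (c * t) / (\<i> * of_real c)) has_vector_derivative cis (c * t)) (at t within {a..b})" by simp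
    qed
    then have "integral {a..b} (\<lambda>t. cis (c * t)) = (cis (c * b) - cis (c * a)) / (\<i> * of_real c)"
      by (simp add: integral_unique diff_divide_distrib)
    then have "norm (integral {a..b} (\<lambda>t. cis (c * t))) = norm (cis (c * b) - cis (c * a)) / \<bar>c\<bar>"
      by (simp add: norm_divide norm_mult)
    also have "\<dots> \<le> 2 / \<bar>c\<bar>"
      using norm_triangle_ineq4[of "cis (c * b)" "cis (c * a)"] by (intro divide_right_mono) auto
    finally show ?thesis .
  qed simp
qed

text \<open>From ln x <= x - 1 at the quotient of the smaller by the larger index. One of the
  summands on the right would do in each order; keeping both makes the bound symmetric and ready for
  summation over pairs.\<close>

lemma inverse_ln_diff_le:
  assumes "m \<ge> 1" "n \<ge> 1" "m \<noteq> n"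
  shows "1 / (real m * real n) * (1 / \<bar>ln (real m) - ln (real n)\<bar>) \<le> (1 / real m + 1 / real n) * (1 / \<bar>real m - real n\<bar>)"
proof -
  have less: "1 / (real m * real n) * (1 / \<bar>ln (real m) - ln (real n)\<bar>) \<le> 1 / real m * (1 / \<bar>real m - real n\<bar>)"
    if "m < n" "m \<ge> 1" for m n :: nat
  proof -
    have "ln (real m / real n) \<le> real m / real n - 1" using that by (intro ln_le_minus_one) auto
    moreover have "ln (real m / real n) = ln (real m) - ln (real n)" using that by (intro ln_divide_pos) auto
    ultimately have "1 - real m / real n \<le> \<bar>ln (real m) - ln (real n)\<bar>" by linarith
    then have l: "(real n - real m) / real n \<le> \<bar>ln (real m) - ln (real n)\<bar>" using that by (simp add: diff_divide_distrib)
    have "1 / \<bar>ln (real m) - ln (real n)\<bar> \<le> 1 / ((real n - real m) / real n)"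
      using that by (intro divide_left_mono l mult_pos_pos less_le_trans[OF _ l]) auto
    then have "1 / (real m * real n) * (1 / \<bar>ln (real m) - ln (real n)\<bar>) \<le> 1 / (real m * real n) * (1 / ((real n - real m) / real n))"
      by (intro mult_left_mono) auto
    also have "\<dots> = 1 / real m * (1 / \<bar>real m - real n\<bar>)" using that by (simp add: field_simps)
    finally show ?thesis .
  qed
  have p: "1 / real m * (1 / \<bar>real m - real n\<bar>) \<ge> 0" "1 / real n * (1 / \<bar>real m - real n\<bar>) \<ge> 0" by auto
  consider "m < n" | "n < m" using assms by linarith
  then show ?thesis
  proof cases
    case 1 then show ?thesis using less[OF 1 assms(1)] p unfolding distrib_right by linarith
  next
    case 2
    have "1 / (real m * real n) * (1 / \<bar>ln (real m) - ln (real n)\<bar>) \<le> 1 / real n * (1 / \<bar>real m - real n\<bar>)"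
      using less[OF 2] assms by (simp only: abs_minus_commute mult.commute[of "real m"])
    then show ?thesis using p unfolding distrib_right by linarith
  qed
qed

lemma sum_inverse_dist_le:
  assumes m: "m \<in> {1..Y}"
  shows "(\<Sum>n\<in>{1..Y}. if n = m then 0 else 1 / \<bar>real m - real n\<bar>) \<le> 2 * (\<Sum>k=1..Y. 1 / real k)"
proof -
  have split: "{1..Y} = {1..<m} \<union> ({m} \<union> {m<..Y})" using m by auto
  have "(\<Sum>n\<in>{1..Y}. if n = m then 0 else 1 / \<bar>real m - real n\<bar>)
      = (\<Sum>n\<in>{1..<m}. if n = m then 0 else 1 / \<bar>real m - real n\<bar>) + (\<Sum>n\<in>{m} \<union> {m<..Y}. if n = m then 0 else 1 / \<bar>real m - real n\<bar>)"
    by (subst split, rule sum.union_disjoint) auto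
  also have "(\<Sum>n\<in>{m} \<union> {m<..Y}. if n = m then 0 else 1 / \<bar>real m - real n\<bar>) = (\<Sum>n\<in>{m<..Y}. if n = m then 0 else 1 / \<bar>real m - real n\<bar>)"
    by simp
  also have "\<dots> = (\<Sum>k\<in>{1..Y - m}. 1 / real k)"
    by (rule sum.reindex_bij_witness[of _ "\<lambda>k. k + m" "\<lambda>n. n - m"]) (auto simp: of_nat_diff)
  also have "\<dots> \<le> (\<Sum>k=1..Y. 1 / real k)" by (rule sum_mono2) auto
  also have "(\<Sum>n\<in>{1..<m}. if n = m then 0 else 1 / \<bar>real m - real n\<bar>) = (\<Sum>k\<in>{1..<m}. 1 / real k)"
    by (rule sum.reindex_bij_witness[of _ "\<lambda>k. m - k" "\<lambda>n. m - n"]) (auto simp: of_nat_diff)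
  also have "\<dots> \<le> (\<Sum>k=1..Y. 1 / real k)" using m by (intro sum_mono2) auto
  finally show ?thesis by simp
qed

text \<open>Diagonal pairs contribute the length 2T. The integral over an off-diagonal pair is at
  most 2 / |ln m - ln n| for every T, and these bounds add up to a square of a harmonic sum. For Y
  of order T^2 this is a power of ln T, negligible against T.\<close>

lemma mean_square_dirichlet_polynomial:
  fixes b :: "nat \<Rightarrow> complex"
  assumes T: "T \<ge> 0" and K: "K \<ge> 0" and b: "\<And>n. n \<in> {1..Y} \<Longrightarrow> norm (b n) \<le> K / real n"
  defines "H \<equiv> \<Sum>k=1..Y. 1 / real k"
  shows "integral {-T..T} (\<lambda>t. (norm (\<Sum>n=1..Y. b n * cis (- (ln (real n) * t))))\<^sup>2)
     \<le> 2 * T * (\<Sum>n=1..Y. (norm (b n))\<^sup>2) + 8 * K\<^sup>2 * H\<^sup>2"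
proof -
  define I where "I n m = integral {-T..T} (\<lambda>t. cis ((ln (real m) - ln (real n)) * t))" for n m
  let ?S = "\<lambda>t. \<Sum>n=1..Y. b n * cis (- (ln (real n) * t))"
  have I: "((\<lambda>t. cis ((ln (real m) - ln (real n)) * t)) has_integral I n m) {-T..T}" for n m
    unfolding I_def by (intro integrable_integral integrable_continuous_real continuous_intros)
  have sq: "complex_of_real ((norm (?S t))\<^sup>2) = (\<Sum>n=1..Y. \<Sum>m=1..Y. b n * cnj (b m) * cis ((ln (real m) - ln (real n)) * t))" for t
  proof -
    have "complex_of_real ((norm (?S t))\<^sup>2) = ?S t * cnj (?S t)" by (rule complex_norm_square)
    also have "\<dots> = (\<Sum>n=1..Y. \<Sum>m=1..Y. (b n * cis (- (ln (real n) * t))) * cnj (b m * cis (- (ln (real m) * t))))"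
      by (simp only: cnj_sum sum_product)
    also have "\<dots> = (\<Sum>n=1..Y. \<Sum>m=1..Y. b n * cnj (b m) * cis ((ln (real m) - ln (real n)) * t))"
    proof (intro sum.cong refl)
      fix n m
      have "cis (- (ln (real n) * t)) * cis (ln (real m) * t) = cis ((ln (real m) - ln (real n)) * t)"
        by (simp add: cis_mult algebra_simps)
      then show "(b n * cis (- (ln (real n) * t))) * cnj (b m * cis (- (ln (real m) * t))) = b n * cnj (b m) * cis ((ln (real m) - ln (real n)) * t)"
        by (simp add: cis_cnj mult_ac)
    qed
    finally show ?thesis .
  qed
  have "((\<lambda>t. complex_of_real ((norm (?S t))\<^sup>2)) has_integral (\<Sum>n=1..Y. \<Sum>m=1..Y. b n * cnj (b m) * I n m)) {-T..T}"
    unfolding sq by (intro has_integral_sum has_integral_mult_right I finite_atLeastAtMost)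
  from has_integral_linear[OF this bounded_linear_Re]
  have "integral {-T..T} (\<lambda>t. (norm (?S t))\<^sup>2) = Re (\<Sum>n=1..Y. \<Sum>m=1..Y. b n * cnj (b m) * I n m)"
    by (simp add: o_def integral_unique del: of_real_power)
  also have "\<dots> \<le> norm (\<Sum>n=1..Y. \<Sum>m=1..Y. b n * cnj (b m) * I n m)" by (rule complex_Re_le_cmod)
  also have "\<dots> \<le> (\<Sum>n=1..Y. \<Sum>m=1..Y. norm (b n * cnj (b m) * I n m))"
    by (intro order_trans[OF norm_sum] sum_mono) auto
  also define d where "d n m = (if m = n then 0 else 1 / \<bar>real n - real m\<bar>)" for n m :: nat
  have "(\<Sum>n=1..Y. \<Sum>m=1..Y. norm (b n * cnj (b m) * I n m)) \<le>
      (\<Sum>n=1..Y. \<Sum>m=1..Y. (if m = n then 2 * T * (norm (b n))\<^sup>2 else 0) + 2 * K\<^sup>2 * (1 / real n * d n m + 1 / real m * d n m))"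
  proof (intro sum_mono)
    fix n m assume nm: "n \<in> {1..Y}" "m \<in> {1..Y}"
    show "norm (b n * cnj (b m) * I n m) \<le> (if m = n then 2 * T * (norm (b n))\<^sup>2 else 0) + 2 * K\<^sup>2 * (1 / real n * d n m + 1 / real m * d n m)"
    proof (cases "m = n")
      case True
      then show ?thesis using T by (simp add: I_def d_def norm_mult power2_eq_square)
    next
      case False
      have ne: "ln (real m) - ln (real n) \<noteq> 0" using nm False by simp
      have "norm (b n * cnj (b m) * I n m) = norm (b n) * norm (b m) * norm (I n m)" by (simp add: norm_mult)
      also have "\<dots> \<le> (K / real n) * (K / real m) * (2 / \<bar>ln (real m) - ln (real n)\<bar>)"
        unfolding I_def using K by (intro mult_mono b nm integral_cis_bound(2)[OF ne]) auto
      also have "\<dots> = 2 * K\<^sup>2 * (1 / (real m * real n) * (1 / \<bar>ln (real m) - ln (real n)\<bar>))"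
        by (simp add: power2_eq_square mult_ac)
      also have "\<dots> \<le> 2 * K\<^sup>2 * ((1 / real m + 1 / real n) * (1 / \<bar>real m - real n\<bar>))"
        using nm False by (intro mult_left_mono inverse_ln_diff_le) auto
      also have "\<dots> = 2 * K\<^sup>2 * (1 / real n * d n m + 1 / real m * d n m)"
        using False by (simp add: d_def abs_minus_commute algebra_simps)
      finally show ?thesis using False by simp
    qed
  qed
  also have "\<dots> = 2 * T * (\<Sum>n=1..Y. (norm (b n))\<^sup>2) + 2 * K\<^sup>2 * ((\<Sum>n=1..Y. 1 / real n * (\<Sum>m=1..Y. d n m)) + (\<Sum>n=1..Y. \<Sum>m=1..Y. 1 / real m * d n m))"
    by (simp add: sum.distrib sum_distrib_left distrib_left)
  also have "(\<Sum>n=1..Y. \<Sum>m=1..Y. 1 / real m * d n m) = (\<Sum>n=1..Y. 1 / real n * (\<Sum>m=1..Y. d n m))"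
  proof -
    have "(\<Sum>n=1..Y. \<Sum>m=1..Y. 1 / real m * d n m) = (\<Sum>m=1..Y. \<Sum>n=1..Y. 1 / real m * d n m)" by (rule sum.swap)
    also have "\<dots> = (\<Sum>m=1..Y. 1 / real m * (\<Sum>n=1..Y. d m n))"
      unfolding sum_distrib_left
    proof (intro sum.cong refl)
      fix n m
      have "d n m = d m n" by (auto simp: d_def abs_minus_commute)
      then show "1 / real m * d n m = 1 / real m * d m n" by (rule arg_cong)
    qed
    finally show ?thesis .
  qed
  also have "2 * T * (\<Sum>n=1..Y. (norm (b n))\<^sup>2) + 2 * K\<^sup>2 * ((\<Sum>n=1..Y. 1 / real n * (\<Sum>m=1..Y. d n m)) + (\<Sum>n=1..Y. 1 / real n * (\<Sum>m=1..Y. d n m)))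
      \<le> 2 * T * (\<Sum>n=1..Y. (norm (b n))\<^sup>2) + 2 * K\<^sup>2 * (H * (2 * H) + H * (2 * H))"
  proof -
    have "(\<Sum>n=1..Y. 1 / real n * (\<Sum>m=1..Y. d n m)) \<le> (\<Sum>n=1..Y. 1 / real n * (2 * H))"
      using sum_inverse_dist_le unfolding d_def H_def by (intro sum_mono mult_left_mono) auto
    also have "\<dots> = H * (2 * H)" by (simp add: H_def sum_distrib_right)
    finally show ?thesis by (intro add_left_mono mult_left_mono add_mono) auto
  qed
  finally show ?thesis by (simp add: power2_eq_square algebra_simps)
qed

lemma sum_ln_over_n_bounded: "\<exists>D\<ge>0. \<forall>Y. (\<Sum>n=1..Y. (ln (real n) / real n)\<^sup>2) \<le> D"
proof -
  have le: "(ln (real n) / real n)\<^sup>2 \<le> 16 * real n powr (-3/2)" for n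
  proof (cases "n = 0")
    case False
    then have "ln (real n) \<le> real n powr (1 / 4) / (1 / 4)" by (intro ln_powr_bound) auto
    then have "ln (real n) / real n \<le> 4 * real n powr (1 / 4) / real n" by (intro divide_right_mono) auto
    then have "(ln (real n) / real n)\<^sup>2 \<le> (4 * real n powr (1 / 4) / real n)\<^sup>2" using False by (intro power_mono) auto
    also have "\<dots> = 16 * (real n powr (1 / 4))\<^sup>2 / (real n)\<^sup>2" by (simp add: power_divide power_mult_distrib)
    also have "(real n powr (1 / 4))\<^sup>2 = real n powr (1 / 2)" by (simp add: power2_eq_square flip: powr_add)
    also have "16 * real n powr (1 / 2) / (real n)\<^sup>2 = 16 * (real n powr (1 / 2) / real n powr 2)" using False by simp
    also have "real n powr (1 / 2) / real n powr 2 = real n powr (1 / 2 - 2)" by (rule powr_diff[symmetric])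
    also have "1 / 2 - 2 = (-3/2 :: real)" by simp
    finally show ?thesis .
  qed simp
  have sm: "summable (\<lambda>n. 16 * real n powr (-3/2))" by (intro summable_mult) (simp add: summable_real_powr_iff)
  have "(\<Sum>n=1..Y. (ln (real n) / real n)\<^sup>2) \<le> (\<Sum>n. 16 * real n powr (-3/2))" for Y
  proof -
    have "(\<Sum>n=1..Y. (ln (real n) / real n)\<^sup>2) \<le> (\<Sum>n=1..Y. 16 * real n powr (-3/2))" by (intro sum_mono le)
    also have "\<dots> \<le> (\<Sum>n. 16 * real n powr (-3/2))" by (rule sum_le_suminf[OF sm]) auto
    finally show ?thesis .
  qed
  moreover have "(\<Sum>n. 16 * real n powr (-3/2)) \<ge> 0" by (rule suminf_nonneg[OF sm]) simp
  ultimately show ?thesis by blast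
qed

context prim_char
begin

lemma nat_powr_Complex:
  "n \<ge> 1 \<Longrightarrow> of_nat n powr (- Complex \<sigma> t) = of_real (real n powr (-\<sigma>)) * cis (- (ln (real n) * t))"
proof -
  assume n: "n \<ge> 1"
  have "Ln (of_nat n) = of_real (ln (real n))" using n Ln_of_real[of "real n"] by simp
  then have "of_nat n powr (- Complex \<sigma> t) = exp (- Complex \<sigma> t * of_real (ln (real n)))" using n by (simp add: powr_def)
  also have "- Complex \<sigma> t * of_real (ln (real n)) = of_real (- \<sigma> * ln (real n)) + \<i> * of_real (- (ln (real n) * t))"
    by (simp add: complex_eq_iff)
  also have "exp \<dots> = of_real (exp (- \<sigma> * ln (real n))) * cis (- (ln (real n) * t))"
    unfolding exp_add cis_conv_exp exp_of_real ..
  finally show ?thesis using n by (simp add: powr_def)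
qed

text \<open>On the disc of radius 1/2 about s one has Re z >= 1/2, so the tail is O(T Y^(-1/2)),
  bounded for Y about T^2. Cauchy's inequality on this disc doubles the bound for the
  derivative.\<close>

lemma dirichlet_approx:
  assumes T: "T \<ge> 2" and \<sigma>: "1 < \<sigma>" "\<sigma> \<le> 2" and t: "\<bar>t\<bar> \<le> T" and Y: "Y = nat \<lceil>T\<^sup>2\<rceil>"
  shows "norm (dseries f (Complex \<sigma> t) - (\<Sum>n=1..Y. f n * of_real (real n powr (-\<sigma>)) * cis (- (ln (real n) * t)))) \<le> 6 * real N"
    "norm (deriv (dseries f) (Complex \<sigma> t) + (\<Sum>n=1..Y. f n * of_real (ln (real n) * real n powr (-\<sigma>)) * cis (- (ln (real n) * t)))) \<le> 12 * real N"
proof -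
  define R where "R z = dseries f z - (\<Sum>n=1..Y. f n * of_nat n powr (-z))" for z
  define s where "s = Complex \<sigma> t"
  have YT: "T\<^sup>2 \<le> real (Suc Y)" unfolding Y using real_nat_ceiling_ge[of "T\<^sup>2"] by linarith
  have Rb: "norm (R z) \<le> 6 * real N" if z: "norm (s - z) \<le> 1 / 2" for z
  proof -
    have Rez: "Re z \<ge> 1 / 2" using z abs_Re_le_cmod[of "s - z"] \<sigma> by (simp add: s_def)
    have "norm z \<le> norm s + norm (s - z)" using norm_triangle_ineq4[of s "s - z"] by simp
    also have "norm s \<le> 2 + T" using cmod_le[of s] \<sigma> t by (simp add: s_def)
    finally have nz: "norm z \<le> T + 3" using z by simp
    have "norm (R z) \<le> real N * (2 + norm z / Re z) * real (Suc Y) powr (- Re z)"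
      unfolding R_def by (rule dseries_conditional(2)[OF f_partial]) (use Rez in simp)
    also have "\<dots> \<le> real N * (2 + (T + 3) / (1 / 2)) * (1 / T)"
    proof (intro mult_mono add_mono frac_le)
      have "real (Suc Y) powr (- Re z) \<le> real (Suc Y) powr (- (1 / 2))" using Rez by (intro powr_mono) auto
      also have "\<dots> \<le> (T\<^sup>2) powr (- (1 / 2))" using YT T by (intro powr_mono2') auto
      also have "\<dots> = 1 / T" using T by (simp add: powr_minus_divide powr_half_sqrt)
      finally show "real (Suc Y) powr (- Re z) \<le> 1 / T" .
    qed (use nz Rez T in auto)
    also have "\<dots> = real N * ((2 * T + 8) / T)" by simp
    also have "\<dots> \<le> real N * 6" using T by (intro mult_left_mono) (auto simp: field_simps)
    finally show ?thesis by simp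
  qed
  have sub: "cball s (1 / 2) \<subseteq> {s. Re s > 0}"
  proof
    fix z assume "z \<in> cball s (1 / 2)"
    then show "z \<in> {s. Re s > 0}" using abs_Re_le_cmod[of "s - z"] \<sigma> by (simp add: s_def dist_norm)
  qed
  have pd: "((\<lambda>z. \<Sum>n=1..Y. f n * of_nat n powr (-z)) has_field_derivative (\<Sum>n=1..Y. - (f n * of_real (ln (real n)) * of_nat n powr (-z)))) (at z)" for z
  proof (rule DERIV_sum)
    fix n assume n: "n \<in> {1..Y}"
    have L: "Ln (of_nat n) = of_real (ln (real n))" using n Ln_of_real[of "real n"] by simp
    have "((\<lambda>z. of_nat n powr (-z)) has_field_derivative (Ln (of_nat n) * of_nat n powr (-z)) * (-1)) (at z)"
      by (rule DERIV_chain2[OF _ DERIV_minus[OF DERIV_ident]]) (rule has_field_derivative_powr_right, use n in simp)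
    from DERIV_cmult[OF this, of "f n"] show "((\<lambda>z. f n * of_nat n powr (-z)) has_field_derivative - (f n * of_real (ln (real n)) * of_nat n powr (-z))) (at z)"
      unfolding L by (simp add: mult_ac)
  qed
  have Rh: "R holomorphic_on cball s (1 / 2)"
    unfolding R_def[abs_def] using pd
    by (intro holomorphic_on_diff holomorphic_on_subset[OF dseries_f_holomorphic sub] holomorphic_on_derivI)
  have Rs: "norm (R s) \<le> 6 * real N" by (rule Rb) simp
  have "(\<Sum>n=1..Y. f n * of_nat n powr (-s)) = (\<Sum>n=1..Y. f n * of_real (real n powr (-\<sigma>)) * cis (- (ln (real n) * t)))"
    unfolding s_def by (intro sum.cong refl) (subst nat_powr_Complex, auto)
  with Rs show "norm (dseries f (Complex \<sigma> t) - (\<Sum>n=1..Y. f n * of_real (real n powr (-\<sigma>)) * cis (- (ln (real n) * t)))) \<le> 6 * real N"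
    by (simp add: R_def s_def)
  have "(R has_field_derivative deriv (dseries f) s - (\<Sum>n=1..Y. - (f n * of_real (ln (real n)) * of_nat n powr (-s)))) (at s)"
    unfolding R_def[abs_def] by (intro DERIV_diff pd dseries_f_deriv) (use \<sigma> in \<open>simp add: s_def\<close>)
  then have "deriv R s = deriv (dseries f) s + (\<Sum>n=1..Y. f n * of_real (ln (real n)) * of_nat n powr (-s))"
    by (simp add: DERIV_imp_deriv sum_negf)
  also have "(\<Sum>n=1..Y. f n * of_real (ln (real n)) * of_nat n powr (-s)) = (\<Sum>n=1..Y. f n * of_real (ln (real n) * real n powr (-\<sigma>)) * cis (- (ln (real n) * t)))"
    unfolding s_def by (intro sum.cong refl) (subst nat_powr_Complex, auto)
  finally have dR: "deriv R s = deriv (dseries f) s + \<dots>" .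
  have "norm ((deriv ^^ 1) R s) \<le> fact 1 * (6 * real N) / (1 / 2) ^ 1"
    by (rule Cauchy_inequality[OF holomorphic_on_subset[OF Rh ball_subset_cball] holomorphic_on_imp_continuous_on[OF Rh]]) (use Rb in auto)
  then show "norm (deriv (dseries f) (Complex \<sigma> t) + (\<Sum>n=1..Y. f n * of_real (ln (real n) * real n powr (-\<sigma>)) * cis (- (ln (real n) * t)))) \<le> 12 * real N"
    using dR by (simp add: s_def)
qed

lemma integral_square_le:
  fixes F S :: "real \<Rightarrow> complex"
  assumes "continuous_on {-T..T} F" "continuous_on {-T..T} S" "T \<ge> 0"
    and "\<And>t. t \<in> {-T..T} \<Longrightarrow> norm (F t - S t) \<le> A"
    and "integral {-T..T} (\<lambda>t. (norm (S t))\<^sup>2) \<le> B"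
  shows "integral {-T..T} (\<lambda>t. (norm (F t))\<^sup>2) \<le> 2 * B + 4 * T * A\<^sup>2"
proof -
  have "integral {-T..T} (\<lambda>t. (norm (F t))\<^sup>2) \<le> integral {-T..T} (\<lambda>t. 2 * (norm (S t))\<^sup>2 + 2 * A\<^sup>2)"
  proof (intro integral_le integrable_continuous_real continuous_intros assms(1,2))
    fix t assume t: "t \<in> {-T..T}"
    have "norm (F t) \<le> norm (S t) + norm (F t - S t)" using norm_triangle_ineq[of "S t" "F t - S t"] by simp
    then have "(norm (F t))\<^sup>2 \<le> (norm (S t) + A)\<^sup>2" using assms(4)[OF t] by (intro power_mono) auto
    also have "\<dots> \<le> 2 * (norm (S t))\<^sup>2 + 2 * A\<^sup>2"
      using sum_squares_bound[of "norm (S t)" A] by (simp add: power2_sum)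
    finally show "(norm (F t))\<^sup>2 \<le> 2 * (norm (S t))\<^sup>2 + 2 * A\<^sup>2" .
  qed
  also have "\<dots> = 2 * integral {-T..T} (\<lambda>t. (norm (S t))\<^sup>2) + 4 * T * A\<^sup>2"
    using assms by (subst Henstock_Kurzweil_Integration.integral_add)
      (auto intro!: integrable_continuous_real continuous_intros)
  finally show ?thesis using assms(5) by linarith
qed

text \<open>The coefficients are at most 1/n and (ln n)/n for every \<sigma> > 1, and both are
  square summable; hence neither C nor the threshold for T depends on \<sigma>.\<close>

lemma mean_square_dseries_f:
  "\<exists>C\<ge>0. \<forall>\<^sub>F T in at_top. \<forall>\<sigma>. 1 < \<sigma> \<longrightarrow> \<sigma> \<le> 2 \<longrightarrow>
     integral {-T..T} (\<lambda>t. (norm (dseries f (Complex \<sigma> t)))\<^sup>2) \<le> C * T \<and>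
     integral {-T..T} (\<lambda>t. (norm (deriv (dseries f) (Complex \<sigma> t)))\<^sup>2) \<le> C * T"
proof -
  obtain D where D: "D \<ge> 0" "\<And>Y. (\<Sum>n=1..Y. (ln (real n) / real n)\<^sup>2) \<le> D" using sum_ln_over_n_bounded by blast
  have sm2: "summable (\<lambda>n. real n powr (-2))" by (simp add: summable_real_powr_iff)
  define D2 where "D2 = (\<Sum>n. real n powr (-2))"
  have D20: "D2 \<ge> 0" unfolding D2_def by (rule suminf_nonneg[OF sm2]) simp
  have D2: "(\<Sum>n=1..Y. (1 / real n)\<^sup>2) \<le> D2" for Y
  proof -
    have "(\<Sum>n=1..Y. (1 / real n)\<^sup>2) = (\<Sum>n=1..Y. real n powr (-2))"
      by (intro sum.cong refl) (simp add: powr_minus_divide power_divide)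
    also have "\<dots> \<le> D2" unfolding D2_def by (rule sum_le_suminf[OF sm2]) auto
    finally show ?thesis .
  qed
  define C where "C = 4 * (D + D2) + 2 + 4 * (12 * real N)\<^sup>2"
  have "\<forall>\<^sub>F T::real in at_top. 8 * (1 + ln (2 * T\<^sup>2)) ^ 4 \<le> T" by real_asymp
  then have "\<forall>\<^sub>F T in at_top. \<forall>\<sigma>. 1 < \<sigma> \<longrightarrow> \<sigma> \<le> 2 \<longrightarrow>
     integral {-T..T} (\<lambda>t. (norm (dseries f (Complex \<sigma> t)))\<^sup>2) \<le> C * T \<and>
     integral {-T..T} (\<lambda>t. (norm (deriv (dseries f) (Complex \<sigma> t)))\<^sup>2) \<le> C * T"
    using eventually_ge_at_top[of 2]
  proof eventually_elim
    case (elim T)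
    define Y where "Y = nat \<lceil>T\<^sup>2\<rceil>"
    have T4: "T\<^sup>2 \<ge> 4" using power_mono[of 2 T 2] elim by simp
    have Y1: "Y \<ge> 1" using T4 unfolding Y_def by linarith
    have "real Y \<le> T\<^sup>2 + 1" unfolding Y_def using T4 by linarith
    then have "real Y \<le> 2 * T\<^sup>2" using T4 by linarith
    then have lnY: "ln (real Y) \<le> ln (2 * T\<^sup>2)" using Y1 by (intro ln_mono) auto
    define E where "E = 1 + ln (2 * T\<^sup>2)"
    have lnY0: "ln (real Y) \<ge> 0" using Y1 by simp
    define H where "H = (\<Sum>k=1..Y. 1 / real k)"
    have H: "0 \<le> H" "H \<le> E" unfolding H_def E_def using sum_inverse_le_ln[OF Y1] lnY by (auto intro!: sum_nonneg)
    have E1: "E \<ge> 1" using lnY lnY0 by (simp add: E_def)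
    have KH: "8 * K\<^sup>2 * H\<^sup>2 \<le> T" if "0 \<le> K" "K \<le> E" for K
    proof -
      have "8 * K\<^sup>2 * H\<^sup>2 \<le> 8 * E\<^sup>2 * E\<^sup>2" using that H by (intro mult_mono power_mono) auto
      also have "\<dots> = 8 * E ^ 4" by (simp add: power2_eq_square power4_eq_xxxx)
      also have "\<dots> \<le> T" using elim by (simp add: E_def)
      finally show ?thesis .
    qed
    show ?case
    proof (intro allI impI conjI)
      fix \<sigma> :: real assume \<sigma>: "1 < \<sigma>" "\<sigma> \<le> 2"
      have np: "norm (of_real (real n powr (-\<sigma>)) :: complex) \<le> 1 / real n" if "n \<ge> 1" for n
      proof -
        have "norm (of_real (real n powr (-\<sigma>)) :: complex) = real n powr (-\<sigma>)"
          by (simp only: norm_of_real abs_of_nonneg[OF powr_ge_zero])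
        also have "\<dots> \<le> real n powr (-1)" using that \<sigma> by (intro powr_mono) auto
        also have "\<dots> = 1 / real n" using that by (simp add: powr_minus_divide)
        finally show ?thesis .
      qed
      have cc: "continuous_on {-T..T} (\<lambda>t. Complex \<sigma> t)" using continuous_ln_pt[of _ "\<sigma> - 1 / 2"] by simp
      have cF: "continuous_on {-T..T} (\<lambda>t. dseries f (Complex \<sigma> t))"
        by (rule continuous_on_compose2[OF dseries_f_continuous(1) cc, of "{s. Re s > 0}"]) (use \<sigma> in auto)
      have cF': "continuous_on {-T..T} (\<lambda>t. deriv (dseries f) (Complex \<sigma> t))"
        by (rule continuous_on_compose2[OF dseries_f_continuous(2) cc, of "{s. Re s > 0}"]) (use \<sigma> in auto)
      {
        define b where "b n = f n * of_real (real n powr (-\<sigma>))" for n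
        have b: "norm (b n) \<le> 1 / real n" if "n \<in> {1..Y}" for n
          using mult_mono[OF cm.f_le np[of n]] that by (simp add: b_def norm_mult)
        have "integral {-T..T} (\<lambda>t. (norm (\<Sum>n=1..Y. b n * cis (- (ln (real n) * t))))\<^sup>2) \<le> 2 * T * (\<Sum>n=1..Y. (norm (b n))\<^sup>2) + 8 * 1\<^sup>2 * H\<^sup>2"
          unfolding H_def by (rule mean_square_dirichlet_polynomial) (use elim b in auto)
        also have "(\<Sum>n=1..Y. (norm (b n))\<^sup>2) \<le> (\<Sum>n=1..Y. (1 / real n)\<^sup>2)" by (intro sum_mono power_mono b) auto
        also have "\<dots> \<le> D2" by (rule D2)
        also have "8 * 1\<^sup>2 * H\<^sup>2 \<le> T" using E1 by (intro KH) auto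
        finally have m: "integral {-T..T} (\<lambda>t. (norm (\<Sum>n=1..Y. b n * cis (- (ln (real n) * t))))\<^sup>2) \<le> 2 * T * D2 + T"
          using elim by (simp add: mult_left_mono)
        have "integral {-T..T} (\<lambda>t. (norm (dseries f (Complex \<sigma> t)))\<^sup>2) \<le> 2 * (2 * T * D2 + T) + 4 * T * (6 * real N)\<^sup>2"
          by (rule integral_square_le[OF cF _ _ _ m])
             (use elim dirichlet_approx(1)[OF _ \<sigma> _ Y_def] in \<open>auto intro!: continuous_intros simp: b_def\<close>)
        also have "\<dots> \<le> C * T" using elim D D20 by (simp add: C_def algebra_simps power2_eq_square)
        finally show "integral {-T..T} (\<lambda>t. (norm (dseries f (Complex \<sigma> t)))\<^sup>2) \<le> C * T" .
      }
      {
        define b where "b n = - (f n * of_real (ln (real n) * real n powr (-\<sigma>)))" for n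
        have b': "norm (b n) \<le> ln (real n) / real n" if "n \<in> {1..Y}" for n
        proof -
          have "norm (b n) = norm (f n) * (ln (real n) * norm (of_real (real n powr (-\<sigma>)) :: complex))"
            using that by (simp add: b_def norm_mult)
          also have "\<dots> \<le> 1 * (ln (real n) * (1 / real n))"
            using that by (intro mult_mono cm.f_le np mult_nonneg_nonneg) auto
          finally show ?thesis by simp
        qed
        have b: "norm (b n) \<le> ln (real Y) / real n" if "n \<in> {1..Y}" for n
        proof -
          have "ln (real n) / real n \<le> ln (real Y) / real n" using that by (intro divide_right_mono ln_mono) auto
          with b'[OF that] show ?thesis by linarith
        qed
        have "integral {-T..T} (\<lambda>t. (norm (\<Sum>n=1..Y. b n * cis (- (ln (real n) * t))))\<^sup>2) \<le> 2 * T * (\<Sum>n=1..Y. (norm (b n))\<^sup>2) + 8 * (ln (real Y))\<^sup>2 * H\<^sup>2"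
          unfolding H_def by (rule mean_square_dirichlet_polynomial) (use elim b lnY0 in auto)
        also have "(\<Sum>n=1..Y. (norm (b n))\<^sup>2) \<le> (\<Sum>n=1..Y. (ln (real n) / real n)\<^sup>2)" by (intro sum_mono power_mono b') auto
        also have "\<dots> \<le> D" by (rule D)
        also have "8 * (ln (real Y))\<^sup>2 * H\<^sup>2 \<le> T" using lnY lnY0 by (intro KH) (auto simp: E_def)
        finally have m: "integral {-T..T} (\<lambda>t. (norm (\<Sum>n=1..Y. b n * cis (- (ln (real n) * t))))\<^sup>2) \<le> 2 * T * D + T"
          using elim by (simp add: mult_left_mono)
        have "integral {-T..T} (\<lambda>t. (norm (deriv (dseries f) (Complex \<sigma> t)))\<^sup>2) \<le> 2 * (2 * T * D + T) + 4 * T * (12 * real N)\<^sup>2"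
          by (rule integral_square_le[OF cF' _ _ _ m])
             (use elim dirichlet_approx(2)[OF _ \<sigma> _ Y_def] in \<open>auto intro!: continuous_intros simp: b_def sum_negf\<close>)
        also have "\<dots> \<le> C * T" using elim D D20 by (simp add: C_def algebra_simps power2_eq_square)
        finally show "integral {-T..T} (\<lambda>t. (norm (deriv (dseries f) (Complex \<sigma> t)))\<^sup>2) \<le> C * T" .
      }
    qed
  qed
  moreover have "C \<ge> 0" unfolding C_def using D(1) D20 by simp
  ultimately show ?thesis by blast
qed

end

section \<open>Integrals of log L close to the line of real part one\<close>

lemma ln_one_plus_le_sqrt:
  assumes "y \<ge> (0::real)" shows "ln (1 + y) \<le> 2 * sqrt y"
proof -
  have "ln (1 + y) = ln (sqrt (1 + y) * sqrt (1 + y))" using assms by simp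
  also have "\<dots> = 2 * ln (sqrt (1 + y))" using assms by (subst ln_mult_pos) (auto intro: real_sqrt_gt_zero)
  also have "\<dots> \<le> 2 * (sqrt (1 + y) - 1)" using assms by (intro mult_left_mono ln_le_minus_one) auto
  also have "sqrt (1 + y) \<le> sqrt 1 + sqrt y" using assms by (intro sqrt_add_le_add_sqrt) auto
  finally show ?thesis by simp
qed

context prim_char
begin

text \<open>The integrand is at most ln (1 + 1/(x - 1)) <= 2 / sqrt (x - 1), whose integral from 1
  to 2 is 4.\<close>

lemma logcoeff_horizontal:
  assumes P: "\<And>s. Re s > 1 \<Longrightarrow> (P has_field_derivative dseries cm.logcoeff s) (at s)"
    and \<sigma>: "1 < \<sigma>" "\<sigma> \<le> 2"
  shows "norm (P (Complex 2 t) - P (Complex \<sigma> t)) \<le> 4"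
proof (cases "\<sigma> = 2")
  case False
  then have lt: "\<sigma> < 2" using \<sigma> by simp
  have e: "Complex x t = of_real x + \<i> * of_real t" for x by (simp add: complex_eq_iff)
  have vd: "((\<lambda>x. P (Complex x t)) has_vector_derivative dseries cm.logcoeff (Complex x t)) (at x)" if "x > 1" for x
  proof -
    have "((\<lambda>z. P (z + \<i> * of_real t)) has_field_derivative dseries cm.logcoeff (of_real x + \<i> * of_real t) * 1) (at (of_real x))"
      by (rule DERIV_chain2[OF P]) (use that in \<open>auto intro!: derivative_eq_intros\<close>)
    from has_vector_derivative_real_field[OF this] show ?thesis unfolding e by simp
  qed
  have "norm (P (Complex 2 t) - P (Complex \<sigma> t)) \<le> 4 * sqrt (2 - 1) - 4 * sqrt (\<sigma> - 1)"
  proof (rule differentiable_bound_general[OF lt, where f' = "\<lambda>x. dseries cm.logcoeff (Complex x t)" and \<phi>' = "\<lambda>x. 2 / sqrt (x - 1)"])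
    show "continuous_on {\<sigma>..2} (\<lambda>x. P (Complex x t))"
      using has_vector_derivative_continuous[OF vd] \<sigma> by (intro continuous_at_imp_continuous_on) auto
    show "continuous_on {\<sigma>..2} (\<lambda>x. 4 * sqrt (x - 1))" by (intro continuous_intros)
    show "((\<lambda>x. 4 * sqrt (x - 1)) has_vector_derivative 2 / sqrt (x - 1)) (at x)" if "\<sigma> < x" "x < 2" for x
      unfolding has_real_derivative_iff_has_vector_derivative[symmetric]
      using that \<sigma> by (auto intro!: derivative_eq_intros simp: field_simps)
    show "norm (dseries cm.logcoeff (Complex x t)) \<le> 2 / sqrt (x - 1)" if "\<sigma> < x" "x < 2" for x
    proof -
      have x: "x > 1" using that \<sigma> by simp
      have "norm (dseries cm.logcoeff (Complex x t)) \<le> logzeta x" using cm.norm_dseries_logcoeff[of "Complex x t"] x by simp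
      also have "\<dots> \<le> ln (1 + 1 / (x - 1))" by (rule logzeta_le[OF x])
      also have "\<dots> \<le> 2 * sqrt (1 / (x - 1))" using x by (intro ln_one_plus_le_sqrt) auto
      finally show ?thesis by (simp add: real_sqrt_divide)
    qed
  qed (use vd \<sigma> in auto)
  then show ?thesis using \<sigma> by (simp add: algebra_simps) (smt (verit) real_sqrt_ge_zero)
qed simp

text \<open>The vertical integral is moved to the line \<open>Re s = 2\<close>; the horizontal pieces stay bounded as
  \<open>\<sigma> \<rightarrow> 1\<close> because \<open>ln (1 + 1 / (x - 1))\<close> is integrable at \<open>x = 1\<close>.\<close>

lemma logcoeff_vertical_integral:
  assumes \<sigma>: "1 < \<sigma>" "\<sigma> \<le> 2" and ab: "a \<le> b"
  shows "norm (integral {a..b} (\<lambda>t. dseries cm.logcoeff (Complex \<sigma> t))) \<le> 8 + (b - a)"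
proof -
  let ?D = "{s::complex. Re s > 1}"
  have hol: "dseries cm.logcoeff holomorphic_on ?D" by (rule dseries_holomorphic[OF cm.conv_logcoeff]) auto
  have fd: "dseries cm.logcoeff field_differentiable at x" if "x \<in> interior ?D - {}" for x
    using that LD_right(2)[of x] interior_subset[of ?D] by (auto simp: field_differentiable_def)
  obtain P where P0: "\<And>s. s \<in> ?D \<Longrightarrow> (P has_field_derivative dseries cm.logcoeff s) (at s within ?D)"
    by (rule holomorphic_convex_primitive[OF convex_halfspace_Re_gt finite.emptyI holomorphic_on_imp_continuous_on[OF hol] fd])
       (assumption, rule that, blast)
  have P: "(P has_field_derivative dseries cm.logcoeff s) (at s)" if "Re s > 1" for s
    using P0[of s] that at_within_open[of s ?D] open_halfspace_Re_gt[of 1] by simp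
  have e: "Complex \<sigma> t = of_real \<sigma> + \<i> * of_real t" for t by (simp add: complex_eq_iff)
  have vd: "((\<lambda>t. P (Complex \<sigma> t)) has_vector_derivative \<i> * dseries cm.logcoeff (Complex \<sigma> t)) (at t within S)" for t S
  proof -
    have "((\<lambda>z. P (of_real \<sigma> + \<i> * z)) has_field_derivative dseries cm.logcoeff (of_real \<sigma> + \<i> * of_real t) * \<i>) (at (of_real t))"
      by (rule DERIV_chain2[OF P]) (use \<sigma> in \<open>auto intro!: derivative_eq_intros\<close>)
    from has_vector_derivative_real_field[OF this] show ?thesis unfolding e by (simp add: mult.commute)
  qed
  have "((\<lambda>t. \<i> * dseries cm.logcoeff (Complex \<sigma> t)) has_integral (P (Complex \<sigma> b) - P (Complex \<sigma> a))) {a..b}"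
    by (rule fundamental_theorem_of_calculus[OF ab vd])
  then have "\<i> * integral {a..b} (\<lambda>t. dseries cm.logcoeff (Complex \<sigma> t)) = P (Complex \<sigma> b) - P (Complex \<sigma> a)"
    by (simp add: integral_unique flip: integral_mult_right)
  then have "norm (\<i> * integral {a..b} (\<lambda>t. dseries cm.logcoeff (Complex \<sigma> t))) = norm (P (Complex \<sigma> b) - P (Complex \<sigma> a))"
    by (rule arg_cong)
  then have 1: "norm (integral {a..b} (\<lambda>t. dseries cm.logcoeff (Complex \<sigma> t))) = norm (P (Complex \<sigma> b) - P (Complex \<sigma> a))"
    by (simp add: norm_mult)
  \<comment> \<open>For Re s >= 2 one has |log L| <= 1/(Re s - 1) <= 1. This is the summand b - a;
    the 8 stands for two horizontal pieces of at most 4.\<close>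
  have 2: "norm (P (Complex 2 b) - P (Complex 2 a)) \<le> 1 * norm (Complex 2 b - Complex 2 a)"
  proof (rule field_differentiable_bound[OF convex_halfspace_Re_ge[of 2]])
    fix z :: complex assume z: "z \<in> {s. Re s \<ge> 2}"
    show "(P has_field_derivative dseries cm.logcoeff z) (at z within {s. Re s \<ge> 2})"
      using z by (intro has_field_derivative_at_within[OF P]) simp
    have "norm (dseries cm.logcoeff z) \<le> logzeta (Re z)" using z by (intro cm.norm_dseries_logcoeff) simp
    also have "\<dots> \<le> ln (1 + 1 / (Re z - 1))" using z by (intro logzeta_le) simp
    also have "\<dots> \<le> 1 / (Re z - 1)" using z by (intro ln_add_one_self_le_self) simp
    also have "\<dots> \<le> 1" using z by simp
    finally show "norm (dseries cm.logcoeff z) \<le> 1" .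
  qed auto
  have "Complex 2 b - Complex 2 a = \<i> * of_real (b - a)" by (simp add: complex_eq_iff)
  then have "norm (Complex 2 b - Complex 2 a) = \<bar>b - a\<bar>" by (simp only: norm_mult norm_of_real) simp
  with 2 have 3: "norm (P (Complex 2 b) - P (Complex 2 a)) \<le> b - a" using ab by simp
  have "P (Complex \<sigma> b) - P (Complex \<sigma> a) = (P (Complex 2 b) - P (Complex 2 a)) - (P (Complex 2 b) - P (Complex \<sigma> b)) + (P (Complex 2 a) - P (Complex \<sigma> a))"
    by simp
  then have "norm (P (Complex \<sigma> b) - P (Complex \<sigma> a)) \<le> norm (P (Complex 2 b) - P (Complex 2 a)) + norm (P (Complex 2 b) - P (Complex \<sigma> b)) + norm (P (Complex 2 a) - P (Complex \<sigma> a))"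
    using norm_triangle_ineq[of "(P (Complex 2 b) - P (Complex 2 a)) - (P (Complex 2 b) - P (Complex \<sigma> b))" "P (Complex 2 a) - P (Complex \<sigma> a)"]
      norm_triangle_ineq4[of "P (Complex 2 b) - P (Complex 2 a)" "P (Complex 2 b) - P (Complex \<sigma> b)"] by simp
  then show ?thesis using 1 3 logcoeff_horizontal[OF P \<sigma>, of a] logcoeff_horizontal[OF P \<sigma>, of b] by linarith
qed

lemma continuous_Complex_right: "continuous_on S (\<lambda>t. Complex \<sigma> t)"
  using continuous_ln_pt[of S "\<sigma> - 1 / 2"] by simp

lemma logcoeff_continuous_line:
  assumes "\<sigma> > 1" shows "continuous_on S (\<lambda>t. dseries cm.logcoeff (Complex \<sigma> t))"
  by (rule continuous_on_compose2[OF holomorphic_on_imp_continuous_on[OF dseries_holomorphic[OF cm.conv_logcoeff, of "{s. Re s > 1}"]] continuous_Complex_right])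
     (use assms in auto)

lemma logcoeff_line_deriv:
  assumes \<sigma>: "\<sigma> > 1"
  shows "((\<lambda>t. dseries cm.logcoeff (Complex \<sigma> t)) has_vector_derivative \<i> * LD (Complex \<sigma> t)) (at t within S)"
proof -
  have e: "Complex \<sigma> t = of_real \<sigma> + \<i> * of_real t" for t by (simp add: complex_eq_iff)
  have "((\<lambda>z. dseries cm.logcoeff (of_real \<sigma> + \<i> * z)) has_field_derivative LD (of_real \<sigma> + \<i> * of_real t) * \<i>) (at (of_real t))"
    by (rule DERIV_chain2[OF LD_right(2)]) (use \<sigma> in \<open>auto intro!: derivative_eq_intros\<close>)
  from has_vector_derivative_real_field[OF this] show ?thesis unfolding e by (simp add: mult.commute)
qed

lemma ln_norm_eq_Re_logcoeff:
  assumes "Re s > 1" shows "ln (norm (dseries f s)) = Re (dseries cm.logcoeff s)"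
  using cm.exp_dseries_logcoeff[OF assms] by (metis ln_exp norm_exp_eq_Re)

lemma integral_ln_norm_lower:
  assumes \<sigma>: "1 < \<sigma>" "\<sigma> \<le> 2" and T: "T \<ge> 0"
  shows "integral {-T..T} (\<lambda>t. ln (norm (dseries f (Complex \<sigma> t)))) \<ge> - (8 + 2 * T)"
proof -
  have "integral {-T..T} (\<lambda>t. ln (norm (dseries f (Complex \<sigma> t)))) = integral {-T..T} (\<lambda>t. Re (dseries cm.logcoeff (Complex \<sigma> t)))"
    using \<sigma> by (simp add: ln_norm_eq_Re_logcoeff)
  also have "\<dots> = Re (integral {-T..T} (\<lambda>t. dseries cm.logcoeff (Complex \<sigma> t)))"
    using integral_linear[OF integrable_continuous_real[OF logcoeff_continuous_line[OF \<sigma>(1)]] bounded_linear_Re, of "-T" T]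
    by (simp add: o_def)
  also have "\<dots> \<ge> - norm (integral {-T..T} (\<lambda>t. dseries cm.logcoeff (Complex \<sigma> t)))"
    using abs_Re_le_cmod by (simp add: abs_le_iff minus_le_iff)
  finally show ?thesis using logcoeff_vertical_integral[OF \<sigma>, of "-T" T] T by linarith
qed

text \<open>Integrating by parts against the triangular weight kills the boundary terms at the ends
  and cancels those at 0. A sharp cut-off would leave values of log L at height T, which need not
  stay bounded as \<sigma> tends to 1; here only its integrals remain.\<close>

lemma weighted_integral_LD:
  assumes \<sigma>: "1 < \<sigma>" "\<sigma> \<le> 2" and T: "T \<ge> 0"
  shows "\<bar>integral {-T..T} (\<lambda>t. (T - \<bar>t\<bar>) * Re (LD (Complex \<sigma> t)))\<bar> \<le> 2 * (8 + T)"
proof -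
  let ?G = "\<lambda>t. dseries cm.logcoeff (Complex \<sigma> t)"
  have Gi: "(?G has_integral integral {a..b} ?G) {a..b}" for a b
    by (intro integrable_integral integrable_continuous_real logcoeff_continuous_line \<sigma>)
  have piece: "((\<lambda>t. of_real (T + c * t) * (\<i> * LD (Complex \<sigma> t))) has_integral
      (of_real (T + c * b) * ?G b - of_real (T + c * a) * ?G a - of_real c * integral {a..b} ?G)) {a..b}" if ab: "a \<le> b" for a b c
  proof -
    have "((\<lambda>t. of_real (T + c * t) * (\<i> * LD (Complex \<sigma> t)) + of_real c * ?G t) has_integral
        (of_real (T + c * b) * ?G b - of_real (T + c * a) * ?G a)) {a..b}"
    proof (rule fundamental_theorem_of_calculus[OF ab])
      fix t
      have "((\<lambda>t. complex_of_real (T + c * t)) has_vector_derivative of_real c) (at t within {a..b})"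
        by (rule has_vector_derivative_of_real) (auto intro!: derivative_eq_intros)
      from has_vector_derivative_mult[OF this logcoeff_line_deriv[OF \<sigma>(1)]]
      show "((\<lambda>t. of_real (T + c * t) * ?G t) has_vector_derivative
          of_real (T + c * t) * (\<i> * LD (Complex \<sigma> t)) + of_real c * ?G t) (at t within {a..b})" .
    qed
    from has_integral_diff[OF this has_integral_mult_right[OF Gi[of a b], of "of_real c"]] show ?thesis by simp
  qed
  have neg: "((\<lambda>t. of_real (T - \<bar>t\<bar>) * (\<i> * LD (Complex \<sigma> t))) has_integral (of_real T * ?G 0 - integral {-T..0} ?G)) {-T..0}"
  proof (rule has_integral_eq)
    show "((\<lambda>t. of_real (T + 1 * t) * (\<i> * LD (Complex \<sigma> t))) has_integral (of_real T * ?G 0 - integral {-T..0} ?G)) {-T..0}"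
      using piece[of "-T" 0 1] T by simp
  qed auto
  have pos: "((\<lambda>t. of_real (T - \<bar>t\<bar>) * (\<i> * LD (Complex \<sigma> t))) has_integral (integral {0..T} ?G - of_real T * ?G 0)) {0..T}"
  proof (rule has_integral_eq)
    show "((\<lambda>t. of_real (T + (-1) * t) * (\<i> * LD (Complex \<sigma> t))) has_integral (integral {0..T} ?G - of_real T * ?G 0)) {0..T}"
      using piece[of 0 T "-1"] T by simp
  qed auto
  have "((\<lambda>t. of_real (T - \<bar>t\<bar>) * (\<i> * LD (Complex \<sigma> t))) has_integral
      ((of_real T * ?G 0 - integral {-T..0} ?G) + (integral {0..T} ?G - of_real T * ?G 0))) {-T..T}"
    by (rule has_integral_combine[OF _ _ neg pos]) (use T in auto)
  from has_integral_linear[OF this bounded_linear_Im]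
  have "((\<lambda>t. (T - \<bar>t\<bar>) * Re (LD (Complex \<sigma> t))) has_integral Im (integral {0..T} ?G - integral {-T..0} ?G)) {-T..T}"
    by (simp add: o_def)
  then have "integral {-T..T} (\<lambda>t. (T - \<bar>t\<bar>) * Re (LD (Complex \<sigma> t))) = Im (integral {0..T} ?G - integral {-T..0} ?G)"
    by (rule integral_unique)
  then have "\<bar>integral {-T..T} (\<lambda>t. (T - \<bar>t\<bar>) * Re (LD (Complex \<sigma> t)))\<bar> \<le> norm (integral {0..T} ?G - integral {-T..0} ?G)"
    using abs_Im_le_cmod by metis
  also have "\<dots> \<le> norm (integral {0..T} ?G) + norm (integral {-T..0} ?G)" by (rule norm_triangle_ineq4)
  also have "\<dots> \<le> (8 + (T - 0)) + (8 + (0 - (-T)))" using T by (intro add_mono logcoeff_vertical_integral \<sigma>) auto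
  finally show ?thesis by simp
qed

end

section \<open>The mean of the absolute value near the line of real part one, and the limit\<close>

context prim_char
begin

text \<open>Where \<open>L\<close> is at least \<open>c\<close>, the negative part is at most \<open>\<bar>L'\<bar> / c\<close>; elsewhere the positivity of the phase
  derivative bounds it by \<open>ln t\<close>, and \<open>- ln \<bar>L\<bar> / ln (1 / c)\<close> exceeds \<open>1\<close>. The square of \<open>\<bar>L\<bar>\<close> makes the last factor
  nonnegative everywhere.\<close>

lemma LD_neg_part_bound:
  "\<exists>C\<ge>0. \<forall>\<eta> t c. 0 < \<eta> \<longrightarrow> \<eta> \<le> 1 \<longrightarrow> 0 < c \<longrightarrow> c < 1 \<longrightarrow>
     max 0 (- Re (LD (Complex (1 + \<eta>) t))) \<le>
       1 / c * (1 + (norm (deriv (dseries f) (Complex (1 + \<eta>) t)))\<^sup>2) +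
       (ln (2 + \<bar>t\<bar>) + C) / ln (1 / c) * ((norm (dseries f (Complex (1 + \<eta>) t)))\<^sup>2 - ln (norm (dseries f (Complex (1 + \<eta>) t))))"
proof -
  obtain C where C: "C \<ge> 0" "\<And>h t. 0 < h \<Longrightarrow> h \<le> 3 / 2 \<Longrightarrow> dseries f (ln_pt h t) \<noteq> 0 \<Longrightarrow>
     \<bar>dphase h t - ln (2 + \<bar>t\<bar>) / 2 - Re (LD (ln_pt h t))\<bar> \<le> C"
    using dphase_bound[of "3 / 2"] by auto
  have "max 0 (- Re (LD (Complex (1 + \<eta>) t))) \<le>
       1 / c * (1 + (norm (deriv (dseries f) (Complex (1 + \<eta>) t)))\<^sup>2) +
       (ln (2 + \<bar>t\<bar>) + C) / ln (1 / c) * ((norm (dseries f (Complex (1 + \<eta>) t)))\<^sup>2 - ln (norm (dseries f (Complex (1 + \<eta>) t))))"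
    if \<eta>: "0 < \<eta>" "\<eta> \<le> 1" and c: "0 < c" "c < 1" for \<eta> t c :: real
  proof -
    define s where "s = Complex (1 + \<eta>) t"
    have es: "ln_pt (1 / 2 + \<eta>) t = s" by (simp add: s_def)
    have g: "good (1 / 2 + \<eta>)" by (rule star_gt_half(1)[of _ 1]) (use \<eta> in auto)
    have nz: "dseries f s \<noteq> 0" using good_dseries[OF g, of t] unfolding es .
    have "0 < dphase (1 / 2 + \<eta>) t" by (rule Q_deriv(2)[OF g])
    moreover have "\<bar>dphase (1 / 2 + \<eta>) t - ln (2 + \<bar>t\<bar>) / 2 - Re (LD s)\<bar> \<le> C"
      using C(2)[of "1 / 2 + \<eta>" t] \<eta> nz unfolding es by simp
    moreover have ln0: "ln (2 + \<bar>t\<bar>) \<ge> 0" by simp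
    ultimately have u: "max 0 (- Re (LD s)) \<le> ln (2 + \<bar>t\<bar>) + C" using C(1) by linarith
    define x where "x = norm (dseries f s)"
    have x: "x > 0" using nz by (simp add: x_def)
    define y where "y = norm (deriv (dseries f) s)"
    have y: "y \<ge> 0" by (simp add: y_def)
    have lc: "ln (1 / c) > 0" using c by simp
    have "x\<^sup>2 - x + 1 = (x - 1 / 2)\<^sup>2 + 3 / 4" by (simp add: power2_eq_square algebra_simps)
    then have "x\<^sup>2 - ln x \<ge> 0" using ln_le_minus_one[OF x] zero_le_power2[of "x - 1 / 2"] by linarith
    moreover have "x\<^sup>2 - ln x \<ge> - ln x" by simp
    ultimately have m: "x\<^sup>2 - ln x \<ge> 0" "x\<^sup>2 - ln x \<ge> - ln x" by auto
    have p1: "1 / c * (1 + y\<^sup>2) \<ge> 0" using c by simp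
    have p2: "(ln (2 + \<bar>t\<bar>) + C) / ln (1 / c) * (x\<^sup>2 - ln x) \<ge> 0"
      using ln0 C(1) lc m by (intro mult_nonneg_nonneg divide_nonneg_pos) auto
    have "max 0 (- Re (LD s)) \<le> 1 / c * (1 + y\<^sup>2) + (ln (2 + \<bar>t\<bar>) + C) / ln (1 / c) * (x\<^sup>2 - ln x)"
    proof (cases "x \<ge> c")
      case True
      have "max 0 (- Re (LD s)) \<le> norm (LD s)" using abs_Re_le_cmod[of "LD s"] by auto
      also have "\<dots> = y / x" by (simp add: LD_def norm_divide x_def y_def)
      also have "\<dots> \<le> y / c" using True c y by (intro divide_left_mono mult_pos_pos x) auto
      also have "\<dots> \<le> (1 + y\<^sup>2) / c"
      proof (rule divide_right_mono)
        have "y\<^sup>2 - y + 1 = (y - 1 / 2)\<^sup>2 + 3 / 4" by (simp add: power2_eq_square algebra_simps)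
        then show "y \<le> 1 + y\<^sup>2" using zero_le_power2[of "y - 1 / 2"] by linarith
      qed (use c in simp)
      finally show ?thesis using p2 by simp
    next
      case False
      then have "ln (1 / c) \<le> - ln x" using x c by (simp add: ln_div)
      then have "ln (1 / c) \<le> x\<^sup>2 - ln x" using m by linarith
      then have "(ln (2 + \<bar>t\<bar>) + C) / ln (1 / c) * ln (1 / c) \<le> (ln (2 + \<bar>t\<bar>) + C) / ln (1 / c) * (x\<^sup>2 - ln x)"
        using ln0 C(1) lc by (intro mult_left_mono divide_nonneg_pos) auto
      then show ?thesis using u p1 lc by simp
    qed
    then show ?thesis unfolding x_def y_def s_def .
  qed
  then show ?thesis using C(1) by blast
qed

text \<open>The weight 2T - |t| is at least T on the inner interval and at most 2T everywhere; write
  |u| as u plus twice its negative part.\<close>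

lemma integral_abs_le_weighted:
  fixes u :: "real \<Rightarrow> real"
  assumes c: "\<And>A. continuous_on A u" and T: "T > 0"
  shows "T * integral {-T..T} (\<lambda>t. \<bar>u t\<bar>) \<le>
    integral {- (2 * T)..2 * T} (\<lambda>t. (2 * T - \<bar>t\<bar>) * u t) + 4 * T * integral {- (2 * T)..2 * T} (\<lambda>t. max 0 (- u t))"
proof -
  have "T * integral {-T..T} (\<lambda>t. \<bar>u t\<bar>) = integral {-T..T} (\<lambda>t. T * \<bar>u t\<bar>)" by simp
  also have "\<dots> \<le> integral {-T..T} (\<lambda>t. (2 * T - \<bar>t\<bar>) * \<bar>u t\<bar>)"
    by (intro integral_le integrable_continuous_real continuous_intros c mult_right_mono) auto
  also have "\<dots> \<le> integral {- (2 * T)..2 * T} (\<lambda>t. (2 * T - \<bar>t\<bar>) * \<bar>u t\<bar>)"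
    using T by (intro integral_subset_le integrable_continuous_real continuous_intros c mult_nonneg_nonneg) auto
  also have "\<dots> \<le> integral {- (2 * T)..2 * T} (\<lambda>t. (2 * T - \<bar>t\<bar>) * u t + 4 * T * max 0 (- u t))"
  proof (intro integral_le integrable_continuous_real continuous_intros c)
    fix t assume t: "t \<in> {- (2 * T)..2 * T}"
    have "(2 * T - \<bar>t\<bar>) * max 0 (- u t) \<le> 2 * T * max 0 (- u t)" by (intro mult_right_mono) auto
    moreover have "\<bar>u t\<bar> = u t + 2 * max 0 (- u t)" by (simp add: max_def)
    ultimately show "(2 * T - \<bar>t\<bar>) * \<bar>u t\<bar> \<le> (2 * T - \<bar>t\<bar>) * u t + 4 * T * max 0 (- u t)"
      by (simp add: algebra_simps)
  qed
  also have "\<dots> = integral {- (2 * T)..2 * T} (\<lambda>t. (2 * T - \<bar>t\<bar>) * u t) + integral {- (2 * T)..2 * T} (\<lambda>t. 4 * T * max 0 (- u t))"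
    by (intro Henstock_Kurzweil_Integration.integral_add integrable_continuous_real continuous_intros c)
  finally show ?thesis by simp
qed

text \<open>The threshold for T is chosen before \<eta>; otherwise the passage to \<eta> = 0 at
  fixed T would be impossible.\<close>

lemma integral_abs_LD_uniform:
  assumes e: "e > 0"
  shows "\<forall>\<^sub>F T in at_top. \<forall>\<eta>. 0 < \<eta> \<longrightarrow> \<eta> \<le> 1 \<longrightarrow>
    integral {-T..T} (\<lambda>t. \<bar>Re (LD (Complex (1 + \<eta>) t))\<bar>) \<le> e * T * ln T"
proof -
  obtain C where C: "C \<ge> 0" "\<forall>\<^sub>F T in at_top. \<forall>\<sigma>. 1 < \<sigma> \<longrightarrow> \<sigma> \<le> 2 \<longrightarrow>
     integral {-T..T} (\<lambda>t. (norm (dseries f (Complex \<sigma> t)))\<^sup>2) \<le> C * T \<and>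
     integral {-T..T} (\<lambda>t. (norm (deriv (dseries f) (Complex \<sigma> t)))\<^sup>2) \<le> C * T"
    using mean_square_dseries_f by blast
  obtain C1 where C1: "C1 \<ge> 0" "\<And>\<eta> t c. 0 < \<eta> \<Longrightarrow> \<eta> \<le> 1 \<Longrightarrow> 0 < c \<Longrightarrow> c < 1 \<Longrightarrow>
     max 0 (- Re (LD (Complex (1 + \<eta>) t))) \<le>
       1 / c * (1 + (norm (deriv (dseries f) (Complex (1 + \<eta>) t)))\<^sup>2) +
       (ln (2 + \<bar>t\<bar>) + C1) / ln (1 / c) * ((norm (dseries f (Complex (1 + \<eta>) t)))\<^sup>2 - ln (norm (dseries f (Complex (1 + \<eta>) t))))"
    using LD_neg_part_bound by auto
  \<comment> \<open>The cut c = exp (- X) is fixed before T. Its inverse enters only the O(T) term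
    collected in \<open>A\<close>, whereas the logarithmic term acquires the factor 8 (C + 3) / X =
    e/8.\<close>
  define X where "X = 64 * (C + 3) / e"
  have X: "X > 0" using C(1) e by (simp add: X_def)
  define c where "c = exp (- X)"
  have "1 / c = exp X" unfolding c_def exp_minus inverse_eq_divide by simp
  then have c: "0 < c" "c < 1" "ln (1 / c) = X" "1 / c = exp X" using X by (simp_all add: c_def)
  define A where "A = 8 * exp X * (C + 2)"
  have "filterlim (\<lambda>T::real. 2 * T) at_top at_top" by real_asymp
  from this[unfolded filterlim_iff, rule_format, OF C(2)]
  have ev1: "\<forall>\<^sub>F T in at_top. \<forall>\<sigma>. 1 < \<sigma> \<longrightarrow> \<sigma> \<le> 2 \<longrightarrow>
     integral {- (2 * T)..2 * T} (\<lambda>t. (norm (dseries f (Complex \<sigma> t)))\<^sup>2) \<le> C * (2 * T) \<and>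
     integral {- (2 * T)..2 * T} (\<lambda>t. (norm (deriv (dseries f) (Complex \<sigma> t)))\<^sup>2) \<le> C * (2 * T)" .
  have "filterlim (\<lambda>T::real. ln T) at_top at_top" by real_asymp
  then have ev2: "\<forall>\<^sub>F T::real in at_top. C1 \<le> ln T" "\<forall>\<^sub>F T::real in at_top. 2 * (2 + A) / e \<le> ln T"
    unfolding filterlim_at_top by blast+
  have ev3: "\<forall>\<^sub>F T::real in at_top. ln (2 + 2 * T) \<le> 2 * ln T" by real_asymp
  show ?thesis using ev1 ev2 ev3 eventually_ge_at_top[of 4]
  proof eventually_elim
    case (elim T)
    show ?case
    proof (intro allI impI)
      fix \<eta> :: real assume \<eta>: "0 < \<eta>" "\<eta> \<le> 1"
      define \<sigma> where "\<sigma> = 1 + \<eta>"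
      have \<sigma>: "1 < \<sigma>" "\<sigma> \<le> 2" using \<eta> by (auto simp: \<sigma>_def)
      define S where "S = 2 * T"
      have S: "S \<ge> 8" using elim by (simp add: S_def)
      define u where "u t = Re (LD (Complex \<sigma> t))" for t
      have nz: "dseries f (Complex \<sigma> t) \<noteq> 0" for t using dseries_f_nonzero[of "Complex \<sigma> t"] \<sigma> by simp
      have cF: "continuous_on B (\<lambda>t. dseries f (Complex \<sigma> t))" for B
        by (rule continuous_on_compose2[OF dseries_f_continuous(1) continuous_Complex_right, of "{s. Re s > 0}"]) (use \<sigma> in auto)
      have cF': "continuous_on B (\<lambda>t. deriv (dseries f) (Complex \<sigma> t))" for B
        by (rule continuous_on_compose2[OF dseries_f_continuous(2) continuous_Complex_right, of "{s. Re s > 0}"]) (use \<sigma> in auto)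
      have cu: "continuous_on B u" for B
        unfolding u_def LD_def by (intro continuous_intros cF cF') (use nz in auto)
      have ms: "integral {-S..S} (\<lambda>t. (norm (dseries f (Complex \<sigma> t)))\<^sup>2) \<le> C * S"
        "integral {-S..S} (\<lambda>t. (norm (deriv (dseries f) (Complex \<sigma> t)))\<^sup>2) \<le> C * S"
        using elim(1) \<sigma> unfolding S_def by auto
      define M where "M = (ln (2 + S) + C1) / X"
      have M: "M \<ge> 0" using S C1(1) X by (simp add: M_def)
      have "integral {-S..S} (\<lambda>t. max 0 (- u t)) \<le> integral {-S..S} (\<lambda>t. 1 / c * (1 + (norm (deriv (dseries f) (Complex \<sigma> t)))\<^sup>2) +
          M * ((norm (dseries f (Complex \<sigma> t)))\<^sup>2 - ln (norm (dseries f (Complex \<sigma> t)))))"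
      proof (rule integral_le)
        show "(\<lambda>t. max 0 (- u t)) integrable_on {-S..S}"
          by (intro integrable_continuous_real continuous_intros cu)
        show "(\<lambda>t. 1 / c * (1 + (norm (deriv (dseries f) (Complex \<sigma> t)))\<^sup>2) +
          M * ((norm (dseries f (Complex \<sigma> t)))\<^sup>2 - ln (norm (dseries f (Complex \<sigma> t))))) integrable_on {-S..S}"
          by (intro integrable_continuous_real continuous_intros cF cF') (use nz in auto)
        fix t assume t: "t \<in> {-S..S}"
        define x where "x = norm (dseries f (Complex \<sigma> t))"
        have x: "x > 0" using nz by (simp add: x_def)
        have "x\<^sup>2 - x + 1 = (x - 1 / 2)\<^sup>2 + 3 / 4" by (simp add: power2_eq_square algebra_simps)
        then have m: "x\<^sup>2 - ln x \<ge> 0" using ln_le_minus_one[OF x] zero_le_power2[of "x - 1 / 2"] by linarith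
        have "ln (2 + \<bar>t\<bar>) \<le> ln (2 + S)" using t by (intro ln_mono) auto
        then have "(ln (2 + \<bar>t\<bar>) + C1) / ln (1 / c) \<le> M" unfolding M_def c(3) using X by (intro divide_right_mono) auto
        then have "(ln (2 + \<bar>t\<bar>) + C1) / ln (1 / c) * (x\<^sup>2 - ln x) \<le> M * (x\<^sup>2 - ln x)" using m by (rule mult_right_mono)
        then show "max 0 (- u t) \<le> 1 / c * (1 + (norm (deriv (dseries f) (Complex \<sigma> t)))\<^sup>2) +
          M * ((norm (dseries f (Complex \<sigma> t)))\<^sup>2 - ln (norm (dseries f (Complex \<sigma> t))))"
          using C1(2)[OF \<eta> c(1,2), of t] unfolding u_def x_def \<sigma>_def by linarith
      qed
      also have "\<dots> = 1 / c * (2 * S + integral {-S..S} (\<lambda>t. (norm (deriv (dseries f) (Complex \<sigma> t)))\<^sup>2)) +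
          M * (integral {-S..S} (\<lambda>t. (norm (dseries f (Complex \<sigma> t)))\<^sup>2) - integral {-S..S} (\<lambda>t. ln (norm (dseries f (Complex \<sigma> t)))))"
      proof (rule integral_unique, intro has_integral_add has_integral_mult_right has_integral_diff)
        show "((\<lambda>t. 1) has_integral 2 * S) {-S..S}" using has_integral_const_real[of "1::real" "-S" S] S by simp
      qed (intro integrable_integral integrable_continuous_real continuous_intros cF cF'; use nz in simp)+
      also have "\<dots> \<le> 1 / c * (2 * S + C * S) + M * (C * S - - (8 + 2 * S))"
        using c(1) M S by (intro add_mono mult_left_mono add_left_mono diff_mono ms integral_ln_norm_lower \<sigma>) auto
      also have "\<dots> \<le> 1 / c * (2 * S + C * S) + M * ((C + 3) * S)"
        using M S by (intro add_left_mono mult_left_mono) (auto simp: algebra_simps)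
      finally have neg: "integral {-S..S} (\<lambda>t. max 0 (- u t)) \<le> exp X * ((C + 2) * S) + M * ((C + 3) * S)"
        unfolding c(4) by (simp add: algebra_simps)
      have "integral {-S..S} (\<lambda>t. (S - \<bar>t\<bar>) * u t) \<le> 2 * (8 + S)"
        unfolding u_def using weighted_integral_LD[OF \<sigma>, of S] S by (simp add: abs_le_iff)
      with integral_abs_le_weighted[OF cu, of T] elim
      have "T * integral {-T..T} (\<lambda>t. \<bar>u t\<bar>) \<le> 2 * (8 + S) + 4 * T * integral {-S..S} (\<lambda>t. max 0 (- u t))"
        unfolding S_def by simp
      also have "\<dots> \<le> T * 8 + 4 * T * (exp X * ((C + 2) * S) + M * ((C + 3) * S))"
        using neg elim by (intro add_mono mult_left_mono) (auto simp: S_def)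
      also have "\<dots> = T * (8 + A * T + 8 * (C + 3) * M * T)"
        by (simp add: A_def S_def algebra_simps)
      finally have "integral {-T..T} (\<lambda>t. \<bar>u t\<bar>) \<le> 8 + A * T + 8 * (C + 3) * M * T" using elim by simp
      also have "8 * (C + 3) * M = e / 8 * (ln (2 + S) + C1)" using C(1) e by (simp add: M_def X_def field_simps)
      also have "8 + A * T + e / 8 * (ln (2 + S) + C1) * T \<le> (2 + A) * T + e / 8 * (3 * ln T) * T"
      proof -
        have "e / 8 * (ln (2 + S) + C1) * T \<le> e / 8 * (3 * ln T) * T"
          using elim e by (intro mult_right_mono mult_left_mono) (auto simp: S_def)
        then show ?thesis using elim by (simp add: algebra_simps)
      qed
      also have "\<dots> \<le> (e / 2 * ln T) * T + e / 8 * (3 * ln T) * T"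
      proof -
        have "2 + A \<le> e / 2 * ln T" using elim e by (simp add: field_simps)
        then show ?thesis using elim by (intro add_right_mono mult_right_mono) auto
      qed
      also have "\<dots> = 7 / 8 * (e * T * ln T)" by (simp add: algebra_simps)
      also have "\<dots> \<le> e * T * ln T" using e elim by simp
      finally show "integral {-T..T} (\<lambda>t. \<bar>Re (LD (Complex (1 + \<eta>) t))\<bar>) \<le> e * T * ln T" unfolding u_def \<sigma>_def .
    qed
  qed
qed

lemma good_half: "good (1 / 2)"
proof -
  have nz: "Xi s \<noteq> 0" if "Re s \<ge> 1 / 2 + 1 / 2" for s
    using dseries_f_nonzero[of s] Xi_eq_0_iff[of s] that by simp
  show ?thesis unfolding good_def using nz Xi_le_unconditional[of "1 / 2"] by auto
qed

text \<open>Since L has no zeros for Re s >= 1, the integrand is continuous on a compact rectangle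
  including \<eta> = 0, and so is its integral as a function of \<eta>.\<close>

lemma integral_abs_LD_limit:
  assumes B: "\<And>\<eta>. 0 < \<eta> \<Longrightarrow> \<eta> \<le> 1 \<Longrightarrow> integral {-T..T} (\<lambda>t. \<bar>Re (LD (Complex (1 + \<eta>) t))\<bar>) \<le> B"
  shows "integral {-T..T} (\<lambda>t. \<bar>Re (LD (Complex 1 t))\<bar>) \<le> B"
proof -
  have e: "Complex (1 + \<eta>) t = 1 + of_real \<eta> + \<i> * of_real t" for \<eta> t by (simp add: complex_eq_iff)
  have "continuous_on ({0..1} \<times> cbox (-T) T) (\<lambda>(\<eta>, t). \<bar>Re (LD (Complex (1 + \<eta>) t))\<bar>)"
    unfolding LD_def e case_prod_beta
  proof (intro continuous_on_rabs continuous_on_Re continuous_on_divide)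
    let ?g = "\<lambda>p::real \<times> real. 1 + complex_of_real (fst p) + \<i> * complex_of_real (snd p)"
    have g: "continuous_on ({0..1} \<times> cbox (-T) T) ?g" by (intro continuous_intros)
    show "continuous_on ({0..1} \<times> cbox (-T) T) (\<lambda>p. deriv (dseries f) (?g p))"
      by (rule continuous_on_compose2[OF dseries_f_continuous(2) g, of "{s. Re s > 0}"]) auto
    show "continuous_on ({0..1} \<times> cbox (-T) T) (\<lambda>p. dseries f (?g p))"
      by (rule continuous_on_compose2[OF dseries_f_continuous(1) g, of "{s. Re s > 0}"]) auto
    show "\<forall>p\<in>{0..1} \<times> cbox (-T) T. dseries f (?g p) \<noteq> 0" by (auto intro!: dseries_f_nonzero)
  qed
  from integral_continuous_on_param[OF this]
  have c: "continuous_on (closure {0<..<1}) (\<lambda>\<eta>. integral {-T..T} (\<lambda>t. \<bar>Re (LD (Complex (1 + \<eta>) t))\<bar>))"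
    by (simp add: cbox_interval)
  have "integral {-T..T} (\<lambda>t. \<bar>Re (LD (Complex (1 + 0) t))\<bar>) \<le> B"
    by (rule continuous_le_on_closure[OF c]) (use B in auto)
  then show ?thesis by simp
qed

lemma star_half:
  assumes e: "e > 0"
  shows "\<forall>\<^sub>F T in at_top. integral {-T..T} (\<lambda>t. \<bar>dphase (1 / 2) t - ln (2 + \<bar>t\<bar>) / 2\<bar>) \<le> e * T * ln T"
proof (rule star_from_LD[OF good_half e])
  fix e :: real assume e: "e > 0"
  have eq: "ln_pt (1 / 2) t = Complex 1 t" for t by simp
  show "\<forall>\<^sub>F T in at_top. integral {-T..T} (\<lambda>t. \<bar>Re (LD (ln_pt (1 / 2) t))\<bar>) \<le> e * T * ln T"
    unfolding eq using integral_abs_LD_uniform[OF e]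
    by eventually_elim (rule integral_abs_LD_limit, blast)
qed

end

section \<open>Conclusion\<close>

context prim_char
begin

lemma FF_has_limiting_spacing_distribution:
  assumes g: "good h" and ab: "norm \<alpha> = norm \<beta>" "\<beta> \<noteq> 0"
    and star: "\<And>e. e > 0 \<Longrightarrow> \<forall>\<^sub>F T in at_top. integral {-T..T} (\<lambda>t. \<bar>dphase h t - ln (2 + \<bar>t\<bar>) / 2\<bar>) \<le> e * T * ln T"
  shows "has_limiting_spacing_distribution (FF \<alpha> \<beta> h)
    (return borel (\<chi> i. 1) :: (real ^ 'k::{finite, linorder}) measure)"
proof -
  obtain P where P: "\<And>t. (P has_real_derivative dphase h t) (at t)"
    "\<And>t. Xi (ln_pt h t) = of_real (norm (Xi (ln_pt h t))) * cis (P t)"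
    using phase_exists[OF g] by blast
  interpret pa: phase_asymp P "dphase h"
    by unfold_locales (use P(1) dphase_continuous[OF g] Q_deriv(2)[OF g] star in auto)
  obtain c where c: "\<And>s. FF \<alpha> \<beta> h s = 0 \<longleftrightarrow> Re s = 1 / 2 \<and> (P (Im s) - c) / pi \<in> \<int>"
    using FF_zeros[OF g ab P] by blast
  have zeros: "FF \<alpha> \<beta> h s = 0 \<longleftrightarrow> s \<in> range (\<lambda>n. Complex (1 / 2) (pa.\<gamma> c n))" for s
    unfolding c pa.gamma_range by (auto simp: complex_eq_iff image_iff)
  have "critical_line_zeros (FF \<alpha> \<beta> h) (pa.\<gamma> c)"
    unfolding critical_line_zeros_def
  proof (intro conjI allI)
    show "strict_mono (pa.\<gamma> c)" by (rule pa.gamma_strict_mono)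
    show "{s. FF \<alpha> \<beta> h s = 0} = range (\<lambda>n. Complex (1 / 2) (pa.\<gamma> c n))" using zeros by blast
    fix n
    have "FF \<alpha> \<beta> h (Complex (1 / 2) (pa.\<gamma> c n)) = 0" unfolding zeros by blast
    then show "zorder (FF \<alpha> \<beta> h) (Complex (1 / 2) (pa.\<gamma> c n)) = 1" by (rule FF_simple[OF g ab(2)])
  qed
  moreover have "weakly_converges (spacing_distribution (pa.\<gamma> c)) (return borel (\<chi> i. 1) :: (real ^ 'k::{finite, linorder}) measure) at_top"
    by (rule pa.spacing_limit)
  moreover have "prob_space (return borel (\<chi> i. 1) :: (real ^ 'k::{finite, linorder}) measure)"
    by (rule prob_space_return) simp
  ultimately show ?thesis unfolding has_limiting_spacing_distribution_def by auto
qed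

text \<open>Reduces negative shifts to positive ones.\<close>

lemma FF_swap: "FF \<alpha> \<beta> h = FF \<beta> \<alpha> (- h)"
  by (rule ext) (simp add: FF_def)

lemma cnj_E_fun: "cnj (E_fun N chi h \<theta> (1 - cnj s)) = cnj (exp (\<i> * of_real \<theta>)) * cnj omega * Xi (s - of_real h)"
proof -
  have e: "1 - cnj s + of_real h = 1 - cnj (s - of_real h)" by simp
  show ?thesis unfolding E_fun_def xi_eq e complex_cnj_mult Xi_functional by simp
qed

lemma A_fun_eq: "A_fun N chi h \<theta> = FF (exp (\<i> * of_real \<theta>) / 2) (cnj (exp (\<i> * of_real \<theta>)) * cnj omega / 2) h"
  by (rule ext) (simp only: A_fun_def cnj_E_fun, simp add: E_fun_def xi_eq FF_def algebra_simps)

lemma B_fun_eq: "B_fun N chi h \<theta> = FF (- (1 / (2 * \<i>)) * exp (\<i> * of_real \<theta>)) (1 / (2 * \<i>) * (cnj (exp (\<i> * of_real \<theta>)) * cnj omega)) h"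
  by (rule ext) (simp only: B_fun_def cnj_E_fun, simp add: E_fun_def xi_eq FF_def algebra_simps)

text \<open>In both functions the two coefficients have modulus 1/2, because \<open>omega\<close>
  and the exponential of i \<theta> are unimodular. The angle \<theta> only selects the levels of
  the phase at which the zeros occur.\<close>

lemma AB_has_limiting_spacing_distribution:
  assumes g: "good \<bar>h\<bar>"
    and star: "\<And>e. e > 0 \<Longrightarrow> \<forall>\<^sub>F T in at_top. integral {-T..T} (\<lambda>t. \<bar>dphase \<bar>h\<bar> t - ln (2 + \<bar>t\<bar>) / 2\<bar>) \<le> e * T * ln T"
  shows "has_limiting_spacing_distribution (A_fun N chi h \<theta>)
      (return borel (\<chi> i. 1) :: (real ^ 'k::{finite, linorder}) measure)"
    "has_limiting_spacing_distribution (B_fun N chi h \<theta>)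
      (return borel (\<chi> i. 1) :: (real ^ 'k::{finite, linorder}) measure)"
proof -
  have FF: "has_limiting_spacing_distribution (FF \<alpha> \<beta> h) (return borel (\<chi> i. 1) :: (real ^ 'k::{finite, linorder}) measure)"
    if "norm \<alpha> = 1 / 2" "norm \<beta> = 1 / 2" for \<alpha> \<beta>
  proof -
    have nz: "\<alpha> \<noteq> 0" "\<beta> \<noteq> 0" using that by auto
    show ?thesis
    proof (cases "h \<ge> 0")
      case True
      then show ?thesis using FF_has_limiting_spacing_distribution[OF g _ nz(2) star, of \<alpha>] that by simp
    next
      case False
      then show ?thesis using FF_has_limiting_spacing_distribution[OF g _ nz(1) star, of \<beta>] that
        by (subst FF_swap) simp
    qed
  qed
  show "has_limiting_spacing_distribution (A_fun N chi h \<theta>)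
      (return borel (\<chi> i. 1) :: (real ^ 'k::{finite, linorder}) measure)"
    unfolding A_fun_eq by (rule FF) (simp_all add: norm_mult norm_divide norm_omega)
  show "has_limiting_spacing_distribution (B_fun N chi h \<theta>)
      (return borel (\<chi> i. 1) :: (real ^ 'k::{finite, linorder}) measure)"
    unfolding B_fun_eq by (rule FF) (simp_all add: norm_mult norm_divide norm_omega)
qed

end

theorem theorem5p2:
  fixes N :: nat and chi :: "int \<Rightarrow> complex"
  assumes "primitive_character N chi" and "non_principal N chi"
  shows "(\<forall>h \<theta>. \<bar>h\<bar> \<ge> 1 / 2 \<longrightarrow> 0 \<le> \<theta> \<longrightarrow> \<theta> < 2 * pi \<longrightarrow>
           has_limiting_spacing_distribution (A_fun N chi h \<theta>)
             (return borel (\<chi> i. 1) :: (real ^ 'k::{finite, linorder}) measure) \<and>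
           has_limiting_spacing_distribution (B_fun N chi h \<theta>)
             (return borel (\<chi> i. 1) :: (real ^ 'k::{finite, linorder}) measure)) \<and>
         (riemann_hypothesis_L chi \<longrightarrow>
          (\<forall>h \<theta>. 0 < \<bar>h\<bar> \<longrightarrow> \<bar>h\<bar> < 1 / 2 \<longrightarrow> 0 \<le> \<theta> \<longrightarrow> \<theta> < 2 * pi \<longrightarrow>
           has_limiting_spacing_distribution (A_fun N chi h \<theta>)
             (return borel (\<chi> i. 1) :: (real ^ 'k::{finite, linorder}) measure) \<and>
           has_limiting_spacing_distribution (B_fun N chi h \<theta>)
             (return borel (\<chi> i. 1) :: (real ^ 'k::{finite, linorder}) measure)))"
proof -
  interpret prim_char N chi by unfold_locales (fact assms)+
  let ?star = "\<lambda>h. \<forall>e>0. \<forall>\<^sub>F T in at_top. integral {-T..T} (\<lambda>t. \<bar>dphase \<bar>h\<bar> t - ln (2 + \<bar>t\<bar>) / 2\<bar>) \<le> e * T * ln T"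
  have 1: "good \<bar>h\<bar> \<and> ?star h" if "\<bar>h\<bar> \<ge> 1 / 2" for h
  proof (cases "\<bar>h\<bar> = 1 / 2")
    case True
    show ?thesis unfolding True using good_half star_half by blast
  next
    case False
    with that have "\<bar>h\<bar> > 1 / 2" by simp
    then show ?thesis using star_gt_half[of "\<bar>h\<bar>"] zero_less_one by blast
  qed
  have 2: "good \<bar>h\<bar> \<and> ?star h"
    if "riemann_hypothesis_L chi" "0 < \<bar>h\<bar>" "\<bar>h\<bar> < 1 / 2" for h
    using RH_good[OF that] RH_star[OF that] by blast
  have AB: "has_limiting_spacing_distribution (A_fun N chi h \<theta>)
      (return borel (\<chi> i. 1) :: (real ^ 'k::{finite, linorder}) measure) \<and>
    has_limiting_spacing_distribution (B_fun N chi h \<theta>)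
      (return borel (\<chi> i. 1) :: (real ^ 'k::{finite, linorder}) measure)" if "good \<bar>h\<bar> \<and> ?star h" for h \<theta>
    by (intro conjI AB_has_limiting_spacing_distribution) (use that in auto)
  show ?thesis by (intro conjI allI impI AB[THEN conjunct1] AB[THEN conjunct2] 1 2)
qed

end
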